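(* Let $\lambda$ be a functional of scaling order $s$ that is continuous on $W_2^\mu(\Omega)$ for some $\mu>d/2$, and let $X$ allow a polynomially exact approximation to $\lambda$ of some order $q\ge\mu>d/2$. Then any scalable stencil for approximation of $\lambda$ on $X$ with that exactness has the optimal convergence rate $m-s-d/2$ in $W_2^m(\Omega)$ for all $m$ with $\mu\le m<q+d/2$. In case $m=q+d/2$, the rate is at least $m-s-d/2-\varepsilon=q-s-\varepsilon$ for arbitrarily small $\varepsilon>0$.
   Context: $\Omega\subset\mathbb{R}^d$ is a bounded Lipschitz domain that is scalable, i.e. it contains the origin as an interior point and $h\Omega\subseteq\Omega$ for all $0\le h\le 1$. $X=\{x_1,\dots,x_M\}\subset\Omega$ is a finite node set. $W_2^m(\Omega)$ is the usual $L_2$-based Sobolev space of order $m$. A functional $\lambda$ has scaling order $s$ if $\lambda(u(h\,\cdot))=h^s\lambda(u)$ for all $u$ in the space and $0<h\le1$. For $a\in\mathbb{R}^M$ put $\lambda_{a,X}(u)=\sum_{j=1}^M a_ju(x_j)$. The scalable stencil with weights $a$ consists of the approximations $u\mapsto h^{-s}\sum_{j=1}^M a_ju(hx_j)$, $0<h\le1$, to $\lambda$, with error functionals $\epsilon_h(u)=\lambda(u)-h^{-s}\sum_{j=1}^M a_ju(hx_j)=h^{-s}(\lambda-\lambda_{a,X})(u(h\,\cdot))$. The approximation $\lambda_{a,X}$, and the corresponding stencil, is polynomially exact of order $q$ if $\lambda-\lambda_{a,X}=0$ on the space of real $d$-variate polynomials of order at most $q$, i.e. of total degree less than $q$. The stencil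 has convergence rate $k$ in $W_2^m(\Omega)$ if $\|\epsilon_h\|_{W_2^m(\Omega)^*}\le Ch^k$ for $h\to0$ with a constant $C$. The rate $m-s-d/2$ is called optimal because it is the upper bound for the convergence rate of nodal approximations $u\mapsto\sum_{j=1}^M a_j(h)u(hx_j)$, with arbitrary weights, to a functional of scaling order $s$ in Sobolev spaces of order $m>d/2$. *)

theory Defs
  imports "HOL-Analysis.Analysis"
begin

section \<open>Scalable Lipschitz domains\<close>

text \<open>Near each boundary point, \<^term>\<open>\<Omega>\<close> is the part of a neighbourhood \<^term>\<open>U\<close> lying above
  the graph of a Lipschitz function over the hyperplane orthogonal to a unit vector \<^term>\<open>e\<close>.\<close>

definition lipschitz_domain :: "(real ^ 'd) set \<Rightarrow> bool" where
  "lipschitz_domain \<Omega> \<longleftrightarrow> open \<Omega> \<and> connected \<Omega> \<and> \<Omega> \<noteq> {} \<and>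
     (\<forall>p \<in> frontier \<Omega>. \<exists>U e L g. open U \<and> p \<in> U \<and> norm e = 1 \<and>
        L-lipschitz_on {y. y \<bullet> e = 0} (g :: real ^ 'd \<Rightarrow> real) \<and>
        \<Omega> \<inter> U = {x \<in> U. g (x - (x \<bullet> e) *\<^sub>R e) < x \<bullet> e})"

definition scalable :: "(real ^ 'd) set \<Rightarrow> bool" where
  "scalable \<Omega> \<longleftrightarrow> 0 \<in> interior \<Omega> \<and> (\<forall>h. 0 \<le> h \<and> h \<le> 1 \<longrightarrow> (\<lambda>x. h *\<^sub>R x) ` \<Omega> \<subseteq> \<Omega>)"


section \<open>Sobolev spaces of real order\<close>

definition partial :: "'d \<Rightarrow> (real ^ 'd \<Rightarrow> real) \<Rightarrow> real ^ 'd \<Rightarrow> real" where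
  "partial i f x = frechet_derivative f (at x) (axis i 1)"

text \<open>Partial derivatives of order \<open>k\<close> are indexed by lists \<open>[i\<^sub>1, \<dots>, i\<^sub>k]\<close> of coordinate indices,
  standing for \<open>\<partial>\<^sub>i\<^sub>1 \<cdots> \<partial>\<^sub>i\<^sub>k\<close>. A multi-index corresponds to all lists with the given multiplicities.\<close>

definition partials :: "'d list \<Rightarrow> (real ^ 'd \<Rightarrow> real) \<Rightarrow> real ^ 'd \<Rightarrow> real" where
  "partials is f = foldr partial is f"

definition smooth :: "(real ^ 'd \<Rightarrow> real) \<Rightarrow> bool" where
  "smooth f \<longleftrightarrow> (\<forall>is x. partials is f differentiable (at x))"

definition test_function :: "(real ^ 'd) set \<Rightarrow> (real ^ 'd \<Rightarrow> real) \<Rightarrow> bool" where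
  "test_function \<Omega> \<phi> \<longleftrightarrow> smooth \<phi> \<and> compact (closure {x. \<phi> x \<noteq> 0}) \<and> closure {x. \<phi> x \<noteq> 0} \<subseteq> \<Omega>"

text \<open>Elements of function spaces on \<^term>\<open>\<Omega>\<close> are represented by total functions, of which only the
  values almost everywhere in \<^term>\<open>\<Omega>\<close> matter.\<close>

definition L2 :: "(real ^ 'd) set \<Rightarrow> (real ^ 'd \<Rightarrow> real) \<Rightarrow> bool" where
  "L2 \<Omega> u \<longleftrightarrow> u \<in> borel_measurable (lebesgue_on \<Omega>) \<and> integrable (lebesgue_on \<Omega>) (\<lambda>x. (u x)\<^sup>2)"

definition is_weak_deriv ::
  "(real ^ 'd) set \<Rightarrow> 'd list \<Rightarrow> (real ^ 'd \<Rightarrow> real) \<Rightarrow> (real ^ 'd \<Rightarrow> real) \<Rightarrow> bool" where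
  "is_weak_deriv \<Omega> is u v \<longleftrightarrow> L2 \<Omega> v \<and>
     (\<forall>\<phi>. test_function \<Omega> \<phi> \<longrightarrow>
        (\<integral>x. u x * partials is \<phi> x \<partial>lebesgue_on \<Omega>)
        = (- 1) ^ length is * (\<integral>x. v x * \<phi> x \<partial>lebesgue_on \<Omega>))"

definition weak_deriv ::
  "(real ^ 'd) set \<Rightarrow> 'd list \<Rightarrow> (real ^ 'd \<Rightarrow> real) \<Rightarrow> real ^ 'd \<Rightarrow> real" where
  "weak_deriv \<Omega> is u = (SOME v. is_weak_deriv \<Omega> is u v)"

text \<open>Square of the Sobolev--Slobodeckij seminorm of order \<open>0 < \<sigma> < 1\<close>.\<close>

definition slobodeckij :: "(real ^ 'd::finite) set \<Rightarrow> real \<Rightarrow> (real ^ 'd \<Rightarrow> real) \<Rightarrow> ennreal" where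
  "slobodeckij \<Omega> \<sigma> v =
     (\<integral>\<^sup>+x. (\<integral>\<^sup>+y. ennreal ((v x - v y)\<^sup>2 / norm (x - y) powr (real CARD('d) + 2 * \<sigma>))
        \<partial>lebesgue_on \<Omega>) \<partial>lebesgue_on \<Omega>)"

text \<open>The space \<open>W\<^sub>2\<^sup>m(\<Omega>)\<close> for real \<open>m \<ge> 0\<close>: weak derivatives up to order \<open>\<lfloor>m\<rfloor>\<close> in \<open>L\<^sub>2\<close>, and, if \<open>m\<close> is
  not an integer, finite Slobodeckij seminorm of order \<open>m - \<lfloor>m\<rfloor>\<close> of the highest derivatives.\<close>

definition sobolev :: "(real ^ 'd::finite) set \<Rightarrow> real \<Rightarrow> (real ^ 'd \<Rightarrow> real) set" where
  "sobolev \<Omega> m = {u. L2 \<Omega> u \<and>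
     (\<forall>is. length is \<le> nat \<lfloor>m\<rfloor> \<longrightarrow> (\<exists>v. is_weak_deriv \<Omega> is u v)) \<and>
     (m \<notin> \<int> \<longrightarrow> (\<forall>is. length is = nat \<lfloor>m\<rfloor> \<longrightarrow>
        slobodeckij \<Omega> (frac m) (weak_deriv \<Omega> is u) < \<infinity>))}"

text \<open>The sum over lists amounts to the Frobenius norm of the derivative tensors, i.e. derivatives
  belonging to a multi-index carry the corresponding multinomial coefficient.\<close>

definition sobolev_norm :: "(real ^ 'd::finite) set \<Rightarrow> real \<Rightarrow> (real ^ 'd \<Rightarrow> real) \<Rightarrow> real" where
  "sobolev_norm \<Omega> m u = sqrt (
     (\<Sum>is | length is \<le> nat \<lfloor>m\<rfloor>. \<integral>x. (weak_deriv \<Omega> is u x)\<^sup>2 \<partial>lebesgue_on \<Omega>) +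
     (if m \<in> \<int> then 0
      else \<Sum>is | length is = nat \<lfloor>m\<rfloor>. enn2real (slobodeckij \<Omega> (frac m) (weak_deriv \<Omega> is u))))"

text \<open>For \<open>m > d/2\<close> every class in \<open>W\<^sub>2\<^sup>m(\<Omega>)\<close> contains a function continuous on \<^term>\<open>\<Omega>\<close>; its values
  there are uniquely determined, and point evaluation refers to it.\<close>

definition cont_rep :: "(real ^ 'd) set \<Rightarrow> (real ^ 'd \<Rightarrow> real) \<Rightarrow> real ^ 'd \<Rightarrow> real" where
  "cont_rep \<Omega> u = (SOME v. continuous_on \<Omega> v \<and> (AE x in lebesgue_on \<Omega>. v x = u x))"


section \<open>Functionals and stencils\<close>

text \<open>Boundedness and linearity together force a functional to agree on functions that coincide
  almost everywhere in \<^term>\<open>\<Omega>\<close>.\<close>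

definition continuous_functional ::
  "(real ^ 'd::finite) set \<Rightarrow> real \<Rightarrow> ((real ^ 'd \<Rightarrow> real) \<Rightarrow> real) \<Rightarrow> bool" where
  "continuous_functional \<Omega> m F \<longleftrightarrow>
     (\<forall>u \<in> sobolev \<Omega> m. \<forall>v \<in> sobolev \<Omega> m. F (\<lambda>x. u x + v x) = F u + F v) \<and>
     (\<forall>u \<in> sobolev \<Omega> m. \<forall>c. F (\<lambda>x. c * u x) = c * F u) \<and>
     (\<exists>C. \<forall>u \<in> sobolev \<Omega> m. \<bar>F u\<bar> \<le> C * sobolev_norm \<Omega> m u)"

definition dual_norm ::
  "(real ^ 'd::finite) set \<Rightarrow> real \<Rightarrow> ((real ^ 'd \<Rightarrow> real) \<Rightarrow> real) \<Rightarrow> ereal" where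
  "dual_norm \<Omega> m F = (SUP u \<in> {u \<in> sobolev \<Omega> m. sobolev_norm \<Omega> m u \<le> 1}. ereal \<bar>F u\<bar>)"

definition has_scaling_order ::
  "(real ^ 'd::finite) set \<Rightarrow> real \<Rightarrow> ((real ^ 'd \<Rightarrow> real) \<Rightarrow> real) \<Rightarrow> real \<Rightarrow> bool" where
  "has_scaling_order \<Omega> m F s \<longleftrightarrow>
     (\<forall>u \<in> sobolev \<Omega> m. \<forall>h. 0 < h \<and> h \<le> 1 \<longrightarrow> F (\<lambda>x. u (h *\<^sub>R x)) = h powr s * F u)"

text \<open>Real polynomials of order at most \<^term>\<open>q\<close>, i.e. of total degree less than \<^term>\<open>q\<close>.\<close>

definition polys_of_order :: "nat \<Rightarrow> (real ^ 'd::finite \<Rightarrow> real) set" where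
  "polys_of_order q = {p. \<exists>c :: ('d \<Rightarrow> nat) \<Rightarrow> real.
     p = (\<lambda>x. \<Sum>\<alpha> | (\<Sum>i\<in>UNIV. \<alpha> i) < q. c \<alpha> * (\<Prod>i\<in>UNIV. (x $ i) ^ \<alpha> i))}"

text \<open>\<open>nodal \<Omega> X a h u = \<Sum>\<^sub>j a\<^sub>j u(h x\<^sub>j)\<close>, the weights being indexed by the nodes in \<^term>\<open>X\<close>.\<close>

definition nodal ::
  "(real ^ 'd) set \<Rightarrow> (real ^ 'd) set \<Rightarrow> (real ^ 'd \<Rightarrow> real) \<Rightarrow> real \<Rightarrow> (real ^ 'd \<Rightarrow> real) \<Rightarrow> real" where
  "nodal \<Omega> X a h u = (\<Sum>y\<in>X. a y * cont_rep \<Omega> u (h *\<^sub>R y))"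

definition poly_exact ::
  "(real ^ 'd::finite) set \<Rightarrow> (real ^ 'd) set \<Rightarrow> (real ^ 'd \<Rightarrow> real) \<Rightarrow>
   ((real ^ 'd \<Rightarrow> real) \<Rightarrow> real) \<Rightarrow> nat \<Rightarrow> bool" where
  "poly_exact \<Omega> X a F q \<longleftrightarrow> (\<forall>p \<in> polys_of_order q. F p - nodal \<Omega> X a 1 p = 0)"

definition stencil_error ::
  "(real ^ 'd) set \<Rightarrow> (real ^ 'd) set \<Rightarrow> (real ^ 'd \<Rightarrow> real) \<Rightarrow>
   ((real ^ 'd \<Rightarrow> real) \<Rightarrow> real) \<Rightarrow> real \<Rightarrow> real \<Rightarrow> (real ^ 'd \<Rightarrow> real) \<Rightarrow> real" where
  "stencil_error \<Omega> X a F s h u = F u - h powr (- s) * nodal \<Omega> X a h u"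

definition stencil_has_rate ::
  "(real ^ 'd::finite) set \<Rightarrow> (real ^ 'd) set \<Rightarrow> (real ^ 'd \<Rightarrow> real) \<Rightarrow>
   ((real ^ 'd \<Rightarrow> real) \<Rightarrow> real) \<Rightarrow> real \<Rightarrow> real \<Rightarrow> real \<Rightarrow> bool" where
  "stencil_has_rate \<Omega> X a F s m k \<longleftrightarrow>
     (\<exists>C. \<forall>\<^sub>F h in at_right 0. dual_norm \<Omega> m (stencil_error \<Omega> X a F s h) \<le> ereal (C * h powr k))"

end

theory Submission
  imports Defs
begin

text \<open>By the scaling order of \<open>F\<close>, the error at \<open>u\<close> is \<open>h powr (-s)\<close> times the error functional for \<open>h = 1\<close>,
  applied to \<open>v = u(h \<sqdot>)\<close> or to \<open>v - p\<close> for any polynomial \<open>p\<close> of order \<open>q\<close>. For small \<open>h\<close> the function \<open>v\<close>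
  lives on a fixed ball containing \<open>\<Omega>\<close>, where \<open>p\<close> can be chosen such that the weak derivatives of \<open>v - p\<close>
  have mean 0; Poincare inequalities then bound the norm of \<open>v - p\<close> by the top order seminorm of \<open>v\<close>, which
  scales like \<open>h powr (m - d / 2)\<close> if \<open>m \<le> q\<close>. If \<open>m > q\<close>, the derivatives of order \<open>q\<close> lie in a Sobolev space of
  order \<open>m - q\<close>, so that their \<open>L\<^sub>2\<close> norm on a ball of radius \<open>h\<close> around the origin is \<open>O(h powr \<tau>)\<close> for
  \<open>\<tau> \<le> m - q\<close>, \<open>\<tau> < d / 2\<close>; this restriction on \<open>\<tau>\<close> causes the loss of \<open>\<epsilon>\<close> for \<open>m = q + d / 2\<close>. The only place
  where the boundary of \<open>\<Omega>\<close> matters is the inclusion of the Sobolev space of order \<open>m\<close> in that of order \<open>\<mu>\<close>,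
  needed for \<open>F\<close> to be bounded there.\<close>

section \<open>Elementary smooth functions\<close>

text \<open>Rescaling replaces an extension operator: once \<open>h * R \<le> r0\<close>, the values
  of u on a small ball inside \<Omega> define v on the large ball. The polynomial approximation can
  therefore be carried out on balls, where convexity provides segments. Squared seminorms collect
  powers of h as follows: 2 M from the chain rule, - d from the Jacobian and 2 \<tau> from the decay
  on the ball of radius \<open>h * R\<close>. The square root, together with the scaling order,
  gives the exponent \<open>M + \<tau> - s - d / 2\<close>. With \<tau> = m - M this is the optimal
  rate, and for m \<ge> q the restriction \<tau> < d / 2 then reads m < q + d / 2. All gradient
  estimates come from a single source, the L2 distance between a function and its translate. The
  choice of p meets an obstacle: weak derivatives are indexed by lists, and a polynomial can match
  their means only if permuted lists have equal means. This symmetry of weak derivatives is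
  inherited from test functions whose derivatives commute.\<close>

fun flat_poly :: "nat \<Rightarrow> real poly" where
  "flat_poly 0 = 1"
| "flat_poly (Suc n) = [:0, 0, 1:] * (flat_poly n - pderiv (flat_poly n))"

text \<open>The n-th derivative of \<open>exp (- 1 / t)\<close>, continued by 0 to t \<le> 0. The
  recursion of \<open>flat_poly\<close> is the chain rule in x = 1 / t: the t-derivative of p(x)
  exp(-x) is x^2 (p - p')(x) exp(-x).\<close>

definition flat :: "nat \<Rightarrow> real \<Rightarrow> real" where
  "flat n t = (if t > 0 then poly (flat_poly n) (1 / t) * exp (- 1 / t) else 0)"

lemma poly_times_exp_neg_tendsto_0: "((\<lambda>x::real. poly p x * exp (- x)) \<longlongrightarrow> 0) at_top"
proof -
  have "((\<lambda>x::real. \<Sum>i\<le>degree p. coeff p i * (x ^ i / exp x)) \<longlongrightarrow> (\<Sum>i\<le>degree p. coeff p i * 0)) at_top"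
    by (intro tendsto_intros tendsto_power_div_exp_0)
  then show ?thesis
    by (simp add: poly_altdef exp_minus sum_distrib_right divide_inverse mult.assoc)
qed

lemma flat_deriv: "(flat n has_real_derivative flat (Suc n) t) (at t)"
proof -
  consider "t > 0" | "t < 0" | "t = 0" by linarith
  then show ?thesis
  proof cases
    case 1
    have "((\<lambda>t. poly (flat_poly n) (1 / t) * exp (- 1 / t)) has_real_derivative flat (Suc n) t) (at t)"
      using 1
      by (auto intro!: derivative_eq_intros DERIV_chain2[OF poly_DERIV]
          simp: flat_def field_simps power2_eq_square)
    then show ?thesis
      by (rule has_field_derivative_transform_within_open[of _ _ _ "{0<..}"]) (use 1 in \<open>auto simp: flat_def\<close>)
  next
    case 2
    have "((\<lambda>t::real. 0::real) has_real_derivative flat (Suc n) t) (at t)"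
      using 2 by (auto simp: flat_def)
    then show ?thesis
      by (rule has_field_derivative_transform_within_open[of _ _ _ "{..<0}"]) (use 2 in \<open>auto simp: flat_def\<close>)
  next
    case 3
    \<comment> \<open>With x = 1 / y the difference quotient is x p(x) exp(-x), which explains the
      additional factor \<open>[:0,1:]\<close>.\<close>
    have r: "((\<lambda>y. (flat n y - flat n 0) / (y - 0)) \<longlongrightarrow> 0) (at_right 0)"
    proof -
      have "((\<lambda>x::real. poly ([:0,1:] * flat_poly n) (inverse x) * exp (- inverse x)) \<longlongrightarrow> 0) (at_right 0)"
        by (rule filterlim_compose[OF poly_times_exp_neg_tendsto_0 filterlim_inverse_at_top_right])
      moreover have "eventually (\<lambda>y::real. poly ([:0,1:] * flat_poly n) (inverse y) * exp (- inverse y)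
            = (flat n y - flat n 0) / (y - 0)) (at_right 0)"
        by (auto simp: eventually_at_filter flat_def field_simps)
      ultimately show ?thesis by (rule Lim_transform_eventually)
    qed
    have l: "((\<lambda>y. (flat n y - flat n 0) / (y - 0)) \<longlongrightarrow> 0) (at_left 0)"
    proof -
      have "eventually (\<lambda>y::real. 0 = (flat n y - flat n 0) / (y - 0)) (at_left 0)"
        by (auto simp: eventually_at_filter flat_def)
      then show ?thesis by (rule Lim_transform_eventually[OF tendsto_const])
    qed
    have "flat (Suc n) 0 = 0" by (simp add: flat_def)
    then show ?thesis
      using filterlim_split_at[OF l r] 3 by (simp add: has_field_derivative_iff)
  qed
qed

text \<open>A set of functions closed under partial differentiation, all of whose members are
  differentiable, consists of smooth functions.\<close>

inductive_set elementary :: "(real ^ 'd \<Rightarrow> real) set" where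
  elementary_const: "(\<lambda>x. c) \<in> elementary"
| elementary_coord: "(\<lambda>x. x $ i) \<in> elementary"
| elementary_flat: "(\<lambda>x. flat n (a + b * x $ i)) \<in> elementary"
| elementary_add: "f \<in> elementary \<Longrightarrow> g \<in> elementary \<Longrightarrow> (\<lambda>x. f x + g x) \<in> elementary"
| elementary_mult: "f \<in> elementary \<Longrightarrow> g \<in> elementary \<Longrightarrow> (\<lambda>x. f x * g x) \<in> elementary"

lemma partial_eqI:
  assumes "(f has_derivative f') (at x)"
  shows "partial i f x = f' (axis i 1)"
  unfolding partial_def using frechet_derivative_at[OF assms] by simp

lemma partial_const [simp]: "partial i (\<lambda>x. c) = (\<lambda>x. 0)"
  by (rule ext) (rule partial_eqI[THEN trans], rule has_derivative_const, simp)

lemma nth_has_derivative: "((\<lambda>x::real^'d. x $ i) has_derivative (\<lambda>v. v $ i)) (at x)"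
  by (rule bounded_linear.has_derivative[OF bounded_linear_vec_nth]) (rule has_derivative_ident)

lemma partial_coord: "partial j (\<lambda>x. x $ i) = (\<lambda>x. if i = j then 1 else 0)"
  by (rule ext) (rule partial_eqI[THEN trans], rule nth_has_derivative, simp add: axis_def)

lemma flat_has_derivative:
  "((\<lambda>x::real^'d. flat n (a + b * x $ i)) has_derivative (\<lambda>v. b * v $ i * flat (Suc n) (a + b * x $ i))) (at x)"
proof -
  have 1: "((\<lambda>x::real^'d. a + b * x $ i) has_derivative (\<lambda>v. b * v $ i)) (at x)"
    by (auto intro!: derivative_eq_intros nth_has_derivative)
  show ?thesis
    using has_derivative_compose[OF 1 flat_deriv[unfolded has_field_derivative_def]]
    by (simp add: mult.commute)
qed

lemma partial_flat: "partial j (\<lambda>x. flat n (a + b * x $ i)) =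
    (\<lambda>x. (if i = j then b else 0) * flat (Suc n) (a + b * x $ i))"
  by (rule ext) (rule partial_eqI[THEN trans], rule flat_has_derivative, simp add: axis_def)

lemma partial_add:
  assumes "f differentiable (at x)" "g differentiable (at x)"
  shows "partial i (\<lambda>x. f x + g x) x = partial i f x + partial i g x"
proof -
  obtain f' g' where "(f has_derivative f') (at x)" "(g has_derivative g') (at x)"
    using assms by (auto simp: differentiable_def)
  then show ?thesis
    by (simp add: partial_eqI[OF has_derivative_add] partial_eqI)
qed

lemma partial_mult:
  assumes "f differentiable (at x)" "g differentiable (at x)"
  shows "partial i (\<lambda>x. f x * g x) x = partial i f x * g x + f x * partial i g x"
proof -
  obtain f' g' where "(f has_derivative f') (at x)" "(g has_derivative g') (at x)"
    using assms by (auto simp: differentiable_def)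
  then show ?thesis
    by (simp add: partial_eqI[OF has_derivative_mult] partial_eqI)
qed

lemma elementary_cmult: "f \<in> elementary \<Longrightarrow> (\<lambda>x. c * f x) \<in> elementary"
  by (rule elementary_mult[OF elementary_const])

lemma elementary_sum: "finite A \<Longrightarrow> (\<And>i. i \<in> A \<Longrightarrow> f i \<in> elementary) \<Longrightarrow> (\<lambda>x. \<Sum>i\<in>A. f i x) \<in> elementary"
  by (induction A rule: finite_induct) (auto intro: elementary_const elementary_add)

lemma elementary_prod: "finite A \<Longrightarrow> (\<And>i. i \<in> A \<Longrightarrow> f i \<in> elementary) \<Longrightarrow> (\<lambda>x. \<Prod>i\<in>A. f i x) \<in> elementary"
  by (induction A rule: finite_induct) (auto intro: elementary_const elementary_mult)

lemma elementary_differentiable: "f \<in> elementary \<Longrightarrow> f differentiable (at x)"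
proof (induction rule: elementary.induct)
  case (elementary_flat n a b i) then show ?case
    by (rule differentiableI[OF flat_has_derivative])
qed (auto intro: differentiableI nth_has_derivative differentiable_add differentiable_mult)

lemma elementary_partial: "f \<in> elementary \<Longrightarrow> partial i f \<in> elementary"
proof (induction rule: elementary.induct)
  case (elementary_const c) then show ?case using elementary.elementary_const by simp
next
  case (elementary_coord j) show ?case unfolding partial_coord using elementary.elementary_const by (cases "j = i") auto
next
  case (elementary_flat n a b j) then show ?case
    unfolding partial_flat by (rule elementary_cmult[OF elementary.elementary_flat])
next
  case (elementary_add f g)
  have "partial i (\<lambda>x. f x + g x) = (\<lambda>x. partial i f x + partial i g x)"
    using elementary_add by (auto intro!: ext partial_add elementary_differentiable)
  then show ?case using elementary_add by (auto intro: elementary.elementary_add)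
next
  case (elementary_mult f g)
  have "partial i (\<lambda>x. f x * g x) = (\<lambda>x. partial i f x * g x + f x * partial i g x)"
    using elementary_mult by (auto intro!: ext partial_mult elementary_differentiable)
  then show ?case using elementary_mult by (auto intro: elementary.elementary_add elementary.elementary_mult)
qed

lemma partials_Nil [simp]: "partials [] f = f"
  by (simp add: partials_def)

lemma partials_Cons: "partials (i # is) f = partial i (partials is f)"
  by (simp add: partials_def)

lemma partials_append: "partials (is @ js) f = partials is (partials js f)"
  by (simp add: partials_def)

lemma partials_snoc: "partials (is @ [i]) f = partials is (partial i f)"
  by (simp add: partials_def)

lemma elementary_partials: "f \<in> elementary \<Longrightarrow> partials is f \<in> elementary"
  by (induction "is") (auto simp: partials_Cons intro: elementary_partial)

lemma elementary_smooth: "f \<in> elementary \<Longrightarrow> smooth f"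
  by (simp add: smooth_def elementary_differentiable elementary_partials)

text \<open>Induction over the generation of the class replaces the theorem of Schwarz: each
  generator depends on at most one coordinate, and the sum and product rules preserve the
  symmetry.\<close>

lemma elementary_partial_commute: "f \<in> elementary \<Longrightarrow> partial i (partial j f) = partial j (partial i f)"
proof (induction rule: elementary.induct)
  case (elementary_flat n a b k)
  have *: "partial i (\<lambda>x. c * flat n (a + b * x $ k)) = (\<lambda>x. c * partial i (\<lambda>x. flat n (a + b * x $ k)) x)" for c n and i :: 'a
    by (rule ext, subst partial_mult) (auto intro!: elementary_differentiable elementary.elementary_flat)
  show ?case by (simp add: partial_flat * cong: if_cong)
next
  case (elementary_add f g)
  have *: "partial i (\<lambda>x. f x + g x) = (\<lambda>x. partial i f x + partial i g x)" if "f \<in> elementary" "g \<in> elementary" for i f g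
    using that by (auto intro!: ext partial_add elementary_differentiable)
  show ?case using elementary_add by (simp add: * elementary_partial)
next
  case (elementary_mult f g)
  have *: "partial i (\<lambda>x. f x * g x) = (\<lambda>x. partial i f x * g x + f x * partial i g x)"
    if "f \<in> elementary" "g \<in> elementary" for i f g
    using that by (auto intro!: ext partial_mult elementary_differentiable)
  have a: "partial i (\<lambda>x. f x + g x) = (\<lambda>x. partial i f x + partial i g x)" if "f \<in> elementary" "g \<in> elementary" for i f g
    using that by (auto intro!: ext partial_add elementary_differentiable)
  show ?case using elementary_mult by (auto simp: * a elementary_partial elementary.elementary_mult)
qed (simp_all add: partial_coord)

lemma elementary_partials_commute: "f \<in> elementary \<Longrightarrow> partials js (partial i f) = partial i (partials js f)"
  by (induction js) (auto simp: partials_Cons elementary_partial_commute elementary_partials)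

text \<open>The head of \<open>is\<close> occurs somewhere in \<open>js\<close> and can be commuted
  to the front. On this class, lists of indices thus act like multi-indices.\<close>

lemma elementary_partials_perm:
  "f \<in> elementary \<Longrightarrow> mset is = mset js \<Longrightarrow> partials is f = partials js f"
proof (induction "is" arbitrary: js)
  case Nil then show ?case by simp
next
  case (Cons i "is")
  have "i \<in> set js" using Cons.prems(2) by (metis list.set_intros(1) set_mset_mset)
  then obtain as bs where js: "js = as @ i # bs" by (meson split_list)
  then have "mset is = mset (as @ bs)" using Cons.prems(2) by simp
  then have "partials is f = partials (as @ bs) f" using Cons by blast
  then show ?case
    using Cons.prems(1) by (simp add: js partials_Cons partials_append elementary_partials_commute elementary_partials)
qed

text \<open>A product over the coordinates, since \<open>flat\<close> is only applied to affine
  functions of a single coordinate. Both factors are positive iff \<bar>z $ i\<bar> < 1 / d, so that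
  the l1 norm, and hence the Euclidean norm, is below 1 wherever the product is nonzero.\<close>

definition bump0 :: "real ^ 'd \<Rightarrow> real" where
  "bump0 z = (\<Prod>i\<in>UNIV. flat 0 (1 + (- real CARD('d)) * z $ i) * flat 0 (1 + real CARD('d) * z $ i))"

lemma flat0_nonneg: "flat 0 t \<ge> 0" by (simp add: flat_def)
lemma flat0_pos: "t > 0 \<Longrightarrow> flat 0 t > 0" by (simp add: flat_def)
lemma flat0_le1: "flat 0 t \<le> 1" by (simp add: flat_def)

lemma bump0_nonneg: "bump0 z \<ge> 0"
  unfolding bump0_def by (intro prod_nonneg mult_nonneg_nonneg flat0_nonneg ballI)

lemma bump0_le1: "bump0 z \<le> 1"
  unfolding bump0_def by (intro prod_le_1 conjI mult_nonneg_nonneg mult_le_one flat0_nonneg flat0_le1)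

lemma bump0_0: "bump0 0 > 0"
  unfolding bump0_def by (intro prod_pos ballI mult_pos_pos flat0_pos) auto

lemma bump0_support:
  fixes z :: "real ^ 'd"
  assumes "bump0 z \<noteq> 0" shows "norm z < 1"
proof -
  have "\<bar>z $ i\<bar> < 1 / real CARD('d)" for i
  proof -
    have "flat 0 (1 + (- real CARD('d)) * z $ i) * flat 0 (1 + real CARD('d) * z $ i) \<noteq> 0"
      using assms unfolding bump0_def by auto
    then have "1 + (- real CARD('d)) * z $ i > 0" "1 + real CARD('d) * z $ i > 0"
      unfolding flat_def by (auto split: if_splits)
    then show ?thesis by (simp add: abs_less_iff field_simps)
  qed
  then have "(\<Sum>i\<in>UNIV. \<bar>z $ i\<bar>) < (\<Sum>i::'d\<in>UNIV. 1 / real CARD('d))"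
    by (intro sum_strict_mono) auto
  then show ?thesis using norm_le_l1_cart[of z] by simp
qed

lemma elementary_continuous: "f \<in> elementary \<Longrightarrow> continuous_on A f"
  by (meson continuous_at_imp_continuous_on differentiable_imp_continuous_within elementary_differentiable)

text \<open>This is why \<open>flat\<close> takes an affine argument in the generators: translates
  and dilates of the bump remain in the class.\<close>

lemma bump0_shift_elem: "(\<lambda>y. bump0 ((y - x) /\<^sub>R e)) \<in> elementary"
proof -
  have "(\<lambda>y. bump0 ((y - x) /\<^sub>R e)) = (\<lambda>y. \<Prod>i\<in>UNIV.
     flat 0 ((1 + real CARD('a) / e * x $ i) + (- real CARD('a) / e) * y $ i) *
     flat 0 ((1 - real CARD('a) / e * x $ i) + (real CARD('a) / e) * y $ i))"
    unfolding bump0_def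
    by (intro ext prod.cong refl arg_cong2[where f="(*)"] arg_cong[where f="flat 0"])
      (auto simp: algebra_simps divide_inverse)
  then show ?thesis by (simp only:) (intro elementary_prod elementary_mult elementary_flat finite)
qed

lemma bump0_elem: "bump0 \<in> elementary"
  using bump0_shift_elem[where x = 0 and e = 1] by simp

section \<open>Mollification\<close>

lemma nn_integral_lborel_affine:
  fixes f :: "'a::euclidean_space \<Rightarrow> ennreal"
  assumes [measurable]: "f \<in> borel_measurable borel" and "c \<noteq> 0"
  shows "(\<integral>\<^sup>+x. f x \<partial>lborel) = ennreal (\<bar>c\<bar> ^ DIM('a)) * (\<integral>\<^sup>+x. f (a + c *\<^sub>R x) \<partial>lborel)"
  by (subst lborel_affine[OF assms(2), of a])
    (simp add: nn_integral_density nn_integral_distr nn_integral_cmult)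

lemma nn_integral_lborel_shift:
  fixes f :: "'a::euclidean_space \<Rightarrow> ennreal"
  assumes "f \<in> borel_measurable borel"
  shows "(\<integral>\<^sup>+x. f (a + x) \<partial>lborel) = (\<integral>\<^sup>+x. f x \<partial>lborel)"
  using nn_integral_lborel_affine[OF assms, of 1 a] by simp

lemma integral_lborel_affine:
  fixes f :: "'a::euclidean_space \<Rightarrow> real"
  assumes [measurable]: "f \<in> borel_measurable borel" and "c \<noteq> 0"
  shows "(\<integral>x. f x \<partial>lborel) = \<bar>c\<bar> ^ DIM('a) * (\<integral>x. f (a + c *\<^sub>R x) \<partial>lborel)"
  by (subst lborel_affine[OF assms(2), of a]) (simp add: integral_density integral_distr)

lemma integrable_lborel_affine:
  fixes f :: "'a::euclidean_space \<Rightarrow> real"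
  assumes "integrable lborel f" and "c \<noteq> 0"
  shows "integrable lborel (\<lambda>x. f (a + c *\<^sub>R x))"
proof -
  have [measurable]: "f \<in> borel_measurable borel" using assms(1) by simp
  have "integrable (density (distr lborel borel (\<lambda>x. a + c *\<^sub>R x)) (\<lambda>_. \<bar>c\<bar> ^ DIM('a))) f"
    using assms(1) lborel_affine[OF assms(2), of a] by metis
  then have "integrable lborel (\<lambda>x. \<bar>c\<bar> ^ DIM('a) * f (a + c *\<^sub>R x))"
    by (simp add: integrable_density integrable_distr_eq)
  then show ?thesis using assms(2) by simp
qed

lemma AE_lborel_affine:
  fixes P :: "'a::euclidean_space \<Rightarrow> bool"
  assumes "AE x in lborel. P x" and c: "c \<noteq> 0"
  shows "AE x in lborel. P (a + c *\<^sub>R x)"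
proof -
  obtain N where N: "N \<in> null_sets lborel" "{x. \<not> P x} \<subseteq> N"
    using assms(1) by (auto simp: eventually_ae_filter)
  then have [measurable]: "N \<in> sets borel" by auto
  have "0 = (\<integral>\<^sup>+x. indicator N x \<partial>lborel)" using N by auto
  also have "\<dots> = ennreal (\<bar>c\<bar> ^ DIM('a)) * (\<integral>\<^sup>+x. indicator N (a + c *\<^sub>R x) \<partial>lborel)"
    by (rule nn_integral_lborel_affine) (use c in auto)
  finally have "(\<integral>\<^sup>+x. indicator N (a + c *\<^sub>R x) \<partial>lborel) = 0"
    using zero_less_power[of "\<bar>c\<bar>" "DIM('a)"] c by (metis ennreal_eq_0_iff mult_eq_0_iff not_le zero_less_abs_iff)
  then have "AE x in lborel. (indicator N (a + c *\<^sub>R x) :: ennreal) = 0"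
    by (subst (asm) nn_integral_0_iff_AE) auto
  then show ?thesis
    by eventually_elim (use N in \<open>auto simp: indicator_def split: if_splits\<close>)
qed

section \<open>Continuity of translations in L1\<close>

lemma open_shift_L1_tendsto_0:
  fixes U :: "'a::euclidean_space set"
  assumes U: "open U" and fin: "emeasure lborel U < \<infinity>" and X: "X \<longlonglongrightarrow> 0"
  shows "(\<lambda>n. \<integral>\<^sup>+x. indicator U x * indicator (- U) (X n + x) \<partial>lborel) \<longlonglongrightarrow> 0"
proof -
  have [measurable]: "U \<in> sets borel" using U by auto
  have "(\<lambda>n. \<integral>\<^sup>+x. indicator U x * indicator (- U) (X n + x) \<partial>lborel) \<longlonglongrightarrow> nn_integral lborel (\<lambda>_::'a. 0)"
  proof (rule nn_integral_dominated_convergence[where w = "indicator U"])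
    show "(\<integral>\<^sup>+ x. indicator U x \<partial>lborel) < \<infinity>" using fin by simp
    \<comment> \<open>A point of the open set U stays in U under all sufficiently small shifts, so
      the integrand is eventually 0.\<close>
    show "AE x in lborel. (\<lambda>n. indicator U x * indicator (- U) (X n + x) :: ennreal) \<longlonglongrightarrow> 0"
    proof (rule AE_I2)
      fix x
      show "(\<lambda>n. indicator U x * indicator (- U) (X n + x) :: ennreal) \<longlonglongrightarrow> 0"
      proof (cases "x \<in> U")
        case True
        have "(\<lambda>n. X n + x) \<longlonglongrightarrow> x" using tendsto_add[OF X tendsto_const[of x]] by simp
        then have "eventually (\<lambda>n. X n + x \<in> U) sequentially"
          using U True by (rule topological_tendstoD)
        then have "eventually (\<lambda>n. indicator U x * indicator (- U) (X n + x) = (0::ennreal)) sequentially"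
          by eventually_elim auto
        then show ?thesis by (rule tendsto_eventually)
      qed simp
    qed
  qed (auto simp: indicator_def)
  then show ?thesis by simp
qed

text \<open>The case of an indicator is the substantial one: outer regularity replaces the Borel set
  by an open set, for which small shifts are harmless. Sums and dominated limits follow by the
  triangle inequality.\<close>

lemma L1_translation_tendsto_0:
  fixes f :: "'a::euclidean_space \<Rightarrow> real"
  assumes "integrable lborel f" and X: "X \<longlonglongrightarrow> 0"
  shows "(\<lambda>n. \<integral>\<^sup>+x. ennreal \<bar>f (X n + x) - f x\<bar> \<partial>lborel) \<longlonglongrightarrow> 0"
  using assms(1)
proof (induction rule: integrable_induct)
  case (base A c)
  then have [measurable]: "A \<in> sets borel" by simp
  have ind: "(\<lambda>n. \<integral>\<^sup>+x. ennreal \<bar>indicator A (X n + x) - indicator A x\<bar> \<partial>lborel) \<longlonglongrightarrow> 0"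
  proof (rule tendsto_zero_ennreal)
    fix r :: real assume r: "0 < r"
    \<comment> \<open>One fifth of r, because four terms of this size, two from shifting U and two
      from U - A, have to add up to less than r.\<close>
    obtain U where U: "open U" "A \<subseteq> U" "emeasure lborel (U - A) < ennreal (r / 5)"
      using outer_regular_lborel[of A "r / 5"] r by auto
    have [measurable]: "U \<in> sets borel" using U by auto
    have fin: "emeasure lborel U < \<infinity>"
    proof -
      have "emeasure lborel U = emeasure lborel A + emeasure lborel (U - A)"
        using U by (subst plus_emeasure) (auto intro!: arg_cong[where f="emeasure lborel"])
      also have "\<dots> < \<infinity>" using base U(3) by (auto simp: less_top[symmetric] top_unique)
      finally show ?thesis .
    qed
    let ?D = "\<lambda>z. \<integral>\<^sup>+x. indicator U x * indicator (- U) (z + x) \<partial>lborel"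
    have "(\<lambda>n. ?D (X n)) \<longlonglongrightarrow> 0" by (rule open_shift_L1_tendsto_0[OF U(1) fin X])
    then have e1: "eventually (\<lambda>n. ?D (X n) < ennreal (r / 5)) sequentially"
      using r by (intro order_tendstoD) auto
    have "(\<lambda>n. - X n) \<longlonglongrightarrow> 0" using tendsto_minus[OF X] by simp
    then have "(\<lambda>n. ?D (- X n)) \<longlonglongrightarrow> 0" by (rule open_shift_L1_tendsto_0[OF U(1) fin])
    then have e2: "eventually (\<lambda>n. ?D (- X n) < ennreal (r / 5)) sequentially"
      using r by (intro order_tendstoD) auto
    show "\<forall>\<^sub>F n in sequentially. (\<integral>\<^sup>+x. ennreal \<bar>indicator A (X n + x) - indicator A x\<bar> \<partial>lborel) < ennreal r"
      using e1 e2
    proof eventually_elim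
      case (elim n)
      let ?z = "X n"
      have "(\<integral>\<^sup>+x. ennreal \<bar>indicator A (?z + x) - indicator A x\<bar> \<partial>lborel) \<le>
         (\<integral>\<^sup>+x. (indicator U x * indicator (- U) (?z + x) + indicator (U - A) (?z + x)) +
           (indicator U (?z + x) * indicator (- U) x + indicator (U - A) x) \<partial>lborel)"
        using U(2) by (intro nn_integral_mono) (auto simp: indicator_def)
      also have "\<dots> = (?D ?z + (\<integral>\<^sup>+x. indicator (U - A) (?z + x) \<partial>lborel)) +
           ((\<integral>\<^sup>+x. indicator U (?z + x) * indicator (- U) x \<partial>lborel) + (\<integral>\<^sup>+x. indicator (U - A) x \<partial>lborel))"
        by (simp add: nn_integral_add)
      also have "(\<integral>\<^sup>+x. indicator (U - A) (?z + x) \<partial>lborel) = emeasure lborel (U - A)"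
        by (subst nn_integral_lborel_shift) auto
      also have "(\<integral>\<^sup>+x. indicator U (?z + x) * indicator (- U) x \<partial>lborel) = ?D (- ?z)"
        using nn_integral_lborel_shift[of "\<lambda>x. indicator U x * indicator (- U) (- ?z + x)" ?z] by simp
      also have "(\<integral>\<^sup>+x. indicator (U - A) x \<partial>lborel) = emeasure lborel (U - A)" by simp
      also have "(?D ?z + emeasure lborel (U - A)) + (?D (- ?z) + emeasure lborel (U - A)) \<le>
          (ennreal (r / 5) + ennreal (r / 5)) + (ennreal (r / 5) + ennreal (r / 5))"
        by (intro add_mono less_imp_le[OF elim(1)] less_imp_le[OF elim(2)] less_imp_le[OF U(3)])
      also have "\<dots> < ennreal r" using r by (simp add: ennreal_less_iff flip: ennreal_plus)
      finally show ?case .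
    qed
  qed
  have "(\<lambda>n. ennreal \<bar>c\<bar> * (\<integral>\<^sup>+x. ennreal \<bar>indicator A (X n + x) - indicator A x\<bar> \<partial>lborel)) \<longlonglongrightarrow> ennreal \<bar>c\<bar> * 0"
    by (intro ennreal_tendsto_cmult ind) auto
  moreover have "ennreal \<bar>c\<bar> * (\<integral>\<^sup>+x. ennreal \<bar>indicator A (X n + x) - indicator A x\<bar> \<partial>lborel) =
      (\<integral>\<^sup>+x. ennreal \<bar>indicator A (X n + x) *\<^sub>R c - indicator A x *\<^sub>R c\<bar> \<partial>lborel)" for n
    by (subst nn_integral_cmult[symmetric])
      (auto simp flip: ennreal_mult abs_mult simp: algebra_simps)
  ultimately show ?case by simp
next
  case (add f g)
  have [measurable]: "f \<in> borel_measurable borel" "g \<in> borel_measurable borel" using add by auto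
  have "(\<lambda>n. (\<integral>\<^sup>+x. ennreal \<bar>f (X n + x) - f x\<bar> \<partial>lborel) + (\<integral>\<^sup>+x. ennreal \<bar>g (X n + x) - g x\<bar> \<partial>lborel)) \<longlonglongrightarrow> 0 + 0"
    by (intro tendsto_add add)
  then have s: "(\<lambda>n. (\<integral>\<^sup>+x. ennreal \<bar>f (X n + x) - f x\<bar> \<partial>lborel) + (\<integral>\<^sup>+x. ennreal \<bar>g (X n + x) - g x\<bar> \<partial>lborel)) \<longlonglongrightarrow> 0"
    by simp
  show ?case
  proof (rule tendsto_sandwich[OF _ _ tendsto_const s])
    show "\<forall>\<^sub>F n in sequentially. (\<integral>\<^sup>+x. ennreal \<bar>f (X n + x) + g (X n + x) - (f x + g x)\<bar> \<partial>lborel)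
      \<le> (\<integral>\<^sup>+x. ennreal \<bar>f (X n + x) - f x\<bar> \<partial>lborel) + (\<integral>\<^sup>+x. ennreal \<bar>g (X n + x) - g x\<bar> \<partial>lborel)"
    proof (rule always_eventually, rule allI)
      fix n
      have "(\<integral>\<^sup>+x. ennreal \<bar>f (X n + x) + g (X n + x) - (f x + g x)\<bar> \<partial>lborel) \<le>
         (\<integral>\<^sup>+x. ennreal \<bar>f (X n + x) - f x\<bar> + ennreal \<bar>g (X n + x) - g x\<bar> \<partial>lborel)"
        by (intro nn_integral_mono) (auto simp flip: ennreal_plus intro!: ennreal_leI)
      also have "\<dots> = (\<integral>\<^sup>+x. ennreal \<bar>f (X n + x) - f x\<bar> \<partial>lborel) + (\<integral>\<^sup>+x. ennreal \<bar>g (X n + x) - g x\<bar> \<partial>lborel)"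
        by (intro nn_integral_add) auto
      finally show "(\<integral>\<^sup>+x. ennreal \<bar>f (X n + x) + g (X n + x) - (f x + g x)\<bar> \<partial>lborel) \<le> \<dots>" .
    qed
  qed auto
next
  case (lim f s)
  have [measurable]: "f \<in> borel_measurable borel" "\<And>i. s i \<in> borel_measurable borel" using lim by auto
  have "(\<lambda>i. \<integral>\<^sup>+x. ennreal \<bar>s i x - f x\<bar> \<partial>lborel) \<longlonglongrightarrow> nn_integral lborel (\<lambda>_::'a. 0)"
  proof (rule nn_integral_dominated_convergence[where w = "\<lambda>x. ennreal (3 * \<bar>f x\<bar>)"])
    have "integrable lborel (\<lambda>x. 3 * \<bar>f x\<bar>)" using lim by auto
    then show "(\<integral>\<^sup>+ x. ennreal (3 * \<bar>f x\<bar>) \<partial>lborel) < \<infinity>"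
      by (subst nn_integral_eq_integral) auto
    show "AE x in lborel. ennreal \<bar>s j x - f x\<bar> \<le> ennreal (3 * \<bar>f x\<bar>)" for j
    proof (rule AE_I2)
      fix x have "norm (s j x) \<le> 2 * norm (f x)" by (rule lim) simp
      then have "\<bar>s j x\<bar> \<le> 2 * \<bar>f x\<bar>" by simp
      then show "ennreal \<bar>s j x - f x\<bar> \<le> ennreal (3 * \<bar>f x\<bar>)" by (intro ennreal_leI) linarith
    qed
    show "AE x in lborel. (\<lambda>i. ennreal \<bar>s i x - f x\<bar>) \<longlonglongrightarrow> 0"
    proof (rule AE_I2)
      fix x
      have "(\<lambda>i. \<bar>s i x - f x\<bar>) \<longlonglongrightarrow> \<bar>f x - f x\<bar>"
        by (intro tendsto_intros lim) auto
      then have "(\<lambda>i. ennreal \<bar>s i x - f x\<bar>) \<longlonglongrightarrow> ennreal 0"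
        by (intro tendsto_ennrealI) auto
      then show "(\<lambda>i. ennreal \<bar>s i x - f x\<bar>) \<longlonglongrightarrow> 0" by simp
    qed
  qed auto
  then have L: "(\<lambda>i. \<integral>\<^sup>+x. ennreal \<bar>s i x - f x\<bar> \<partial>lborel) \<longlonglongrightarrow> 0" by simp
  show ?case
  proof (rule tendsto_zero_ennreal)
    fix r :: real assume r: "0 < r"
    obtain i where i: "(\<integral>\<^sup>+x. ennreal \<bar>s i x - f x\<bar> \<partial>lborel) < ennreal (r / 4)"
      using order_tendstoD(2)[OF L, of "ennreal (r/4)"] r
      by (auto simp: eventually_sequentially)
    have "(\<lambda>n. \<integral>\<^sup>+x. ennreal \<bar>s i (X n + x) - s i x\<bar> \<partial>lborel) \<longlonglongrightarrow> 0" by (rule lim)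
    then have "eventually (\<lambda>n. (\<integral>\<^sup>+x. ennreal \<bar>s i (X n + x) - s i x\<bar> \<partial>lborel) < ennreal (r / 4)) sequentially"
      by (rule order_tendstoD) (use r in simp)
    then show "\<forall>\<^sub>F n in sequentially. (\<integral>\<^sup>+x. ennreal \<bar>f (X n + x) - f x\<bar> \<partial>lborel) < ennreal r"
    proof eventually_elim
      case (elim n)
      have "(\<integral>\<^sup>+x. ennreal \<bar>f (X n + x) - f x\<bar> \<partial>lborel) \<le>
         (\<integral>\<^sup>+x. (ennreal \<bar>s i (X n + x) - f (X n + x)\<bar> + ennreal \<bar>s i x - f x\<bar>) + ennreal \<bar>s i (X n + x) - s i x\<bar> \<partial>lborel)"
        by (intro nn_integral_mono) (auto simp flip: ennreal_plus intro!: ennreal_leI)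
      also have "\<dots> = ((\<integral>\<^sup>+x. ennreal \<bar>s i (X n + x) - f (X n + x)\<bar> \<partial>lborel) + (\<integral>\<^sup>+x. ennreal \<bar>s i x - f x\<bar> \<partial>lborel))
         + (\<integral>\<^sup>+x. ennreal \<bar>s i (X n + x) - s i x\<bar> \<partial>lborel)"
        by (simp add: nn_integral_add)
      also have "(\<integral>\<^sup>+x. ennreal \<bar>s i (X n + x) - f (X n + x)\<bar> \<partial>lborel) = (\<integral>\<^sup>+x. ennreal \<bar>s i x - f x\<bar> \<partial>lborel)"
        using nn_integral_lborel_shift[of "\<lambda>x. ennreal \<bar>s i x - f x\<bar>" "X n"] by simp
      also have "((\<integral>\<^sup>+x. ennreal \<bar>s i x - f x\<bar> \<partial>lborel) + (\<integral>\<^sup>+x. ennreal \<bar>s i x - f x\<bar> \<partial>lborel))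
         + (\<integral>\<^sup>+x. ennreal \<bar>s i (X n + x) - s i x\<bar> \<partial>lborel) \<le> (ennreal (r/4) + ennreal (r/4)) + ennreal (r / 4)"
        by (intro add_mono less_imp_le[OF i] less_imp_le[OF elim])
      also have "\<dots> < ennreal r" using r by (simp add: ennreal_less_iff flip: ennreal_plus)
      finally show ?case .
    qed
  qed
qed

text \<open>General enough to include the normalised indicator of the unit ball besides
  \<open>bump\<close>: the latter yields test functions, the former means over balls.\<close>

definition kernel :: "('a::euclidean_space \<Rightarrow> real) \<Rightarrow> bool" where
  "kernel K \<longleftrightarrow> K \<in> borel_measurable borel \<and> (\<forall>z. 0 \<le> K z) \<and> (\<exists>M. \<forall>z. K z \<le> M) \<and>
     (\<forall>z. norm z \<ge> 1 \<longrightarrow> K z = 0) \<and> (\<integral>z. K z \<partial>lborel) = 1"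

text \<open>With \<open>x + e z\<close> instead of \<open>x - e z\<close>, the substitution y = x +
  e z produces the kernel at (y - x) / e without a reflection.\<close>

definition mollify :: "('a::euclidean_space \<Rightarrow> real) \<Rightarrow> real \<Rightarrow> ('a \<Rightarrow> real) \<Rightarrow> 'a \<Rightarrow> real" where
  "mollify K e f x = (\<integral>z. K z * f (x + e *\<^sub>R z) \<partial>lborel)"

lemma kernel_measurable: "kernel K \<Longrightarrow> K \<in> borel_measurable borel"
  and kernel_nonneg: "kernel K \<Longrightarrow> 0 \<le> K z"
  and kernel_zero: "kernel K \<Longrightarrow> norm z \<ge> 1 \<Longrightarrow> K z = 0"
  and kernel_integral: "kernel K \<Longrightarrow> (\<integral>z. K z \<partial>lborel) = 1"
  by (auto simp: kernel_def)

lemma kernel_integrable: "kernel K \<Longrightarrow> integrable lborel K"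
  using kernel_integral not_integrable_integral_eq by fastforce

lemma kernel_nn_integral: "kernel K \<Longrightarrow> (\<integral>\<^sup>+z. ennreal (K z) \<partial>lborel) = 1"
  by (subst nn_integral_eq_integral) (auto simp: kernel_integrable kernel_nonneg kernel_integral)

lemma kernel_mult_integrable:
  assumes K: "kernel K" and f: "integrable lborel f" and e: "e \<noteq> 0"
  shows "integrable lborel (\<lambda>z. K z * f (x + e *\<^sub>R z))"
proof -
  obtain M where M: "\<And>z. K z \<le> M" using K by (auto simp: kernel_def)
  have [measurable]: "f \<in> borel_measurable borel" "K \<in> borel_measurable borel"
    using f K kernel_measurable by auto
  have "integrable lborel (\<lambda>z. M * f (x + e *\<^sub>R z))"
    using integrable_lborel_affine[OF f e] by simp
  then show ?thesis
    by (rule Bochner_Integration.integrable_bound)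
      (auto simp: abs_mult intro!: mult_right_mono order_trans[OF M abs_ge_self] kernel_nonneg[OF K] AE_I2
        simp: kernel_nonneg[OF K])
qed

lemma mollify_measurable [measurable]:
  assumes [measurable]: "K \<in> borel_measurable borel" "f \<in> borel_measurable borel"
  shows "mollify K e f \<in> borel_measurable borel"
  unfolding mollify_def[abs_def] by measurable

text \<open>In this form, mollification pairs f with a rescaled kernel centred at x. For
  \<open>bump\<close> that kernel is a test function, which connects mollification with weak
  derivatives.\<close>

lemma mollify_alt:
  fixes f :: "'a::euclidean_space \<Rightarrow> real"
  assumes [measurable]: "K \<in> borel_measurable borel" "f \<in> borel_measurable borel" and e: "e > 0"
  shows "mollify K e f x = (\<integral>y. f y * (K ((y - x) /\<^sub>R e) / e ^ DIM('a)) \<partial>lborel)"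
proof -
  have "(\<integral>y. f y * (K ((y - x) /\<^sub>R e) / e ^ DIM('a)) \<partial>lborel) =
     \<bar>e\<bar> ^ DIM('a) * (\<integral>z. f (x + e *\<^sub>R z) * (K ((x + e *\<^sub>R z - x) /\<^sub>R e) / e ^ DIM('a)) \<partial>lborel)"
    by (rule integral_lborel_affine) (use e in auto)
  also have "\<dots> = (\<integral>z. \<bar>e\<bar> ^ DIM('a) * (f (x + e *\<^sub>R z) * (K ((x + e *\<^sub>R z - x) /\<^sub>R e) / e ^ DIM('a))) \<partial>lborel)"
    by simp
  also have "\<dots> = mollify K e f x"
    unfolding mollify_def by (rule Bochner_Integration.integral_cong) (use e in auto)
  finally show ?thesis by simp
qed

lemma mollify_L1_le:
  assumes K: "kernel K" and f: "integrable lborel f" and e: "e \<noteq> 0"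
  shows "(\<integral>\<^sup>+x. ennreal \<bar>mollify K e f x - f x\<bar> \<partial>lborel) \<le>
    (\<integral>\<^sup>+z. ennreal (K z) * (\<integral>\<^sup>+x. ennreal \<bar>f (e *\<^sub>R z + x) - f x\<bar> \<partial>lborel) \<partial>lborel)"
proof -
  have [measurable]: "f \<in> borel_measurable borel" "K \<in> borel_measurable borel"
    using f K kernel_measurable by auto
  have i1: "integrable lborel (\<lambda>z. K z * f (x + e *\<^sub>R z))" for x
    by (rule kernel_mult_integrable[OF K f e])
  have i2: "integrable lborel (\<lambda>z. K z * f x)" for x
    using kernel_integrable[OF K] by simp
  have "ennreal \<bar>mollify K e f x - f x\<bar> \<le> (\<integral>\<^sup>+z. ennreal (K z * \<bar>f (e *\<^sub>R z + x) - f x\<bar>) \<partial>lborel)" for x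
  proof -
    have "mollify K e f x - f x = (\<integral>z. K z * f (x + e *\<^sub>R z) - K z * f x \<partial>lborel)"
      unfolding mollify_def Bochner_Integration.integral_diff[OF i1 i2]
      by (simp add: kernel_integral[OF K])
    then have "ennreal \<bar>mollify K e f x - f x\<bar> \<le> (\<integral>\<^sup>+z. ennreal \<bar>K z * f (x + e *\<^sub>R z) - K z * f x\<bar> \<partial>lborel)"
      using integral_norm_bound_ennreal[OF Bochner_Integration.integrable_diff[OF i1 i2]] by simp
    also have "\<dots> = (\<integral>\<^sup>+z. ennreal (K z * \<bar>f (e *\<^sub>R z + x) - f x\<bar>) \<partial>lborel)"
      by (intro nn_integral_cong arg_cong[where f=ennreal])
        (auto simp: kernel_nonneg[OF K] abs_mult add.commute simp flip: right_diff_distrib)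
    finally show ?thesis .
  qed
  then have "(\<integral>\<^sup>+x. ennreal \<bar>mollify K e f x - f x\<bar> \<partial>lborel) \<le>
     (\<integral>\<^sup>+x. \<integral>\<^sup>+z. ennreal (K z * \<bar>f (e *\<^sub>R z + x) - f x\<bar>) \<partial>lborel \<partial>lborel)"
    by (intro nn_integral_mono)
  also have "\<dots> = (\<integral>\<^sup>+z. \<integral>\<^sup>+x. ennreal (K z * \<bar>f (e *\<^sub>R z + x) - f x\<bar>) \<partial>lborel \<partial>lborel)"
    by (rule lborel_pair.Fubini') measurable
  also have "\<dots> = (\<integral>\<^sup>+z. ennreal (K z) * (\<integral>\<^sup>+x. ennreal \<bar>f (e *\<^sub>R z + x) - f x\<bar> \<partial>lborel) \<partial>lborel)"
    by (intro nn_integral_cong) (subst nn_integral_cmult[symmetric], auto simp: ennreal_mult kernel_nonneg[OF K])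
  finally show ?thesis .
qed

text \<open>Dominated convergence in z: the inner integral tends to 0 by continuity of translations
  and is at most twice the L1 norm of f.\<close>

lemma mollify_L1_tendsto:
  assumes K: "kernel K" and f: "integrable lborel f" and e: "\<And>n. e n \<noteq> 0" "e \<longlonglongrightarrow> 0"
  shows "(\<lambda>n. \<integral>\<^sup>+x. ennreal \<bar>mollify K (e n) f x - f x\<bar> \<partial>lborel) \<longlonglongrightarrow> 0"
proof -
  have [measurable]: "f \<in> borel_measurable borel" "K \<in> borel_measurable borel"
    using f K kernel_measurable by auto
  define c where "c = (\<integral>\<^sup>+x. ennreal \<bar>f x\<bar> \<partial>lborel)"
  have c: "c < \<infinity>" unfolding c_def using f by (simp add: integrable_iff_bounded)
  have b: "(\<integral>\<^sup>+x. ennreal \<bar>f (a + x) - f x\<bar> \<partial>lborel) \<le> c + c" for a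
  proof -
    have "(\<integral>\<^sup>+x. ennreal \<bar>f (a + x) - f x\<bar> \<partial>lborel) \<le> (\<integral>\<^sup>+x. ennreal \<bar>f (a + x)\<bar> + ennreal \<bar>f x\<bar> \<partial>lborel)"
      by (intro nn_integral_mono) (auto simp flip: ennreal_plus intro!: ennreal_leI)
    also have "\<dots> = c + c"
      unfolding c_def by (subst nn_integral_add) (auto simp: nn_integral_lborel_shift[of "\<lambda>x. ennreal \<bar>f x\<bar>"])
    finally show ?thesis .
  qed
  have "(\<lambda>n. \<integral>\<^sup>+z. ennreal (K z) * (\<integral>\<^sup>+x. ennreal \<bar>f (e n *\<^sub>R z + x) - f x\<bar> \<partial>lborel) \<partial>lborel)
     \<longlonglongrightarrow> nn_integral lborel (\<lambda>_::'a. 0)"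
  proof (rule nn_integral_dominated_convergence[where w = "\<lambda>z. ennreal (K z) * (c + c)"])
    show "(\<integral>\<^sup>+z. ennreal (K z) * (c + c) \<partial>lborel) < \<infinity>"
      using c by (subst nn_integral_multc) (auto simp: kernel_nn_integral[OF K])
    show "AE x in lborel. ennreal (K x) * (\<integral>\<^sup>+ xa. ennreal \<bar>f (e j *\<^sub>R x + xa) - f xa\<bar> \<partial>lborel)
         \<le> ennreal (K x) * (c + c)" for j
      by (rule AE_I2) (rule mult_left_mono[OF b zero_le])
    show "AE x in lborel. (\<lambda>i. ennreal (K x) * (\<integral>\<^sup>+ xa. ennreal \<bar>f (e i *\<^sub>R x + xa) - f xa\<bar> \<partial>lborel)) \<longlonglongrightarrow> 0"
    proof (rule AE_I2)
      fix x :: 'a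
      have "(\<lambda>n. e n *\<^sub>R x) \<longlonglongrightarrow> 0 *\<^sub>R x" by (intro tendsto_intros e)
      then have "(\<lambda>i. ennreal (K x) * (\<integral>\<^sup>+ xa. ennreal \<bar>f (e i *\<^sub>R x + xa) - f xa\<bar> \<partial>lborel)) \<longlonglongrightarrow> ennreal (K x) * 0"
        by (intro ennreal_tendsto_cmult L1_translation_tendsto_0[OF f]) auto
      then show "(\<lambda>i. ennreal (K x) * (\<integral>\<^sup>+ xa. ennreal \<bar>f (e i *\<^sub>R x + xa) - f xa\<bar> \<partial>lborel)) \<longlonglongrightarrow> 0" by simp
    qed
  qed measurable
  then have s: "(\<lambda>n. \<integral>\<^sup>+z. ennreal (K z) * (\<integral>\<^sup>+x. ennreal \<bar>f (e n *\<^sub>R z + x) - f x\<bar> \<partial>lborel) \<partial>lborel) \<longlonglongrightarrow> 0"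
    by simp
  show ?thesis
    by (rule tendsto_sandwich[OF _ _ tendsto_const s])
      (simp_all add: mollify_L1_le[OF K f e(1)])
qed

text \<open>Convergence almost everywhere along a subsequence is enough to identify limits, and it
  follows from L1 convergence without Lebesgue points.\<close>

lemma mollify_AE_subseq:
  assumes K: "kernel K" and f: "integrable lborel f" and e: "\<And>n. e n \<noteq> 0" "e \<longlonglongrightarrow> 0"
  obtains r :: "nat \<Rightarrow> nat" where "strict_mono r" "AE x in lborel. (\<lambda>n. mollify K (e (r n)) f x) \<longlonglongrightarrow> f x"
proof -
  have [measurable]: "f \<in> borel_measurable borel" "K \<in> borel_measurable borel"
    using f K kernel_measurable by auto
  let ?d = "\<lambda>n x. mollify K (e n) f x - f x"
  have L: "(\<lambda>n. \<integral>\<^sup>+x. ennreal \<bar>?d n x\<bar> \<partial>lborel) \<longlonglongrightarrow> 0"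
    by (rule mollify_L1_tendsto[OF K f e])
  \<comment> \<open>Beyond N the differences have L1 norm below 1, which gives their
    integrability.\<close>
  obtain N where N: "\<And>n. n \<ge> N \<Longrightarrow> (\<integral>\<^sup>+x. ennreal \<bar>?d n x\<bar> \<partial>lborel) < 1"
    using order_tendstoD(2)[OF L, of 1] by (auto simp: eventually_sequentially)
  have int: "integrable lborel (?d (n + N))" for n
    unfolding integrable_iff_bounded using N[of "n + N"] by (auto intro: less_trans)
  have "(\<lambda>n. \<integral>x. norm (?d (n + N) x) \<partial>lborel) \<longlonglongrightarrow> 0"
  proof -
    have "(\<lambda>n. enn2real (\<integral>\<^sup>+x. ennreal \<bar>?d (n + N) x\<bar> \<partial>lborel)) \<longlonglongrightarrow> enn2real 0"
      using L[THEN LIMSEQ_ignore_initial_segment, of N] by (intro tendsto_enn2real) auto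
    then show ?thesis
      by (simp add: integral_eq_nn_integral)
  qed
  from tendsto_L1_AE_subseq[of lborel "\<lambda>n. ?d (n + N)", OF int this] obtain r :: "nat \<Rightarrow> nat"
    where r: "strict_mono r" "AE x in lborel. (\<lambda>n. ?d (r n + N) x) \<longlonglongrightarrow> 0" by auto
  have "strict_mono (\<lambda>n. r n + N)" using r(1) by (simp add: strict_mono_def)
  moreover have "AE x in lborel. (\<lambda>n. mollify K (e (r n + N)) f x) \<longlonglongrightarrow> f x"
    using r(2) by eventually_elim (rule LIM_zero_cancel)
  ultimately show ?thesis by (rule that[of "\<lambda>n. r n + N"])
qed

text \<open>Jensen's inequality for the square and the probability density P, obtained from the
  nonnegativity of the variance. Integrability of \<open>P x * g x\<close> need not be known: if it
  fails, the Bochner integral on the left has the default value 0.\<close>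

lemma square_integral_le:
  assumes P: "\<And>x. P x \<ge> (0::real)" "integrable M P" "(\<integral>x. P x \<partial>M) = 1"
    and g1: "g \<in> borel_measurable M"
  shows "ennreal ((\<integral>x. P x * g x \<partial>M)\<^sup>2) \<le> (\<integral>\<^sup>+x. ennreal (P x * (g x)\<^sup>2) \<partial>M)"
proof (cases "integrable M (\<lambda>x. P x * g x) \<and> (\<integral>\<^sup>+x. ennreal (P x * (g x)\<^sup>2) \<partial>M) < \<infinity>")
  case True
  note g = g1 conjunct1[OF True]
  have [measurable]: "P \<in> borel_measurable M" "g \<in> borel_measurable M" using P g by auto
  have i: "integrable M (\<lambda>x. P x * (g x)\<^sup>2)"
    unfolding integrable_iff_bounded using True P(1) by auto
  define a where "a = (\<integral>x. P x * g x \<partial>M)"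
  have "0 \<le> (\<integral>x. P x * (g x - a)\<^sup>2 \<partial>M)" using P by simp
  also have "(\<lambda>x. P x * (g x - a)\<^sup>2) = (\<lambda>x. (P x * (g x)\<^sup>2 - 2 * a * (P x * g x)) + a\<^sup>2 * P x)"
    by (auto simp: power2_diff algebra_simps)
  also have "(\<integral>x. (P x * (g x)\<^sup>2 - 2 * a * (P x * g x)) + a\<^sup>2 * P x \<partial>M) = (\<integral>x. P x * (g x)\<^sup>2 \<partial>M) - 2 * a * a + a\<^sup>2"
    using i g P by (simp add: a_def)
  finally have "a\<^sup>2 \<le> (\<integral>x. P x * (g x)\<^sup>2 \<partial>M)" by (simp add: power2_eq_square)
  then show ?thesis
    unfolding a_def using i P(1) by (subst nn_integral_eq_integral) (auto intro: ennreal_leI)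
next
  case False
  then have "(\<integral>x. P x * g x \<partial>M) = 0 \<or> (\<integral>\<^sup>+x. ennreal (P x * (g x)\<^sup>2) \<partial>M) = top"
    by (auto simp: not_less top_unique not_integrable_integral_eq)
  then show ?thesis by auto
qed

lemma mollify_square_le:
  assumes K: "kernel K" and f: "integrable lborel f" and e: "e \<noteq> 0"
  shows "ennreal ((mollify K e f x)\<^sup>2) \<le> (\<integral>\<^sup>+z. ennreal (K z * (f (x + e *\<^sub>R z))\<^sup>2) \<partial>lborel)"
proof -
  have [measurable]: "f \<in> borel_measurable borel" using f by auto
  show ?thesis
    unfolding mollify_def
    by (rule square_integral_le)
      (auto simp: kernel_nonneg[OF K] kernel_integrable[OF K] kernel_integral[OF K] kernel_mult_integrable[OF K f e])
qed

section \<open>The smooth kernel\<close>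

definition bump :: "real ^ 'd \<Rightarrow> real" where
  "bump z = bump0 z / (\<integral>x. bump0 (x :: real ^ 'd) \<partial>lborel)"

lemma bump0_integrable: "integrable lborel bump0"
proof -
  have "integrable lborel (\<lambda>x. indicator (cball 0 1) x *\<^sub>R bump0 x)"
    by (rule borel_integrable_compact) (auto intro: elementary_continuous bump0_elem)
  moreover have "(\<lambda>x. indicator (cball 0 1) x *\<^sub>R bump0 x) = bump0"
    using bump0_support by (force simp: indicator_def intro!: ext)
  ultimately show ?thesis by metis
qed

lemma AE_notin_open_imp_empty:
  fixes U :: "'a::euclidean_space set"
  assumes "open U" "AE x in lborel. x \<notin> U" shows "U = {}"
proof -
  have "U \<in> null_sets lborel" using assms by (subst AE_iff_null_sets) auto
  then have 0: "measure lborel U = 0" "emeasure lborel U \<noteq> \<infinity>"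
    by (auto simp: null_sets_def measure_def)
  show ?thesis
  proof (rule ccontr)
    assume "U \<noteq> {}"
    then obtain x r where r: "r > 0" "ball x r \<subseteq> U" using assms(1) openE by blast
    have "measure lborel (ball x r) \<le> measure lborel U"
      using r(2) 0(2) assms(1) by (intro measure_mono_fmeasurable) (auto simp: fmeasurable_def less_top)
    then show False using content_ball_pos[OF r(1), of x] 0 by simp
  qed
qed

lemma bump0_integral_pos: "(\<integral>z. bump0 (z :: real ^ 'a) \<partial>lborel) > 0"
proof -
  have "(\<integral>z. bump0 (z :: real ^ 'a) \<partial>lborel) \<noteq> 0"
  proof
    assume "(\<integral>z. bump0 (z :: real ^ 'a) \<partial>lborel) = 0"
    then have "AE z in lborel. bump0 (z :: real ^ 'a) = 0"
      by (subst (asm) integral_nonneg_eq_0_iff_AE) (auto simp: bump0_nonneg bump0_integrable)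
    then have "AE z in lborel. z \<notin> {z :: real ^ 'a. bump0 z > 0}" by eventually_elim auto
    moreover have "open {z :: real ^ 'a. bump0 z > 0}"
      using elementary_continuous[OF bump0_elem, of UNIV] by (intro open_Collect_less) auto
    ultimately have "{z :: real ^ 'a. bump0 z > 0} = {}"
      using AE_notin_open_imp_empty by blast
    then show False using bump0_0[where 'a='a] by auto
  qed
  moreover have "(\<integral>z. bump0 (z :: real ^ 'a) \<partial>lborel) \<ge> 0" by (simp add: bump0_nonneg)
  ultimately show ?thesis by simp
qed

lemma bump_elem: "bump \<in> elementary"
  using elementary_cmult[OF bump0_elem, of "1 / (\<integral>z. bump0 z \<partial>lborel)"] by (simp add: bump_def[abs_def])

lemma bump_kernel: "kernel bump"
proof -
  have m: "bump \<in> borel_measurable borel"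
    using elementary_continuous[OF bump_elem, of UNIV] by (rule borel_measurable_continuous_onI)
  have "bump z \<le> 1 / (\<integral>z. bump0 (z::real^'a) \<partial>lborel)" for z :: "real ^ 'a"
    unfolding bump_def by (intro divide_right_mono bump0_le1 less_imp_le[OF bump0_integral_pos])
  moreover have "norm z \<ge> 1 \<Longrightarrow> bump z = 0" for z :: "real ^ 'a"
    using bump0_support[of z] by (auto simp: bump_def)
  moreover have "integral\<^sup>L lborel (bump :: real^'a \<Rightarrow> real) = 1"
    unfolding bump_def[abs_def] using bump0_integral_pos[where 'a='a] by simp
  ultimately show ?thesis
    using m unfolding kernel_def
    by (intro conjI allI exI impI) (auto simp: bump_def bump0_nonneg less_imp_le[OF bump0_integral_pos])
qed

lemma bump_shift_elem: "(\<lambda>y. bump ((y - x) /\<^sub>R e) / c) \<in> elementary"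
  using elementary_cmult[OF bump0_shift_elem, of "1 / (c * (\<integral>z. bump0 (z::real^'a) \<partial>lborel))"] 
  by (simp add: bump_def mult.commute)

lemma bump_shift_test_function:
  fixes x :: "real ^ 'd"
  assumes e: "e > 0" and U: "cball x e \<subseteq> U"
  shows "test_function U (\<lambda>y. bump ((y - x) /\<^sub>R e) / c)"
proof -
  have "{y. bump ((y - x) /\<^sub>R e) / c \<noteq> 0} \<subseteq> cball x e"
  proof safe
    fix y assume "bump ((y - x) /\<^sub>R e) / c \<noteq> 0"
    then have "norm ((y - x) /\<^sub>R e) < 1"
      using kernel_zero[OF bump_kernel, of "(y - x) /\<^sub>R e"] by (cases "norm ((y - x) /\<^sub>R e) < 1") auto
    then have "norm (y - x) / e < 1" using e by (simp only: norm_scaleR) (simp add: divide_inverse mult.commute)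
    then show "y \<in> cball x e" using e by (simp add: dist_norm norm_minus_commute field_simps)
  qed
  then have "closure {y. bump ((y - x) /\<^sub>R e) / c \<noteq> 0} \<subseteq> cball x e"
    by (rule closure_minimal) auto
  then show ?thesis
    unfolding test_function_def
    using U elementary_smooth[OF bump_shift_elem, of e x c]
    by (auto simp: compact_eq_bounded_closed intro: bounded_subset[OF bounded_cball])
qed

section \<open>Weak derivatives and translations\<close>

text \<open>An indicator under \<open>lborel\<close> instead of a restricted measure, so that
  shifts, dilations and Fubini apply directly; values in \<open>ennreal\<close> avoid integrability
  side conditions.\<close>

definition sq_norm :: "'a::euclidean_space set \<Rightarrow> ('a \<Rightarrow> real) \<Rightarrow> ennreal" where
  "sq_norm U f = (\<integral>\<^sup>+x. indicator U x * ennreal ((f x)\<^sup>2) \<partial>lborel)"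

definition sq_int :: "'a::euclidean_space set \<Rightarrow> ('a \<Rightarrow> real) \<Rightarrow> bool" where
  "sq_int U f \<longleftrightarrow> f \<in> borel_measurable borel \<and> sq_norm U f < \<infinity>"

text \<open>The integrals extend over the whole space, but test functions vanish outside U, so only
  the values of f and g in U matter.\<close>

definition weak_partial :: "(real ^ 'd) set \<Rightarrow> 'd \<Rightarrow> (real ^ 'd \<Rightarrow> real) \<Rightarrow> (real ^ 'd \<Rightarrow> real) \<Rightarrow> bool" where
  "weak_partial U i f g \<longleftrightarrow> (\<forall>\<phi>. test_function U \<phi> \<longrightarrow>
     (\<integral>x. f x * partial i \<phi> x \<partial>lborel) = - (\<integral>x. g x * \<phi> x \<partial>lborel))"

section \<open>Test functions and square-integrable functions\<close>

lemma has_derivative_partials: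
  fixes f :: "real ^ 'd \<Rightarrow> real"
  assumes "f differentiable (at x)"
  shows "(f has_derivative (\<lambda>v. \<Sum>i\<in>UNIV. v $ i * partial i f x)) (at x)"
proof -
  obtain f' where f': "(f has_derivative f') (at x)" using assms by (auto simp: differentiable_def)
  then have lin: "linear f'" by (rule has_derivative_linear)
  have "f' = (\<lambda>v. \<Sum>i\<in>UNIV. v $ i * partial i f x)"
  proof
    fix v
    have "f' v = f' (\<Sum>i\<in>UNIV. v $ i *\<^sub>R axis i 1)"
      using basis_expansion[of v] by (simp add: scalar_mult_eq_scaleR)
    then show "f' v = (\<Sum>i\<in>UNIV. v $ i * partial i f x)"
      using lin by (simp add: linear_sum linear_cmul partial_eqI[OF f'])
  qed
  then show ?thesis using f' by simp
qed

lemma test_function_differentiable: "test_function U \<phi> \<Longrightarrow> \<phi> differentiable (at x)"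
  unfolding test_function_def smooth_def by (metis partials_Nil)

lemma test_function_continuous: "test_function U \<phi> \<Longrightarrow> continuous_on A \<phi>"
  by (meson continuous_at_imp_continuous_on differentiable_imp_continuous_within test_function_differentiable)

lemma notin_closure_support: "x \<notin> closure {x. \<phi> x \<noteq> 0} \<Longrightarrow> \<phi> x = 0"
  using subsetD[OF closure_subset, of x "{x. \<phi> x \<noteq> 0}"] by blast

lemma test_function_zero: "test_function U \<phi> \<Longrightarrow> x \<notin> U \<Longrightarrow> \<phi> x = 0"
  unfolding test_function_def using notin_closure_support[of x \<phi>] by blast

lemma test_function_mono: "test_function U \<phi> \<Longrightarrow> U \<subseteq> V \<Longrightarrow> test_function V \<phi>"
  unfolding test_function_def by auto

lemma test_function_partial:
  assumes "test_function U \<phi>" shows "test_function U (partial i \<phi>)"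
proof -
  have sm: "smooth (partial i \<phi>)"
    using assms unfolding test_function_def smooth_def by (metis partials_snoc)
  let ?S = "closure {x. \<phi> x \<noteq> 0}"
  have "{x. partial i \<phi> x \<noteq> 0} \<subseteq> ?S"
  proof (rule subsetI, rule ccontr)
    fix x assume x: "x \<in> {x. partial i \<phi> x \<noteq> 0}" "x \<notin> ?S"
    have "((\<lambda>x. 0) has_derivative (\<lambda>v. 0)) (at x)" by simp
    then have "(\<phi> has_derivative (\<lambda>v. 0)) (at x)"
    proof (rule has_derivative_transform_within_open[of _ _ _ _ "- ?S"])
      show "0 = \<phi> y" if "y \<in> - ?S" for y
      proof -
        have "\<phi> y = 0" by (rule notin_closure_support) (use that in blast)
        then show ?thesis by (rule sym)
      qed
    qed (use x in auto)
    then show False using x(1) by (simp add: partial_eqI)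
  qed
  then have "closure {x. partial i \<phi> x \<noteq> 0} \<subseteq> ?S" by (rule closure_minimal) auto
  with assms sm show ?thesis unfolding test_function_def
    by (auto simp: compact_eq_bounded_closed intro: bounded_subset)
qed

lemma test_function_measurable: "test_function U \<phi> \<Longrightarrow> \<phi> \<in> borel_measurable borel"
  by (rule borel_measurable_continuous_onI) (rule test_function_continuous)

lemma test_function_bounded:
  assumes "test_function U \<phi>" obtains M where "\<And>x. \<bar>\<phi> x\<bar> \<le> M"
proof -
  let ?S = "closure {x. \<phi> x \<noteq> 0}"
  have "compact (\<phi> ` ?S)"
    using assms test_function_continuous[OF assms] unfolding test_function_def
    by (intro compact_continuous_image) auto
  then obtain B where B: "\<And>y. y \<in> \<phi> ` ?S \<Longrightarrow> norm y \<le> B"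
    by (meson bounded_iff compact_imp_bounded)
  have "\<bar>\<phi> x\<bar> \<le> max B 0" for x
  proof (cases "x \<in> ?S")
    case True
    then have "norm (\<phi> x) \<le> B" by (intro B imageI)
    then show ?thesis by simp
  next
    case False
    then have "\<phi> x = 0" by (rule notin_closure_support)
    then show ?thesis by simp
  qed
  then show ?thesis by (rule that)
qed

lemma test_function_square_integrable:
  assumes "test_function U \<phi>" shows "integrable lborel (\<lambda>x. (\<phi> x)\<^sup>2)"
proof -
  let ?S = "closure {x. \<phi> x \<noteq> 0}"
  have "integrable lborel (\<lambda>x. indicator ?S x *\<^sub>R (\<phi> x)\<^sup>2)"
    using assms unfolding test_function_def
    by (intro borel_integrable_compact continuous_intros test_function_continuous[OF assms]) auto
  moreover have "(\<lambda>x. indicator ?S x *\<^sub>R (\<phi> x)\<^sup>2) = (\<lambda>x. (\<phi> x)\<^sup>2)"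
  proof
    fix x show "indicator ?S x *\<^sub>R (\<phi> x)\<^sup>2 = (\<phi> x)\<^sup>2"
    proof (cases "x \<in> ?S")
      case False
      then have "\<phi> x = 0" by (rule notin_closure_support)
      then show ?thesis by simp
    qed simp
  qed
  ultimately show ?thesis by metis
qed

lemma sq_int_measurable: "sq_int U f \<Longrightarrow> f \<in> borel_measurable borel"
  by (simp add: sq_int_def)

lemma sq_int_square_integrable:
  assumes "sq_int U f" "U \<in> sets borel"
  shows "integrable lborel (\<lambda>x. indicator U x * (f x)\<^sup>2)"
proof -
  have [measurable]: "U \<in> sets borel" "f \<in> borel_measurable borel" using assms by (auto simp: sq_int_def)
  have "(\<integral>\<^sup>+x. ennreal (norm (indicator U x * (f x)\<^sup>2)) \<partial>lborel) = sq_norm U f"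
    unfolding sq_norm_def by (intro nn_integral_cong) (auto simp: indicator_def)
  then show ?thesis using assms(1) unfolding integrable_iff_bounded sq_int_def by simp
qed

text \<open>The inequality 2 a b \<le> a^2 + b^2 supplies an integrable majorant; outside U the test
  function vanishes.\<close>

lemma sq_int_test_integrable:
  assumes f: "sq_int U f" and U: "U \<in> sets borel" and \<phi>: "test_function U \<phi>"
  shows "integrable lborel (\<lambda>x. f x * \<phi> x)"
proof (rule Bochner_Integration.integrable_bound)
  show "integrable lborel (\<lambda>x. indicator U x * (f x)\<^sup>2 + (\<phi> x)\<^sup>2)"
    by (intro Bochner_Integration.integrable_add sq_int_square_integrable[OF f U] test_function_square_integrable[OF \<phi>])
  show "(\<lambda>x. f x * \<phi> x) \<in> borel_measurable lborel"
    using sq_int_measurable[OF f] test_function_measurable[OF \<phi>] by simp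
  show "AE x in lborel. norm (f x * \<phi> x) \<le> norm (indicator U x * (f x)\<^sup>2 + (\<phi> x)\<^sup>2)"
  proof (rule AE_I2)
    fix x
    have "2 * (\<bar>f x\<bar> * \<bar>\<phi> x\<bar>) \<le> (f x)\<^sup>2 + (\<phi> x)\<^sup>2"
      using sum_squares_bound[of "\<bar>f x\<bar>" "\<bar>\<phi> x\<bar>"] by (simp add: power2_eq_square algebra_simps)
    moreover have "0 \<le> \<bar>f x\<bar> * \<bar>\<phi> x\<bar>" by simp
    ultimately have "\<bar>f x\<bar> * \<bar>\<phi> x\<bar> \<le> (f x)\<^sup>2 + (\<phi> x)\<^sup>2" by linarith
    then show "norm (f x * \<phi> x) \<le> norm (indicator U x * (f x)\<^sup>2 + (\<phi> x)\<^sup>2)"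
      using test_function_zero[OF \<phi>, of x] by (cases "x \<in> U") (auto simp: abs_mult)
  qed
qed

text \<open>By \<bar>a\<bar> \<le> 1 + a^2 and the finite measure of U. Cutting off makes f globally
  integrable, whatever its values outside U, so that it can be mollified.\<close>

lemma cut_integrable:
  assumes f: "sq_int U f" and U: "U \<in> sets borel" "bounded U"
  shows "integrable lborel (\<lambda>x. indicator U x * f x)"
proof (rule Bochner_Integration.integrable_bound)
  have "emeasure lborel U < \<infinity>"
    using emeasure_bounded_finite[OF U(2)] by simp
  then show "integrable lborel (\<lambda>x. indicator U x + indicator U x * (f x)\<^sup>2)"
    using U by (intro Bochner_Integration.integrable_add sq_int_square_integrable[OF f]) auto
  show "(\<lambda>x. indicator U x * f x) \<in> borel_measurable lborel"
    using sq_int_measurable[OF f] U by simp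
  have "\<bar>a\<bar> \<le> 1 + a\<^sup>2" for a :: real
    using sum_squares_bound[of 1 "\<bar>a\<bar>"] by simp
  then show "AE x in lborel. norm (indicator U x * f x) \<le> norm (indicator U x + indicator U x * (f x)\<^sup>2)"
    by (intro AE_I2) (auto simp: indicator_def)
qed

text \<open>The cut is invisible at points whose closed ball of radius e lies in U: there,
  mollifying means testing f with a shifted bump supported in U.\<close>

lemma mollify_cut_bump:
  fixes f :: "real ^ 'd \<Rightarrow> real"
  assumes f: "sq_int U f" and U: "U \<in> sets borel" and e: "e > 0" and c: "cball x e \<subseteq> U"
  shows "mollify bump e (\<lambda>x. indicator U x * f x) x = (\<integral>y. f y * (bump ((y - x) /\<^sub>R e) / e ^ CARD('d)) \<partial>lborel)"
proof -
  have [measurable]: "U \<in> sets borel" "f \<in> borel_measurable borel" using f U by (auto simp: sq_int_def)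
  have "mollify bump e (\<lambda>x. indicator U x * f x) x = 
      (\<integral>y. (indicator U y * f y) * (bump ((y - x) /\<^sub>R e) / e ^ DIM(real ^ 'd)) \<partial>lborel)"
    by (rule mollify_alt) (use e kernel_measurable[OF bump_kernel] in auto)
  also have "\<dots> = (\<integral>y. f y * (bump ((y - x) /\<^sub>R e) / e ^ CARD('d)) \<partial>lborel)"
    by (rule Bochner_Integration.integral_cong)
      (use test_function_zero[OF bump_shift_test_function[OF e c]] in \<open>auto simp: indicator_def\<close>)
  finally show ?thesis .
qed

text \<open>Testing only with elementary functions, whose partial derivatives commute for algebraic
  reasons, later yields the symmetry of weak derivatives.\<close>

lemma fundamental_lemma:
  fixes f :: "real ^ 'd \<Rightarrow> real"
  assumes U: "open U" "bounded U" and f: "sq_int U f"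
    and z: "\<And>\<phi>. \<phi> \<in> elementary \<Longrightarrow> test_function U \<phi> \<Longrightarrow> (\<integral>x. f x * \<phi> x \<partial>lborel) = 0"
  shows "AE x in lborel. x \<in> U \<longrightarrow> f x = 0"
proof -
  have Ub: "U \<in> sets borel" using U by auto
  let ?e = "\<lambda>n. 1 / real (Suc n)"
  have e0: "?e \<longlonglongrightarrow> 0" by (rule lim_1_over_n[THEN LIMSEQ_Suc])
  obtain r where r: "strict_mono r"
    "AE x in lborel. (\<lambda>n. mollify bump (?e (r n)) (\<lambda>x. indicator U x * f x) x) \<longlonglongrightarrow> indicator U x * f x"
    using mollify_AE_subseq[OF bump_kernel cut_integrable[OF f Ub U(2)] _ e0] by (auto simp del: of_nat_Suc)
  from r(2) show ?thesis
  proof eventually_elim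
    case (elim x)
    show ?case
    proof
      assume x: "x \<in> U"
      then obtain d where d: "d > 0" "cball x d \<subseteq> U" using U(1) open_contains_cball by blast
      have "(\<lambda>n. ?e (r n)) \<longlonglongrightarrow> 0" using LIMSEQ_subseq_LIMSEQ[OF e0 r(1)] by (simp add: o_def)
      then have "eventually (\<lambda>n. ?e (r n) < d) sequentially" using d(1) by (rule order_tendstoD)
      then have "eventually (\<lambda>n. mollify bump (?e (r n)) (\<lambda>x. indicator U x * f x) x = 0) sequentially"
      proof eventually_elim
        case (elim n)
        have p: "?e (r n) > 0" by simp
        have c: "cball x (?e (r n)) \<subseteq> U" using elim d(2) by (meson less_imp_le order_trans subset_cball)
        show ?case
          unfolding mollify_cut_bump[OF f Ub p c]
          by (rule z[OF bump_shift_elem bump_shift_test_function[OF p c]])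
      qed
      then have "(\<lambda>n. mollify bump (?e (r n)) (\<lambda>x. indicator U x * f x) x) \<longlonglongrightarrow> 0"
        by (rule tendsto_eventually)
      from LIMSEQ_unique[OF this elim] x show "f x = 0" by simp
    qed
  qed
qed

section \<open>Translation estimates for weak derivatives\<close>

lemma partial_shift:
  assumes "\<psi> differentiable (at (y - a))"
  shows "partial i (\<lambda>y. \<psi> (y - a)) y = partial i \<psi> (y - a)"
proof -
  obtain D where D: "(\<psi> has_derivative D) (at (y - a))" using assms by (auto simp: differentiable_def)
  have "((\<lambda>y. y - a) has_derivative (\<lambda>v. v)) (at y)"
    by (auto intro!: derivative_eq_intros)
  from has_derivative_compose[OF this D]
  have "((\<lambda>y. \<psi> (y - a)) has_derivative D) (at y)" by simp
  from partial_eqI[OF this] show ?thesis by (simp add: partial_eqI[OF D])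
qed

text \<open>The mollified function is never differentiated. The difference of two shifted bumps is
  the integral of a directional derivative along the segment; Fubini brings the integral over t
  outside, and for each t the weak derivative moves the derivative from the bump to f.\<close>

lemma mollify_diff_integral:
  fixes f :: "real ^ 'd \<Rightarrow> real" and g :: "'d \<Rightarrow> real ^ 'd \<Rightarrow> real"
  assumes U: "open U" "bounded U" and f: "sq_int U f" and g: "\<And>i. sq_int U (g i)" "\<And>i. weak_partial U i f (g i)"
    and e: "e > 0" and c: "\<And>t. t \<in> {0..1} \<Longrightarrow> cball (x + t *\<^sub>R \<zeta>) e \<subseteq> U"
  shows "mollify bump e (\<lambda>x. indicator U x * f x) (x + \<zeta>) - mollify bump e (\<lambda>x. indicator U x * f x) x
    = (\<integral>t. indicator {0..1} t * (\<Sum>i\<in>UNIV. \<zeta> $ i * mollify bump e (\<lambda>x. indicator U x * g i x) (x + t *\<^sub>R \<zeta>)) \<partial>lborel)"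
proof -
  have Ub: "U \<in> sets borel" using U by auto
  have [measurable]: "f \<in> borel_measurable borel" "\<And>i. g i \<in> borel_measurable borel" 
    using f g by (auto simp: sq_int_def)
  define f0 where "f0 = (\<lambda>x. indicator U x * f x)"
  have f0: "integrable lborel f0" unfolding f0_def by (rule cut_integrable[OF f Ub U(2)])
  have f0m[measurable]: "f0 \<in> borel_measurable borel" using f0 by simp
  define \<psi> where "\<psi> y = bump ((y - x) /\<^sub>R e) / e ^ CARD('d)" for y
  have \<psi>: "\<psi> \<in> elementary" unfolding \<psi>_def[abs_def] by (rule bump_shift_elem)
  have dpsi: "\<psi> differentiable (at y)" for y by (rule elementary_differentiable[OF \<psi>])
  have \<psi>t: "test_function UNIV \<psi>" unfolding \<psi>_def[abs_def]
    by (rule bump_shift_test_function[OF e]) simp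
  have sh: "\<psi> (y - t *\<^sub>R \<zeta>) = bump ((y - (x + t *\<^sub>R \<zeta>)) /\<^sub>R e) / e ^ CARD('d)" for y t
    by (simp add: \<psi>_def algebra_simps)
  have T: "test_function U (\<lambda>y. \<psi> (y - t *\<^sub>R \<zeta>))" if "t \<in> {0..1}" for t
    unfolding sh by (rule bump_shift_test_function[OF e c[OF that]])
  define p where "p z = (\<Sum>i\<in>UNIV. \<zeta> $ i * partial i \<psi> z)" for z
  have pc: "continuous_on A p" for A
    unfolding p_def[abs_def] by (intro continuous_intros elementary_continuous elementary_partial \<psi>)
  have [measurable]: "p \<in> borel_measurable borel" by (rule borel_measurable_continuous_onI) (rule pc)
  have pb: "\<exists>M. \<forall>z. \<bar>p z\<bar> \<le> M"
  proof -
    have "\<forall>i. \<exists>M. \<forall>z. \<bar>partial i \<psi> z\<bar> \<le> M"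
      using test_function_bounded[OF test_function_partial[OF \<psi>t]] by metis
    then obtain M where M: "\<And>i z. \<bar>partial i \<psi> z\<bar> \<le> M i" by metis
    have "\<bar>p z\<bar> \<le> (\<Sum>i\<in>UNIV. \<bar>\<zeta> $ i\<bar> * M i)" for z
      unfolding p_def by (rule order_trans[OF sum_abs]) (auto simp: abs_mult intro!: sum_mono mult_left_mono M)
    then show ?thesis by blast
  qed
  then obtain M where M: "\<And>z. \<bar>p z\<bar> \<le> M" by blast
  have FTC: "(\<integral>t. indicator {0..1} t * (- p (y - t *\<^sub>R \<zeta>)) \<partial>lborel) = \<psi> (y - \<zeta>) - \<psi> y" for y
  proof -
    have "(\<integral>t. indicator {0..1} t *\<^sub>R (- p (y - t *\<^sub>R \<zeta>)) \<partial>lborel) = \<psi> (y - 1 *\<^sub>R \<zeta>) - \<psi> (y - 0 *\<^sub>R \<zeta>)"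
    proof (rule integral_FTC_atLeastAtMost)
      fix t :: real
      have 1: "((\<lambda>t. y - t *\<^sub>R \<zeta>) has_derivative (\<lambda>s. - (s *\<^sub>R \<zeta>))) (at t within {0..1})"
        by (auto intro!: derivative_eq_intros)
      have "((\<lambda>t. \<psi> (y - t *\<^sub>R \<zeta>)) has_derivative (\<lambda>s. \<Sum>i\<in>UNIV. (- (s *\<^sub>R \<zeta>)) $ i * partial i \<psi> (y - t *\<^sub>R \<zeta>))) (at t within {0..1})"
        by (rule has_derivative_compose[OF 1 has_derivative_partials[OF dpsi]])
      then show "((\<lambda>t. \<psi> (y - t *\<^sub>R \<zeta>)) has_vector_derivative - p (y - t *\<^sub>R \<zeta>)) (at t within {0..1})"
        unfolding has_vector_derivative_def p_def by (simp add: sum_distrib_left sum_negf mult.assoc)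
    next
      show "continuous_on {0..1} (\<lambda>t. - p (y - t *\<^sub>R \<zeta>))"
        by (intro continuous_intros continuous_on_compose2[OF pc[of UNIV]]) auto
    qed simp
    then show ?thesis by simp
  qed
  have int1: "integrable lborel (\<lambda>y. f0 y * \<psi> (y - t *\<^sub>R \<zeta>))" for t
  proof -
    obtain B where B: "\<And>z. \<bar>\<psi> z\<bar> \<le> B" using test_function_bounded[OF \<psi>t] by blast
    have "integrable lborel (\<lambda>y. f0 y * B)" using f0 by simp
    then show ?thesis
    proof (rule Bochner_Integration.integrable_bound)
      show "AE y in lborel. norm (f0 y * \<psi> (y - t *\<^sub>R \<zeta>)) \<le> norm (f0 y * B)"
        unfolding real_norm_def abs_mult by (intro AE_I2 mult_left_mono order_trans[OF B abs_ge_self]) simp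
    qed (use test_function_measurable[OF \<psi>t] in measurable)
  qed
  have m0: "mollify bump e f0 (x + t *\<^sub>R \<zeta>) = (\<integral>y. f0 y * \<psi> (y - t *\<^sub>R \<zeta>) \<partial>lborel)" for t
    unfolding sh using mollify_alt[of bump f0 e "x + t *\<^sub>R \<zeta>"] e kernel_measurable[OF bump_kernel] by simp
  have "mollify bump e f0 (x + \<zeta>) - mollify bump e f0 x = (\<integral>y. f0 y * (\<psi> (y - \<zeta>) - \<psi> y) \<partial>lborel)"
    using m0[of 1] m0[of 0] int1[of 1] int1[of 0] by (simp add: right_diff_distrib)
  also have "\<dots> = (\<integral>y. (\<integral>t. f0 y * (indicator {0..1} t * (- p (y - t *\<^sub>R \<zeta>))) \<partial>lborel) \<partial>lborel)"
    by (simp flip: FTC)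
  \<comment> \<open>Fubini is justified by the bound M on \<open>p\<close> and the restriction of t
    to the unit interval.\<close>
  also have "\<dots> = (\<integral>t. (\<integral>y. f0 y * (indicator {0..1} t * (- p (y - t *\<^sub>R \<zeta>))) \<partial>lborel) \<partial>lborel)"
  proof (rule lborel_pair.Fubini_integral[symmetric])
    show "integrable (lborel \<Otimes>\<^sub>M lborel) (\<lambda>(y, t). f0 y * (indicator {0..1} t * (- p (y - t *\<^sub>R \<zeta>))))"
    proof (rule Bochner_Integration.integrable_bound)
      show "integrable (lborel \<Otimes>\<^sub>M lborel) (\<lambda>(y, t). f0 y * (M * indicator {0..1::real} t))"
      proof (rule lborel_pair.Fubini_integrable)
        show "integrable lborel (\<lambda>x. LBINT y. norm (case (x, y) of (y, t) \<Rightarrow> f0 y * (M * indicator {0..1::real} t)))"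
          using f0 by (simp add: abs_mult)
      qed (auto intro!: AE_I2 f0)
      show "AE z in lborel \<Otimes>\<^sub>M lborel. norm (case z of (y, t) \<Rightarrow> f0 y * (indicator {0..1} t * - p (y - t *\<^sub>R \<zeta>)))
         \<le> norm (case z of (y, t) \<Rightarrow> f0 y * (M * indicator {0..1} t))"
        using order_trans[OF M abs_ge_self] by (auto intro!: AE_I2 mult_left_mono simp: abs_mult indicator_def)
    qed measurable
  qed
  also have "\<dots> = (\<integral>t. indicator {0..1} t * (\<Sum>i\<in>UNIV. \<zeta> $ i * mollify bump e (\<lambda>x. indicator U x * g i x) (x + t *\<^sub>R \<zeta>)) \<partial>lborel)"
  proof (rule Bochner_Integration.integral_cong[OF refl])
    fix t :: real
    show "(\<integral>y. f0 y * (indicator {0..1} t * (- p (y - t *\<^sub>R \<zeta>))) \<partial>lborel) =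
      indicator {0..1} t * (\<Sum>i\<in>UNIV. \<zeta> $ i * mollify bump e (\<lambda>x. indicator U x * g i x) (x + t *\<^sub>R \<zeta>))"
    proof (cases "t \<in> {0..1}")
      case True
      note Tt = T[OF True]
      have pt: "partial i (\<lambda>y. \<psi> (y - t *\<^sub>R \<zeta>)) = (\<lambda>y. partial i \<psi> (y - t *\<^sub>R \<zeta>))" for i
        by (rule ext) (rule partial_shift[OF dpsi])
      have Tp: "test_function U (\<lambda>y. partial i \<psi> (y - t *\<^sub>R \<zeta>))" for i
        using test_function_partial[OF Tt, of i] unfolding pt .
      have "(\<integral>y. f0 y * (indicator {0..1} t * (- p (y - t *\<^sub>R \<zeta>))) \<partial>lborel) =
         (\<integral>y. (\<Sum>i\<in>UNIV. - \<zeta> $ i * (f y * partial i \<psi> (y - t *\<^sub>R \<zeta>))) \<partial>lborel)"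
      proof (rule Bochner_Integration.integral_cong[OF refl])
        fix y
        show "f0 y * (indicator {0..1} t * - p (y - t *\<^sub>R \<zeta>)) = (\<Sum>i\<in>UNIV. - \<zeta> $ i * (f y * partial i \<psi> (y - t *\<^sub>R \<zeta>)))"
          using True test_function_zero[OF Tp, of y]
          by (cases "y \<in> U") (auto simp: f0_def p_def sum_distrib_left sum_negf algebra_simps)
      qed
      also have "\<dots> = (\<Sum>i\<in>UNIV. - \<zeta> $ i * (\<integral>y. f y * partial i \<psi> (y - t *\<^sub>R \<zeta>) \<partial>lborel))"
        by (simp add: sq_int_test_integrable[OF f Ub Tp])
      also have "\<dots> = (\<Sum>i\<in>UNIV. \<zeta> $ i * (\<integral>y. g i y * \<psi> (y - t *\<^sub>R \<zeta>) \<partial>lborel))"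
      proof (rule sum.cong[OF refl])
        fix i
        have "(\<integral>y. f y * partial i \<psi> (y - t *\<^sub>R \<zeta>) \<partial>lborel) = - (\<integral>y. g i y * \<psi> (y - t *\<^sub>R \<zeta>) \<partial>lborel)"
          using g(2)[of i, unfolded weak_partial_def, rule_format, OF Tt] unfolding pt .
        then show "- \<zeta> $ i * (\<integral>y. f y * partial i \<psi> (y - t *\<^sub>R \<zeta>) \<partial>lborel) = \<zeta> $ i * (\<integral>y. g i y * \<psi> (y - t *\<^sub>R \<zeta>) \<partial>lborel)"
          by simp
      qed
      also have "\<dots> = (\<Sum>i\<in>UNIV. \<zeta> $ i * mollify bump e (\<lambda>x. indicator U x * g i x) (x + t *\<^sub>R \<zeta>))"
        unfolding sh mollify_cut_bump[OF g(1) Ub e c[OF True]] ..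
      finally show ?thesis using True by simp
    qed simp
  qed
  finally show ?thesis unfolding f0_def .
qed

text \<open>Jensen in t, the Cauchy-Schwarz inequality in the coordinates of \<zeta>, and Jensen in
  z lead to the majorant \<open>H\<close>. When H is integrated over x first, the shift by
  \<open>t \<zeta> + e z\<close> disappears, and the total masses of the kernel and of the unit
  interval are 1.\<close>

lemma mollify_translation_estimate:
  fixes f :: "real ^ 'd \<Rightarrow> real" and g :: "'d \<Rightarrow> real ^ 'd \<Rightarrow> real"
  assumes U: "open U" "bounded U" and f: "sq_int U f" and g: "\<And>i. sq_int U (g i)" "\<And>i. weak_partial U i f (g i)"
    and e: "e > 0" and K: "\<And>x t. x \<in> K \<Longrightarrow> t \<in> {0..1} \<Longrightarrow> cball (x + t *\<^sub>R \<zeta>) e \<subseteq> U"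
  shows "(\<integral>\<^sup>+x. indicator K x * ennreal ((mollify bump e (\<lambda>x. indicator U x * f x) (x + \<zeta>)
       - mollify bump e (\<lambda>x. indicator U x * f x) x)\<^sup>2) \<partial>lborel)
    \<le> ennreal ((norm \<zeta>)\<^sup>2) * (\<Sum>i\<in>UNIV. sq_norm U (g i))"
proof -
  have Ub[measurable]: "U \<in> sets borel" using U by auto
  have gm[measurable]: "\<And>i. g i \<in> borel_measurable borel" using g by (auto simp: sq_int_def)
  have bm[measurable]: "bump \<in> borel_measurable borel" by (rule kernel_measurable[OF bump_kernel])
  define g0 where "g0 i = (\<lambda>x. indicator U x * g i x)" for i
  have g0m[measurable]: "\<And>i. g0 i \<in> borel_measurable borel" unfolding g0_def by measurable
  have g0i: "integrable lborel (g0 i)" for i unfolding g0_def by (rule cut_integrable[OF g(1) Ub U(2)])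
  let ?m = "mollify bump e (\<lambda>x. indicator U x * f x)"
  let ?I = "\<lambda>t. indicator {0..1::real} t :: ennreal"
  define H where "H x = (\<integral>\<^sup>+t. ?I t * (\<Sum>i\<in>UNIV. \<integral>\<^sup>+z. ennreal (bump z * (g0 i ((x + t *\<^sub>R \<zeta>) + e *\<^sub>R z))\<^sup>2) \<partial>lborel) \<partial>lborel)" for x
  have "indicator K x * ennreal ((?m (x + \<zeta>) - ?m x)\<^sup>2) \<le> ennreal ((norm \<zeta>)\<^sup>2) * H x" for x
  proof (cases "x \<in> K")
    case True
    have "?m (x + \<zeta>) - ?m x = (\<integral>t. indicator {0..1} t * (\<Sum>i\<in>UNIV. \<zeta> $ i * mollify bump e (g0 i) (x + t *\<^sub>R \<zeta>)) \<partial>lborel)"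
      unfolding g0_def by (rule mollify_diff_integral[OF U f g e K[OF True]])
    then have "ennreal ((?m (x + \<zeta>) - ?m x)\<^sup>2) \<le>
        (\<integral>\<^sup>+t. ennreal (indicator {0..1} t * (\<Sum>i\<in>UNIV. \<zeta> $ i * mollify bump e (g0 i) (x + t *\<^sub>R \<zeta>))\<^sup>2) \<partial>lborel)"
      by (simp only:) (rule square_integral_le, auto)
    also have "\<dots> \<le> (\<integral>\<^sup>+t. ennreal ((norm \<zeta>)\<^sup>2) * (?I t * (\<Sum>i\<in>UNIV. \<integral>\<^sup>+z. ennreal (bump z * (g0 i ((x + t *\<^sub>R \<zeta>) + e *\<^sub>R z))\<^sup>2) \<partial>lborel)) \<partial>lborel)"
    proof (rule nn_integral_mono)
      fix t :: real
      let ?G = "\<lambda>i. mollify bump e (g0 i) (x + t *\<^sub>R \<zeta>)"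
      have "(\<Sum>i\<in>UNIV. \<zeta> $ i * ?G i)\<^sup>2 \<le> (\<Sum>i\<in>UNIV. (\<zeta> $ i)\<^sup>2) * (\<Sum>i\<in>UNIV. (?G i)\<^sup>2)"
        by (rule Cauchy_Schwarz_ineq_sum)
      also have "(\<Sum>i\<in>UNIV. (\<zeta> $ i)\<^sup>2) = (norm \<zeta>)\<^sup>2"
        by (simp add: norm_vec_def L2_set_def sum_nonneg)
      finally have "ennreal ((\<Sum>i\<in>UNIV. \<zeta> $ i * ?G i)\<^sup>2) \<le> ennreal ((norm \<zeta>)\<^sup>2) * (\<Sum>i\<in>UNIV. ennreal ((?G i)\<^sup>2))"
        by (simp add: ennreal_leI sum_nonneg flip: ennreal_mult)
      also have "\<dots> \<le> ennreal ((norm \<zeta>)\<^sup>2) * (\<Sum>i\<in>UNIV. \<integral>\<^sup>+z. ennreal (bump z * (g0 i ((x + t *\<^sub>R \<zeta>) + e *\<^sub>R z))\<^sup>2) \<partial>lborel)"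
        using e by (intro mult_left_mono sum_mono mollify_square_le[OF bump_kernel g0i]) auto
      finally show "ennreal (indicator {0..1} t * (\<Sum>i\<in>UNIV. \<zeta> $ i * ?G i)\<^sup>2)
         \<le> ennreal ((norm \<zeta>)\<^sup>2) * (?I t * (\<Sum>i\<in>UNIV. \<integral>\<^sup>+z. ennreal (bump z * (g0 i ((x + t *\<^sub>R \<zeta>) + e *\<^sub>R z))\<^sup>2) \<partial>lborel))"
        by (auto simp: indicator_def)
    qed
    also have "\<dots> = ennreal ((norm \<zeta>)\<^sup>2) * H x"
      unfolding H_def by (rule nn_integral_cmult) measurable
    finally show ?thesis using True by simp
  qed simp
  then have "(\<integral>\<^sup>+x. indicator K x * ennreal ((?m (x + \<zeta>) - ?m x)\<^sup>2) \<partial>lborel) \<le> (\<integral>\<^sup>+x. ennreal ((norm \<zeta>)\<^sup>2) * H x \<partial>lborel)"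
    by (intro nn_integral_mono)
  also have "\<dots> = ennreal ((norm \<zeta>)\<^sup>2) * (\<integral>\<^sup>+x. H x \<partial>lborel)"
    unfolding H_def by (rule nn_integral_cmult) measurable
  also have "(\<integral>\<^sup>+x. H x \<partial>lborel) = (\<integral>\<^sup>+t. (\<integral>\<^sup>+x. ?I t * (\<Sum>i\<in>UNIV. \<integral>\<^sup>+z. ennreal (bump z * (g0 i ((x + t *\<^sub>R \<zeta>) + e *\<^sub>R z))\<^sup>2) \<partial>lborel) \<partial>lborel) \<partial>lborel)"
    unfolding H_def by (rule lborel_pair.Fubini'[symmetric]) measurable
  also have "\<dots> = (\<integral>\<^sup>+t. ?I t * (\<Sum>i\<in>UNIV. sq_norm U (g i)) \<partial>lborel)"
  proof (rule nn_integral_cong)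
    fix t :: real
    have "(\<integral>\<^sup>+x. (\<integral>\<^sup>+z. ennreal (bump z * (g0 i ((x + t *\<^sub>R \<zeta>) + e *\<^sub>R z))\<^sup>2) \<partial>lborel) \<partial>lborel) = sq_norm U (g i)" for i
    proof -
      have "(\<integral>\<^sup>+x. (\<integral>\<^sup>+z. ennreal (bump z * (g0 i ((x + t *\<^sub>R \<zeta>) + e *\<^sub>R z))\<^sup>2) \<partial>lborel) \<partial>lborel) =
         (\<integral>\<^sup>+z. (\<integral>\<^sup>+x. ennreal (bump z * (g0 i ((x + t *\<^sub>R \<zeta>) + e *\<^sub>R z))\<^sup>2) \<partial>lborel) \<partial>lborel)"
        by (rule lborel_pair.Fubini') measurable
      also have "\<dots> = (\<integral>\<^sup>+z. ennreal (bump (z :: real ^ 'd)) * sq_norm U (g i) \<partial>lborel)"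
      proof (rule nn_integral_cong)
        fix z
        have "(\<integral>\<^sup>+x. ennreal (bump z * (g0 i ((x + t *\<^sub>R \<zeta>) + e *\<^sub>R z))\<^sup>2) \<partial>lborel) =
            ennreal (bump z) * (\<integral>\<^sup>+x. ennreal ((g0 i ((t *\<^sub>R \<zeta> + e *\<^sub>R z) + x))\<^sup>2) \<partial>lborel)"
          by (subst nn_integral_cmult[symmetric])
            (auto simp: ennreal_mult kernel_nonneg[OF bump_kernel] algebra_simps)
        also have "(\<integral>\<^sup>+x. ennreal ((g0 i ((t *\<^sub>R \<zeta> + e *\<^sub>R z) + x))\<^sup>2) \<partial>lborel) = (\<integral>\<^sup>+x. ennreal ((g0 i x)\<^sup>2) \<partial>lborel)"
          by (rule nn_integral_lborel_shift) measurable
        also have "\<dots> = sq_norm U (g i)"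
          unfolding sq_norm_def g0_def by (intro nn_integral_cong) (auto simp: indicator_def)
        finally show "(\<integral>\<^sup>+x. ennreal (bump z * (g0 i ((x + t *\<^sub>R \<zeta>) + e *\<^sub>R z))\<^sup>2) \<partial>lborel) = ennreal (bump z) * sq_norm U (g i)" .
      qed
      also have "\<dots> = sq_norm U (g i)"
        by (subst nn_integral_multc) (auto simp: kernel_nn_integral[OF bump_kernel])
      finally show ?thesis .
    qed
    then show "(\<integral>\<^sup>+x. ?I t * (\<Sum>i\<in>UNIV. \<integral>\<^sup>+z. ennreal (bump z * (g0 i ((x + t *\<^sub>R \<zeta>) + e *\<^sub>R z))\<^sup>2) \<partial>lborel) \<partial>lborel) =
       ?I t * (\<Sum>i\<in>UNIV. sq_norm U (g i))"
      by (subst nn_integral_cmult) (measurable, simp add: nn_integral_sum)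
  qed
  also have "\<dots> = (\<Sum>i\<in>UNIV. sq_norm U (g i))"
    by (subst nn_integral_multc) auto
  finally show ?thesis .
qed

text \<open>Mollification reduces the estimate to the fundamental theorem of calculus along the
  segment; Fatou's lemma along a subsequence converging almost everywhere removes the mollifier.\<close>

theorem translation_estimate:
  fixes f :: "real ^ 'd \<Rightarrow> real" and g :: "'d \<Rightarrow> real ^ 'd \<Rightarrow> real"
  assumes U: "open U" "bounded U" and f: "sq_int U f" and g: "\<And>i. sq_int U (g i)" "\<And>i. weak_partial U i f (g i)"
  shows "(\<integral>\<^sup>+x. indicator {x. closed_segment x (x + \<zeta>) \<subseteq> U} x * ennreal ((f (x + \<zeta>) - f x)\<^sup>2) \<partial>lborel)
    \<le> ennreal ((norm \<zeta>)\<^sup>2) * (\<Sum>i\<in>UNIV. sq_norm U (g i))"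
proof -
  have Ub[measurable]: "U \<in> sets borel" using U by auto
  have fm[measurable]: "f \<in> borel_measurable borel" using f by (auto simp: sq_int_def)
  have bm[measurable]: "bump \<in> borel_measurable borel" by (rule kernel_measurable[OF bump_kernel])
  let ?f0 = "\<lambda>x. indicator U x * f x"
  let ?e = "\<lambda>n. 1 / real (Suc n)"
  have e0: "?e \<longlonglongrightarrow> 0" by (rule lim_1_over_n[THEN LIMSEQ_Suc])
  obtain r where r: "strict_mono r"
    "AE x in lborel. (\<lambda>n. mollify bump (?e (r n)) ?f0 x) \<longlonglongrightarrow> ?f0 x"
    using mollify_AE_subseq[OF bump_kernel cut_integrable[OF f Ub U(2)] _ e0] by (auto simp del: of_nat_Suc)
  define e where "e n = ?e (r n)" for n
  have e: "e n > 0" for n by (simp add: e_def)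
  have etend: "e \<longlonglongrightarrow> 0" using LIMSEQ_subseq_LIMSEQ[OF e0 r(1)] by (simp add: o_def e_def[abs_def])
  \<comment> \<open>Open balls make \<open>K n\<close> the complement of an open set and thus
    measurable; the factor 2 ensures that the closed balls of radius \<open>e n\<close> demanded by
    the estimate fit in.\<close>
  define K where "K n = {x. \<forall>t\<in>{0..1}. ball (x + t *\<^sub>R \<zeta>) (2 * e n) \<subseteq> U}" for n
  have "K n = - (\<Union>y\<in>-U. \<Union>t\<in>{0..1}. ball (y - t *\<^sub>R \<zeta>) (2 * e n))" for n
    unfolding K_def by (force simp: dist_norm algebra_simps norm_minus_commute)
  moreover have "open (\<Union>y\<in>-U. \<Union>t\<in>{0..1}. ball (y - t *\<^sub>R \<zeta>) (2 * e n))" for n by (intro open_UN ballI open_ball)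
  ultimately have K[measurable]: "K n \<in> sets borel" for n by (metis borel_open borel_comp)
  have Kc: "cball (x + t *\<^sub>R \<zeta>) (e n) \<subseteq> U" if "x \<in> K n" "t \<in> {0..1}" for x t n
  proof -
    have "cball (x + t *\<^sub>R \<zeta>) (e n) \<subseteq> ball (x + t *\<^sub>R \<zeta>) (2 * e n)" using e[of n] by auto
    then show ?thesis using that unfolding K_def by blast
  qed
  let ?m = "\<lambda>n. mollify bump (e n) ?f0"
  let ?A = "{x. closed_segment x (x + \<zeta>) \<subseteq> U}"
  have lim: "AE x in lborel. (\<lambda>n. ?m n x) \<longlonglongrightarrow> ?f0 x" using r(2) by (simp add: e_def)
  have lim2: "AE x in lborel. (\<lambda>n. ?m n (x + \<zeta>)) \<longlonglongrightarrow> ?f0 (x + \<zeta>)"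
    using AE_lborel_affine[OF lim, of 1 \<zeta>] by (simp add: add.commute)
  have "(\<integral>\<^sup>+x. indicator ?A x * ennreal ((f (x + \<zeta>) - f x)\<^sup>2) \<partial>lborel) \<le>
     (\<integral>\<^sup>+x. liminf (\<lambda>n. indicator (K n) x * ennreal ((?m n (x + \<zeta>) - ?m n x)\<^sup>2)) \<partial>lborel)"
  proof (rule nn_integral_mono_AE)
    show "AE x in lborel. indicator ?A x * ennreal ((f (x + \<zeta>) - f x)\<^sup>2) \<le>
       liminf (\<lambda>n. indicator (K n) x * ennreal ((?m n (x + \<zeta>) - ?m n x)\<^sup>2))"
      using lim lim2
    proof eventually_elim
      case (elim x)
      show ?case
      proof (cases "x \<in> ?A")
        case True
        have seg: "closed_segment x (x + \<zeta>) = (\<lambda>t. x + t *\<^sub>R \<zeta>) ` {0..1}"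
          by (auto simp: closed_segment_def algebra_simps image_def)
        obtain d where d: "d > 0" "(\<Union>y\<in>closed_segment x (x + \<zeta>). ball y d) \<subseteq> U"
          using compact_subset_open_imp_ball_epsilon_subset[of "closed_segment x (x + \<zeta>)" U] True U by auto
        have "x \<in> U" "x + \<zeta> \<in> U" using True by auto
        then have L: "(\<lambda>n. ennreal ((?m n (x + \<zeta>) - ?m n x)\<^sup>2)) \<longlonglongrightarrow> ennreal ((f (x + \<zeta>) - f x)\<^sup>2)"
          using elim by (intro tendsto_ennrealI tendsto_intros) auto
        have "eventually (\<lambda>n. e n < d / 2) sequentially"
          using etend d by (intro order_tendstoD) auto
        then have "eventually (\<lambda>n. ennreal ((?m n (x + \<zeta>) - ?m n x)\<^sup>2) = indicator (K n) x * ennreal ((?m n (x + \<zeta>) - ?m n x)\<^sup>2)) sequentially"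
        proof eventually_elim
          case (elim n)
          have "ball (x + t *\<^sub>R \<zeta>) (2 * e n) \<subseteq> U" if "t \<in> {0..1}" for t
          proof -
            have "ball (x + t *\<^sub>R \<zeta>) (2 * e n) \<subseteq> ball (x + t *\<^sub>R \<zeta>) d" using elim by (intro subset_ball) simp
            also have "\<dots> \<subseteq> U" using d(2) that unfolding seg by blast
            finally show ?thesis .
          qed
          then have "x \<in> K n" unfolding K_def by auto
          then show ?case by simp
        qed
        from Lim_transform_eventually[OF L this]
        have "(\<lambda>n. indicator (K n) x * ennreal ((?m n (x + \<zeta>) - ?m n x)\<^sup>2)) \<longlonglongrightarrow> ennreal ((f (x + \<zeta>) - f x)\<^sup>2)" .
        then have "liminf (\<lambda>n. indicator (K n) x * ennreal ((?m n (x + \<zeta>) - ?m n x)\<^sup>2)) = ennreal ((f (x + \<zeta>) - f x)\<^sup>2)"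
          by (intro lim_imp_Liminf) auto
        then show ?thesis using True by simp
      qed simp
    qed
  qed
  also have "\<dots> \<le> liminf (\<lambda>n. \<integral>\<^sup>+x. indicator (K n) x * ennreal ((?m n (x + \<zeta>) - ?m n x)\<^sup>2) \<partial>lborel)"
    by (rule nn_integral_liminf) measurable
  also have "\<dots> \<le> ennreal ((norm \<zeta>)\<^sup>2) * (\<Sum>i\<in>UNIV. sq_norm U (g i))"
  proof (rule Liminf_le)
    show "\<forall>\<^sub>F n in sequentially. (\<integral>\<^sup>+x. indicator (K n) x * ennreal ((?m n (x + \<zeta>) - ?m n x)\<^sup>2) \<partial>lborel) \<le> ennreal ((norm \<zeta>)\<^sup>2) * (\<Sum>i\<in>UNIV. sq_norm U (g i))"
      by (intro always_eventually allI mollify_translation_estimate[OF U f g e Kc])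
  qed simp
  finally show ?thesis .
qed

section \<open>Poincare inequalities and decay on balls\<close>

definition Slob :: "(real ^ 'd) set \<Rightarrow> real \<Rightarrow> (real ^ 'd \<Rightarrow> real) \<Rightarrow> ennreal" where
  "Slob U \<sigma> f = (\<integral>\<^sup>+x. indicator U x * (\<integral>\<^sup>+y. indicator U y *
     ennreal ((f x - f y)\<^sup>2 / norm (x - y) powr (real CARD('d) + 2 * \<sigma>)) \<partial>lborel) \<partial>lborel)"

text \<open>A family models all weak derivatives of order at most \<open>\<lfloor>m\<rfloor>\<close> of its member \<open>V []\<close>, by Borel functions
  on the whole space of which only the restrictions to \<open>U\<close> matter. Each component of the squared Sobolev
  norm is bounded by \<open>N\<close> separately.\<close>

definition sobolev_family :: "(real ^ 'd) set \<Rightarrow> real \<Rightarrow> real \<Rightarrow> ('d list \<Rightarrow> real ^ 'd \<Rightarrow> real) \<Rightarrow> bool" where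
  "sobolev_family U m N V \<longleftrightarrow>
     (\<forall>is. length is \<le> nat \<lfloor>m\<rfloor> \<longrightarrow> V is \<in> borel_measurable borel \<and> sq_norm U (V is) \<le> ennreal N) \<and>
     (\<forall>is i. length is < nat \<lfloor>m\<rfloor> \<longrightarrow> weak_partial U i (V is) (V (is @ [i]))) \<and>
     (m \<notin> \<int> \<longrightarrow> (\<forall>is. length is = nat \<lfloor>m\<rfloor> \<longrightarrow> Slob U (frac m) (V is) \<le> ennreal N))"

section \<open>Restriction of families to smaller domains\<close>

lemma ball_sets_borel [measurable]: "ball c r \<in> sets borel"
  by simp

lemma sq_norm_mono: "U \<subseteq> U' \<Longrightarrow> sq_norm U f \<le> sq_norm U' f"
  unfolding sq_norm_def by (intro nn_integral_mono mult_right_mono) (auto simp: indicator_def)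

lemma Slob_mono: "U \<subseteq> U' \<Longrightarrow> Slob U \<sigma> f \<le> Slob U' \<sigma> f"
  unfolding Slob_def by (intro nn_integral_mono mult_mono) (auto simp: indicator_def)

lemma weak_partial_mono: "weak_partial U' i f g \<Longrightarrow> U \<subseteq> U' \<Longrightarrow> weak_partial U i f g"
  unfolding weak_partial_def using test_function_mono by blast

lemma sq_int_mono: "sq_int U' f \<Longrightarrow> U \<subseteq> U' \<Longrightarrow> sq_int U f"
  unfolding sq_int_def using sq_norm_mono by (meson order.strict_trans1)

lemma sobolev_family_mono: "sobolev_family U' m N V \<Longrightarrow> U \<subseteq> U' \<Longrightarrow> sobolev_family U m N V"
  unfolding sobolev_family_def using sq_norm_mono Slob_mono weak_partial_mono by (meson order_trans)

lemma sobolev_family_sq: "sobolev_family U m N V \<Longrightarrow> length is \<le> nat \<lfloor>m\<rfloor> \<Longrightarrow> sq_int U (V is)"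
  unfolding sobolev_family_def sq_int_def by (auto intro: le_less_trans[OF _ ennreal_less_top])

lemma sobolev_family_E2: "sobolev_family U m N V \<Longrightarrow> length is \<le> nat \<lfloor>m\<rfloor> \<Longrightarrow> sq_norm U (V is) \<le> ennreal N"
  unfolding sobolev_family_def by blast

lemma sobolev_family_Slob: "sobolev_family U m N V \<Longrightarrow> m \<notin> \<int> \<Longrightarrow> length is = nat \<lfloor>m\<rfloor> \<Longrightarrow> Slob U (frac m) (V is) \<le> ennreal N"
  unfolding sobolev_family_def by blast

lemma sobolev_family_wder: "sobolev_family U m N V \<Longrightarrow> length is < nat \<lfloor>m\<rfloor> \<Longrightarrow> weak_partial U i (V is) (V (is @ [i]))"
  unfolding sobolev_family_def by blast

lemma sobolev_family_measurable: "sobolev_family U m N V \<Longrightarrow> length is \<le> nat \<lfloor>m\<rfloor> \<Longrightarrow> V is \<in> borel_measurable borel"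
  unfolding sobolev_family_def by blast

section \<open>Oscillation and Poincare inequalities\<close>

definition mean :: "'a::euclidean_space set \<Rightarrow> ('a \<Rightarrow> real) \<Rightarrow> real" where
  "mean B f = (\<integral>x. indicator B x * f x \<partial>lborel) / measure lborel B"

definition osc_sq :: "'a::euclidean_space set \<Rightarrow> ('a \<Rightarrow> real) \<Rightarrow> ennreal" where
  "osc_sq B f = (\<integral>\<^sup>+x. indicator B x * (\<integral>\<^sup>+y. indicator B y * ennreal ((f x - f y)\<^sup>2) \<partial>lborel) \<partial>lborel)"

lemma measure_ball: "r > 0 \<Longrightarrow> measure lborel (ball (c::real^'d) r) = r ^ CARD('d) * measure lborel (ball (0::real^'d) 1)"
  using content_ball_conv_unit_ball[of r c] by simp

lemma measure_ball_pos: "r > 0 \<Longrightarrow> measure lborel (ball (c::'a::euclidean_space) r) > 0"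
  using content_ball_pos by auto

lemma emeasure_ball_eq: "emeasure lborel (ball (c::'a::euclidean_space) r) = ennreal (measure lborel (ball c r))"
  using emeasure_lborel_ball_finite[of c r] by (intro emeasure_eq_ennreal_measure) auto

lemma integral_cut_ball_ident:
  "r > 0 \<Longrightarrow> (\<integral>y. indicator (ball c r) y / measure lborel (ball c r) \<partial>lborel) = (1::real)"
  using measure_ball_pos[of r c] emeasure_lborel_ball_finite[of c r] by simp

text \<open>Jensen, since \<open>f x - mean\<close> is the average over y of
  \<open>f x - f y\<close>.\<close>

lemma sq_norm_minus_mean_le:
  fixes f :: "'a::euclidean_space \<Rightarrow> real"
  assumes f: "sq_int (ball c r) f" and r: "r > 0"
  shows "sq_norm (ball c r) (\<lambda>x. f x - mean (ball c r) f) \<le> ennreal (1 / measure lborel (ball c r)) * osc_sq (ball c r) f"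
proof -
  let ?B = "ball c r" let ?b = "measure lborel (ball c r)"
  have [measurable]: "f \<in> borel_measurable borel" using f by (simp add: sq_int_def)
  have b: "?b > 0" by (rule measure_ball_pos[OF r])
  have i: "integrable lborel (\<lambda>y. indicator ?B y * f y)" by (rule cut_integrable[OF f]) auto
  have i1: "integrable lborel (\<lambda>y. indicator ?B y / ?b)" using emeasure_lborel_ball_finite[of c r] by simp
  have "ennreal ((f x - mean ?B f)\<^sup>2) \<le> ennreal (1 / ?b) * (\<integral>\<^sup>+y. indicator ?B y * ennreal ((f x - f y)\<^sup>2) \<partial>lborel)" for x
  proof -
    have "(\<integral>y. indicator ?B y / ?b * (f x - f y) \<partial>lborel) = (\<integral>y. f x * (indicator ?B y / ?b) - (indicator ?B y * f y) / ?b \<partial>lborel)"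
      by (rule Bochner_Integration.integral_cong) (auto simp: diff_divide_distrib left_diff_distrib right_diff_distrib mult.commute)
    also have "\<dots> = f x - mean ?B f"
    proof -
      have j1: "integrable lborel (\<lambda>y. f x * (indicator ?B y / ?b))" using i1 by (rule integrable_mult_right)
      have j2: "integrable lborel (\<lambda>y. (indicator ?B y * f y) / ?b)" using i by (rule integrable_divide)
      show ?thesis
        unfolding Bochner_Integration.integral_diff[OF j1 j2] integral_mult_right_zero
          integral_cut_ball_ident[OF r] mean_def by simp
    qed
    finally have "ennreal ((f x - mean ?B f)\<^sup>2) = ennreal ((\<integral>y. indicator ?B y / ?b * (f x - f y) \<partial>lborel)\<^sup>2)" by simp
    also have "\<dots> \<le> (\<integral>\<^sup>+y. ennreal (indicator ?B y / ?b * (f x - f y)\<^sup>2) \<partial>lborel)"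
      by (rule square_integral_le) (use b i1 integral_cut_ball_ident[OF r, of c] in auto)
    also have "\<dots> = (\<integral>\<^sup>+y. ennreal (1 / ?b) * (indicator ?B y * ennreal ((f x - f y)\<^sup>2)) \<partial>lborel)"
      using b by (intro nn_integral_cong) (auto simp: indicator_def simp flip: ennreal_mult)
    also have "\<dots> = ennreal (1 / ?b) * (\<integral>\<^sup>+y. indicator ?B y * ennreal ((f x - f y)\<^sup>2) \<partial>lborel)"
      by (rule nn_integral_cmult) measurable
    finally show ?thesis .
  qed
  then have "sq_norm ?B (\<lambda>x. f x - mean ?B f) \<le> (\<integral>\<^sup>+x. ennreal (1 / ?b) * (indicator ?B x * (\<integral>\<^sup>+y. indicator ?B y * ennreal ((f x - f y)\<^sup>2) \<partial>lborel)) \<partial>lborel)"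
    unfolding sq_norm_def by (intro nn_integral_mono) (auto simp: indicator_def)
  also have "\<dots> = ennreal (1 / ?b) * osc_sq ?B f"
    unfolding osc_sq_def by (rule nn_integral_cmult) measurable
  finally show ?thesis .
qed

text \<open>The substitution y = x + z turns a double integral of differences into an integral over
  z of quantities to which translation estimates apply.\<close>

lemma nn_integral_pair_shift:
  fixes h :: "'a::euclidean_space \<Rightarrow> 'a \<Rightarrow> ennreal"
  assumes [measurable]: "(\<lambda>(x, y). h x y) \<in> borel_measurable (borel \<Otimes>\<^sub>M borel)"
  shows "(\<integral>\<^sup>+x. \<integral>\<^sup>+y. h x y \<partial>lborel \<partial>lborel) = (\<integral>\<^sup>+z. \<integral>\<^sup>+x. h x (x + z) \<partial>lborel \<partial>lborel)"
proof -
  have "(\<integral>\<^sup>+x. \<integral>\<^sup>+y. h x y \<partial>lborel \<partial>lborel) = (\<integral>\<^sup>+x. \<integral>\<^sup>+z. h x (x + z) \<partial>lborel \<partial>lborel)"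
    by (intro nn_integral_cong nn_integral_lborel_shift[symmetric]) measurable
  also have "\<dots> = (\<integral>\<^sup>+z. \<integral>\<^sup>+x. h x (x + z) \<partial>lborel \<partial>lborel)"
    by (rule lborel_pair.Fubini') measurable
  finally show ?thesis .
qed

text \<open>Balls are convex, so \<open>translation_estimate\<close> covers every pair x, x + z in
  the ball. Only z with norm below 2 r contribute, which accounts for the volume of the ball of
  radius 2 r and for the factor 4 r^2.\<close>

lemma osc_sq_gradient_le:
  fixes f :: "real ^ 'd \<Rightarrow> real" and g :: "'d \<Rightarrow> real ^ 'd \<Rightarrow> real"
  assumes r: "r > 0" and f: "sq_int (ball c r) f" and g: "\<And>i. sq_int (ball c r) (g i)" "\<And>i. weak_partial (ball c r) i f (g i)"
  shows "osc_sq (ball c r) f \<le> ennreal (measure lborel (ball (0::real^'d) (2 * r)) * (4 * r\<^sup>2)) * (\<Sum>i\<in>UNIV. sq_norm (ball c r) (g i))"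
proof -
  let ?B = "ball c r" let ?G = "\<Sum>i\<in>UNIV. sq_norm ?B (g i)"
  have [measurable]: "f \<in> borel_measurable borel" using f by (simp add: sq_int_def)
  have "osc_sq ?B f = (\<integral>\<^sup>+x. \<integral>\<^sup>+y. indicator ?B x * (indicator ?B y * ennreal ((f x - f y)\<^sup>2)) \<partial>lborel \<partial>lborel)"
    unfolding osc_sq_def by (simp add: nn_integral_cmult)
  also have "\<dots> = (\<integral>\<^sup>+z. \<integral>\<^sup>+x. indicator ?B x * (indicator ?B (x + z) * ennreal ((f x - f (x + z))\<^sup>2)) \<partial>lborel \<partial>lborel)"
    by (rule nn_integral_pair_shift) measurable
  also have "\<dots> \<le> (\<integral>\<^sup>+z. (ennreal (4 * r\<^sup>2) * ?G) * indicator (ball (0::real^'d) (2 * r)) z \<partial>lborel)"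
  proof (rule nn_integral_mono)
    fix z :: "real ^ 'd"
    show "(\<integral>\<^sup>+x. indicator ?B x * (indicator ?B (x + z) * ennreal ((f x - f (x + z))\<^sup>2)) \<partial>lborel)
      \<le> (ennreal (4 * r\<^sup>2) * ?G) * indicator (ball 0 (2 * r)) z"
    proof (cases "norm z < 2 * r")
      case True
      have "(\<integral>\<^sup>+x. indicator ?B x * (indicator ?B (x + z) * ennreal ((f x - f (x + z))\<^sup>2)) \<partial>lborel)
         \<le> (\<integral>\<^sup>+x. indicator {x. closed_segment x (x + z) \<subseteq> ?B} x * ennreal ((f (x + z) - f x)\<^sup>2) \<partial>lborel)"
      proof (rule nn_integral_mono)
        fix x
        show "indicator ?B x * (indicator ?B (x + z) * ennreal ((f x - f (x + z))\<^sup>2)) \<le>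
          indicator {x. closed_segment x (x + z) \<subseteq> ?B} x * ennreal ((f (x + z) - f x)\<^sup>2)"
        proof (cases "x \<in> ?B \<and> x + z \<in> ?B")
          case True
          then have "closed_segment x (x + z) \<subseteq> ?B"
            by (intro closed_segment_subset) auto
          then show ?thesis by (simp add: power2_commute indicator_def)
        qed (auto simp: indicator_def)
      qed
      also have "\<dots> \<le> ennreal ((norm z)\<^sup>2) * ?G"
        by (rule translation_estimate[OF _ _ f g]) auto
      also have "\<dots> \<le> ennreal (4 * r\<^sup>2) * ?G"
      proof (intro mult_right_mono ennreal_leI)
        have "(norm z)\<^sup>2 \<le> (2 * r)\<^sup>2" using True by (intro power_mono) auto
        then show "(norm z)\<^sup>2 \<le> 4 * r\<^sup>2" by (simp add: power_mult_distrib)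
      qed simp
      finally show ?thesis using True by simp
    next
      case False
      have "indicator ?B x * (indicator ?B (x + z) * ennreal ((f x - f (x + z))\<^sup>2)) = 0" for x
      proof -
        have "\<not> (x \<in> ?B \<and> x + z \<in> ?B)"
        proof
          assume a: "x \<in> ?B \<and> x + z \<in> ?B"
          have "norm z = dist x (x + z)" by (simp add: dist_norm)
          also have "\<dots> \<le> dist c x + dist c (x + z)" by (rule dist_triangle3)
          also have "\<dots> < 2 * r" using a by simp
          finally show False using False by simp
        qed
        then show ?thesis by (auto simp: indicator_def)
      qed
      then have "(\<integral>\<^sup>+x. indicator ?B x * (indicator ?B (x + z) * ennreal ((f x - f (x + z))\<^sup>2)) \<partial>lborel) = 0"
        by (simp only: nn_integral_const) simp
      then show ?thesis by simp
    qed
  qed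
  also have "\<dots> = (ennreal (4 * r\<^sup>2) * ?G) * emeasure lborel (ball (0::real^'d) (2 * r))"
    by (subst nn_integral_cmult) auto
  also have "\<dots> = ennreal (measure lborel (ball (0::real^'d) (2 * r)) * (4 * r\<^sup>2)) * ?G"
    by (simp add: emeasure_ball_eq ennreal_mult mult_ac)
  finally show ?thesis .
qed

text \<open>The constant is the volume ratio 2^d of the balls of radius 2 r and r, times the squared
  diameter 4 r^2.\<close>

lemma poincare_ball:
  fixes f :: "real ^ 'd \<Rightarrow> real" and g :: "'d \<Rightarrow> real ^ 'd \<Rightarrow> real"
  assumes r: "r > 0" and f: "sq_int (ball c r) f" and g: "\<And>i. sq_int (ball c r) (g i)" "\<And>i. weak_partial (ball c r) i f (g i)"
  shows "sq_norm (ball c r) (\<lambda>x. f x - mean (ball c r) f) \<le> ennreal (2 ^ (CARD('d) + 2) * r\<^sup>2) * (\<Sum>i\<in>UNIV. sq_norm (ball c r) (g i))"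
proof -
  let ?G = "\<Sum>i\<in>UNIV. sq_norm (ball c r) (g i)" let ?\<omega> = "measure lborel (ball (0::real^'d) 1)"
  have w: "?\<omega> > 0" by (rule measure_ball_pos) simp
  have "sq_norm (ball c r) (\<lambda>x. f x - mean (ball c r) f) \<le> ennreal (1 / measure lborel (ball c r)) * osc_sq (ball c r) f"
    by (rule sq_norm_minus_mean_le[OF f r])
  also have "\<dots> \<le> ennreal (1 / measure lborel (ball c r)) * (ennreal (measure lborel (ball (0::real^'d) (2 * r)) * (4 * r\<^sup>2)) * ?G)"
    by (intro mult_left_mono osc_sq_gradient_le[OF r f g]) auto
  also have "\<dots> = ennreal (1 / measure lborel (ball c r) * (measure lborel (ball (0::real^'d) (2 * r)) * (4 * r\<^sup>2))) * ?G"
    by (subst ennreal_mult) (auto simp: mult.assoc)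
  also have "1 / measure lborel (ball c r) * (measure lborel (ball (0::real^'d) (2 * r)) * (4 * r\<^sup>2)) = 2 ^ (CARD('d) + 2) * r\<^sup>2"
    using r w measure_ball[of r c] measure_ball[of "2 * r" "0::real^'d"] by (simp add: field_simps power_add power_mult_distrib)
  finally show ?thesis .
qed

text \<open>No derivative is involved: on the ball \<bar>x - y\<bar> is at most 2 r, so the
  Slobodeckij kernel is bounded below by \<open>(2 * r) powr - (d + 2 * \<sigma>)\<close>. Division
  by the volume leaves \<open>r powr (2 * \<sigma>)\<close>.\<close>

lemma slobodeckij_poincare_ball:
  fixes f :: "real ^ 'd \<Rightarrow> real"
  assumes r: "r > 0" and f: "sq_int (ball c r) f" and s: "\<sigma> \<ge> 0"
  shows "sq_norm (ball c r) (\<lambda>x. f x - mean (ball c r) f) \<le>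
    ennreal (2 powr (real CARD('d) + 2 * \<sigma>) / measure lborel (ball (0::real^'d) 1) * r powr (2 * \<sigma>)) * Slob (ball c r) \<sigma> f"
proof -
  let ?B = "ball c r" let ?\<omega> = "measure lborel (ball (0::real^'d) 1)" let ?a = "real CARD('d) + 2 * \<sigma>"
  have w: "?\<omega> > 0" by (rule measure_ball_pos) simp
  have a: "?a > 0" using s by (simp add: add_pos_nonneg)
  have [measurable]: "f \<in> borel_measurable borel" using f by (simp add: sq_int_def)
  have "osc_sq ?B f \<le> (\<integral>\<^sup>+x. ennreal ((2 * r) powr ?a) * (indicator ?B x * (\<integral>\<^sup>+y. indicator ?B y * ennreal ((f x - f y)\<^sup>2 / norm (x - y) powr ?a) \<partial>lborel)) \<partial>lborel)"
    unfolding osc_sq_def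
  proof (rule nn_integral_mono)
    fix x
    show "indicator ?B x * (\<integral>\<^sup>+y. indicator ?B y * ennreal ((f x - f y)\<^sup>2) \<partial>lborel) \<le>
      ennreal ((2 * r) powr ?a) * (indicator ?B x * (\<integral>\<^sup>+y. indicator ?B y * ennreal ((f x - f y)\<^sup>2 / norm (x - y) powr ?a) \<partial>lborel))"
    proof (cases "x \<in> ?B")
      case True
      have "(\<integral>\<^sup>+y. indicator ?B y * ennreal ((f x - f y)\<^sup>2) \<partial>lborel) \<le>
        (\<integral>\<^sup>+y. ennreal ((2 * r) powr ?a) * (indicator ?B y * ennreal ((f x - f y)\<^sup>2 / norm (x - y) powr ?a)) \<partial>lborel)"
      proof (rule nn_integral_mono)
        fix y
        have "(f x - f y)\<^sup>2 \<le> (2 * r) powr ?a * ((f x - f y)\<^sup>2 / norm (x - y) powr ?a)" if "y \<in> ?B"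
        proof (cases "x = y")
          case False
          have "norm (x - y) \<le> 2 * r"
            using True that dist_triangle3[of x y c] by (simp add: dist_norm[symmetric])
          then have "norm (x - y) powr ?a \<le> (2 * r) powr ?a" using a by (intro powr_mono2) auto
          then show ?thesis using False by (simp add: field_simps mult_left_mono)
        qed simp
        then show "indicator ?B y * ennreal ((f x - f y)\<^sup>2) \<le> ennreal ((2 * r) powr ?a) * (indicator ?B y * ennreal ((f x - f y)\<^sup>2 / norm (x - y) powr ?a))"
          by (auto simp: indicator_def intro!: ennreal_leI simp flip: ennreal_mult)
      qed
      also have "\<dots> = ennreal ((2 * r) powr ?a) * (\<integral>\<^sup>+y. indicator ?B y * ennreal ((f x - f y)\<^sup>2 / norm (x - y) powr ?a) \<partial>lborel)"
        by (rule nn_integral_cmult) measurable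
      finally show ?thesis using True by simp
    qed simp
  qed
  also have "\<dots> = ennreal ((2 * r) powr ?a) * Slob ?B \<sigma> f"
    unfolding Slob_def by (rule nn_integral_cmult) measurable
  finally have o: "osc_sq ?B f \<le> ennreal ((2 * r) powr ?a) * Slob ?B \<sigma> f" .
  have "sq_norm ?B (\<lambda>x. f x - mean ?B f) \<le> ennreal (1 / measure lborel ?B) * osc_sq ?B f"
    by (rule sq_norm_minus_mean_le[OF f r])
  also have "\<dots> \<le> ennreal (1 / measure lborel ?B) * (ennreal ((2 * r) powr ?a) * Slob ?B \<sigma> f)"
    by (intro mult_left_mono o) auto
  also have "\<dots> = ennreal (1 / measure lborel ?B * (2 * r) powr ?a) * Slob ?B \<sigma> f"
    by (subst ennreal_mult) (auto simp: mult.assoc)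
  also have "1 / measure lborel ?B * (2 * r) powr ?a = 2 powr ?a / ?\<omega> * r powr (2 * \<sigma>)"
    using r w measure_ball[of r c] by (simp add: powr_mult powr_add powr_realpow field_simps)
  finally show ?thesis .
qed

section \<open>Decay of L2 norms on shrinking balls\<close>

lemma sq_norm_add_le:
  assumes [measurable]: "f \<in> borel_measurable borel" "g \<in> borel_measurable borel" and U[measurable]: "U \<in> sets borel" and \<eta>: "\<eta> > 0"
  shows "sq_norm U (\<lambda>x. f x + g x) \<le> ennreal (1 + 1 / \<eta>) * sq_norm U f + ennreal (1 + \<eta>) * sq_norm U g"
proof -
  \<comment> \<open>Young's inequality with a free parameter: the factor 1 + \<eta> of the second
    term must come arbitrarily close to 1 for the later iteration to contract.\<close>
  have p: "(a + b)\<^sup>2 \<le> (1 + 1 / \<eta>) * a\<^sup>2 + (1 + \<eta>) * b\<^sup>2" for a b :: real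
  proof -
    have "0 \<le> (a - \<eta> * b)\<^sup>2 / \<eta>" using \<eta> by simp
    also have "(a - \<eta> * b)\<^sup>2 / \<eta> = a\<^sup>2 / \<eta> - 2 * a * b + \<eta> * b\<^sup>2" using \<eta> by (simp add: power2_eq_square field_simps)
    finally show ?thesis by (simp add: power2_sum algebra_simps)
  qed
  have "sq_norm U (\<lambda>x. f x + g x) \<le> (\<integral>\<^sup>+x. ennreal (1 + 1 / \<eta>) * (indicator U x * ennreal ((f x)\<^sup>2)) + ennreal (1 + \<eta>) * (indicator U x * ennreal ((g x)\<^sup>2)) \<partial>lborel)"
    unfolding sq_norm_def
  proof (rule nn_integral_mono)
    fix x
    have "ennreal ((f x + g x)\<^sup>2) \<le> ennreal ((1 + 1 / \<eta>) * (f x)\<^sup>2 + (1 + \<eta>) * (g x)\<^sup>2)" by (rule ennreal_leI[OF p])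
    also have "\<dots> = ennreal (1 + 1 / \<eta>) * ennreal ((f x)\<^sup>2) + ennreal (1 + \<eta>) * ennreal ((g x)\<^sup>2)"
      using \<eta> by (simp add: ennreal_plus ennreal_mult)
    finally show "indicator U x * ennreal ((f x + g x)\<^sup>2) \<le> ennreal (1 + 1 / \<eta>) * (indicator U x * ennreal ((f x)\<^sup>2)) + ennreal (1 + \<eta>) * (indicator U x * ennreal ((g x)\<^sup>2))"
      by (auto simp: indicator_def)
  qed
  also have "\<dots> = ennreal (1 + 1 / \<eta>) * sq_norm U f + ennreal (1 + \<eta>) * sq_norm U g"
    unfolding sq_norm_def by (simp add: nn_integral_add nn_integral_cmult)
  finally show ?thesis .
qed

lemma mean_square_le:
  fixes f :: "'a::euclidean_space \<Rightarrow> real"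
  assumes f: "f \<in> borel_measurable borel" and r: "r > 0"
  shows "ennreal ((mean (ball c r) f)\<^sup>2 * measure lborel (ball c r)) \<le> sq_norm (ball c r) f"
proof -
  let ?B = "ball c r" let ?b = "measure lborel (ball c r)"
  have [measurable]: "f \<in> borel_measurable borel" by fact
  have b: "?b > 0" by (rule measure_ball_pos[OF r])
  have i1: "integrable lborel (\<lambda>y. indicator ?B y / ?b)" using emeasure_lborel_ball_finite[of c r] by simp
  have "ennreal ((mean ?B f)\<^sup>2) = ennreal ((\<integral>y. indicator ?B y / ?b * f y \<partial>lborel)\<^sup>2)"
    unfolding mean_def by simp
  also have "\<dots> \<le> (\<integral>\<^sup>+y. ennreal (indicator ?B y / ?b * (f y)\<^sup>2) \<partial>lborel)"
    by (rule square_integral_le) (use b i1 integral_cut_ball_ident[OF r, of c] in auto)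
  also have "\<dots> = (\<integral>\<^sup>+y. ennreal (1 / ?b) * (indicator ?B y * ennreal ((f y)\<^sup>2)) \<partial>lborel)"
    using b by (intro nn_integral_cong) (auto simp: indicator_def simp flip: ennreal_mult)
  also have "\<dots> = ennreal (1 / ?b) * sq_norm ?B f"
    unfolding sq_norm_def by (rule nn_integral_cmult) measurable
  finally have "ennreal ((mean ?B f)\<^sup>2) * ennreal ?b \<le> (ennreal (1 / ?b) * sq_norm ?B f) * ennreal ?b"
    by (intro mult_right_mono) auto
  also have "\<dots> = ennreal (1 / ?b * ?b) * sq_norm ?B f" using b by (subst ennreal_mult) (auto simp: mult_ac)
  also have "\<dots> = sq_norm ?B f" using b by simp
  finally show ?thesis by (simp add: ennreal_mult)
qed

lemma sq_norm_const_ball: "sq_norm (ball c r) (\<lambda>x. a) = ennreal (a\<^sup>2 * measure lborel (ball c r))"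
  unfolding sq_norm_def by (subst nn_integral_multc) (auto simp: emeasure_ball_eq ennreal_mult mult.commute)

text \<open>Split f into its deviation from the mean and the mean. A constant has only the fraction
  2^-d of its squared norm on the half ball, and the norm of the mean is at most that of f.\<close>

lemma half_ball_step:
  fixes f :: "real ^ 'd \<Rightarrow> real"
  assumes f: "f \<in> borel_measurable borel" and r: "r > 0" and \<eta>: "\<eta> > 0"
  shows "sq_norm (ball c (r / 2)) f \<le> ennreal (1 + 1 / \<eta>) * sq_norm (ball c r) (\<lambda>x. f x - mean (ball c r) f)
     + ennreal ((1 + \<eta>) / 2 ^ CARD('d)) * sq_norm (ball c r) f"
proof -
  let ?a = "mean (ball c r) f"
  have [measurable]: "f \<in> borel_measurable borel" by fact
  have "sq_norm (ball c (r / 2)) f = sq_norm (ball c (r / 2)) (\<lambda>x. (f x - ?a) + ?a)" by simp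
  also have "\<dots> \<le> ennreal (1 + 1 / \<eta>) * sq_norm (ball c (r / 2)) (\<lambda>x. f x - ?a) + ennreal (1 + \<eta>) * sq_norm (ball c (r / 2)) (\<lambda>x. ?a)"
    by (rule sq_norm_add_le) (use \<eta> in auto)
  also have "\<dots> \<le> ennreal (1 + 1 / \<eta>) * sq_norm (ball c r) (\<lambda>x. f x - ?a) + ennreal ((1 + \<eta>) / 2 ^ CARD('d)) * sq_norm (ball c r) f"
  proof (rule add_mono)
    show "ennreal (1 + 1 / \<eta>) * sq_norm (ball c (r / 2)) (\<lambda>x. f x - ?a) \<le> ennreal (1 + 1 / \<eta>) * sq_norm (ball c r) (\<lambda>x. f x - ?a)"
      using r by (intro mult_left_mono sq_norm_mono subset_ball) auto
    have "ennreal (1 + \<eta>) * sq_norm (ball c (r / 2)) (\<lambda>x. ?a) = ennreal ((1 + \<eta>) / 2 ^ CARD('d)) * ennreal (?a\<^sup>2 * measure lborel (ball c r))"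
    proof -
      have q: "measure lborel (ball c r) = 2 ^ CARD('d) * measure lborel (ball c (r / 2))"
        using r measure_ball[of r c] measure_ball[of "r / 2" c] by (simp add: power_divide)
      have "ennreal (1 + \<eta>) * ennreal (?a\<^sup>2 * measure lborel (ball c (r / 2))) = ennreal ((1 + \<eta>) * (?a\<^sup>2 * measure lborel (ball c (r / 2))))"
        using \<eta> by (intro ennreal_mult[symmetric]) auto
      also have "(1 + \<eta>) * (?a\<^sup>2 * measure lborel (ball c (r / 2))) = (1 + \<eta>) / 2 ^ CARD('d) * (?a\<^sup>2 * (2 ^ CARD('d) * measure lborel (ball c (r / 2))))"
        by simp
      also have "ennreal \<dots> = ennreal ((1 + \<eta>) / 2 ^ CARD('d)) * ennreal (?a\<^sup>2 * (2 ^ CARD('d) * measure lborel (ball c (r / 2))))"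
        using \<eta> by (intro ennreal_mult) auto
      finally show ?thesis unfolding sq_norm_const_ball q .
    qed
    also have "\<dots> \<le> ennreal ((1 + \<eta>) / 2 ^ CARD('d)) * sq_norm (ball c r) f"
      by (intro mult_left_mono mean_square_le f r) auto
    finally show "ennreal (1 + \<eta>) * sq_norm (ball c (r / 2)) (\<lambda>x. ?a) \<le> ennreal ((1 + \<eta>) / 2 ^ CARD('d)) * sq_norm (ball c r) f" .
  qed
  finally show ?thesis .
qed

lemma dyadic_scale:
  fixes r R :: real
  assumes "0 < r" "r \<le> R"
  shows "\<exists>j::nat. R / 2 ^ Suc j < r \<and> r \<le> R / 2 ^ j"
proof -
  obtain k :: nat where k: "R / r < 2 ^ k" using real_arch_pow[of 2 "R / r"] by auto
  define j where "j = (LEAST k::nat. R / 2 ^ k < r)"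
  have kk: "R / 2 ^ k < r" using k assms by (simp add: field_simps)
  have j: "R / 2 ^ j < r" unfolding j_def by (rule LeastI[of _ k]) (rule kk)
  then have "j \<noteq> 0" using assms by (intro notI) simp
  then obtain i where i: "j = Suc i" by (cases j) auto
  have "\<not> R / 2 ^ i < r" using not_less_Least[of i "\<lambda>k. R / 2 ^ k < r"] i unfolding j_def by simp
  then show ?thesis using j i by auto
qed

lemma ennreal_lincomb:
  "0 \<le> a \<Longrightarrow> 0 \<le> b \<Longrightarrow> 0 \<le> c \<Longrightarrow> 0 \<le> d \<Longrightarrow> ennreal a * ennreal b + ennreal c * ennreal d = ennreal (a * b + c * d)"
  by (simp add: ennreal_mult ennreal_plus)

text \<open>Comparing with the mean gives \<open>E(r/2) \<le> (1 + \<eta>) 2\<^sup>-\<^sup>d E(r) + O(r\<^sup>2\<^sup>\<tau>)\<close> for \<open>E(r)\<close> the squared norm on the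
  ball of radius \<open>r\<close>. As \<open>2\<tau> < d\<close>, iterating this is a contraction for \<open>r\<^sup>-\<^sup>2\<^sup>\<tau> E(r)\<close> if \<open>\<eta>\<close> is small.\<close>

lemma decay:
  fixes \<tau> R :: real
  assumes t: "2 * \<tau> < real CARD('d)" and R: "R > 0"
  shows "\<exists>C\<ge>0. \<forall>(c :: real ^ 'd) f K N. f \<in> borel_measurable borel \<longrightarrow> 0 \<le> K \<longrightarrow> 0 \<le> N \<longrightarrow>
     (\<forall>r. 0 < r \<and> r \<le> R \<longrightarrow> sq_norm (ball c r) (\<lambda>x. f x - mean (ball c r) f) \<le> ennreal (K * r powr (2 * \<tau>))) \<longrightarrow>
     sq_norm (ball c R) f \<le> ennreal N \<longrightarrow>
     (\<forall>r. 0 < r \<and> r \<le> R \<longrightarrow> sq_norm (ball c r) f \<le> ennreal (C * (K + N) * r powr (2 * \<tau>)))"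
proof -
  let ?d = "real CARD('d)"
  \<comment> \<open>The contraction factor for \<open>r powr (- 2 * \<tau>) * E(r)\<close> when the
    radius is halved, if \<eta> were 0.\<close>
  define b where "b = 2 powr (2 * \<tau> - ?d)"
  have b: "0 < b" "b < 1" using t by (auto simp: b_def powr_less_one)
  \<comment> \<open>Chosen such that (1 + \<eta>) b is the midpoint (1 + b) / 2 between b and
    1.\<close>
  define \<eta> where "\<eta> = (1 - b) / (2 * b)"
  have \<eta>: "\<eta> > 0" using b by (simp add: \<eta>_def)
  have \<eta>b: "(1 + \<eta>) * b = (1 + b) / 2" using b by (simp add: \<eta>_def field_simps)
  \<comment> \<open>The first summand settles the initial radius R; the second lets the gap (1 - b)
    / 2 absorb the oscillation term at each halving.\<close>
  define A where "A = R powr (- (2 * \<tau>)) + (1 + 1 / \<eta>) * 2 powr (2 * \<tau>) / ((1 - b) / 2)"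
  have A: "A \<ge> 0" unfolding A_def using \<eta> b by (intro add_nonneg_nonneg divide_nonneg_nonneg mult_nonneg_nonneg) auto
  \<comment> \<open>The price of passing from dyadic to arbitrary radii; the absolute value allows
    for negative \<tau>.\<close>
  let ?E = "2 powr (2 * \<bar>\<tau>\<bar>)"
  show ?thesis
  proof (intro exI[of _ "A * ?E"] conjI allI impI)
    show "0 \<le> A * ?E" using A by simp
    fix c :: "real ^ 'd" and f and K N r :: real
    assume f: "f \<in> borel_measurable borel" and K: "0 \<le> K" and N: "0 \<le> N"
      and O: "\<forall>r. 0 < r \<and> r \<le> R \<longrightarrow> sq_norm (ball c r) (\<lambda>x. f x - mean (ball c r) f) \<le> ennreal (K * r powr (2 * \<tau>))"
      and E: "sq_norm (ball c R) f \<le> ennreal N" and r: "0 < r \<and> r \<le> R"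
    define D where "D = A * (K + N)"
    have D: "D \<ge> 0" using A K N by (simp add: D_def)
    have D1: "N \<le> D * R powr (2 * \<tau>)"
    proof -
      have "N = N * (R powr (- (2 * \<tau>)) * R powr (2 * \<tau>))" using R by (simp flip: powr_add)
      also have "\<dots> \<le> (K + N) * A * R powr (2 * \<tau>)"
      proof -
        have "R powr (- (2 * \<tau>)) \<le> A" unfolding A_def using \<eta> b by simp
        then have "N * R powr (- (2 * \<tau>)) \<le> (K + N) * A" using K N A by (intro mult_mono) auto
        then show ?thesis by (simp add: mult.assoc[symmetric] mult_right_mono)
      qed
      finally show ?thesis by (simp add: D_def mult_ac)
    qed
    have D2: "(1 + 1 / \<eta>) * 2 powr (2 * \<tau>) * K \<le> (1 - b) / 2 * D"
    proof -
      have "(1 + 1 / \<eta>) * 2 powr (2 * \<tau>) / ((1 - b) / 2) \<le> A" unfolding A_def by simp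
      then have "(1 + 1 / \<eta>) * 2 powr (2 * \<tau>) \<le> (1 - b) / 2 * A" using b by (simp add: field_simps)
      then have "(1 + 1 / \<eta>) * 2 powr (2 * \<tau>) * K \<le> ((1 - b) / 2 * A) * (K + N)"
        by (rule mult_mono) (use K N A b in auto)
      also have "\<dots> = (1 - b) / 2 * D" by (simp only: D_def mult.assoc)
      finally show ?thesis .
    qed
    have dy: "sq_norm (ball c (R / 2 ^ j)) f \<le> ennreal (D * (R / 2 ^ j) powr (2 * \<tau>))" for j :: nat
    proof (induction j)
      case 0
      show ?case using E D1 by (simp add: order_trans[OF _ ennreal_leI])
    next
      case (Suc j)
      let ?r = "R / 2 ^ j"
      have rp: "?r > 0" using R by simp
      have "?r \<le> R" using R by (simp add: divide_le_eq)
      have "sq_norm (ball c (?r / 2)) f \<le> ennreal (1 + 1 / \<eta>) * sq_norm (ball c ?r) (\<lambda>x. f x - mean (ball c ?r) f)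
     + ennreal ((1 + \<eta>) / 2 ^ CARD('d)) * sq_norm (ball c ?r) f"
        by (rule half_ball_step[OF f rp \<eta>])
      also have "\<dots> \<le> ennreal (1 + 1 / \<eta>) * ennreal (K * ?r powr (2 * \<tau>)) + ennreal ((1 + \<eta>) / 2 ^ CARD('d)) * ennreal (D * ?r powr (2 * \<tau>))"
        using O rp \<open>?r \<le> R\<close> by (intro add_mono mult_left_mono Suc) auto
      also have "\<dots> = ennreal ((1 + 1 / \<eta>) * (K * ?r powr (2 * \<tau>)) + (1 + \<eta>) / 2 ^ CARD('d) * (D * ?r powr (2 * \<tau>)))"
        by (rule ennreal_lincomb) (use \<eta> K D in auto)
      also have "\<dots> \<le> ennreal (D * (?r / 2) powr (2 * \<tau>))"
      proof (rule ennreal_leI)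
        have e: "(1 + \<eta>) / 2 ^ CARD('d) = (1 + b) / 2 / 2 powr (2 * \<tau>)"
          using \<eta>b by (simp add: b_def powr_diff powr_realpow field_simps)
        have "((1 + 1 / \<eta>) * 2 powr (2 * \<tau>) * K + (1 + b) / 2 * D) \<le> (1 - b) / 2 * D + (1 + b) / 2 * D"
          using D2 by simp
        also have "\<dots> = D" by (simp add: field_simps)
        finally have "((1 + 1 / \<eta>) * 2 powr (2 * \<tau>) * K + (1 + b) / 2 * D) * (?r powr (2 * \<tau>) / 2 powr (2 * \<tau>)) \<le> D * (?r powr (2 * \<tau>) / 2 powr (2 * \<tau>))"
          by (intro mult_right_mono) auto
        also have "?r powr (2 * \<tau>) / 2 powr (2 * \<tau>) = (?r / 2) powr (2 * \<tau>)"
          by (rule powr_divide[symmetric])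
        also have "((1 + 1 / \<eta>) * 2 powr (2 * \<tau>) * K + (1 + b) / 2 * D) * (?r / 2) powr (2 * \<tau>) =
          (1 + 1 / \<eta>) * (K * ?r powr (2 * \<tau>)) + (1 + \<eta>) / 2 ^ CARD('d) * (D * ?r powr (2 * \<tau>))"
        proof -
          have k: "(X * T * K' + Y * D') * (P / T) = X * (K' * P) + Y / T * (D' * P)" if "T \<noteq> 0" for X T K' Y D' P :: real
            using that by (simp add: field_simps)
          show ?thesis unfolding e powr_divide[of ?r 2] by (rule k) simp
        qed
        finally show "(1 + 1 / \<eta>) * (K * ?r powr (2 * \<tau>)) + (1 + \<eta>) / 2 ^ CARD('d) * (D * ?r powr (2 * \<tau>)) \<le> D * (?r / 2) powr (2 * \<tau>)" .
      qed
      finally show ?case by (simp add: field_simps)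
    qed
    from r have "0 < r" "r \<le> R" by auto
    from dyadic_scale[OF this] obtain j :: nat where j: "R / 2 ^ Suc j < r" "r \<le> R / 2 ^ j" by blast
    have "(R / 2 ^ j) powr (2 * \<tau>) \<le> ?E * r powr (2 * \<tau>)"
    proof (cases "\<tau> \<ge> 0")
      case True
      have "(R / 2 ^ j) powr (2 * \<tau>) \<le> (2 * r) powr (2 * \<tau>)" using j(1) R True by (intro powr_mono2) (auto simp: field_simps)
      then show ?thesis using True r by (simp add: powr_mult)
    next
      case False
      have "(R / 2 ^ j) powr (2 * \<tau>) \<le> r powr (2 * \<tau>)" using j(2) r False by (intro powr_mono2') auto
      also have "\<dots> = 1 * r powr (2 * \<tau>)" by simp
      also have "\<dots> \<le> ?E * r powr (2 * \<tau>)" by (intro mult_right_mono ge_one_powr_ge_zero) auto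
      finally show ?thesis .
    qed
    then have "D * (R / 2 ^ j) powr (2 * \<tau>) \<le> A * ?E * (K + N) * r powr (2 * \<tau>)"
      using mult_left_mono[OF _ D] by (fastforce simp: D_def mult_ac)
    moreover have "sq_norm (ball c r) f \<le> sq_norm (ball c (R / 2 ^ j)) f" using j by (intro sq_norm_mono subset_ball)
    ultimately show "sq_norm (ball c r) f \<le> ennreal (A * ?E * (K + N) * r powr (2 * \<tau>))"
      using dy[of j] by (meson ennreal_leI order_trans)
  qed
qed

section \<open>Sobolev embedding and Bramble--Hilbert estimate on balls\<close>

text \<open>The type argument fixes the dimension, which otherwise occurs only in variables bound
  inside. The constant is chosen before the centre, the family and N.\<close>

definition decays :: "'d::finite itself \<Rightarrow> real \<Rightarrow> real \<Rightarrow> nat \<Rightarrow> real \<Rightarrow> bool" where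
  "decays T m R l \<tau> \<longleftrightarrow> (\<exists>C\<ge>0. \<forall>(c :: real ^ 'd) V N. 0 \<le> N \<longrightarrow> sobolev_family (ball c R) m N V \<longrightarrow>
     (\<forall>is r. length is = l \<longrightarrow> 0 < r \<and> r \<le> R \<longrightarrow> sq_norm (ball c r) (V is) \<le> ennreal (C * N * r powr (2 * \<tau>))))"

definition osc_decays :: "'d::finite itself \<Rightarrow> real \<Rightarrow> real \<Rightarrow> nat \<Rightarrow> real \<Rightarrow> bool" where
  "osc_decays T m R l \<tau> \<longleftrightarrow> (\<exists>C\<ge>0. \<forall>(c :: real ^ 'd) V N. 0 \<le> N \<longrightarrow> sobolev_family (ball c R) m N V \<longrightarrow>
     (\<forall>is r. length is = l \<longrightarrow> 0 < r \<and> r \<le> R \<longrightarrow>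
        sq_norm (ball c r) (\<lambda>x. V is x - mean (ball c r) (V is)) \<le> ennreal (C * N * r powr (2 * \<tau>))))"

text \<open>The Slobodeckij form of the Poincare inequality gives the exponent
  \<open>frac m\<close>; lowering it to \<kappa> costs a power of R, as r \<le> R.\<close>

lemma osc_decays_top:
  assumes m: "m \<notin> \<int>" and k: "\<kappa> \<le> frac m" and R: "R > 0"
  shows "osc_decays TYPE('d::finite) m R (nat \<lfloor>m\<rfloor>) \<kappa>"
proof -
  let ?s = "frac m"
  have s: "?s \<ge> 0" by simp
  define A where "A = 2 powr (real CARD('d) + 2 * ?s) / measure lborel (ball (0::real^'d) 1)"
  have A: "A \<ge> 0" by (simp add: A_def)
  show ?thesis unfolding osc_decays_def
  proof (intro exI[of _ "A * R powr (2 * (?s - \<kappa>))"] conjI allI impI)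
    show "0 \<le> A * R powr (2 * (?s - \<kappa>))" using A by simp
    fix c :: "real ^ 'd" and V N and "is" :: "'d list" and r :: real
    assume N: "0 \<le> N" and V: "sobolev_family (ball c R) m N V" and l: "length is = nat \<lfloor>m\<rfloor>" and r: "0 < r \<and> r \<le> R"
    have V': "sobolev_family (ball c r) m N V" using r by (intro sobolev_family_mono[OF V] subset_ball) simp
    have "sq_norm (ball c r) (\<lambda>x. V is x - mean (ball c r) (V is)) \<le> ennreal (A * r powr (2 * ?s)) * Slob (ball c r) ?s (V is)"
      unfolding A_def by (rule slobodeckij_poincare_ball) (use r s l sobolev_family_sq[OF V'] in auto)
    also have "\<dots> \<le> ennreal (A * r powr (2 * ?s)) * ennreal N"
      by (intro mult_left_mono sobolev_family_Slob[OF V' m l]) auto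
    also have "\<dots> = ennreal (A * r powr (2 * ?s) * N)" using A N by (intro ennreal_mult[symmetric]) auto
    also have "\<dots> \<le> ennreal (A * R powr (2 * (?s - \<kappa>)) * N * r powr (2 * \<kappa>))"
    proof (rule ennreal_leI)
      have "r powr (2 * ?s) = r powr (2 * (?s - \<kappa>)) * r powr (2 * \<kappa>)"
        by (simp flip: powr_add add: algebra_simps)
      also have "\<dots> \<le> R powr (2 * (?s - \<kappa>)) * r powr (2 * \<kappa>)"
        using r k by (intro mult_right_mono powr_mono2) auto
      finally have "A * N * r powr (2 * ?s) \<le> A * N * (R powr (2 * (?s - \<kappa>)) * r powr (2 * \<kappa>))"
        using A N by (intro mult_left_mono) auto
      then show "A * r powr (2 * ?s) * N \<le> A * R powr (2 * (?s - \<kappa>)) * N * r powr (2 * \<kappa>)"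
        by (simp add: mult_ac)
    qed
    finally show "sq_norm (ball c r) (\<lambda>x. V is x - mean (ball c r) (V is)) \<le> ennreal (A * R powr (2 * (?s - \<kappa>)) * N * r powr (2 * \<kappa>))" .
  qed
qed

text \<open>The exponent grows by one because of the factor r^2 in the Poincare inequality.\<close>

lemma osc_decays_step:
  assumes l: "l < nat \<lfloor>m\<rfloor>" and D: "decays TYPE('d::finite) m R (Suc l) (\<kappa> - 1)"
  shows "osc_decays TYPE('d) m R l \<kappa>"
proof -
  obtain C where C: "C \<ge> 0" "\<And>(c :: real ^ 'd) V N is r. 0 \<le> N \<Longrightarrow> sobolev_family (ball c R) m N V \<Longrightarrow>
     length is = Suc l \<Longrightarrow> 0 < r \<and> r \<le> R \<Longrightarrow> sq_norm (ball c r) (V is) \<le> ennreal (C * N * r powr (2 * (\<kappa> - 1)))"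
    using D unfolding decays_def by blast
  let ?K = "2 ^ (CARD('d) + 2) * real CARD('d) * C"
  show ?thesis unfolding osc_decays_def
  proof (intro exI[of _ ?K] conjI allI impI)
    show "0 \<le> ?K" using C by simp
    fix c :: "real ^ 'd" and V N and "is" :: "'d list" and r :: real
    assume N: "0 \<le> N" and V: "sobolev_family (ball c R) m N V" and li: "length is = l" and r: "0 < r \<and> r \<le> R"
    have V': "sobolev_family (ball c r) m N V" using r by (intro sobolev_family_mono[OF V] subset_ball) simp
    have "sq_norm (ball c r) (\<lambda>x. V is x - mean (ball c r) (V is)) \<le> ennreal (2 ^ (CARD('d) + 2) * r\<^sup>2) * (\<Sum>i\<in>UNIV. sq_norm (ball c r) (V (is @ [i])))"
      by (rule poincare_ball) (use r li l sobolev_family_sq[OF V'] sobolev_family_wder[OF V'] in auto)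
    also have "\<dots> \<le> ennreal (2 ^ (CARD('d) + 2) * r\<^sup>2) * (\<Sum>i::'d\<in>UNIV. ennreal (C * N * r powr (2 * (\<kappa> - 1))))"
      by (intro mult_left_mono sum_mono C(2)[OF N V _ r]) (auto simp: li)
    also have "\<dots> = ennreal (2 ^ (CARD('d) + 2) * r\<^sup>2 * (real CARD('d) * (C * N * r powr (2 * (\<kappa> - 1)))))"
      using C N by (simp add: ennreal_mult ennreal_of_nat_eq_real_of_nat)
    also have "2 ^ (CARD('d) + 2) * r\<^sup>2 * (real CARD('d) * (C * N * r powr (2 * (\<kappa> - 1)))) = ?K * N * r powr (2 * \<kappa>)"
    proof -
      have "r powr (2 * \<kappa>) = r\<^sup>2 * r powr (2 * (\<kappa> - 1))"
      proof -
        have "r\<^sup>2 = r powr 2" using r by (simp add: powr_numeral)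
        then show ?thesis by (simp flip: powr_add)
      qed
      then show ?thesis by (simp only: mult_ac)
    qed
    finally show "sq_norm (ball c r) (\<lambda>x. V is x - mean (ball c r) (V is)) \<le> ennreal (?K * N * r powr (2 * \<kappa>))" .
  qed
qed

lemma osc_decays_imp_decays:
  assumes l: "l \<le> nat \<lfloor>m\<rfloor>" and R: "R > 0" and t: "2 * \<tau> < real CARD('d)" and O: "osc_decays TYPE('d::finite) m R l \<tau>"
  shows "decays TYPE('d) m R l \<tau>"
proof -
  obtain C where C: "C \<ge> 0" "\<And>(c :: real ^ 'd) V N is r. 0 \<le> N \<Longrightarrow> sobolev_family (ball c R) m N V \<Longrightarrow>
     length is = l \<Longrightarrow> 0 < r \<and> r \<le> R \<Longrightarrow> sq_norm (ball c r) (\<lambda>x. V is x - mean (ball c r) (V is)) \<le> ennreal (C * N * r powr (2 * \<tau>))"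
    using O unfolding osc_decays_def by blast
  obtain C' where C': "C' \<ge> 0" "\<And>(c :: real ^ 'd) f K N r. f \<in> borel_measurable borel \<Longrightarrow> 0 \<le> K \<Longrightarrow> 0 \<le> N \<Longrightarrow>
     (\<forall>r. 0 < r \<and> r \<le> R \<longrightarrow> sq_norm (ball c r) (\<lambda>x. f x - mean (ball c r) f) \<le> ennreal (K * r powr (2 * \<tau>))) \<Longrightarrow>
     sq_norm (ball c R) f \<le> ennreal N \<Longrightarrow> 0 < r \<and> r \<le> R \<Longrightarrow> sq_norm (ball c r) f \<le> ennreal (C' * (K + N) * r powr (2 * \<tau>))"
    using decay[OF t R] by blast
  show ?thesis unfolding decays_def
  proof (intro exI[of _ "C' * (C + 1)"] conjI allI impI)
    show "0 \<le> C' * (C + 1)" using C C' by simp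
    fix c :: "real ^ 'd" and V N and "is" :: "'d list" and r :: real
    assume N: "0 \<le> N" and V: "sobolev_family (ball c R) m N V" and li: "length is = l" and r: "0 < r \<and> r \<le> R"
    have "sq_norm (ball c r) (V is) \<le> ennreal (C' * (C * N + N) * r powr (2 * \<tau>))"
    proof (rule C'(2))
      show "V is \<in> borel_measurable borel" by (rule sobolev_family_measurable[OF V]) (simp add: li l)
      show "\<forall>r. 0 < r \<and> r \<le> R \<longrightarrow> sq_norm (ball c r) (\<lambda>x. V is x - mean (ball c r) (V is)) \<le> ennreal (C * N * r powr (2 * \<tau>))"
        using C(2)[OF N V li] by blast
      show "sq_norm (ball c R) (V is) \<le> ennreal N" by (rule sobolev_family_E2[OF V]) (simp add: li l)
    qed (use C N r in auto)
    also have "C' * (C * N + N) = C' * (C + 1) * N" by (simp add: algebra_simps)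
    finally show "sq_norm (ball c r) (V is) \<le> ennreal (C' * (C + 1) * N * r powr (2 * \<tau>))" .
  qed
qed

text \<open>For integer m the top derivatives are only known to lie in L2, so nothing beyond the
  trivial bound on the full ball is used; this is the start of the descent.\<close>

lemma decays_top_int:
  assumes m: "0 \<le> m" "m \<in> \<int>" and t: "\<tau> \<le> 0" and R: "R > 0"
  shows "decays TYPE('d::finite) m R (nat \<lfloor>m\<rfloor>) \<tau>"
  unfolding decays_def
proof (intro exI[of _ "R powr (- (2 * \<tau>))"] conjI allI impI)
  fix c :: "real ^ 'd" and V N and "is" :: "'d list" and r :: real
  assume N: "0 \<le> N" and V: "sobolev_family (ball c R) m N V" and li: "length is = nat \<lfloor>m\<rfloor>" and r: "0 < r \<and> r \<le> R"
  have "sq_norm (ball c r) (V is) \<le> sq_norm (ball c R) (V is)" using r by (intro sq_norm_mono subset_ball) simp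
  also have "\<dots> \<le> ennreal N" by (rule sobolev_family_E2[OF V]) (simp add: li)
  also have "\<dots> \<le> ennreal (R powr (- (2 * \<tau>)) * N * r powr (2 * \<tau>))"
  proof (rule ennreal_leI)
    have "N = N * (R powr (- (2 * \<tau>)) * R powr (2 * \<tau>))" using R by (simp flip: powr_add)
    also have "\<dots> \<le> N * (R powr (- (2 * \<tau>)) * r powr (2 * \<tau>))"
      using N r t by (intro mult_left_mono powr_mono2') auto
    finally show "N \<le> R powr (- (2 * \<tau>)) * N * r powr (2 * \<tau>)" by (simp add: mult_ac)
  qed
  finally show "sq_norm (ball c r) (V is) \<le> ennreal (R powr (- (2 * \<tau>)) * N * r powr (2 * \<tau>))" .
qed simp

text \<open>Descending in the order of the derivative, decay of \<open>V (is @ [i])\<close> with exponent \<open>\<tau> - 1\<close> gives decay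
  of the oscillation of \<open>V is\<close> with exponent \<open>\<tau>\<close> by the Poincare inequality, and hence decay of \<open>V is\<close>
  as long as \<open>2\<tau> < d\<close>.\<close>

lemma family_decays:
  assumes m: "0 \<le> m" and R: "R > 0" and l: "l \<le> nat \<lfloor>m\<rfloor>" and t: "\<tau> \<le> m - real l" "2 * \<tau> < real CARD('d)"
  shows "decays TYPE('d::finite) m R l \<tau>"
  using l t
proof (induction "nat \<lfloor>m\<rfloor> - l" arbitrary: l \<tau>)
  case 0
  then have l: "l = nat \<lfloor>m\<rfloor>" by simp
  then have rl: "real l = of_int \<lfloor>m\<rfloor>" using m by simp
  show ?case
  proof (cases "m \<in> \<int>")
    case True
    then have "\<tau> \<le> 0" using 0(3) rl by (auto elim!: Ints_cases)
    then show ?thesis unfolding l by (rule decays_top_int[OF m True _ R])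
  next
    case False
    have "osc_decays TYPE('d) m R l \<tau>"
      unfolding l by (rule osc_decays_top[OF False _ R]) (use 0(3) rl in \<open>simp add: frac_def\<close>)
    then show ?thesis by (intro osc_decays_imp_decays 0 R)
  qed
next
  case (Suc k)
  have "decays TYPE('d) m R (Suc l) (\<tau> - 1)"
    by (rule Suc.hyps(1)) (use Suc in auto)
  then have "osc_decays TYPE('d) m R l \<tau>" by (rule osc_decays_step[rotated]) (use Suc in simp)
  then show ?case by (intro osc_decays_imp_decays Suc.prems R)
qed

text \<open>Oscillations reach beyond the barrier d / 2: below the top order, only the derivative of
  next order has to satisfy it, with exponent \<kappa> - 1. Exponents above d / 2 are what gives
  access to point values. The condition \<open>nt\<close> leaves out the top order of an integer m,
  where there is neither a gradient nor a Slobodeckij seminorm to control the oscillation.\<close>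

lemma family_osc_decays:
  assumes m: "0 \<le> m" and R: "R > 0" and l: "l \<le> nat \<lfloor>m\<rfloor>" and t: "\<kappa> \<le> m - real l" "2 * \<kappa> < real CARD('d) + 2"
    and nt: "l < nat \<lfloor>m\<rfloor> \<or> m \<notin> \<int>"
  shows "osc_decays TYPE('d::finite) m R l \<kappa>"
proof (cases "l < nat \<lfloor>m\<rfloor>")
  case True
  have "decays TYPE('d) m R (Suc l) (\<kappa> - 1)" by (rule family_decays[OF m R]) (use True t in auto)
  then show ?thesis by (rule osc_decays_step[OF True])
next
  case False
  then have leq: "l = nat \<lfloor>m\<rfloor>" using l by simp
  then have "real l = of_int \<lfloor>m\<rfloor>" using m by simp
  then show ?thesis using nt False t unfolding leq by (intro osc_decays_top R) (auto simp: frac_def)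
qed

section \<open>Point values as limits of means\<close>

lemma mean_diff_const:
  fixes f :: "'a::euclidean_space \<Rightarrow> real"
  assumes f: "sq_int (ball c r) f" and r: "r > 0"
  shows "mean (ball c r) (\<lambda>x. f x - a) = mean (ball c r) f - a"
proof -
  let ?B = "ball c r"
  have i: "integrable lborel (\<lambda>y. indicator ?B y * f y)" by (rule cut_integrable[OF f]) auto
  have j: "integrable lborel (\<lambda>y. a * indicator ?B y)"
    using emeasure_lborel_ball_finite[of c r] by simp
  have "(\<integral>x. indicator ?B x * (f x - a) \<partial>lborel) = (\<integral>x. indicator ?B x * f x - a * indicator ?B x \<partial>lborel)"
    by (rule Bochner_Integration.integral_cong) (auto simp: indicator_def)
  also have "\<dots> = (\<integral>x. indicator ?B x * f x \<partial>lborel) - a * measure lborel ?B"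
    using Bochner_Integration.integral_diff[OF i j] by simp
  finally show ?thesis using measure_ball_pos[OF r, of c] by (simp add: mean_def diff_divide_distrib)
qed

text \<open>Means over concentric balls of radius r / 2 and r differ by at most a constant times the
  L2 oscillation on the larger ball divided by \<open>r powr (d / 2)\<close>, hence by
  \<open>O(r powr \<delta>)\<close>. Along dyadic radii this is geometric with ratio
  \<open>2 powr (- \<delta>)\<close>.\<close>

lemma mean_increments:
  assumes m: "m > real CARD('d) / 2" and R: "R > 0"
  shows "\<exists>C q. 0 \<le> C \<and> 0 < q \<and> q < 1 \<and> (\<forall>(c :: real ^ 'd) V N. 0 \<le> N \<longrightarrow> sobolev_family (ball c R) m N V \<longrightarrow>
     \<bar>mean (ball c R) (V [])\<bar> \<le> C * sqrt N \<and>
     (\<forall>j. \<bar>mean (ball c (R / 2 ^ Suc j)) (V []) - mean (ball c (R / 2 ^ j)) (V [])\<bar> \<le> C * sqrt N * q ^ j))"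
proof -
  \<comment> \<open>Capped in order to meet \<open>2 * \<kappa> < d + 2\<close> in
    \<open>family_osc_decays\<close>, but still above d / 2, so that \<delta> is positive.\<close>
  define \<kappa> where "\<kappa> = min m (real CARD('d) / 2 + 1 / 2)"
  define \<delta> where "\<delta> = \<kappa> - real CARD('d) / 2"
  have d: "\<delta> > 0" using m by (simp add: \<delta>_def \<kappa>_def)
  have m0: "m > 0" using m by (meson divide_nonneg_nonneg of_nat_0_le_iff order.strict_trans1 zero_le_numeral)
  have "osc_decays TYPE('d) m R 0 \<kappa>"
  proof (rule family_osc_decays)
    show "0 < nat \<lfloor>m\<rfloor> \<or> m \<notin> \<int>"
      using m0 by (auto elim!: Ints_cases)
  qed (use m0 R in \<open>auto simp: \<kappa>_def min_def\<close>)
  then obtain C where C: "C \<ge> 0" "\<And>(c :: real ^ 'd) V N is r. 0 \<le> N \<Longrightarrow> sobolev_family (ball c R) m N V \<Longrightarrow>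
     length is = 0 \<Longrightarrow> 0 < r \<and> r \<le> R \<Longrightarrow> sq_norm (ball c r) (\<lambda>x. V is x - mean (ball c r) (V is)) \<le> ennreal (C * N * r powr (2 * \<kappa>))"
    unfolding osc_decays_def by meson
  let ?\<omega> = "measure lborel (ball (0::real^'d) 1)"
  have w: "?\<omega> > 0" by (rule measure_ball_pos) simp
  define C1 where "C1 = sqrt (C * 2 ^ CARD('d) / ?\<omega>) * R powr \<delta>"
  define C2 where "C2 = sqrt (1 / (?\<omega> * R ^ CARD('d)))"
  define q :: real where "q = 2 powr (- \<delta>)"
  have q: "0 < q" "q < 1" using d by (auto simp: q_def powr_less_one)
  have C1: "C1 \<ge> 0" "C2 \<ge> 0" using C w R by (auto simp: C1_def C2_def)
  have "\<bar>mean (ball c R) (V [])\<bar> \<le> (C1 + C2) * sqrt N \<and>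
     (\<forall>j. \<bar>mean (ball c (R / 2 ^ Suc j)) (V []) - mean (ball c (R / 2 ^ j)) (V [])\<bar> \<le> (C1 + C2) * sqrt N * q ^ j)"
    if N: "0 \<le> N" and V: "sobolev_family (ball c R) m N V" for c :: "real ^ 'd" and V N
  proof (intro conjI allI)
    have sqV: "sq_int (ball c R) (V [])" by (rule sobolev_family_sq[OF V]) simp
    have meas: "V [] \<in> borel_measurable borel" using sqV by (simp add: sq_int_def)
    have "ennreal ((mean (ball c R) (V []))\<^sup>2 * measure lborel (ball c R)) \<le> ennreal N"
      by (rule order_trans[OF mean_square_le[OF meas R] sobolev_family_E2[OF V]]) simp
    then have "(mean (ball c R) (V []))\<^sup>2 * (?\<omega> * R ^ CARD('d)) \<le> N"
      using N measure_ball[OF R, of c] by (simp add: ennreal_le_iff mult_ac)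
    then have "(mean (ball c R) (V []))\<^sup>2 \<le> 1 / (?\<omega> * R ^ CARD('d)) * N" using w R by (simp add: field_simps)
    then have "sqrt ((mean (ball c R) (V []))\<^sup>2) \<le> sqrt (1 / (?\<omega> * R ^ CARD('d)) * N)" by (rule real_sqrt_le_mono)
    then have "\<bar>mean (ball c R) (V [])\<bar> \<le> C2 * sqrt N" unfolding C2_def real_sqrt_mult real_sqrt_abs .
    also have "\<dots> \<le> (C1 + C2) * sqrt N" using C1 N by (intro mult_right_mono) auto
    finally show "\<bar>mean (ball c R) (V [])\<bar> \<le> (C1 + C2) * sqrt N" .
    fix j :: nat
    let ?r = "R / 2 ^ j" let ?r2 = "R / 2 ^ Suc j" let ?a = "mean (ball c ?r) (V [])"
    have rp: "?r > 0" "?r2 > 0" using R by auto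
    have rR: "?r \<le> R" using R by (simp add: divide_le_eq)
    have r2r: "?r2 \<le> ?r" using R by (simp add: field_simps)
    have sq2: "sq_int (ball c ?r2) (V [])" by (rule sq_int_mono[OF sqV]) (use r2r rR in \<open>auto intro!: subset_ball\<close>)
    have "ennreal ((mean (ball c ?r2) (\<lambda>x. V [] x - ?a))\<^sup>2 * measure lborel (ball c ?r2)) \<le> sq_norm (ball c ?r2) (\<lambda>x. V [] x - ?a)"
      by (rule mean_square_le) (use meas rp in auto)
    also have "\<dots> \<le> sq_norm (ball c ?r) (\<lambda>x. V [] x - ?a)" by (rule sq_norm_mono[OF subset_ball[OF r2r]])
    also have "\<dots> \<le> ennreal (C * N * ?r powr (2 * \<kappa>))"
      by (rule C(2)[OF N V]) (use rp rR in auto)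
    finally have "(mean (ball c ?r2) (V []) - ?a)\<^sup>2 * measure lborel (ball c ?r2) \<le> C * N * ?r powr (2 * \<kappa>)"
      using C N unfolding mean_diff_const[OF sq2 rp(2)] by (subst (asm) ennreal_le_iff) auto
    also have "measure lborel (ball c ?r2) = ?r ^ CARD('d) * (?\<omega> / 2 ^ CARD('d))"
      using measure_ball[OF rp(2), of c] by (simp add: power_divide power_mult_distrib field_simps)
    finally have "(mean (ball c ?r2) (V []) - ?a)\<^sup>2 \<le> (C * N * ?r powr (2 * \<kappa>)) / (?r ^ CARD('d) * (?\<omega> / 2 ^ CARD('d)))"
      using w rp by (subst pos_le_divide_eq) auto
    also have "\<dots> = (C * 2 ^ CARD('d) / ?\<omega>) * N * (?r powr (2 * \<kappa>) / ?r ^ CARD('d))"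
    proof -
      have k: "C * N * p / (t * (v / u)) = (C * u / v) * N * (p / t)" for p t v u :: real
        by (simp add: mult_ac)
      show ?thesis by (rule k)
    qed
    also have "?r powr (2 * \<kappa>) / ?r ^ CARD('d) = (?r powr \<delta>)\<^sup>2"
    proof -
      have "?r ^ CARD('d) = ?r powr real CARD('d)" using rp by (simp add: powr_realpow)
      then have "?r powr (2 * \<kappa>) / ?r ^ CARD('d) = ?r powr (2 * \<kappa> - real CARD('d))"
        by (simp only: powr_diff)
      also have "2 * \<kappa> - real CARD('d) = \<delta> + \<delta>" by (simp add: \<delta>_def)
      finally show ?thesis by (simp only: powr_add power2_eq_square)
    qed
    finally have "sqrt ((mean (ball c ?r2) (V []) - ?a)\<^sup>2) \<le> sqrt ((C * 2 ^ CARD('d) / ?\<omega>) * N * (?r powr \<delta>)\<^sup>2)"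
      by (rule real_sqrt_le_mono)
    then have "\<bar>mean (ball c ?r2) (V []) - ?a\<bar> \<le> sqrt (C * 2 ^ CARD('d) / ?\<omega>) * sqrt N * ?r powr \<delta>"
      unfolding real_sqrt_abs real_sqrt_mult[of "_ * N"] real_sqrt_mult[of _ N] by simp
    also have "?r powr \<delta> = R powr \<delta> * q ^ j"
    proof -
      have "q ^ j = q powr real j" using q(1) by (simp add: powr_realpow)
      also have "\<dots> = (2 powr real j) powr (- \<delta>)" by (simp add: q_def powr_powr mult.commute)
      also have "\<dots> = 1 / (2 ^ j) powr \<delta>" by (simp add: powr_realpow powr_minus divide_inverse)
      finally show ?thesis by (simp add: powr_divide)
    qed
    also have "sqrt (C * 2 ^ CARD('d) / ?\<omega>) * sqrt N * (R powr \<delta> * q ^ j) = C1 * sqrt N * q ^ j"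
      by (simp only: C1_def mult_ac)
    also have "\<dots> \<le> (C1 + C2) * sqrt N * q ^ j" using C1 N q by (intro mult_right_mono) auto
    finally show "\<bar>mean (ball c ?r2) (V []) - ?a\<bar> \<le> (C1 + C2) * sqrt N * q ^ j" .
  qed
  then show ?thesis using q C1 by (intro exI[of _ "C1 + C2"] exI[of _ q]) auto
qed

text \<open>Views means over balls as mollifications, so that continuity in the centre and
  convergence almost everywhere come from the general theory.\<close>

definition ball_kernel :: "'a::euclidean_space \<Rightarrow> real" where
  "ball_kernel z = indicator (ball 0 1) z / measure lborel (ball (0::'a) 1)"

lemma ball_kernel_kernel: "kernel (ball_kernel :: 'a::euclidean_space \<Rightarrow> real)"
proof -
  have w: "measure lborel (ball (0::'a) 1) > 0" by (rule measure_ball_pos) simp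
  have "ball_kernel \<in> borel_measurable (borel :: 'a measure)" unfolding ball_kernel_def[abs_def] by measurable
  moreover have "integral\<^sup>L lborel (ball_kernel :: 'a \<Rightarrow> real) = 1"
    unfolding ball_kernel_def[abs_def] by (rule integral_cut_ball_ident) simp
  moreover have "ball_kernel z \<le> 1 / measure lborel (ball (0::'a) 1)" for z :: 'a
    unfolding ball_kernel_def using w by (intro divide_right_mono) (auto simp: indicator_def)
  ultimately show ?thesis unfolding kernel_def using w by (auto simp: ball_kernel_def)
qed

lemma mollify_ball_kernel:
  fixes f :: "real ^ 'd \<Rightarrow> real"
  assumes f: "f \<in> borel_measurable borel" and e: "e > 0"
  shows "mollify ball_kernel e f x = mean (ball x e) f"
proof -
  have "mollify ball_kernel e f x = (\<integral>y. f y * (ball_kernel ((y - x) /\<^sub>R e) / e ^ CARD('d)) \<partial>lborel)"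
    using mollify_alt[OF kernel_measurable[OF ball_kernel_kernel] f e, of x] by simp
  also have "\<dots> = (\<integral>y. (indicator (ball x e) y * f y) / measure lborel (ball x e) \<partial>lborel)"
  proof (rule Bochner_Integration.integral_cong[OF refl])
    fix y
    have "(y - x) /\<^sub>R e \<in> ball 0 1 \<longleftrightarrow> y \<in> ball x e"
    proof -
      have "norm ((y - x) /\<^sub>R e) = norm (y - x) / e"
        using e by (simp only: norm_scaleR) (simp add: divide_inverse mult.commute)
      then show ?thesis unfolding mem_ball dist_0_norm using e by (simp add: dist_norm norm_minus_commute)
    qed
    then show "f y * (ball_kernel ((y - x) /\<^sub>R e) / e ^ CARD('d)) = (indicator (ball x e) y * f y) / measure lborel (ball x e)"
      unfolding ball_kernel_def measure_ball[OF e, of x] by (simp add: indicator_def)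
  qed
  finally show ?thesis by (simp add: mean_def)
qed

text \<open>Since the kernel may jump, continuity comes from f: a change of x is a translation of f,
  which is continuous in L1, and K is bounded.\<close>

lemma mollify_continuous:
  assumes K: "kernel K" and f: "integrable lborel f" and e: "e > 0"
  shows "continuous_on A (mollify K e f)"
proof -
  have [measurable]: "f \<in> borel_measurable borel" "K \<in> borel_measurable borel"
    using f K kernel_measurable by auto
  obtain M where M: "\<And>z. K z \<le> M" using K by (auto simp: kernel_def)
  have "isCont (mollify K e f) x" for x
    unfolding continuous_at_sequentially
  proof (intro allI impI)
    fix X assume X: "X \<longlonglongrightarrow> x"
    let ?t = "\<lambda>n. \<integral>\<^sup>+y. ennreal \<bar>f ((X n - x) + y) - f y\<bar> \<partial>lborel"
    have "(\<lambda>n. X n - x) \<longlonglongrightarrow> 0" using X by (simp add: LIM_zero)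
    then have t0: "?t \<longlonglongrightarrow> 0" by (rule L1_translation_tendsto_0[OF f])
    have b: "ennreal \<bar>mollify K e f (X n) - mollify K e f x\<bar> \<le> ennreal (M * (1 / e ^ DIM('a))) * ?t n" for n
    proof -
      have i: "integrable lborel (\<lambda>z. K z * f (y + e *\<^sub>R z))" for y
        using kernel_mult_integrable[OF K f] e by simp
      have M0: "M \<ge> 0" using M[of 0] kernel_nonneg[OF K, of 0] by simp
      have "ennreal \<bar>mollify K e f (X n) - mollify K e f x\<bar> = ennreal \<bar>\<integral>z. K z * f (X n + e *\<^sub>R z) - K z * f (x + e *\<^sub>R z) \<partial>lborel\<bar>"
        unfolding mollify_def by (simp add: i)
      also have "\<dots> \<le> (\<integral>\<^sup>+z. ennreal \<bar>K z * f (X n + e *\<^sub>R z) - K z * f (x + e *\<^sub>R z)\<bar> \<partial>lborel)"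
        using integral_norm_bound_ennreal[OF Bochner_Integration.integrable_diff[OF i i]] by simp
      also have "\<dots> \<le> (\<integral>\<^sup>+z. ennreal M * ennreal \<bar>f ((X n - x) + (x + e *\<^sub>R z)) - f (x + e *\<^sub>R z)\<bar> \<partial>lborel)"
      proof (rule nn_integral_mono)
        fix z
        have "\<bar>K z * f (X n + e *\<^sub>R z) - K z * f (x + e *\<^sub>R z)\<bar> = K z * \<bar>f (X n + e *\<^sub>R z) - f (x + e *\<^sub>R z)\<bar>"
          by (simp add: kernel_nonneg[OF K] abs_mult flip: right_diff_distrib)
        also have "\<dots> \<le> M * \<bar>f (X n + e *\<^sub>R z) - f (x + e *\<^sub>R z)\<bar>" by (intro mult_right_mono M) auto
        finally show "ennreal \<bar>K z * f (X n + e *\<^sub>R z) - K z * f (x + e *\<^sub>R z)\<bar> \<le> ennreal M * ennreal \<bar>f ((X n - x) + (x + e *\<^sub>R z)) - f (x + e *\<^sub>R z)\<bar>"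
          using M0 by (simp add: ennreal_leI algebra_simps flip: ennreal_mult)
      qed
      also have "\<dots> = ennreal M * (\<integral>\<^sup>+z. ennreal \<bar>f ((X n - x) + (x + e *\<^sub>R z)) - f (x + e *\<^sub>R z)\<bar> \<partial>lborel)"
        by (rule nn_integral_cmult) measurable
      also have "(\<integral>\<^sup>+z. ennreal \<bar>f ((X n - x) + (x + e *\<^sub>R z)) - f (x + e *\<^sub>R z)\<bar> \<partial>lborel) = ennreal (1 / e ^ DIM('a)) * ?t n"
      proof -
        have "?t n = ennreal (\<bar>e\<bar> ^ DIM('a)) * (\<integral>\<^sup>+z. ennreal \<bar>f ((X n - x) + (x + e *\<^sub>R z)) - f (x + e *\<^sub>R z)\<bar> \<partial>lborel)"
          by (rule nn_integral_lborel_affine) (use e in auto)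
        then have "ennreal (1 / e ^ DIM('a)) * ?t n = ennreal (1 / e ^ DIM('a) * e ^ DIM('a)) * (\<integral>\<^sup>+z. ennreal \<bar>f ((X n - x) + (x + e *\<^sub>R z)) - f (x + e *\<^sub>R z)\<bar> \<partial>lborel)"
          using e by (subst ennreal_mult) (auto simp: mult.assoc)
        then show ?thesis using e by simp
      qed
      finally show ?thesis using M0 e by (subst ennreal_mult) (auto simp: mult.assoc)
    qed
    have "(\<lambda>n. ennreal (M * (1 / e ^ DIM('a))) * ?t n) \<longlonglongrightarrow> ennreal (M * (1 / e ^ DIM('a))) * 0"
      by (intro ennreal_tendsto_cmult t0) auto
    then have s: "(\<lambda>n. ennreal (M * (1 / e ^ DIM('a))) * ?t n) \<longlonglongrightarrow> 0" by simp
    have "(\<lambda>n. ennreal \<bar>mollify K e f (X n) - mollify K e f x\<bar>) \<longlonglongrightarrow> 0"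
      by (rule tendsto_sandwich[OF _ _ tendsto_const s]) (use b in \<open>simp_all only: always_eventually zero_le simp_thms\<close>)
    then have "(\<lambda>n. enn2real (ennreal \<bar>mollify K e f (X n) - mollify K e f x\<bar>)) \<longlonglongrightarrow> enn2real 0"
      by (intro tendsto_enn2real) auto
    then have "(\<lambda>n. \<bar>mollify K e f (X n) - mollify K e f x\<bar>) \<longlonglongrightarrow> 0" by simp
    then show "(mollify K e f \<circ> X) \<longlonglongrightarrow> mollify K e f x"
      by (simp add: tendsto_rabs_zero_iff LIM_zero_iff o_def)
  qed
  then show ?thesis by (simp add: continuous_at_imp_continuous_on)
qed

lemma mean_cong: "(\<And>x. x \<in> B \<Longrightarrow> f x = g x) \<Longrightarrow> mean B f = mean B g"
  unfolding mean_def by (intro arg_cong2[where f="(/)"] Bochner_Integration.integral_cong refl) (auto simp: indicator_def)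

text \<open>The oscillation decays with an exponent above \<open>d / 2\<close>, so the means over dyadic balls
  converge locally uniformly, at a geometric rate.\<close>

lemma continuous_representative:
  fixes V :: "'d::finite list \<Rightarrow> real ^ 'd \<Rightarrow> real"
  assumes m: "m > real CARD('d) / 2" and U: "open U" "bounded U" and N: "0 \<le> N" and V: "sobolev_family U m N V"
  shows "\<exists>w. continuous_on U w \<and> (AE x in lborel. x \<in> U \<longrightarrow> w x = V [] x) \<and>
    (\<forall>x\<in>U. (\<lambda>j. mean (ball x (1 / 2 ^ j)) (\<lambda>y. indicator U y * V [] y)) \<longlonglongrightarrow> w x)"
proof -
  have Ub: "U \<in> sets borel" using U by auto
  have sqV: "sq_int U (V [])" by (rule sobolev_family_sq[OF V]) simp
  define f0 where "f0 = (\<lambda>y. indicator U y * V [] y)"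
  have f0: "integrable lborel f0" unfolding f0_def by (rule cut_integrable[OF sqV Ub U(2)])
  have f0m: "f0 \<in> borel_measurable borel" using f0 by simp
  define F where "F j x = mean (ball x (1 / 2 ^ j)) f0" for j :: nat and x
  have Fm: "F j = mollify ball_kernel (1 / 2 ^ j) f0" for j
    unfolding F_def by (rule ext) (simp add: mollify_ball_kernel[OF f0m])
  have Fc: "continuous_on A (F j)" for A j
    unfolding Fm by (rule mollify_continuous[OF ball_kernel_kernel f0]) simp
  define w where "w x = lim (\<lambda>j. F j x)" for x
  have loc: "\<exists>r>0. continuous_on (ball x0 r) w \<and> (\<forall>x\<in>ball x0 r. (\<lambda>j. F j x) \<longlonglongrightarrow> w x)" if x0: "x0 \<in> U" for x0
  proof -
    obtain e where e: "e > 0" "ball x0 e \<subseteq> U" using x0 U(1) openE by blast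
    \<comment> \<open>The balls of radius \<open>?R\<close> around all points of
      \<open>ball x0 ?R\<close> must lie in \<open>ball x0 e\<close>, hence the half.\<close>
    obtain J :: nat where J: "1 / 2 ^ J < e / 2"
      using real_arch_pow_inv[of "e / 2" "1 / 2"] e by (auto simp: power_one_over)
    let ?R = "1 / 2 ^ J :: real"
    have R: "?R > 0" by simp
    obtain C q where Cq: "0 \<le> C" "0 < q" "q < 1" "\<And>(c :: real ^ 'd) V N j. 0 \<le> N \<Longrightarrow> sobolev_family (ball c ?R) m N V \<Longrightarrow>
       \<bar>mean (ball c (?R / 2 ^ Suc j)) (V []) - mean (ball c (?R / 2 ^ j)) (V [])\<bar> \<le> C * sqrt N * q ^ j"
      using mean_increments[OF m R] by blast
    let ?B = "ball x0 ?R"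
    have sub: "ball x ?R \<subseteq> U" if "x \<in> ?B" for x
    proof -
      have "ball x ?R \<subseteq> ball x0 e"
      proof
        fix y assume "y \<in> ball x ?R"
        then have "dist x0 y < ?R + ?R" using that dist_triangle[of x0 y x] by simp
        then show "y \<in> ball x0 e" using J by simp
      qed
      then show ?thesis using e(2) by blast
    qed
    have inc: "norm (F (Suc (j + J)) x - F (j + J) x) \<le> C * sqrt N * q ^ j" if x: "x \<in> ?B" for x j
    proof -
      have VB: "sobolev_family (ball x ?R) m N V" by (rule sobolev_family_mono[OF V sub[OF x]])
      have eq: "F (k + J) x = mean (ball x (?R / 2 ^ k)) (V [])" for k
      proof -
        have le: "?R / 2 ^ k \<le> ?R" by (simp add: divide_le_eq)
        have "ball x (?R / 2 ^ k) \<subseteq> U" using subset_ball[OF le, of x] sub[OF x] by blast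
        then have "mean (ball x (?R / 2 ^ k)) f0 = mean (ball x (?R / 2 ^ k)) (V [])"
          by (intro mean_cong) (auto simp: f0_def indicator_def)
        moreover have "1 / 2 ^ (k + J) = ?R / 2 ^ k" by (simp add: power_add)
        ultimately show ?thesis by (simp add: F_def)
      qed
      show ?thesis
        using Cq(4)[OF N VB, of j] eq[of j] eq[of "Suc j"] by simp
    qed
    \<comment> \<open>The M-test applies to the increments of the means; their partial sums
      telescope.\<close>
    have "uniform_limit ?B (\<lambda>n x. \<Sum>i<n. F (Suc (i + J)) x - F (i + J) x) (\<lambda>x. suminf (\<lambda>i. F (Suc (i + J)) x - F (i + J) x)) sequentially"
      by (rule Weierstrass_m_test[OF inc]) (use Cq in \<open>auto intro!: summable_mult summable_geometric\<close>)
    moreover have tel: "(\<Sum>i<n. F (Suc (i + J)) x - F (i + J) x) = F (n + J) x - F J x" for n x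
      using sum_lessThan_telescope[of "\<lambda>i. F (i + J) x" n] by simp
    ultimately have ul: "uniform_limit ?B (\<lambda>n x. F (n + J) x - F J x) (\<lambda>x. suminf (\<lambda>i. F (Suc (i + J)) x - F (i + J) x)) sequentially"
      (is "uniform_limit _ _ ?S _") by simp
    have Sc: "continuous_on ?B ?S"
      by (rule uniform_limit_theorem[OF _ ul]) (auto intro!: always_eventually continuous_intros Fc)
    have lim: "(\<lambda>j. F j x) \<longlonglongrightarrow> ?S x + F J x" if "x \<in> ?B" for x
    proof -
      have "(\<lambda>n. F (n + J) x - F J x) \<longlonglongrightarrow> ?S x" using tendsto_uniform_limitI[OF ul that] .
      then have "(\<lambda>n. (F (n + J) x - F J x) + F J x) \<longlonglongrightarrow> ?S x + F J x" by (intro tendsto_intros)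
      then have "(\<lambda>n. F (n + J) x) \<longlonglongrightarrow> ?S x + F J x" by simp
      then show ?thesis by (rule LIMSEQ_offset)
    qed
    have weq: "w x = ?S x + F J x" if "x \<in> ?B" for x
      unfolding w_def using lim[OF that] by (rule limI)
    have "continuous_on ?B (\<lambda>x. ?S x + F J x)" by (intro continuous_on_add Sc Fc)
    then have "continuous_on ?B w" by (rule continuous_on_eq) (simp add: weq)
    then show ?thesis using lim weq by (intro exI[of _ ?R]) auto
  qed
  have "continuous_on U w"
  proof (rule continuous_at_imp_continuous_on, rule ballI)
    fix x assume "x \<in> U"
    then obtain r where "r > 0" "continuous_on (ball x r) w" using loc by blast
    then show "isCont w x" by (simp add: continuous_on_eq_continuous_at)
  qed
  moreover have lim: "\<forall>x\<in>U. (\<lambda>j. F j x) \<longlonglongrightarrow> w x" using loc by (meson centre_in_ball)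
  moreover have "AE x in lborel. x \<in> U \<longrightarrow> w x = V [] x"
  proof -
    have e0: "(\<lambda>n. 1 / 2 ^ n :: real) \<longlonglongrightarrow> 0"
      using LIMSEQ_realpow_zero[of "1 / 2 :: real"] by (simp add: power_one_over)
    \<comment> \<open>The means also converge to \<open>f0\<close> almost everywhere along a
      subsequence, and this identifies the limit w with \<open>V []\<close>.\<close>
    obtain r :: "nat \<Rightarrow> nat" where r: "strict_mono r" "AE x in lborel. (\<lambda>n. mollify ball_kernel (1 / 2 ^ r n) f0 x) \<longlonglongrightarrow> f0 x"
      using mollify_AE_subseq[OF ball_kernel_kernel f0 _ e0] by auto
    from r(2) show ?thesis
    proof eventually_elim
      case (elim x)
      show ?case
      proof
        assume x: "x \<in> U"
        have "(\<lambda>n. F (r n) x) \<longlonglongrightarrow> w x"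
          using LIMSEQ_subseq_LIMSEQ[OF bspec[OF lim x] r(1)] by (simp add: o_def)
        moreover have "(\<lambda>n. F (r n) x) \<longlonglongrightarrow> f0 x" using elim by (simp add: Fm)
        ultimately have "w x = f0 x" by (rule LIMSEQ_unique)
        then show "w x = V [] x" using x by (simp add: f0_def)
      qed
    qed
  qed
  ultimately show ?thesis unfolding F_def f0_def by (intro exI[of _ w] conjI)
qed

lemma continuous_AE_eq:
  fixes v w :: "'a::euclidean_space \<Rightarrow> real"
  assumes U: "open U" and v: "continuous_on U v" and w: "continuous_on U w"
    and eq: "AE x in lborel. x \<in> U \<longrightarrow> v x = w x" and x: "x \<in> U"
  shows "v x = w x"
proof -
  let ?D = "{x \<in> U. v x - w x \<noteq> 0}"
  have "open ?D"
  proof -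
    have "continuous_on U (\<lambda>x. v x - w x)" by (intro continuous_intros v w)
    then have "open (U \<inter> (\<lambda>x. v x - w x) -` (- {0}))"
      using U by (metis continuous_on_open_vimage inf_commute open_Compl closed_singleton)
    moreover have "U \<inter> (\<lambda>x. v x - w x) -` (- {0}) = ?D" by auto
    ultimately show ?thesis by simp
  qed
  moreover have "AE x in lborel. x \<notin> ?D" using eq by eventually_elim auto
  ultimately have "?D = {}" by (rule AE_notin_open_imp_empty)
  then show ?thesis using x by auto
qed

text \<open>The value at the centre is the limit of the means over dyadic balls; the first mean and
  the geometric series of increments are both bounded by multiples of \<open>sqrt N\<close>.\<close>

lemma sobolev_pointwise:
  assumes m: "m > real CARD('d) / 2"
  shows "\<exists>C\<ge>0. \<forall>(c :: real ^ 'd) V N w. 0 \<le> N \<longrightarrow> sobolev_family (ball c 1) m N V \<longrightarrow> continuous_on (ball c 1) w \<longrightarrow>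
    (AE x in lborel. x \<in> ball c 1 \<longrightarrow> w x = V [] x) \<longrightarrow> \<bar>w c\<bar> \<le> C * sqrt N"
proof -
  obtain C q where Cq: "0 \<le> C" "0 < q" "q < 1" "\<And>(c :: real ^ 'd) V N. 0 \<le> N \<Longrightarrow> sobolev_family (ball c 1) m N V \<Longrightarrow>
     \<bar>mean (ball c 1) (V [])\<bar> \<le> C * sqrt N \<and>
     (\<forall>j. \<bar>mean (ball c (1 / 2 ^ Suc j)) (V []) - mean (ball c (1 / 2 ^ j)) (V [])\<bar> \<le> C * sqrt N * q ^ j)"
    using mean_increments[OF m zero_less_one] by metis
  show ?thesis
  proof (intro exI[of _ "C * (1 + 1 / (1 - q))"] conjI allI impI)
    show "0 \<le> C * (1 + 1 / (1 - q))" using Cq by simp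
    fix c :: "real ^ 'd" and V N w
    assume N: "0 \<le> N" and V: "sobolev_family (ball c 1) m N V" and wc: "continuous_on (ball c 1) w"
      and w: "AE x in lborel. x \<in> ball c 1 \<longrightarrow> w x = V [] x"
    obtain w' where w': "continuous_on (ball c 1) w'" "AE x in lborel. x \<in> ball c 1 \<longrightarrow> w' x = V [] x"
      "\<forall>x\<in>ball c 1. (\<lambda>j. mean (ball x (1 / 2 ^ j)) (\<lambda>y. indicator (ball c 1) y * V [] y)) \<longlonglongrightarrow> w' x"
      using continuous_representative[OF m open_ball bounded_ball N V] by blast
    have "AE x in lborel. x \<in> ball c 1 \<longrightarrow> w x = w' x" using w w'(2) by eventually_elim auto
    then have eq: "w c = w' c" by (rule continuous_AE_eq[OF open_ball wc w'(1)]) simp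
    let ?F = "\<lambda>j. mean (ball c (1 / 2 ^ j)) (V [])"
    have "mean (ball c (1 / 2 ^ j)) (\<lambda>y. indicator (ball c 1) y * V [] y) = ?F j" for j :: nat
    proof (rule mean_cong)
      fix y assume y: "y \<in> ball c (1 / 2 ^ j)"
      have "1 / 2 ^ j \<le> (1::real)" by simp
      then have "y \<in> ball c 1" using y subset_ball by blast
      then show "indicator (ball c 1) y * V [] y = V [] y" by simp
    qed
    moreover have "(\<lambda>j. mean (ball c (1 / 2 ^ j)) (\<lambda>y. indicator (ball c 1) y * V [] y)) \<longlonglongrightarrow> w' c"
      using w'(3) by (rule bspec) simp
    ultimately have lim: "?F \<longlonglongrightarrow> w c" unfolding eq by presburger
    have b: "\<bar>?F j\<bar> \<le> C * sqrt N * (1 + (\<Sum>i<j. q ^ i))" for j :: nat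
    proof (induction j)
      case 0 then show ?case using Cq(4)[OF N V] by simp
    next
      case (Suc j)
      have "\<bar>?F (Suc j)\<bar> \<le> \<bar>?F j\<bar> + \<bar>?F (Suc j) - ?F j\<bar>" by simp
      also have "\<dots> \<le> C * sqrt N * (1 + (\<Sum>i<j. q ^ i)) + C * sqrt N * q ^ j"
        by (intro add_mono Suc) (use Cq(4)[OF N V] in blast)
      finally show ?case by (simp add: algebra_simps)
    qed
    have "\<bar>?F j\<bar> \<le> C * (1 + 1 / (1 - q)) * sqrt N" for j
    proof -
      have "(\<Sum>i<j. q ^ i) \<le> 1 / (1 - q)"
        using Cq(2,3) by (simp add: sum_gp_strict divide_right_mono)
      then have "C * sqrt N * (1 + (\<Sum>i<j. q ^ i)) \<le> C * sqrt N * (1 + 1 / (1 - q))"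
        using Cq N by (intro mult_left_mono) auto
      with b[of j] show ?thesis by (simp add: mult_ac)
    qed
    moreover have "(\<lambda>j. \<bar>?F j\<bar>) \<longlonglongrightarrow> \<bar>w c\<bar>" by (intro tendsto_intros lim)
    ultimately show "\<bar>w c\<bar> \<le> C * (1 + 1 / (1 - q)) * sqrt N"
      by (intro LIMSEQ_le_const2) auto
  qed
qed

text \<open>With vanishing means the Poincare inequalities bound the functions themselves, and a
  descent from the top order reaches all lower ones. The bound N0 only guarantees square
  integrability and does not enter the result. The use of \<open>\<lceil>m\<rceil>\<close> includes
  the means at order \<open>\<lfloor>m\<rfloor>\<close> if m is not an integer, as the Slobodeckij
  form of the inequality requires.\<close>

lemma bramble_hilbert:
  assumes m: "0 \<le> m" and R: "R > 0"
  shows "\<exists>C\<ge>0. \<forall>(c :: real ^ 'd) W N0 N. 0 \<le> N \<longrightarrow> sobolev_family (ball c R) m N0 W \<longrightarrow>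
     (\<forall>is. length is < nat \<lceil>m\<rceil> \<longrightarrow> mean (ball c R) (W is) = 0) \<longrightarrow>
     (m \<in> \<int> \<longrightarrow> (\<forall>is. length is = nat \<lfloor>m\<rfloor> \<longrightarrow> sq_norm (ball c R) (W is) \<le> ennreal N)) \<longrightarrow>
     (m \<notin> \<int> \<longrightarrow> (\<forall>is. length is = nat \<lfloor>m\<rfloor> \<longrightarrow> Slob (ball c R) (frac m) (W is) \<le> ennreal N)) \<longrightarrow>
     sobolev_family (ball c R) m (C * N) W"
proof -
  let ?n = "nat \<lfloor>m\<rfloor>"
  \<comment> \<open>Bundles the hypotheses, so that the constant found at each order l is uniform in
    W, c and N.\<close>
  define P where "P W (c :: real ^ 'd) N \<longleftrightarrow> 0 \<le> N \<and> (\<exists>N0. sobolev_family (ball c R) m N0 W) \<and>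
     (\<forall>is. length is < nat \<lceil>m\<rceil> \<longrightarrow> mean (ball c R) (W is) = 0) \<and>
     (m \<in> \<int> \<longrightarrow> (\<forall>is. length is = ?n \<longrightarrow> sq_norm (ball c R) (W is) \<le> ennreal N)) \<and>
     (m \<notin> \<int> \<longrightarrow> (\<forall>is. length is = ?n \<longrightarrow> Slob (ball c R) (frac m) (W is) \<le> ennreal N))" for W c N
  have lev: "\<exists>C\<ge>0. \<forall>c W N is. P W c N \<longrightarrow> length is = l \<longrightarrow> sq_norm (ball c R) (W is) \<le> ennreal (C * N)" if "l \<le> ?n" for l
    using that
  proof (induction "?n - l" arbitrary: l)
    case 0
    then have l: "l = ?n" by simp
    show ?case
    proof (cases "m \<in> \<int>")
      case True then show ?thesis by (intro exI[of _ 1]) (auto simp: P_def l)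
    next
      case False
      have ceil: "nat \<lceil>m\<rceil> = Suc ?n" using False m by (auto simp: ceiling_altdef nat_add_distrib)
          (metis Ints_of_int)
      define A where "A = 2 powr (real CARD('d) + 2 * frac m) / measure lborel (ball (0::real^'d) 1) * R powr (2 * frac m)"
      have A: "A \<ge> 0" by (simp add: A_def)
      have "sq_norm (ball c R) (W is) \<le> ennreal (A * N)" if PP: "P W c N" and li: "length is = l" for c W N "is"
      proof -
        obtain N0 where N0: "sobolev_family (ball c R) m N0 W" using PP by (auto simp: P_def)
        have z: "mean (ball c R) (W is) = 0" using PP li l ceil by (simp add: P_def)
        have "sq_norm (ball c R) (\<lambda>x. W is x - mean (ball c R) (W is)) \<le> ennreal A * Slob (ball c R) (frac m) (W is)"
          unfolding A_def by (rule slobodeckij_poincare_ball[OF R]) (use sobolev_family_sq[OF N0] li l in auto)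
        also have "\<dots> \<le> ennreal A * ennreal N" using PP li l False by (intro mult_left_mono) (auto simp: P_def)
        also have "\<dots> = ennreal (A * N)" using A PP by (intro ennreal_mult[symmetric]) (auto simp: P_def)
        finally show ?thesis by (simp add: z)
      qed
      then show ?thesis using A by blast
    qed
  next
    case (Suc k)
    have "\<exists>C\<ge>0. \<forall>c W N is. P W c N \<longrightarrow> length is = Suc l \<longrightarrow> sq_norm (ball c R) (W is) \<le> ennreal (C * N)"
      by (rule Suc.hyps(1)) (use Suc in auto)
    then obtain C where C: "C \<ge> 0" "\<And>c W N is. P W c N \<Longrightarrow> length is = Suc l \<Longrightarrow> sq_norm (ball c R) (W is) \<le> ennreal (C * N)"
      by blast
    let ?K = "2 ^ (CARD('d) + 2) * R\<^sup>2 * (real CARD('d) * C)"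
    have ln: "l < ?n" using Suc by simp
    have lc: "l < nat \<lceil>m\<rceil>" using ln m by linarith
    have "sq_norm (ball c R) (W is) \<le> ennreal (?K * N)" if PP: "P W c N" and li: "length is = l" for c W N "is"
    proof -
      obtain N0 where N0: "sobolev_family (ball c R) m N0 W" and N: "0 \<le> N" using PP by (auto simp: P_def)
      have z: "mean (ball c R) (W is) = 0" using PP li lc by (simp add: P_def)
      have "sq_norm (ball c R) (\<lambda>x. W is x - mean (ball c R) (W is)) \<le> ennreal (2 ^ (CARD('d) + 2) * R\<^sup>2) * (\<Sum>i\<in>UNIV. sq_norm (ball c R) (W (is @ [i])))"
        by (rule poincare_ball[OF R]) (use li ln sobolev_family_sq[OF N0] sobolev_family_wder[OF N0] in auto)
      also have "\<dots> \<le> ennreal (2 ^ (CARD('d) + 2) * R\<^sup>2) * (\<Sum>i::'d\<in>UNIV. ennreal (C * N))"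
        by (intro mult_left_mono sum_mono C(2)[OF PP]) (auto simp: li)
      also have "\<dots> = ennreal (2 ^ (CARD('d) + 2) * R\<^sup>2 * (real CARD('d) * (C * N)))"
        using C N by (simp add: ennreal_mult ennreal_of_nat_eq_real_of_nat)
      finally show ?thesis by (simp add: z mult_ac)
    qed
    moreover have "?K \<ge> 0" using C by simp
    ultimately show ?case by blast
  qed
  then have "\<forall>l. \<exists>C. l \<le> ?n \<longrightarrow> C \<ge> 0 \<and> (\<forall>c W N is. P W c N \<longrightarrow> length is = l \<longrightarrow> sq_norm (ball c R) (W is) \<le> ennreal (C * N))"
    by blast
  then obtain C where C: "\<And>l. l \<le> ?n \<Longrightarrow> C l \<ge> 0"
    "\<And>l c W N is. l \<le> ?n \<Longrightarrow> P W c N \<Longrightarrow> length is = l \<Longrightarrow> sq_norm (ball c R) (W is) \<le> ennreal (C l * N)"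
    by metis
  \<comment> \<open>The summand 1 covers the Slobodeckij seminorm, which is bounded by N
    itself.\<close>
  define D where "D = 1 + (\<Sum>l\<le>?n. C l)"
  have D: "D \<ge> 1" unfolding D_def using sum_nonneg[of "{..?n}" C] C(1) by simp
  have CD: "C l \<le> D" if "l \<le> ?n" for l
    unfolding D_def using member_le_sum[of l "{..?n}" C] C(1) that by simp
  show ?thesis
  proof (intro exI[of _ D] conjI allI impI)
    show "0 \<le> D" using D by simp
    fix c :: "real ^ 'd" and W N0 N
    assume N: "0 \<le> N" and W: "sobolev_family (ball c R) m N0 W"
      and z: "\<forall>is. length is < nat \<lceil>m\<rceil> \<longrightarrow> mean (ball c R) (W is) = 0"
      and t1: "m \<in> \<int> \<longrightarrow> (\<forall>is. length is = ?n \<longrightarrow> sq_norm (ball c R) (W is) \<le> ennreal N)"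
      and t2: "m \<notin> \<int> \<longrightarrow> (\<forall>is. length is = ?n \<longrightarrow> Slob (ball c R) (frac m) (W is) \<le> ennreal N)"
    have PP: "P W c N" unfolding P_def using N W z t1 t2 by blast
    have ND: "N \<le> D * N" using D N mult_right_mono[of 1 D N] by simp
    show "sobolev_family (ball c R) m (D * N) W"
      unfolding sobolev_family_def
    proof (intro conjI allI impI)
      fix "is" :: "'d list"
      assume l: "length is \<le> ?n"
      show "W is \<in> borel_measurable borel" by (rule sobolev_family_measurable[OF W l])
      show "sq_norm (ball c R) (W is) \<le> ennreal (D * N)"
        using C(2)[OF l PP refl] CD[OF l] N by (meson ennreal_leI mult_right_mono order_trans)
    next
      fix "is" :: "'d list" and i
      assume "length is < ?n" then show "weak_partial (ball c R) i (W is) (W (is @ [i]))" by (rule sobolev_family_wder[OF W])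
    next
      fix "is" :: "'d list"
      assume "m \<notin> \<int>" "length is = ?n"
      then show "Slob (ball c R) (frac m) (W is) \<le> ennreal (D * N)"
        using t2 ND by (meson ennreal_leI order_trans)
    qed
  qed
qed

section \<open>Embeddings between Sobolev orders\<close>

text \<open>Dyadic balls take the place of polar coordinates: at scale r the integrand is comparable
  to \<open>r powr (a - d)\<close> and the volume to r^d, which leaves the terms
  \<open>r powr a\<close> of a geometric series.\<close>

lemma norm_powr_integral_finite:
  fixes a \<delta> :: real
  assumes a: "a > 0" and d: "\<delta> > 0"
  shows "(\<integral>\<^sup>+z. indicator (ball (0 :: real ^ 'd) \<delta>) z * ennreal (norm z powr (a - real CARD('d))) \<partial>lborel) < \<infinity>"
proof -
  let ?D = "real CARD('d)" let ?\<omega> = "measure lborel (ball (0::real^'d) 1)"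
  \<comment> \<open>Within a dyadic shell the norm varies by a factor of at most 2, so its power
    varies by a factor of at most c, whatever the sign of the exponent.\<close>
  define c where "c = 2 powr \<bar>a - ?D\<bar>"
  have c: "c \<ge> 1" by (simp add: c_def ge_one_powr_ge_zero)
  let ?t = "\<lambda>j (z :: real ^ 'd). ennreal (c * (\<delta> / 2 ^ j) powr (a - ?D)) * indicator (ball 0 (2 * (\<delta> / 2 ^ j))) z"
  have "(\<integral>\<^sup>+z. indicator (ball (0 :: real ^ 'd) \<delta>) z * ennreal (norm z powr (a - ?D)) \<partial>lborel) \<le> (\<integral>\<^sup>+z. (\<Sum>j::nat. ?t j z) \<partial>lborel)"
  proof (rule nn_integral_mono)
    fix z :: "real ^ 'd"
    show "indicator (ball (0 :: real ^ 'd) \<delta>) z * ennreal (norm z powr (a - ?D)) \<le> (\<Sum>j::nat. ?t j z)"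
    proof (cases "z \<in> ball 0 \<delta> \<and> z \<noteq> 0")
      case True
      then have z: "0 < norm z" "norm z \<le> \<delta>" by auto
      from dyadic_scale[OF this] obtain j :: nat where j: "\<delta> / 2 ^ Suc j < norm z" "norm z \<le> \<delta> / 2 ^ j" by blast
      have "norm z powr (a - ?D) \<le> c * (\<delta> / 2 ^ j) powr (a - ?D)"
      proof (cases "a - ?D \<ge> 0")
        case True
        have "norm z powr (a - ?D) \<le> 1 * (\<delta> / 2 ^ j) powr (a - ?D)" using j z True by (simp add: powr_mono2)
        also have "\<dots> \<le> c * (\<delta> / 2 ^ j) powr (a - ?D)" by (intro mult_right_mono c) auto
        finally show ?thesis .
      next
        case False
        have "norm z powr (a - ?D) \<le> (\<delta> / 2 ^ j / 2) powr (a - ?D)"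
          using j(1) d False by (intro powr_mono2') auto
        also have "\<dots> = (\<delta> / 2 ^ j) powr (a - ?D) / 2 powr (a - ?D)" by (rule powr_divide)
        also have "\<dots> = c * (\<delta> / 2 ^ j) powr (a - ?D)"
          using False powr_minus[of 2 "a - ?D"] by (simp add: c_def divide_inverse mult.commute)
        finally show ?thesis .
      qed
      moreover have "z \<in> ball 0 (2 * (\<delta> / 2 ^ j))" using j(2) d by (simp add: le_less_trans field_simps)
      ultimately have "indicator (ball (0 :: real ^ 'd) \<delta>) z * ennreal (norm z powr (a - ?D)) \<le> ?t j z"
        using True by (simp add: ennreal_leI)
      also have "\<dots> \<le> (\<Sum>j. ?t j z)"
      proof -
        have "(\<Sum>i\<in>{j}. ?t i z) \<le> (\<Sum>j. ?t j z)" by (rule sum_le_suminf) auto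
        then show ?thesis by (simp only: sum.insert sum.empty finite.emptyI empty_iff not_False_eq_True add_0_right)
      qed
      finally show ?thesis .
    next
      case False
      \<comment> \<open>At the origin the convention that \<open>0 powr _\<close> is 0 makes the
        integrand vanish even for negative exponents.\<close>
      then have "indicator (ball (0 :: real ^ 'd) \<delta>) z * ennreal (norm z powr (a - ?D)) = 0" by (auto simp: indicator_def)
      then show ?thesis by (simp only: zero_le)
    qed
  qed
  also have "\<dots> = (\<Sum>j. \<integral>\<^sup>+z. ?t j z \<partial>lborel)" by (rule nn_integral_suminf) measurable
  also have "\<dots> = (\<Sum>j. ennreal ((c * \<delta> powr a * 2 ^ CARD('d) * ?\<omega>) * (2 powr (- a)) ^ j))"
  proof (intro suminf_cong)
    fix j :: nat
    let ?r = "\<delta> / 2 ^ j"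
    have r: "?r > 0" using d by simp
    have "(\<integral>\<^sup>+z. ?t j z \<partial>lborel) = ennreal (c * ?r powr (a - ?D)) * emeasure lborel (ball (0::real^'d) (2 * ?r))"
      by (rule nn_integral_cmult_indicator) simp
    also have "\<dots> = ennreal (c * ?r powr (a - ?D) * ((2 * ?r) ^ CARD('d) * ?\<omega>))"
      unfolding emeasure_ball_eq using r measure_ball[of "2 * ?r" "0 :: real ^ 'd"] c
      by (subst ennreal_mult[symmetric]) auto
    also have "c * ?r powr (a - ?D) * ((2 * ?r) ^ CARD('d) * ?\<omega>) = (c * \<delta> powr a * 2 ^ CARD('d) * ?\<omega>) * (2 powr (- a)) ^ j"
    proof -
      have e: "(2 powr (- a)) ^ j = 1 / (2 ^ j) powr a"
      proof -
        have "(2 powr (- a)) ^ j = (2 powr (- a)) powr real j" by (simp add: powr_realpow)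
        also have "\<dots> = (2 powr real j) powr (- a)" by (simp add: powr_powr mult.commute)
        finally show ?thesis by (simp add: powr_realpow powr_minus divide_inverse)
      qed
      have "?r powr (a - ?D) * ?r ^ CARD('d) = ?r powr (a - ?D) * ?r powr ?D" by (subst powr_realpow[OF r]) simp
      also have "\<dots> = ?r powr a" by (simp flip: powr_add)
      also have "\<dots> = \<delta> powr a * (2 powr (- a)) ^ j" unfolding e by (simp add: powr_divide)
      finally have "?r powr (a - ?D) * ?r ^ CARD('d) = \<delta> powr a * (2 powr (- a)) ^ j" .
      then have "c * (?r powr (a - ?D) * ?r ^ CARD('d)) * 2 ^ CARD('d) * ?\<omega> = c * (\<delta> powr a * (2 powr (- a)) ^ j) * 2 ^ CARD('d) * ?\<omega>" by (rule arg_cong)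
      then show ?thesis unfolding power_mult_distrib by (simp only: mult_ac)
    qed
    finally show "(\<integral>\<^sup>+z. ?t j z \<partial>lborel) = ennreal ((c * \<delta> powr a * 2 ^ CARD('d) * ?\<omega>) * (2 powr (- a)) ^ j)" .
  qed
  also have "\<dots> < \<infinity>"
  proof -
    have "(2::real) powr (- a) < 1" using a by (simp add: powr_less_one)
    then have "summable (\<lambda>j. (c * \<delta> powr a * 2 ^ CARD('d) * ?\<omega>) * (2 powr (- a)) ^ j)"
      by (intro summable_mult summable_geometric) simp
    then show ?thesis
      using c by (subst suminf_ennreal2) auto
  qed
  finally show ?thesis .
qed

text \<open>Nearby points \<open>x\<close>, \<open>y\<close> can be joined inside \<open>U\<close> by moving both by the same vector of length comparable
  to their distance; in a Lipschitz domain this vector points inwards.\<close>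

definition chain_domain :: "(real ^ 'd) set \<Rightarrow> bool" where
  "chain_domain U \<longleftrightarrow> (\<exists>\<delta>>0. \<exists>B. finite B \<and> (\<forall>x\<in>U. \<forall>y\<in>U. dist x y < \<delta> \<longrightarrow>
     (\<exists>b\<in>B. closed_segment x (x + norm (y - x) *\<^sub>R b) \<subseteq> U \<and>
       closed_segment (x + norm (y - x) *\<^sub>R b) (y + norm (y - x) *\<^sub>R b) \<subseteq> U \<and>
       closed_segment y (y + norm (y - x) *\<^sub>R b) \<subseteq> U)))"

text \<open>No lifting is required: with b = 0 the chain reduces to the segment from x to y.\<close>

lemma convex_chain_domain:
  assumes "convex U" shows "chain_domain U"
  unfolding chain_domain_def
proof (intro exI[of _ "1::real"] conjI exI[of _ "{0}"] ballI impI)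
  fix x y assume "x \<in> U" "y \<in> U"
  with closed_segment_subset[OF this assms] show "\<exists>b\<in>{0}. closed_segment x (x + norm (y - x) *\<^sub>R b) \<subseteq> U \<and>
       closed_segment (x + norm (y - x) *\<^sub>R b) (y + norm (y - x) *\<^sub>R b) \<subseteq> U \<and>
       closed_segment y (y + norm (y - x) *\<^sub>R b) \<subseteq> U" by simp
qed auto

section \<open>Slobodeckij seminorms and gradients on chain domains\<close>

lemma open_segment_set:
  fixes U :: "'a::euclidean_space set"
  assumes U: "open U" shows "open {x. closed_segment x (x + \<zeta>) \<subseteq> U}"
  unfolding open_contains_ball
proof (rule ballI)
  fix x assume "x \<in> {x. closed_segment x (x + \<zeta>) \<subseteq> U}"
  then have x: "closed_segment x (x + \<zeta>) \<subseteq> U" by simp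
  have seg: "closed_segment x (x + \<zeta>) = (\<lambda>t. x + t *\<^sub>R \<zeta>) ` {0..1}" for x
    by (auto simp: closed_segment_def algebra_simps image_def)
  obtain d where d: "d > 0" "(\<Union>y\<in>closed_segment x (x + \<zeta>). ball y d) \<subseteq> U"
    using compact_subset_open_imp_ball_epsilon_subset[of "closed_segment x (x + \<zeta>)" U] x U by auto
  have "ball x d \<subseteq> {x. closed_segment x (x + \<zeta>) \<subseteq> U}"
  proof safe
    fix x' y assume x': "x' \<in> ball x d" and "y \<in> closed_segment x' (x' + \<zeta>)"
    then obtain t where t: "t \<in> {0..1}" "y = x' + t *\<^sub>R \<zeta>" unfolding seg by auto
    have "y \<in> ball (x + t *\<^sub>R \<zeta>) d" using x' t(2) by (simp add: dist_norm)
    then show "y \<in> U" using d(2) t(1) unfolding seg by blast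
  qed
  then show "\<exists>e>0. ball x e \<subseteq> {x. closed_segment x (x + \<zeta>) \<subseteq> U}"
    using d(1) by blast
qed

lemma square_sum3_le: "(a + b + c)\<^sup>2 \<le> 3 * (a\<^sup>2 + b\<^sup>2 + c\<^sup>2)" for a b c :: real
proof -
  have "0 \<le> (a - b)\<^sup>2 + (b - c)\<^sup>2 + (a - c)\<^sup>2" by simp
  then show ?thesis by (simp add: power2_eq_square algebra_simps)
qed

text \<open>The segment from x to x + z may leave U, but each of the three legs of the chain is
  covered by \<open>translation_estimate\<close>: two of length \<bar>z\<bar> \<bar>b\<bar> and one
  of length \<bar>z\<bar>. The vector b depends on x; summing over the finite set B avoids a
  measurable choice of it.\<close>

lemma chain_translation_estimate:
  fixes f :: "real ^ 'd \<Rightarrow> real" and g :: "'d \<Rightarrow> real ^ 'd \<Rightarrow> real"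
  assumes U: "open U" "bounded U" and f: "sq_int U f" and g: "\<And>i. sq_int U (g i)" "\<And>i. weak_partial U i f (g i)"
    and B: "finite B" and ch: "\<And>x. x \<in> U \<Longrightarrow> x + z \<in> U \<Longrightarrow>
     (\<exists>b\<in>B. closed_segment x (x + norm z *\<^sub>R b) \<subseteq> U \<and>
       closed_segment (x + norm z *\<^sub>R b) ((x + z) + norm z *\<^sub>R b) \<subseteq> U \<and>
       closed_segment (x + z) ((x + z) + norm z *\<^sub>R b) \<subseteq> U)"
  shows "(\<integral>\<^sup>+x. indicator U x * (indicator U (x + z) * ennreal ((f x - f (x + z))\<^sup>2)) \<partial>lborel)
    \<le> ennreal ((norm z)\<^sup>2 * (\<Sum>b\<in>B. 3 * (2 * (norm b)\<^sup>2 + 1))) * (\<Sum>i\<in>UNIV. sq_norm U (g i))"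
proof -
  have [measurable]: "U \<in> sets borel" using U by auto
  have [measurable]: "f \<in> borel_measurable borel" using f by (simp add: sq_int_def)
  let ?G = "\<Sum>i\<in>UNIV. sq_norm U (g i)"
  define S where "S \<zeta> = {x. closed_segment x (x + \<zeta>) \<subseteq> U}" for \<zeta>
  have S[measurable]: "S \<zeta> \<in> sets borel" for \<zeta>
    unfolding S_def by (intro borel_open open_segment_set U)
  define \<Delta> where "\<Delta> x \<zeta> = indicator (S \<zeta>) x * ennreal ((f (x + \<zeta>) - f x)\<^sup>2)" for x \<zeta>
  have dm[measurable]: "(\<lambda>x. \<Delta> x \<zeta>) \<in> borel_measurable borel" for \<zeta>
    unfolding \<Delta>_def by measurable
  have T: "(\<integral>\<^sup>+x. \<Delta> x \<zeta> \<partial>lborel) \<le> ennreal ((norm \<zeta>)\<^sup>2) * ?G" for \<zeta>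
    unfolding \<Delta>_def S_def by (rule translation_estimate[OF U f g])
  have T': "(\<integral>\<^sup>+x. \<Delta> (x + a) \<zeta> \<partial>lborel) \<le> ennreal ((norm \<zeta>)\<^sup>2) * ?G" for a \<zeta>
  proof -
    have "(\<integral>\<^sup>+x. \<Delta> (x + a) \<zeta> \<partial>lborel) = (\<integral>\<^sup>+x. \<Delta> x \<zeta> \<partial>lborel)"
      using nn_integral_lborel_shift[of "\<lambda>x. \<Delta> x \<zeta>" a] by (simp add: add.commute)
    then show ?thesis using T by simp
  qed
  let ?Z = "\<lambda>b. norm z *\<^sub>R b"
  have "(\<integral>\<^sup>+x. indicator U x * (indicator U (x + z) * ennreal ((f x - f (x + z))\<^sup>2)) \<partial>lborel) \<le>
     (\<integral>\<^sup>+x. (\<Sum>b\<in>B. 3 * (\<Delta> x (?Z b) + \<Delta> (x + ?Z b) z + \<Delta> (x + z) (?Z b))) \<partial>lborel)"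
  proof (rule nn_integral_mono)
    fix x
    show "indicator U x * (indicator U (x + z) * ennreal ((f x - f (x + z))\<^sup>2)) \<le>
       (\<Sum>b\<in>B. 3 * (\<Delta> x (?Z b) + \<Delta> (x + ?Z b) z + \<Delta> (x + z) (?Z b)))"
    proof (cases "x \<in> U \<and> x + z \<in> U")
      case True
      then obtain b where b: "b \<in> B" "closed_segment x (x + ?Z b) \<subseteq> U"
       "closed_segment (x + ?Z b) ((x + z) + ?Z b) \<subseteq> U" "closed_segment (x + z) ((x + z) + ?Z b) \<subseteq> U"
        using ch by blast
      have "(x + ?Z b) + z = (x + z) + ?Z b" by simp
      then have mem: "x \<in> S (?Z b)" "x + ?Z b \<in> S z" "x + z \<in> S (?Z b)"
        using b unfolding S_def mem_Collect_eq by metis+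
      let ?a = "f (x + ?Z b) - f x" and ?b = "f ((x + ?Z b) + z) - f (x + ?Z b)" and ?c = "f ((x + z) + ?Z b) - f (x + z)"
      have "f x - f (x + z) = - (?a + ?b + (- ?c))" by (simp add: algebra_simps)
      then have "(f x - f (x + z))\<^sup>2 = (?a + ?b + (- ?c))\<^sup>2" by (metis power2_minus)
      also have "\<dots> \<le> 3 * (?a\<^sup>2 + ?b\<^sup>2 + ?c\<^sup>2)" using square_sum3_le[of ?a ?b "- ?c"] by (simp only: power2_minus)
      finally have "ennreal ((f x - f (x + z))\<^sup>2) \<le> ennreal (3 * (?a\<^sup>2 + ?b\<^sup>2 + ?c\<^sup>2))" by (rule ennreal_leI)
      also have "\<dots> = 3 * (\<Delta> x (?Z b) + \<Delta> (x + ?Z b) z + \<Delta> (x + z) (?Z b))"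
        unfolding \<Delta>_def using mem by (simp add: ennreal_mult ennreal_plus)
      also have "\<dots> \<le> (\<Sum>b\<in>B. 3 * (\<Delta> x (?Z b) + \<Delta> (x + ?Z b) z + \<Delta> (x + z) (?Z b)))"
        by (rule member_le_sum[OF b(1) _ B]) simp
      finally show ?thesis using True by simp
    qed (auto simp: indicator_def)
  qed
  also have "\<dots> = (\<Sum>b\<in>B. 3 * ((\<integral>\<^sup>+x. \<Delta> x (?Z b) \<partial>lborel) + (\<integral>\<^sup>+x. \<Delta> (x + ?Z b) z \<partial>lborel) + (\<integral>\<^sup>+x. \<Delta> (x + z) (?Z b) \<partial>lborel)))"
    by (subst nn_integral_sum) (auto simp: nn_integral_cmult nn_integral_add)
  also have "\<dots> \<le> (\<Sum>b\<in>B. 3 * (ennreal ((norm (?Z b))\<^sup>2) * ?G + ennreal ((norm z)\<^sup>2) * ?G + ennreal ((norm (?Z b))\<^sup>2) * ?G))"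
    by (intro sum_mono mult_left_mono add_mono T T') auto
  also have "\<dots> = (\<Sum>b\<in>B. ennreal ((norm z)\<^sup>2 * (3 * (2 * (norm b)\<^sup>2 + 1))) * ?G)"
  proof (rule sum.cong[OF refl])
    fix b
    have "3 * (ennreal ((norm (?Z b))\<^sup>2) * ?G + ennreal ((norm z)\<^sup>2) * ?G + ennreal ((norm (?Z b))\<^sup>2) * ?G)
       = (ennreal 3 * (ennreal ((norm (?Z b))\<^sup>2) + ennreal ((norm z)\<^sup>2) + ennreal ((norm (?Z b))\<^sup>2))) * ?G"
      by (simp add: distrib_right distrib_left mult.assoc)
    also have "ennreal 3 * (ennreal ((norm (?Z b))\<^sup>2) + ennreal ((norm z)\<^sup>2) + ennreal ((norm (?Z b))\<^sup>2)) =
      ennreal (3 * ((norm (?Z b))\<^sup>2 + (norm z)\<^sup>2 + (norm (?Z b))\<^sup>2))"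
    proof -
      have "ennreal (3 * (u + v + u)) = ennreal 3 * (ennreal u + ennreal v + ennreal u)" if "0 \<le> u" "0 \<le> v" for u v
      proof -
        have "ennreal (3 * (u + v + u)) = ennreal 3 * ennreal (u + v + u)" by (rule ennreal_mult) (use that in auto)
        also have "ennreal (u + v + u) = ennreal (u + v) + ennreal u" by (rule ennreal_plus) (use that in auto)
        also have "ennreal (u + v) = ennreal u + ennreal v" by (rule ennreal_plus) (use that in auto)
        finally show ?thesis .
      qed
      from this[symmetric] show ?thesis by (simp only: zero_le_power2)
    qed
    also have "3 * ((norm (?Z b))\<^sup>2 + (norm z)\<^sup>2 + (norm (?Z b))\<^sup>2) = (norm z)\<^sup>2 * (3 * (2 * (norm b)\<^sup>2 + 1))"
      by (simp add: power_mult_distrib algebra_simps)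
    finally show "3 * (ennreal ((norm (?Z b))\<^sup>2) * ?G + ennreal ((norm z)\<^sup>2) * ?G + ennreal ((norm (?Z b))\<^sup>2) * ?G)
       = ennreal ((norm z)\<^sup>2 * (3 * (2 * (norm b)\<^sup>2 + 1))) * ?G" .
  qed
  also have "\<dots> = (\<Sum>b\<in>B. ennreal ((norm z)\<^sup>2 * (3 * (2 * (norm b)\<^sup>2 + 1)))) * ?G"
    by (rule sum_distrib_right[symmetric])
  also have "(\<Sum>b\<in>B. ennreal ((norm z)\<^sup>2 * (3 * (2 * (norm b)\<^sup>2 + 1)))) = ennreal (\<Sum>b\<in>B. (norm z)\<^sup>2 * (3 * (2 * (norm b)\<^sup>2 + 1)))"
    by (rule sum_ennreal) simp
  also have "(\<Sum>b\<in>B. (norm z)\<^sup>2 * (3 * (2 * (norm b)\<^sup>2 + 1))) = (norm z)\<^sup>2 * (\<Sum>b\<in>B. 3 * (2 * (norm b)\<^sup>2 + 1))"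
    by (rule sum_distrib_left[symmetric])
  finally show ?thesis .
qed

text \<open>Pairs at distance below \<delta> are treated by translations: the gradient contributes
  \<bar>z\<bar>^2, and the quotient by the kernel has the exponent 2 - 2 \<sigma> - d, which is
  integrable at 0 by \<sigma> < 1. For all other pairs the kernel is bounded, and the L2 norm on the
  bounded set U suffices.\<close>

lemma slobodeckij_le_gradient:
  fixes U :: "(real ^ 'd) set"
  assumes U: "open U" "bounded U" and ch: "chain_domain U" and s: "0 \<le> \<sigma>" "\<sigma> < 1"
  shows "\<exists>C\<ge>0. \<forall>f g N. 0 \<le> N \<longrightarrow> sq_int U f \<longrightarrow> (\<forall>i. sq_int U (g i) \<and> weak_partial U i f (g i)) \<longrightarrow>
    sq_norm U f \<le> ennreal N \<longrightarrow> (\<forall>i. sq_norm U (g i) \<le> ennreal N) \<longrightarrow> Slob U \<sigma> f \<le> ennreal (C * N)"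
proof -
  have Ub[measurable]: "U \<in> sets borel" using U by auto
  let ?a = "real CARD('d) + 2 * \<sigma>"
  have a: "?a > 0" using s by (simp add: add_pos_nonneg)
  obtain \<delta> B where \<delta>: "\<delta> > 0" and B: "finite B" and chB: "\<And>x y. x \<in> U \<Longrightarrow> y \<in> U \<Longrightarrow> dist x y < \<delta> \<Longrightarrow>
     (\<exists>b\<in>B. closed_segment x (x + norm (y - x) *\<^sub>R b) \<subseteq> U \<and>
       closed_segment (x + norm (y - x) *\<^sub>R b) (y + norm (y - x) *\<^sub>R b) \<subseteq> U \<and>
       closed_segment y (y + norm (y - x) *\<^sub>R b) \<subseteq> U)"
    using ch unfolding chain_domain_def by metis
  define K where "K = (\<Sum>b\<in>B. 3 * (2 * (norm b)\<^sup>2 + 1))"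
  have K: "K \<ge> 0" unfolding K_def by (intro sum_nonneg) auto
  define I where "I = (\<integral>\<^sup>+z. indicator (ball (0 :: real ^ 'd) \<delta>) z * ennreal (norm z powr ((2 - 2 * \<sigma>) - real CARD('d))) \<partial>lborel)"
  have I: "I < \<infinity>" unfolding I_def by (rule norm_powr_integral_finite[OF _ \<delta>]) (use s in simp)
  have uf: "emeasure lborel U < \<infinity>" using emeasure_bounded_finite[OF U(2)] by simp
  define C where "C = K * real CARD('d) * enn2real I + 4 * \<delta> powr (- ?a) * measure lborel U"
  have C: "C \<ge> 0" unfolding C_def using K by simp
  have "Slob U \<sigma> f \<le> ennreal (C * N)"
    if N: "0 \<le> N" and f: "sq_int U f" and g: "\<And>i. sq_int U (g i)" "\<And>i. weak_partial U i f (g i)"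
      and fN: "sq_norm U f \<le> ennreal N" and gN: "\<And>i. sq_norm U (g i) \<le> ennreal N" for f g N
  proof -
    have fm[measurable]: "f \<in> borel_measurable borel" using f by (simp add: sq_int_def)
    define near where "near x y = indicator (ball 0 \<delta>) (y - x) * (indicator U x * (indicator U y * ennreal ((f x - f y)\<^sup>2 / norm (x - y) powr ?a)))" for x y
    define far where "far x y = ennreal (2 * \<delta> powr (- ?a)) * (indicator U x * (indicator U y * (ennreal ((f x)\<^sup>2) + ennreal ((f y)\<^sup>2))))" for x y
    have nm[measurable]: "(\<lambda>(x, y). near x y) \<in> borel_measurable (borel \<Otimes>\<^sub>M borel)" unfolding near_def by measurable
    have fm2[measurable]: "(\<lambda>(x, y). far x y) \<in> borel_measurable (borel \<Otimes>\<^sub>M borel)" unfolding far_def by measurable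
    have "Slob U \<sigma> f = (\<integral>\<^sup>+x. \<integral>\<^sup>+y. indicator U x * (indicator U y * ennreal ((f x - f y)\<^sup>2 / norm (x - y) powr ?a)) \<partial>lborel \<partial>lborel)"
      unfolding Slob_def by (simp add: nn_integral_cmult)
    also have "\<dots> \<le> (\<integral>\<^sup>+x. \<integral>\<^sup>+y. near x y + far x y \<partial>lborel \<partial>lborel)"
    proof (intro nn_integral_mono)
      fix x y
      show "indicator U x * (indicator U y * ennreal ((f x - f y)\<^sup>2 / norm (x - y) powr ?a)) \<le> near x y + far x y"
      proof (cases "x \<in> U \<and> y \<in> U \<and> \<not> dist x y < \<delta>")
        case True
        have "\<delta> \<le> norm (x - y)" using True by (simp add: dist_norm)
        then have "norm (x - y) powr (- ?a) \<le> \<delta> powr (- ?a)" using \<delta> a by (intro powr_mono2') auto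
        moreover have "(f x - f y)\<^sup>2 \<le> 2 * ((f x)\<^sup>2 + (f y)\<^sup>2)"
          using sum_squares_bound[of "f x" "- f y"] by (simp add: power2_diff)
        ultimately have "(f x - f y)\<^sup>2 * norm (x - y) powr (- ?a) \<le> (2 * ((f x)\<^sup>2 + (f y)\<^sup>2)) * \<delta> powr (- ?a)"
          by (intro mult_mono) auto
        then have "(f x - f y)\<^sup>2 / norm (x - y) powr ?a \<le> 2 * \<delta> powr (- ?a) * ((f x)\<^sup>2 + (f y)\<^sup>2)"
          unfolding powr_minus_divide by (simp add: mult_ac)
        then have "ennreal ((f x - f y)\<^sup>2 / norm (x - y) powr ?a) \<le> ennreal (2 * \<delta> powr (- ?a)) * (ennreal ((f x)\<^sup>2) + ennreal ((f y)\<^sup>2))"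
          by (subst ennreal_plus[symmetric], simp, simp, subst ennreal_mult[symmetric]) (auto intro: ennreal_leI)
        then show ?thesis using True by (simp add: far_def add_increasing)
      next
        case False
        then show ?thesis by (auto simp: near_def indicator_def dist_norm norm_minus_commute add_increasing2)
      qed
    qed
    also have "\<dots> = (\<integral>\<^sup>+x. \<integral>\<^sup>+y. near x y \<partial>lborel \<partial>lborel) + (\<integral>\<^sup>+x. \<integral>\<^sup>+y. far x y \<partial>lborel \<partial>lborel)"
      by (simp add: nn_integral_add)
    also have "(\<integral>\<^sup>+x. \<integral>\<^sup>+y. near x y \<partial>lborel \<partial>lborel) \<le> ennreal (K * real CARD('d) * enn2real I * N)"
    proof -
      have "(\<integral>\<^sup>+x. \<integral>\<^sup>+y. near x y \<partial>lborel \<partial>lborel) = (\<integral>\<^sup>+z. \<integral>\<^sup>+x. near x (x + z) \<partial>lborel \<partial>lborel)"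
        by (rule nn_integral_pair_shift) measurable
      also have "\<dots> \<le> (\<integral>\<^sup>+z. ennreal (K * (real CARD('d) * N)) * (indicator (ball (0 :: real ^ 'd) \<delta>) z * ennreal (norm z powr ((2 - 2 * \<sigma>) - real CARD('d)))) \<partial>lborel)"
      proof (rule nn_integral_mono)
        fix z :: "real ^ 'd"
        show "(\<integral>\<^sup>+x. near x (x + z) \<partial>lborel) \<le> ennreal (K * (real CARD('d) * N)) * (indicator (ball 0 \<delta>) z * ennreal (norm z powr ((2 - 2 * \<sigma>) - real CARD('d))))"
        proof (cases "z \<in> ball 0 \<delta> \<and> z \<noteq> 0")
          case True
          have "(\<integral>\<^sup>+x. near x (x + z) \<partial>lborel) = (\<integral>\<^sup>+x. ennreal (1 / norm z powr ?a) * (indicator U x * (indicator U (x + z) * ennreal ((f x - f (x + z))\<^sup>2))) \<partial>lborel)"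
            using True unfolding near_def
            by (intro nn_integral_cong) (auto simp: indicator_def norm_minus_commute simp flip: ennreal_mult)
          also have "\<dots> = ennreal (1 / norm z powr ?a) * (\<integral>\<^sup>+x. indicator U x * (indicator U (x + z) * ennreal ((f x - f (x + z))\<^sup>2)) \<partial>lborel)"
            by (rule nn_integral_cmult) measurable
          also have "\<dots> \<le> ennreal (1 / norm z powr ?a) * (ennreal ((norm z)\<^sup>2 * K) * (\<Sum>i\<in>UNIV. sq_norm U (g i)))"
          proof (intro mult_left_mono)
            show "(\<integral>\<^sup>+x. indicator U x * (indicator U (x + z) * ennreal ((f x - f (x + z))\<^sup>2)) \<partial>lborel) \<le> ennreal ((norm z)\<^sup>2 * K) * (\<Sum>i\<in>UNIV. sq_norm U (g i))"
              unfolding K_def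
            proof (rule chain_translation_estimate[OF U f g B])
              fix x assume x: "x \<in> U" "x + z \<in> U"
              show "\<exists>b\<in>B. closed_segment x (x + norm z *\<^sub>R b) \<subseteq> U \<and>
                 closed_segment (x + norm z *\<^sub>R b) ((x + z) + norm z *\<^sub>R b) \<subseteq> U \<and>
                 closed_segment (x + z) ((x + z) + norm z *\<^sub>R b) \<subseteq> U"
                using chB[OF x] True by (simp add: dist_norm)
            qed
          qed simp
          also have "\<dots> \<le> ennreal (1 / norm z powr ?a) * (ennreal ((norm z)\<^sup>2 * K) * (\<Sum>i::'d\<in>UNIV. ennreal N))"
            by (intro mult_left_mono sum_mono gN) auto
          also have "(\<Sum>i::'d\<in>UNIV. ennreal N) = ennreal (real CARD('d) * N)"
            using N by (simp add: ennreal_mult ennreal_of_nat_eq_real_of_nat)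
          also have "ennreal (1 / norm z powr ?a) * (ennreal ((norm z)\<^sup>2 * K) * ennreal (real CARD('d) * N)) =
            ennreal (1 / norm z powr ?a * ((norm z)\<^sup>2 * K * (real CARD('d) * N)))"
          proof -
            have "ennreal u * (ennreal v * ennreal w) = ennreal (u * (v * w))" if "0 \<le> u" "0 \<le> v" "0 \<le> w" for u v w
              using that by (simp add: ennreal_mult)
            then show ?thesis using N K by (simp only: zero_le_mult_iff of_nat_0_le_iff zero_le_power2 powr_ge_zero zero_le_divide_1_iff simp_thms)
          qed
          also have "1 / norm z powr ?a * ((norm z)\<^sup>2 * K * (real CARD('d) * N)) = K * (real CARD('d) * N) * norm z powr ((2 - 2 * \<sigma>) - real CARD('d))"
          proof -
            have "norm z powr ((2 - 2 * \<sigma>) - real CARD('d)) = norm z powr (2 - ?a)" by (simp add: algebra_simps)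
            also have "\<dots> = (norm z)\<^sup>2 / norm z powr ?a" using True by (simp add: powr_diff powr_numeral)
            finally show ?thesis by simp
          qed
          also have "ennreal (K * (real CARD('d) * N) * norm z powr ((2 - 2 * \<sigma>) - real CARD('d))) =
             ennreal (K * (real CARD('d) * N)) * ennreal (norm z powr ((2 - 2 * \<sigma>) - real CARD('d)))"
            using K N by (intro ennreal_mult) auto
          finally show ?thesis using True by simp
        next
          case False
          have "near x (x + z) = 0" for x using False by (auto simp: near_def indicator_def)
          then show ?thesis by simp
        qed
      qed
      also have "\<dots> = ennreal (K * (real CARD('d) * N)) * I"
        unfolding I_def by (rule nn_integral_cmult) measurable
      also have "\<dots> = ennreal (K * (real CARD('d) * N)) * ennreal (enn2real I)" using I by simp
      also have "\<dots> = ennreal (K * (real CARD('d) * N) * enn2real I)" using K N by (intro ennreal_mult[symmetric]) auto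
      finally show ?thesis by (simp add: mult_ac)
    qed
    also have "(\<integral>\<^sup>+x. \<integral>\<^sup>+y. far x y \<partial>lborel \<partial>lborel) \<le> ennreal (4 * \<delta> powr (- ?a) * measure lborel U * N)"
    proof -
      let ?e = "\<lambda>x. indicator U x * ennreal ((f x)\<^sup>2)"
      have "(\<integral>\<^sup>+x. \<integral>\<^sup>+y. far x y \<partial>lborel \<partial>lborel) = (\<integral>\<^sup>+x. \<integral>\<^sup>+y. ennreal (2 * \<delta> powr (- ?a)) * (?e x * indicator U y + indicator U x * ?e y) \<partial>lborel \<partial>lborel)"
        unfolding far_def by (intro nn_integral_cong) (auto simp: indicator_def)
      also have "\<dots> = ennreal (2 * \<delta> powr (- ?a)) * (sq_norm U f * emeasure lborel U + emeasure lborel U * sq_norm U f)"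
        unfolding sq_norm_def by (simp add: nn_integral_cmult nn_integral_add nn_integral_multc)
      also have "\<dots> \<le> ennreal (2 * \<delta> powr (- ?a)) * (ennreal N * emeasure lborel U + emeasure lborel U * ennreal N)"
        by (intro mult_left_mono add_mono mult_right_mono fN) auto
      also have "emeasure lborel U = ennreal (measure lborel U)" using uf by (intro emeasure_eq_ennreal_measure) auto
      also have "ennreal (2 * \<delta> powr (- ?a)) * (ennreal N * ennreal (measure lborel U) + ennreal (measure lborel U) * ennreal N) =
         ennreal (2 * \<delta> powr (- ?a) * (N * measure lborel U + measure lborel U * N))"
        unfolding ennreal_lincomb[OF N measure_nonneg measure_nonneg N]
        by (rule ennreal_mult[symmetric]) (use N in auto)
      finally show ?thesis by (simp add: algebra_simps)
    qed
    finally have "Slob U \<sigma> f \<le> ennreal (K * real CARD('d) * enn2real I * N) + ennreal (4 * \<delta> powr (- ?a) * measure lborel U * N)"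
      by (simp add: add_mono)
    also have "\<dots> = ennreal (C * N)"
      using K N by (subst ennreal_plus[symmetric]) (auto simp: C_def algebra_simps)
    finally show ?thesis .
  qed
  then show ?thesis using C by (intro exI[of _ C]) auto
qed

text \<open>On a bounded set the surplus power \<bar>x - y\<bar>^(2 (\<sigma>' - \<sigma>)) is
  bounded by the same power of 2 D.\<close>

lemma slobodeckij_mono_order:
  fixes U :: "(real ^ 'd) set"
  assumes U: "U \<in> sets borel" "bounded U" and s: "0 \<le> \<sigma>" "\<sigma> \<le> \<sigma>'"
  shows "\<exists>C\<ge>0. \<forall>f. f \<in> borel_measurable borel \<longrightarrow> Slob U \<sigma> f \<le> ennreal C * Slob U \<sigma>' f"
proof -
  have [measurable]: "U \<in> sets borel" by fact
  obtain D where D: "\<And>x. x \<in> U \<Longrightarrow> norm x \<le> D" using U(2) by (auto simp: bounded_iff)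
  let ?C = "(2 * \<bar>D\<bar>) powr (2 * (\<sigma>' - \<sigma>))"
  let ?a = "real CARD('d) + 2 * \<sigma>" and ?a' = "real CARD('d) + 2 * \<sigma>'"
  have "Slob U \<sigma> f \<le> ennreal ?C * Slob U \<sigma>' f" if [measurable]: "f \<in> borel_measurable borel" for f
  proof -
    have "Slob U \<sigma> f \<le> (\<integral>\<^sup>+x. ennreal ?C * (indicator U x * (\<integral>\<^sup>+y. indicator U y *
        ennreal ((f x - f y)\<^sup>2 / norm (x - y) powr ?a') \<partial>lborel)) \<partial>lborel)"
      unfolding Slob_def
    proof (rule nn_integral_mono)
      fix x
      have "(\<integral>\<^sup>+y. indicator U y * ennreal ((f x - f y)\<^sup>2 / norm (x - y) powr ?a) \<partial>lborel) \<le>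
         (\<integral>\<^sup>+y. ennreal ?C * (indicator U y * ennreal ((f x - f y)\<^sup>2 / norm (x - y) powr ?a')) \<partial>lborel)" if x: "x \<in> U"
      proof (rule nn_integral_mono)
        fix y
        have "(f x - f y)\<^sup>2 / norm (x - y) powr ?a \<le> ?C * ((f x - f y)\<^sup>2 / norm (x - y) powr ?a')" if y: "y \<in> U"
        proof (cases "x = y")
          case False
          have "norm (x - y) \<le> 2 * \<bar>D\<bar>" using D[OF x] D[OF y] norm_triangle_ineq4[of x y] by linarith
          then have "norm (x - y) powr (2 * (\<sigma>' - \<sigma>)) \<le> ?C" using s by (intro powr_mono2) auto
          then have "(f x - f y)\<^sup>2 / norm (x - y) powr ?a' * norm (x - y) powr (2 * (\<sigma>' - \<sigma>)) \<le> (f x - f y)\<^sup>2 / norm (x - y) powr ?a' * ?C"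
            by (intro mult_left_mono) auto
          also have "(f x - f y)\<^sup>2 / norm (x - y) powr ?a' * norm (x - y) powr (2 * (\<sigma>' - \<sigma>)) = (f x - f y)\<^sup>2 / norm (x - y) powr ?a"
          proof -
            have "norm (x - y) powr ?a' = norm (x - y) powr ?a * norm (x - y) powr (2 * (\<sigma>' - \<sigma>))"
              by (simp flip: powr_add add: algebra_simps)
            then show ?thesis using False by simp
          qed
          finally show ?thesis by (simp only: mult.commute)
        qed simp
        then show "indicator U y * ennreal ((f x - f y)\<^sup>2 / norm (x - y) powr ?a) \<le> ennreal ?C * (indicator U y * ennreal ((f x - f y)\<^sup>2 / norm (x - y) powr ?a'))"
          by (auto simp: indicator_def intro!: ennreal_leI simp flip: ennreal_mult)
      qed
      also have "(\<integral>\<^sup>+y. ennreal ?C * (indicator U y * ennreal ((f x - f y)\<^sup>2 / norm (x - y) powr ?a')) \<partial>lborel) =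
         ennreal ?C * (\<integral>\<^sup>+y. (indicator U y * ennreal ((f x - f y)\<^sup>2 / norm (x - y) powr ?a')) \<partial>lborel)"
        by (rule nn_integral_cmult) measurable
      finally show "indicator U x * (\<integral>\<^sup>+y. indicator U y * ennreal ((f x - f y)\<^sup>2 / norm (x - y) powr ?a) \<partial>lborel) \<le>
         ennreal ?C * (indicator U x * (\<integral>\<^sup>+y. indicator U y * ennreal ((f x - f y)\<^sup>2 / norm (x - y) powr ?a') \<partial>lborel))"
        by (auto simp: indicator_def)
    qed
    also have "\<dots> = ennreal ?C * Slob U \<sigma>' f"
      unfolding Slob_def by (rule nn_integral_cmult) measurable
    finally show ?thesis .
  qed
  then show ?thesis by (intro exI[of _ ?C]) auto
qed

text \<open>Only the Slobodeckij seminorm of order \<open>frac \<mu>\<close> needs an argument. If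
  the integer parts of \<mu> and m agree, seminorms of different order are compared; otherwise the
  derivatives of order \<open>\<lfloor>\<mu>\<rfloor>\<close> have weak gradients in L2, and the
  geometry of U is used.\<close>

theorem sobolev_order_embedding:
  fixes U :: "(real ^ 'd) set"
  assumes U: "open U" "bounded U" and ch: "chain_domain U" and m: "0 \<le> \<mu>" "\<mu> \<le> m"
  shows "\<exists>C\<ge>0. \<forall>V N. 0 \<le> N \<longrightarrow> sobolev_family U m N V \<longrightarrow> sobolev_family U \<mu> (C * N) V"
proof -
  have Ub: "U \<in> sets borel" using U by auto
  have nle: "nat \<lfloor>\<mu>\<rfloor> \<le> nat \<lfloor>m\<rfloor>" using m by (intro nat_mono floor_mono)
  have "\<exists>C\<ge>0. \<forall>V N is. 0 \<le> N \<longrightarrow> sobolev_family U m N V \<longrightarrow> \<mu> \<notin> \<int> \<longrightarrow> length is = nat \<lfloor>\<mu>\<rfloor> \<longrightarrow> Slob U (frac \<mu>) (V is) \<le> ennreal (C * N)"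
  proof (cases "nat \<lfloor>\<mu>\<rfloor> = nat \<lfloor>m\<rfloor>")
    case True
    moreover have "0 \<le> \<lfloor>\<mu>\<rfloor>" "0 \<le> \<lfloor>m\<rfloor>" using m by auto
    ultimately have fl: "\<lfloor>\<mu>\<rfloor> = \<lfloor>m\<rfloor>" by linarith
    then have fr: "frac \<mu> \<le> frac m" using m by (simp add: frac_def)
    obtain C where C: "C \<ge> 0" "\<And>f. f \<in> borel_measurable borel \<Longrightarrow> Slob U (frac \<mu>) f \<le> ennreal C * Slob U (frac m) f"
      using slobodeckij_mono_order[OF Ub U(2) frac_ge_0 fr] by blast
    have "Slob U (frac \<mu>) (V is) \<le> ennreal (C * N)"
      if N: "0 \<le> N" and V: "sobolev_family U m N V" and nz: "\<mu> \<notin> \<int>" and l: "length is = nat \<lfloor>\<mu>\<rfloor>" for V N "is"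
    proof -
      have "m \<notin> \<int>"
      proof
        assume "m \<in> \<int>"
        then have "frac m = 0" by simp
        then have "frac \<mu> = 0" using fr frac_ge_0[of \<mu>] by linarith
        then show False using nz by (simp add: frac_eq_0_iff)
      qed
      have "Slob U (frac \<mu>) (V is) \<le> ennreal C * Slob U (frac m) (V is)"
        by (rule C(2)) (rule sobolev_family_measurable[OF V], use l True in simp)
      also have "\<dots> \<le> ennreal C * ennreal N"
        by (intro mult_left_mono sobolev_family_Slob[OF V \<open>m \<notin> \<int>\<close>]) (use l True in auto)
      finally show ?thesis using C N by (simp add: ennreal_mult)
    qed
    then show ?thesis using C(1) by blast
  next
    case False
    obtain C where C: "C \<ge> 0" "\<And>f g N. 0 \<le> N \<Longrightarrow> sq_int U f \<Longrightarrow> (\<forall>i. sq_int U (g i) \<and> weak_partial U i f (g i)) \<Longrightarrow>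
    sq_norm U f \<le> ennreal N \<Longrightarrow> (\<forall>i. sq_norm U (g i) \<le> ennreal N) \<Longrightarrow> Slob U (frac \<mu>) f \<le> ennreal (C * N)"
      using slobodeckij_le_gradient[OF U ch frac_ge_0 frac_lt_1] by metis
    have "Slob U (frac \<mu>) (V is) \<le> ennreal (C * N)"
      if N: "0 \<le> N" and V: "sobolev_family U m N V" and l: "length is = nat \<lfloor>\<mu>\<rfloor>" for V N "is"
    proof -
      have ln: "length is < nat \<lfloor>m\<rfloor>" using l False nle by linarith
      show ?thesis
        by (rule C(2)[OF N, of _ "\<lambda>i. V (is @ [i])"])
          (use ln sobolev_family_sq[OF V] sobolev_family_wder[OF V] sobolev_family_E2[OF V] in auto)
    qed
    then show ?thesis using C(1) by blast
  qed
  then obtain C where C: "C \<ge> 0" "\<And>V N is. 0 \<le> N \<Longrightarrow> sobolev_family U m N V \<Longrightarrow> \<mu> \<notin> \<int> \<Longrightarrow> length is = nat \<lfloor>\<mu>\<rfloor> \<Longrightarrow> Slob U (frac \<mu>) (V is) \<le> ennreal (C * N)"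
    by blast
  show ?thesis
  proof (intro exI[of _ "1 + C"] conjI allI impI)
    show "0 \<le> 1 + C" using C by simp
    fix V N assume N: "0 \<le> N" and V: "sobolev_family U m N V"
    have le: "N \<le> (1 + C) * N" "C * N \<le> (1 + C) * N" using C N by (auto simp: algebra_simps)
    show "sobolev_family U \<mu> ((1 + C) * N) V"
      unfolding sobolev_family_def
    proof (intro conjI allI impI)
      fix "is" :: "'d list" assume "length is \<le> nat \<lfloor>\<mu>\<rfloor>"
      then have l: "length is \<le> nat \<lfloor>m\<rfloor>" using nle by simp
      show "V is \<in> borel_measurable borel" by (rule sobolev_family_measurable[OF V l])
      show "sq_norm U (V is) \<le> ennreal ((1 + C) * N)" using sobolev_family_E2[OF V l] ennreal_leI[OF le(1)] by (rule order_trans)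
    next
      fix "is" :: "'d list" and i assume "length is < nat \<lfloor>\<mu>\<rfloor>"
      then show "weak_partial U i (V is) (V (is @ [i]))" using nle by (intro sobolev_family_wder[OF V]) simp
    next
      fix "is" :: "'d list" assume "\<mu> \<notin> \<int>" "length is = nat \<lfloor>\<mu>\<rfloor>"
      from C(2)[OF N V this] ennreal_leI[OF le(2)] show "Slob U (frac \<mu>) (V is) \<le> ennreal ((1 + C) * N)" by (rule order_trans)
    qed
  qed
qed

text \<open>Along a segment of length t the graph rises by at most L t while the height drops by at
  most t. Raising both endpoints by (L + 1) t in direction e compensates for both, and raising a
  point never leads below the graph.\<close>

lemma lipschitz_graph_segments:
  fixes g :: "real ^ 'd \<Rightarrow> real"
  assumes e: "norm e = 1" and g: "L-lipschitz_on {y. y \<bullet> e = 0} g"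
    and G: "\<Omega> \<inter> U = {x \<in> U. g (x - (x \<bullet> e) *\<^sub>R e) < x \<bullet> e}" and r: "r > 0" "ball p r \<subseteq> U"
  shows "\<exists>\<rho>>0. \<exists>b. \<forall>x\<in>\<Omega> \<inter> ball p \<rho>. \<forall>y\<in>\<Omega>. dist x y < \<rho> \<longrightarrow>
     closed_segment x (x + norm (y - x) *\<^sub>R b) \<subseteq> \<Omega> \<and>
     closed_segment (x + norm (y - x) *\<^sub>R b) (y + norm (y - x) *\<^sub>R b) \<subseteq> \<Omega> \<and>
     closed_segment y (y + norm (y - x) *\<^sub>R b) \<subseteq> \<Omega>"
proof -
  have L: "L \<ge> 0" using lipschitz_on_nonneg[OF g] .
  have ee: "e \<bullet> e = 1" using e by (simp add: norm_eq_1)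
  \<comment> \<open>The point y lies within 2 \<rho> of p and the lift has length at most \<rho> (L
    + 1), so \<rho> (L + 3) < r keeps all segments inside the ball where the graph describes
    \<Omega>.\<close>
  define \<rho> where "\<rho> = r / (L + 4)"
  have \<rho>: "\<rho> > 0" using r L by (simp add: \<rho>_def)
  have \<rho>r: "\<rho> * (L + 3) < r" using r L by (simp add: \<rho>_def field_simps)
  define b where "b = (L + 1) *\<^sub>R e"
  have nb: "norm b = L + 1" using e L by (simp add: b_def)
  define pr where "pr x = x - (x \<bullet> e) *\<^sub>R e" for x
  have pr0: "pr x \<bullet> e = 0" for x using ee by (simp add: pr_def inner_diff_left)
  have prlin: "pr (x + y) = pr x + pr y" "pr (c *\<^sub>R x) = c *\<^sub>R pr x" for x y c
    by (simp_all add: pr_def inner_add_left algebra_simps)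
  have prb: "pr b = 0" using ee by (simp add: pr_def b_def)
  have prn: "norm (pr v) \<le> norm v" for v
  proof (rule norm_le_square[THEN iffD2], intro conjI)
    have "pr v \<bullet> pr v = v \<bullet> v - (v \<bullet> e)\<^sup>2"
      using ee by (simp add: pr_def inner_diff_left inner_diff_right inner_commute power2_eq_square)
    also have "\<dots> \<le> (norm v)\<^sup>2" by (simp add: power2_norm_eq_inner)
    finally show "pr v \<bullet> pr v \<le> (norm v)\<^sup>2" .
  qed simp
  have inO: "w \<in> \<Omega>" if "w \<in> ball p r" "g (pr w) < w \<bullet> e" for w
    using that G r(2) by (auto simp: pr_def)
  have outO: "g (pr w) < w \<bullet> e" if "w \<in> ball p r" "w \<in> \<Omega>" for w
    using that G r(2) by (auto simp: pr_def)
  have up: "closed_segment w (w + t *\<^sub>R b) \<subseteq> \<Omega>" if t: "t \<ge> 0" and w: "w \<in> \<Omega>" "w \<in> ball p r" "w + t *\<^sub>R b \<in> ball p r" for w t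
  proof
    fix v assume v: "v \<in> closed_segment w (w + t *\<^sub>R b)"
    have vb: "v \<in> ball p r" using v w closed_segment_subset[OF w(2,3) convex_ball] by blast
    obtain u where u: "0 \<le> u" "u \<le> 1" "v = w + (u * t) *\<^sub>R b"
      using v by (auto simp: closed_segment_def algebra_simps)
    have "pr v = pr w" unfolding u(3) prlin prb by simp
    moreover have "v \<bullet> e = w \<bullet> e + u * t * (L + 1)" using ee by (simp add: u(3) b_def inner_add_left)
    moreover have "0 \<le> u * t * (L + 1)" using u t L by simp
    ultimately show "v \<in> \<Omega>" using outO[OF w(2,1)] by (intro inO[OF vb]) simp
  qed
  show ?thesis
  proof (intro exI[of _ \<rho>] conjI exI[of _ b] ballI impI \<rho>)
    fix x y assume x: "x \<in> \<Omega> \<inter> ball p \<rho>" and y: "y \<in> \<Omega>" and xy: "dist x y < \<rho>"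
    define t where "t = norm (y - x)"
    have t: "0 \<le> t" "t < \<rho>" using xy by (auto simp: t_def dist_norm norm_minus_commute)
    have ntb: "norm (t *\<^sub>R b) \<le> \<rho> * (L + 1)"
      using t L nb by (simp add: mult_right_mono)
    have px: "norm (x - p) < \<rho>" using x by (simp add: dist_norm norm_minus_commute)
    have py: "norm (y - p) < 2 * \<rho>"
      using norm_triangle_ineq[of "y - x" "x - p"] px t by (simp add: t_def)
    have bound: "\<rho> * (L + 1) + 2 * \<rho> < r" using \<rho>r by (simp add: algebra_simps)
    have L1: "0 \<le> \<rho> * (L + 1)" using \<rho> L by simp
    have inb: "x \<in> ball p r" "y \<in> ball p r" "x + t *\<^sub>R b \<in> ball p r" "y + t *\<^sub>R b \<in> ball p r"
    proof -
      have "norm (x + t *\<^sub>R b - p) \<le> norm (x - p) + norm (t *\<^sub>R b)" using norm_triangle_ineq[of "x - p" "t *\<^sub>R b"] by (simp add: algebra_simps)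
      moreover have "norm (y + t *\<^sub>R b - p) \<le> norm (y - p) + norm (t *\<^sub>R b)" using norm_triangle_ineq[of "y - p" "t *\<^sub>R b"] by (simp add: algebra_simps)
      ultimately show "x \<in> ball p r" "y \<in> ball p r" "x + t *\<^sub>R b \<in> ball p r" "y + t *\<^sub>R b \<in> ball p r"
        using px py ntb bound L1 \<rho> by (auto simp: dist_norm norm_minus_commute)
    qed
    have s1: "closed_segment x (x + t *\<^sub>R b) \<subseteq> \<Omega>" using x by (intro up t inb) auto
    have s3: "closed_segment y (y + t *\<^sub>R b) \<subseteq> \<Omega>" by (intro up t y inb)
    have s2: "closed_segment (x + t *\<^sub>R b) (y + t *\<^sub>R b) \<subseteq> \<Omega>"
    proof
      fix v assume v: "v \<in> closed_segment (x + t *\<^sub>R b) (y + t *\<^sub>R b)"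
      have vb: "v \<in> ball p r" using v closed_segment_subset[OF inb(3,4) convex_ball] by blast
      obtain u where u: "0 \<le> u" "u \<le> 1" "v = x + u *\<^sub>R (y - x) + t *\<^sub>R b"
        using v by (auto simp: closed_segment_def algebra_simps)
      have "pr v = pr x + u *\<^sub>R pr (y - x)" unfolding u(3) prlin prb by simp
      then have "norm (pr v - pr x) = u * norm (pr (y - x))" using u by simp
      also have "\<dots> \<le> 1 * norm (y - x)" by (intro mult_mono prn) (use u in auto)
      finally have "norm (pr v - pr x) \<le> t" by (simp add: t_def)
      then have "L * norm (pr v - pr x) \<le> L * t" using L by (intro mult_left_mono)
      moreover have "dist (g (pr v)) (g (pr x)) \<le> L * dist (pr v) (pr x)"
        by (rule lipschitz_onD[OF g]) (auto simp: pr0)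
      ultimately have g1: "g (pr v) \<le> g (pr x) + L * t" by (simp add: dist_norm)
      have "\<bar>u * ((y - x) \<bullet> e)\<bar> \<le> 1 * (norm (y - x) * norm e)"
        unfolding abs_mult by (intro mult_mono Cauchy_Schwarz_ineq2) (use u in auto)
      then have "- t \<le> u * ((y - x) \<bullet> e)" using e by (simp add: t_def)
      moreover have "v \<bullet> e = x \<bullet> e + u * ((y - x) \<bullet> e) + t * (L + 1)"
        using ee by (simp add: u(3) b_def inner_add_left)
      ultimately have "x \<bullet> e + L * t \<le> v \<bullet> e" by (simp add: algebra_simps)
      moreover have "g (pr x) < x \<bullet> e" using x by (intro outO inb) auto
      ultimately show "v \<in> \<Omega>" using g1 by (intro inO[OF vb]) simp
    qed
    show "closed_segment x (x + norm (y - x) *\<^sub>R b) \<subseteq> \<Omega>" using s1 by (simp add: t_def)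
    show "closed_segment (x + norm (y - x) *\<^sub>R b) (y + norm (y - x) *\<^sub>R b) \<subseteq> \<Omega>" using s2 by (simp add: t_def)
    show "closed_segment y (y + norm (y - x) *\<^sub>R b) \<subseteq> \<Omega>" using s3 by (simp add: t_def)
  qed
qed

text \<open>Interior points admit b = 0, boundary points the inward vector of their graph.
  Compactness of the closure leaves finitely many vectors and a smallest radius.\<close>

theorem lipschitz_chain_domain:
  fixes \<Omega> :: "(real ^ 'd) set"
  assumes b: "bounded \<Omega>" and lip: "lipschitz_domain \<Omega>"
  shows "chain_domain \<Omega>"
proof -
  have op: "open \<Omega>" using lip by (simp add: lipschitz_domain_def)
  define P where "P p \<rho> b \<longleftrightarrow> \<rho> > 0 \<and> (\<forall>x\<in>\<Omega> \<inter> ball p \<rho>. \<forall>y\<in>\<Omega>. dist x y < \<rho> \<longrightarrow>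
     closed_segment x (x + norm (y - x) *\<^sub>R b) \<subseteq> \<Omega> \<and>
     closed_segment (x + norm (y - x) *\<^sub>R b) (y + norm (y - x) *\<^sub>R b) \<subseteq> \<Omega> \<and>
     closed_segment y (y + norm (y - x) *\<^sub>R b) \<subseteq> \<Omega>)" for p \<rho> b
  have loc: "\<exists>\<rho> b. P p \<rho> b" if p: "p \<in> closure \<Omega>" for p
  proof (cases "p \<in> \<Omega>")
    case True
    then obtain r where r: "r > 0" "ball p r \<subseteq> \<Omega>" using op openE by blast
    have "P p (r / 2) 0"
      unfolding P_def
    proof (intro conjI ballI impI)
      fix x y assume x: "x \<in> \<Omega> \<inter> ball p (r / 2)" and y: "y \<in> \<Omega>" and xy: "dist x y < r / 2"
      have "x \<in> ball p r" "y \<in> ball p r" using x xy dist_triangle[of p y x] r by auto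
      then have "closed_segment x y \<subseteq> ball p r" by (intro closed_segment_subset) auto
      then show "closed_segment (x + norm (y - x) *\<^sub>R 0) (y + norm (y - x) *\<^sub>R 0) \<subseteq> \<Omega>" using r by auto
      show "closed_segment x (x + norm (y - x) *\<^sub>R 0) \<subseteq> \<Omega>" "closed_segment y (y + norm (y - x) *\<^sub>R 0) \<subseteq> \<Omega>"
        using x y by auto
    qed (use r in simp)
    then show ?thesis by blast
  next
    case False
    then have "p \<in> frontier \<Omega>" using p op by (simp add: frontier_def interior_open)
    then obtain U e L g where U: "open U" "p \<in> U" and e: "norm e = 1"
      and g: "L-lipschitz_on {y. y \<bullet> e = 0} (g :: real ^ 'd \<Rightarrow> real)"
      and G: "\<Omega> \<inter> U = {x \<in> U. g (x - (x \<bullet> e) *\<^sub>R e) < x \<bullet> e}"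
      using lip unfolding lipschitz_domain_def by blast
    obtain r where r: "r > 0" "ball p r \<subseteq> U" using U openE by blast
    show ?thesis using lipschitz_graph_segments[OF e g G r] unfolding P_def by blast
  qed
  then obtain \<rho> b where Pp: "\<And>p. p \<in> closure \<Omega> \<Longrightarrow> P p (\<rho> p) (b p)" by metis
  have "compact (closure \<Omega>)" using b by simp
  moreover have cover: "closure \<Omega> \<subseteq> (\<Union>p\<in>closure \<Omega>. ball p (\<rho> p))" using Pp by (auto simp: P_def)
  ultimately obtain S where S: "S \<subseteq> closure \<Omega>" "finite S" "closure \<Omega> \<subseteq> (\<Union>p\<in>S. ball p (\<rho> p))"
    using compactE_image[OF _ open_ball cover] by blast
  define \<delta> where "\<delta> = Min (insert 1 (\<rho> ` S))"
  have \<delta>: "\<delta> > 0" unfolding \<delta>_def using S Pp by (subst Min_gr_iff) (auto simp: P_def)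
  have \<delta>le: "\<delta> \<le> \<rho> p" if "p \<in> S" for p unfolding \<delta>_def using S that by (intro Min_le) auto
  show ?thesis unfolding chain_domain_def
  proof (intro exI[of _ \<delta>] conjI exI[of _ "b ` S"] ballI impI \<delta>)
    show "finite (b ` S)" using S by simp
    fix x y assume x: "x \<in> \<Omega>" and y: "y \<in> \<Omega>" and xy: "dist x y < \<delta>"
    have "x \<in> closure \<Omega>" using x closure_subset by blast
    then obtain p where p: "p \<in> S" "x \<in> ball p (\<rho> p)" using S(3) by blast
    have "dist x y < \<rho> p" using xy \<delta>le[OF p(1)] by simp
    with Pp[of p] p S(1) x y show "\<exists>b\<in>b ` S. closed_segment x (x + norm (y - x) *\<^sub>R b) \<subseteq> \<Omega> \<and>
       closed_segment (x + norm (y - x) *\<^sub>R b) (y + norm (y - x) *\<^sub>R b) \<subseteq> \<Omega> \<and>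
       closed_segment y (y + norm (y - x) *\<^sub>R b) \<subseteq> \<Omega>"
      unfolding P_def by blast
  qed
qed

section \<open>Polynomials matching the means of weak derivatives\<close>

lemma axis_shift_has_derivative:
  fixes f :: "real ^ 'd \<Rightarrow> real"
  assumes "\<And>x. f differentiable (at x)"
  shows "((\<lambda>t. f (x + t *\<^sub>R axis i 1)) has_real_derivative partial i f (x + s *\<^sub>R axis i 1)) (at s)"
proof -
  have 1: "((\<lambda>t. x + t *\<^sub>R axis i 1) has_derivative (\<lambda>t. t *\<^sub>R (axis i 1 :: real ^ 'd))) (at s)"
    by (auto intro!: derivative_eq_intros)
  have "((\<lambda>t. f (x + t *\<^sub>R axis i 1)) has_derivative
     (\<lambda>t. \<Sum>j\<in>UNIV. (t *\<^sub>R (axis i 1 :: real ^ 'd)) $ j * partial j f (x + s *\<^sub>R axis i 1))) (at s)"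
    by (rule has_derivative_compose[OF 1 has_derivative_partials[OF assms]])
  moreover have "(\<lambda>t. \<Sum>j\<in>UNIV. (t *\<^sub>R (axis i 1 :: real ^ 'd)) $ j * partial j f y) = (*) (partial i f y)" for y
    by (rule ext) (simp add: axis_def if_distrib[of "\<lambda>a. _ * a * _"] cong: if_cong)
  ultimately show ?thesis unfolding has_field_derivative_def by (simp only:)
qed

text \<open>The difference quotients have integral 0 by translation invariance.\<close>

lemma integral_partial_eq_0:
  fixes f :: "real ^ 'd \<Rightarrow> real"
  assumes d: "\<And>x. f differentiable (at x)" and c: "continuous_on UNIV (partial i f)"
    and z: "\<And>x. norm x > R \<Longrightarrow> f x = 0" and R: "R > 0"
  shows "(\<integral>x. partial i f x \<partial>lborel) = 0"
proof -
  have fc: "continuous_on A f" for A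
    by (meson continuous_at_imp_continuous_on differentiable_imp_continuous_within d)
  have [measurable]: "f \<in> borel_measurable borel" by (rule borel_measurable_continuous_onI) (rule fc)
  have [measurable]: "partial i f \<in> borel_measurable borel" by (rule borel_measurable_continuous_onI) (rule c)
  have fi: "integrable lborel f"
  proof -
    have "integrable lborel (\<lambda>x. indicator (cball 0 R) x *\<^sub>R f x)" by (rule borel_integrable_compact) (auto intro: fc)
    moreover have "(\<lambda>x. indicator (cball 0 R) x *\<^sub>R f x) = f"
      using z by (auto simp: indicator_def intro!: ext)
    ultimately show ?thesis by metis
  qed
  let ?a = "axis i 1 :: real ^ 'd"
  let ?t = "\<lambda>n. 1 / real (Suc n)"
  let ?q = "\<lambda>n x. (f (x + ?t n *\<^sub>R ?a) - f x) / ?t n"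
  have "compact (partial i f ` cball 0 (R + 2))"
    by (intro compact_continuous_image continuous_on_subset[OF c]) auto
  then have "bounded (partial i f ` cball 0 (R + 2))" by (rule compact_imp_bounded)
  then obtain M where "\<forall>y\<in>partial i f ` cball 0 (R + 2). norm y \<le> M" unfolding bounded_iff by blast
  then have M: "\<And>x. x \<in> cball 0 (R + 2) \<Longrightarrow> \<bar>partial i f x\<bar> \<le> M" by simp
  have M0: "M \<ge> 0" using M[of 0] R by simp
  have na: "norm ?a = 1" by simp
  \<comment> \<open>The mean value theorem bounds the quotient by the maximum of the partial
    derivative; steps of length at most 1 enlarge the support by at most 1.\<close>
  have qb: "\<bar>?q n x\<bar> \<le> M * indicator (cball 0 (R + 1)) x" for n x
  proof (cases "x \<in> cball 0 (R + 1)")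
    case True
    have t: "0 < ?t n" "?t n \<le> 1" by auto
    obtain s where s: "0 < s" "s < ?t n" "f (x + ?t n *\<^sub>R ?a) - f (x + 0 *\<^sub>R ?a) = (?t n - 0) * partial i f (x + s *\<^sub>R ?a)"
      using MVT2[OF t(1), of "\<lambda>t. f (x + t *\<^sub>R ?a)" "\<lambda>s. partial i f (x + s *\<^sub>R ?a)"]
        axis_shift_has_derivative[OF d] by blast
    have "?q n x = partial i f (x + s *\<^sub>R ?a)" using s(3) t by (simp add: field_simps)
    moreover have "norm (x + s *\<^sub>R ?a) \<le> R + 2"
    proof -
      have "norm (x + s *\<^sub>R ?a) \<le> norm x + s" using norm_triangle_ineq[of x "s *\<^sub>R ?a"] s(1) na by simp
      moreover have "norm x \<le> R + 1" using True by simp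
      ultimately show ?thesis using s(2) t(2) by linarith
    qed
    ultimately show ?thesis using M[of "x + s *\<^sub>R ?a"] True by simp
  next
    case False
    then have "norm x > R + 1" by simp
    moreover have "norm x \<le> norm (x + ?t n *\<^sub>R ?a) + norm (?t n *\<^sub>R ?a)"
      using norm_triangle_ineq4[of "x + ?t n *\<^sub>R ?a" "?t n *\<^sub>R ?a"] by simp
    moreover have "norm (?t n *\<^sub>R ?a) \<le> 1" using na by simp
    ultimately have "norm (x + ?t n *\<^sub>R ?a) > R" "norm x > R" by linarith+
    then show ?thesis using z False by simp
  qed
  have "(\<lambda>n. \<integral>x. ?q n x \<partial>lborel) \<longlonglongrightarrow> (\<integral>x. partial i f x \<partial>lborel)"
  proof (rule integral_dominated_convergence[where w = "\<lambda>x. M * indicator (cball 0 (R + 1)) x"])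
    have "emeasure lborel (cball (0 :: real ^ 'd) (R + 1)) < \<infinity>" using emeasure_lborel_cball_finite by auto
    then show "integrable lborel (\<lambda>x :: real ^ 'd. M * indicator (cball 0 (R + 1)) x)" by simp
    show "AE x in lborel. norm (?q n x) \<le> M * indicator (cball 0 (R + 1)) x" for n using qb by simp
    show "AE x in lborel. (\<lambda>n. ?q n x) \<longlonglongrightarrow> partial i f x"
    proof (rule AE_I2)
      fix x
      have "((\<lambda>t. f (x + t *\<^sub>R ?a)) has_real_derivative partial i f (x + 0 *\<^sub>R ?a)) (at 0)"
        by (rule axis_shift_has_derivative[OF d])
      then have "((\<lambda>t. (f (x + (0 + t) *\<^sub>R ?a) - f (x + 0 *\<^sub>R ?a)) / t) \<longlongrightarrow> partial i f (x + 0 *\<^sub>R ?a)) (at 0)"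
        by (simp only: DERIV_def)
      then have T: "((\<lambda>t. (f (x + t *\<^sub>R ?a) - f x) / t) \<longlongrightarrow> partial i f x) (at 0)" by simp
      have "filterlim ?t (at 0) sequentially"
        unfolding filterlim_at by (intro conjI lim_1_over_n[THEN LIMSEQ_Suc] always_eventually allI) auto
      from filterlim_compose[OF T this] show "(\<lambda>n. ?q n x) \<longlonglongrightarrow> partial i f x" .
    qed
  qed measurable
  moreover have "(\<integral>x. ?q n x \<partial>lborel) = 0" for n
  proof -
    have i2: "integrable lborel (\<lambda>x. f (x + ?t n *\<^sub>R ?a))"
      using integrable_lborel_affine[OF fi, of 1 "?t n *\<^sub>R ?a"] by (simp add: add.commute)
    have "(\<integral>x. f (x + ?t n *\<^sub>R ?a) \<partial>lborel) = (\<integral>x. f x \<partial>lborel)"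
      using integral_lborel_affine[of f 1 "?t n *\<^sub>R ?a"] by (simp add: add.commute)
    then have "(\<integral>x. f (x + ?t n *\<^sub>R ?a) - f x \<partial>lborel) = 0"
      using i2 fi by (simp del: of_nat_Suc)
    then show ?thesis unfolding integral_divide_zero by simp
  qed
  ultimately show ?thesis using LIMSEQ_unique[OF _ tendsto_const] by fastforce
qed

lemma elementary_measurable: "f \<in> elementary \<Longrightarrow> f \<in> borel_measurable borel"
  by (rule borel_measurable_continuous_onI) (rule elementary_continuous)

lemma elementary_bounded_on:
  assumes "f \<in> elementary" "bounded U" obtains M where "M \<ge> 0" "\<And>x. x \<in> U \<Longrightarrow> \<bar>f x\<bar> \<le> M"
proof -
  have "compact (f ` closure U)" using assms by (intro compact_continuous_image elementary_continuous) auto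
  then obtain B where B: "\<And>y. y \<in> f ` closure U \<Longrightarrow> norm y \<le> B" by (meson bounded_iff compact_imp_bounded)
  have "\<bar>f x\<bar> \<le> \<bar>B\<bar>" if "x \<in> U" for x
    using B[of "f x"] closure_subset[of U] that by (simp add: image_eqI subsetD order_trans[OF _ abs_ge_self])
  then show ?thesis by (intro that[of "\<bar>B\<bar>"]) auto
qed

lemma elementary_sq:
  assumes "f \<in> elementary" "bounded U" "U \<in> sets borel" shows "sq_int U f"
proof -
  obtain M where M: "M \<ge> 0" "\<And>x. x \<in> U \<Longrightarrow> \<bar>f x\<bar> \<le> M" using elementary_bounded_on[OF assms(1,2)] by blast
  have "sq_norm U f \<le> (\<integral>\<^sup>+x. ennreal (M\<^sup>2) * indicator U x \<partial>lborel)"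
    unfolding sq_norm_def using M(2) power_mono[OF M(2) abs_ge_zero, of _ 2]
    by (intro nn_integral_mono) (auto simp: indicator_def intro!: ennreal_leI)
  also have "\<dots> = ennreal (M\<^sup>2) * emeasure lborel U" using assms(3) by (simp add: nn_integral_cmult_indicator)
  also have "\<dots> < \<infinity>" using emeasure_bounded_finite[OF assms(2)] by (simp add: ennreal_mult_less_top)
  finally show ?thesis using elementary_measurable[OF assms(1)] by (simp add: sq_int_def)
qed

text \<open>The product of f with a test function has compact support, so its partial derivative
  integrates to 0; the product rule does the rest.\<close>

lemma elementary_wder:
  fixes f :: "real ^ 'd \<Rightarrow> real"
  assumes f: "f \<in> elementary" shows "weak_partial U i f (partial i f)"
  unfolding weak_partial_def
proof (intro allI impI)
  fix \<phi> assume \<phi>: "test_function U \<phi>"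
  let ?S = "closure {x. \<phi> x \<noteq> 0}"
  have "bounded ?S" using \<phi> by (simp add: test_function_def compact_imp_bounded)
  then obtain R where R: "R > 0" "\<And>x. x \<in> ?S \<Longrightarrow> norm x \<le> R" by (auto simp: bounded_pos)
  have \<phi>z: "\<phi> x = 0" if "norm x > R" for x
    using notin_closure_support[of x \<phi>] R(2)[of x] that by linarith
  have p\<phi>: "test_function U (partial i \<phi>)" by (rule test_function_partial[OF \<phi>])
  have \<phi>d: "\<phi> differentiable (at x)" for x by (rule test_function_differentiable[OF \<phi>])
  have eq: "partial i (\<lambda>x. f x * \<phi> x) = (\<lambda>x. partial i f x * \<phi> x + f x * partial i \<phi> x)"
    by (rule ext) (rule partial_mult[OF elementary_differentiable[OF f] \<phi>d])
  have "(\<integral>x. partial i (\<lambda>x. f x * \<phi> x) x \<partial>lborel) = 0"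
  proof (rule integral_partial_eq_0[OF _ _ _ R(1)])
    show "(\<lambda>x. f x * \<phi> x) differentiable (at x)" for x
      by (intro differentiable_mult elementary_differentiable[OF f] \<phi>d)
    show "continuous_on UNIV (partial i (\<lambda>x. f x * \<phi> x))"
      unfolding eq by (intro continuous_intros elementary_continuous elementary_partial f
          test_function_continuous[OF \<phi>] test_function_continuous[OF p\<phi>])
  qed (use \<phi>z in auto)
  moreover have "integrable lborel (\<lambda>x. g x * \<psi> x)" if g: "g \<in> elementary" and \<psi>: "test_function U \<psi>" for g \<psi>
  proof -
    have "bounded (closure {x. \<psi> x \<noteq> 0})" using \<psi> by (simp add: test_function_def compact_imp_bounded)
    then obtain R where R: "R > 0" "\<And>x. x \<in> closure {x. \<psi> x \<noteq> 0} \<Longrightarrow> norm x \<le> R" by (auto simp: bounded_pos)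
    have "integrable lborel (\<lambda>x. indicator (cball 0 R) x *\<^sub>R (g x * \<psi> x))"
      by (rule borel_integrable_compact)
        (simp, intro continuous_on_mult elementary_continuous[OF g] test_function_continuous[OF \<psi>])
    moreover have "(\<lambda>x. indicator (cball 0 R) x *\<^sub>R (g x * \<psi> x)) = (\<lambda>x. g x * \<psi> x)"
    proof
      fix x show "indicator (cball 0 R) x *\<^sub>R (g x * \<psi> x) = g x * \<psi> x"
      proof (cases "norm x \<le> R")
        case False
        then have "\<psi> x = 0" using R(2)[of x] notin_closure_support[of x \<psi>] by blast
        then show ?thesis by simp
      qed simp
    qed
    ultimately show ?thesis by metis
  qed
  ultimately have "(\<integral>x. partial i f x * \<phi> x \<partial>lborel) + (\<integral>x. f x * partial i \<phi> x \<partial>lborel) = 0"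
    unfolding eq using elementary_partial[OF f] f \<phi> p\<phi> by simp
  then show "(\<integral>x. f x * partial i \<phi> x \<partial>lborel) = - (\<integral>x. partial i f x * \<phi> x \<partial>lborel)" by simp
qed

section \<open>Differences and symmetry of families\<close>

lemma sq_int_diff:
  assumes "sq_int U f" "sq_int U g" "U \<in> sets borel" shows "sq_int U (\<lambda>x. f x - g x)"
proof -
  have "sq_norm U (\<lambda>x. f x + (- g x)) \<le> ennreal (1 + 1 / 1) * sq_norm U f + ennreal (1 + 1) * sq_norm U (\<lambda>x. - g x)"
    by (rule sq_norm_add_le) (use assms in \<open>auto simp: sq_int_def\<close>)
  also have "sq_norm U (\<lambda>x. - g x) = sq_norm U g" by (simp add: sq_norm_def)
  also have "ennreal (1 + 1 / 1) * sq_norm U f + ennreal (1 + 1) * sq_norm U g < \<infinity>" using assms by (auto simp: sq_int_def ennreal_mult_less_top)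
  finally have "sq_norm U (\<lambda>x. f x - g x) < \<infinity>" by simp
  moreover have "(\<lambda>x. f x - g x) \<in> borel_measurable borel"
    using sq_int_measurable[OF assms(1)] sq_int_measurable[OF assms(2)] by measurable
  ultimately show ?thesis by (simp add: sq_int_def)
qed

lemma weak_partial_diff:
  assumes "sq_int U f" "sq_int U g" "sq_int U f'" "sq_int U g'" and U: "U \<in> sets borel"
    and "weak_partial U i f f'" "weak_partial U i g g'"
  shows "weak_partial U i (\<lambda>x. f x - g x) (\<lambda>x. f' x - g' x)"
  unfolding weak_partial_def
proof (intro allI impI)
  fix \<phi> assume \<phi>: "test_function U \<phi>"
  note p\<phi> = test_function_partial[OF \<phi>, of i]
  have "(\<integral>x. (f x - g x) * partial i \<phi> x \<partial>lborel) = (\<integral>x. f x * partial i \<phi> x \<partial>lborel) - (\<integral>x. g x * partial i \<phi> x \<partial>lborel)"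
    unfolding left_diff_distrib by (intro Bochner_Integration.integral_diff sq_int_test_integrable[OF _ U p\<phi>] assms)
  moreover have "(\<integral>x. (f' x - g' x) * \<phi> x \<partial>lborel) = (\<integral>x. f' x * \<phi> x \<partial>lborel) - (\<integral>x. g' x * \<phi> x \<partial>lborel)"
    unfolding left_diff_distrib by (intro Bochner_Integration.integral_diff sq_int_test_integrable[OF _ U \<phi>] assms)
  ultimately show "(\<integral>x. (f x - g x) * partial i \<phi> x \<partial>lborel) = - (\<integral>x. (f' x - g' x) * \<phi> x \<partial>lborel)"
    using assms(6,7) \<phi> unfolding weak_partial_def by simp
qed

lemma finite_lists_length: "finite {is :: 'd::finite list. length is \<le> n}"
  using finite_lists_length_le[of "UNIV :: 'd set" n] by simp

lemma common_bound:
  assumes "\<And>is :: 'd::finite list. length is \<le> n \<Longrightarrow> F is < (\<infinity>::ennreal)"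
  shows "\<exists>N\<ge>0. \<forall>is. length is \<le> n \<longrightarrow> F is \<le> ennreal N"
proof (intro exI[of _ "\<Sum>is | length is \<le> n. enn2real (F is)"] conjI allI impI)
  show "0 \<le> (\<Sum>is | length is \<le> n. enn2real (F is))" by (simp add: sum_nonneg)
  fix "is" :: "'d list" assume l: "length is \<le> n"
  have "F is = ennreal (enn2real (F is))" using assms[OF l] by simp
  also have "\<dots> \<le> ennreal (\<Sum>is | length is \<le> n. enn2real (F is))"
    by (intro ennreal_leI member_le_sum) (auto simp: l finite_lists_length)
  finally show "F is \<le> ennreal (\<Sum>is | length is \<le> n. enn2real (F is))" .
qed

text \<open>An integer order, so that no Slobodeckij condition arises; other orders follow later by
  embedding.\<close>

lemma elementary_fam:
  fixes p :: "real ^ 'd \<Rightarrow> real"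
  assumes p: "p \<in> elementary" and U: "U \<in> sets borel" "bounded U"
  shows "\<exists>N\<ge>0. sobolev_family U (real n) N (\<lambda>is. partials is p)"
proof -
  have "sq_norm U (partials is p) < \<infinity>" for "is" :: "'d list"
    using elementary_sq[OF elementary_partials[OF p] U(2,1)] by (simp add: sq_int_def)
  then obtain N where N: "N \<ge> 0" "\<forall>is :: 'd list. length is \<le> n \<longrightarrow> sq_norm U (partials is p) \<le> ennreal N"
    using common_bound[of n "\<lambda>is. sq_norm U (partials is p)"] by blast
  have "weak_partial U i (partials is p) (partials (is @ [i]) p)" for i and "is" :: "'d list"
    using elementary_wder[OF elementary_partials[OF p], of U i "is"] by (simp add: partials_snoc elementary_partials_commute[OF p])
  then show ?thesis using N by (intro exI[of _ N]) (auto simp: sobolev_family_def elementary_measurable elementary_partials p)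
qed

text \<open>Constants drop out of the differences in the Slobodeckij seminorm. This is why the top
  derivatives of p have to be constant when m is not an integer.\<close>

lemma sobolev_family_minus_elem:
  fixes p :: "real ^ 'd \<Rightarrow> real"
  assumes V: "sobolev_family U m N V" and p: "p \<in> elementary" and U: "U \<in> sets borel" "bounded U" and N: "0 \<le> N"
    and const: "\<And>is. m \<notin> \<int> \<Longrightarrow> length is = nat \<lfloor>m\<rfloor> \<Longrightarrow> \<exists>k. partials is p = (\<lambda>x. k)"
  shows "\<exists>N'\<ge>0. sobolev_family U m N' (\<lambda>is x. V is x - partials is p x)"
proof -
  have pf: "partials is p \<in> elementary" for "is" by (rule elementary_partials[OF p])
  have psq: "sq_int U (partials is p)" for "is" by (rule elementary_sq[OF pf U(2,1)])
  have sqd: "sq_int U (\<lambda>x. V is x - partials is p x)" if "length is \<le> nat \<lfloor>m\<rfloor>" for "is"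
    by (rule sq_int_diff[OF sobolev_family_sq[OF V that] psq U(1)])
  obtain N' where N': "N' \<ge> 0" "\<forall>is. length is \<le> nat \<lfloor>m\<rfloor> \<longrightarrow> sq_norm U (\<lambda>x. V is x - partials is p x) \<le> ennreal N'"
    using common_bound[of "nat \<lfloor>m\<rfloor>" "\<lambda>is. sq_norm U (\<lambda>x. V is x - partials is p x)"] sqd unfolding sq_int_def by blast
  show ?thesis
  proof (intro exI[of _ "max N N'"] conjI)
    show "sobolev_family U m (max N N') (\<lambda>is x. V is x - partials is p x)"
      unfolding sobolev_family_def
    proof (intro conjI allI impI)
      fix "is" :: "'d list" assume l: "length is \<le> nat \<lfloor>m\<rfloor>"
      show "(\<lambda>x. V is x - partials is p x) \<in> borel_measurable borel" using sqd[OF l] by (simp add: sq_int_def)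
      have "ennreal N' \<le> ennreal (max N N')" by (rule ennreal_leI) simp
      then show "sq_norm U (\<lambda>x. V is x - partials is p x) \<le> ennreal (max N N')"
        using N'(2) l by (meson order_trans)
    next
      fix "is" :: "'d list" and i assume l: "length is < nat \<lfloor>m\<rfloor>"
      show "weak_partial U i (\<lambda>x. V is x - partials is p x) (\<lambda>x. V (is @ [i]) x - partials (is @ [i]) p x)"
      proof (rule weak_partial_diff)
        show "weak_partial U i (partials is p) (partials (is @ [i]) p)"
          using elementary_wder[OF pf, of U i "is"] by (simp add: partials_snoc elementary_partials_commute[OF p])
      qed (use l sobolev_family_sq[OF V] sobolev_family_wder[OF V] psq U in auto)
    next
      fix "is" :: "'d list" assume m: "m \<notin> \<int>" and l: "length is = nat \<lfloor>m\<rfloor>"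
      obtain k where k: "partials is p = (\<lambda>x. k)" using const[OF m l] by blast
      have "Slob U (frac m) (\<lambda>x. V is x - partials is p x) = Slob U (frac m) (V is)" by (simp add: Slob_def k)
      also have "\<dots> \<le> ennreal N" by (rule sobolev_family_Slob[OF V m l])
      also have "\<dots> \<le> ennreal (max N N')" by (rule ennreal_leI) simp
      finally show "Slob U (frac m) (\<lambda>x. V is x - partials is p x) \<le> ennreal (max N N')" .
    qed
  qed (use N in simp)
qed

text \<open>A family records single differentiation steps, whereas \<open>is_weak_deriv\<close>
  demands all of them at once. The induction runs from the end of the list, where families are
  extended and where \<open>partials\<close> applies the first derivative.\<close>

lemma sobolev_family_partials:
  assumes V: "sobolev_family U m N V"
  shows "length is \<le> nat \<lfloor>m\<rfloor> \<Longrightarrow> test_function U \<phi> \<Longrightarrow>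
    (\<integral>x. V [] x * partials is \<phi> x \<partial>lborel) = (- 1) ^ length is * (\<integral>x. V is x * \<phi> x \<partial>lborel)"
proof (induction "is" arbitrary: \<phi> rule: rev_induct)
  case Nil then show ?case by simp
next
  case (snoc i "is")
  have "(\<integral>x. V [] x * partials (is @ [i]) \<phi> x \<partial>lborel) = (\<integral>x. V [] x * partials is (partial i \<phi>) x \<partial>lborel)"
    by (simp add: partials_snoc)
  also have "\<dots> = (- 1) ^ length is * (\<integral>x. V is x * partial i \<phi> x \<partial>lborel)"
    using snoc by (intro snoc.IH test_function_partial) auto
  also have "(\<integral>x. V is x * partial i \<phi> x \<partial>lborel) = - (\<integral>x. V (is @ [i]) x * \<phi> x \<partial>lborel)"
    using sobolev_family_wder[OF V, of "is" i] snoc.prems unfolding weak_partial_def by simp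
  finally show ?case by simp
qed

text \<open>Weak derivatives inherit the symmetry of the derivatives of elementary test
  functions.\<close>

lemma sobolev_family_perm:
  fixes V :: "'d::finite list \<Rightarrow> real ^ 'd \<Rightarrow> real"
  assumes V: "sobolev_family U m N V" and U: "open U" "bounded U" and l: "length is \<le> nat \<lfloor>m\<rfloor>" and p: "mset is = mset js"
  shows "AE x in lborel. x \<in> U \<longrightarrow> V is x = V js x"
proof -
  have Ub: "U \<in> sets borel" using U by auto
  have ll: "length js = length is" using p by (metis size_mset)
  then have l': "length js \<le> nat \<lfloor>m\<rfloor>" using l by simp
  have "AE x in lborel. x \<in> U \<longrightarrow> V is x - V js x = 0"
  proof (rule fundamental_lemma[OF U sq_int_diff[OF sobolev_family_sq[OF V l] sobolev_family_sq[OF V l'] Ub]])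
    fix \<phi> :: "real ^ 'd \<Rightarrow> real" assume e: "\<phi> \<in> elementary" and \<phi>: "test_function U \<phi>"
    have "(- 1) ^ length is * (\<integral>x. V is x * \<phi> x \<partial>lborel) = (- 1) ^ length is * (\<integral>x. V js x * \<phi> x \<partial>lborel)"
      using sobolev_family_partials[OF V l \<phi>] sobolev_family_partials[OF V l' \<phi>] elementary_partials_perm[OF e p] ll by simp
    then have "(\<integral>x. V is x * \<phi> x \<partial>lborel) = (\<integral>x. V js x * \<phi> x \<partial>lborel)" by simp
    then show "(\<integral>x. (V is x - V js x) * \<phi> x \<partial>lborel) = 0"
      unfolding left_diff_distrib
      by (subst Bochner_Integration.integral_diff) (use sq_int_test_integrable[OF _ Ub \<phi>] sobolev_family_sq[OF V] l l' in auto)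
  qed
  then show ?thesis by eventually_elim auto
qed

lemma mean_cong_AE:
  assumes "AE x in lborel. x \<in> B \<longrightarrow> f x = g x" "f \<in> borel_measurable borel" "g \<in> borel_measurable borel" "B \<in> sets borel"
  shows "mean B f = mean B g"
proof -
  have [measurable]: "f \<in> borel_measurable borel" "g \<in> borel_measurable borel" "B \<in> sets borel" by fact+
  have "(\<integral>x. indicator B x * f x \<partial>lborel) = (\<integral>x. indicator B x * g x \<partial>lborel)"
    by (rule integral_cong_AE) (use assms(1) in \<open>auto elim!: eventually_mono simp: indicator_def\<close>)
  then show ?thesis by (simp add: mean_def)
qed

text \<open>The contraction of a tensor c of rank k with k copies of x. Coefficients indexed by
  lists fit the indexing of weak derivatives.\<close>

primrec hom_poly :: "nat \<Rightarrow> ('d::finite list \<Rightarrow> real) \<Rightarrow> real ^ 'd \<Rightarrow> real" where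
  "hom_poly 0 c = (\<lambda>x. c [])"
| "hom_poly (Suc k) c = (\<lambda>x. \<Sum>i\<in>UNIV. x $ i * hom_poly k (\<lambda>is. c (i # is)) x)"

definition perm_invariant :: "('d list \<Rightarrow> real) \<Rightarrow> bool" where
  "perm_invariant c \<longleftrightarrow> (\<forall>is js. mset is = mset js \<longrightarrow> c is = c js)"

lemma perm_invariant_Cons: "perm_invariant c \<Longrightarrow> perm_invariant (\<lambda>is. c (i # is))"
  by (simp add: perm_invariant_def)

lemma hom_poly_elem: "hom_poly k c \<in> elementary"
proof (induction k arbitrary: c)
  case 0 show ?case unfolding hom_poly.simps by (rule elementary_const)
next
  case (Suc k) show ?case unfolding hom_poly.simps by (intro elementary_sum elementary_mult elementary_coord Suc finite)
qed

lemma elementary_partial_add: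
  "f \<in> elementary \<Longrightarrow> g \<in> elementary \<Longrightarrow> partial i (\<lambda>x. f x + g x) = (\<lambda>x. partial i f x + partial i g x)"
  by (auto intro!: ext partial_add elementary_differentiable)

lemma elementary_partial_mult:
  "f \<in> elementary \<Longrightarrow> g \<in> elementary \<Longrightarrow> partial i (\<lambda>x. f x * g x) = (\<lambda>x. partial i f x * g x + f x * partial i g x)"
  by (auto intro!: ext partial_mult elementary_differentiable)

lemma elementary_partial_cmult: "f \<in> elementary \<Longrightarrow> partial i (\<lambda>x. c * f x) = (\<lambda>x. c * partial i f x)"
  using elementary_partial_mult[OF elementary_const, of f i c] by simp

lemma elementary_partial_sum:
  "finite A \<Longrightarrow> (\<And>a. a \<in> A \<Longrightarrow> f a \<in> elementary) \<Longrightarrow> partial i (\<lambda>x. \<Sum>a\<in>A. f a x) = (\<lambda>x. \<Sum>a\<in>A. partial i (f a) x)"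
  by (induction A rule: finite_induct) (simp_all add: elementary_partial_add elementary_sum)

lemma elementary_partials_add:
  "f \<in> elementary \<Longrightarrow> g \<in> elementary \<Longrightarrow> partials is (\<lambda>x. f x + g x) = (\<lambda>x. partials is f x + partials is g x)"
  by (induction "is") (simp_all add: partials_Cons elementary_partial_add elementary_partials)

lemma elementary_partials_cmult: "f \<in> elementary \<Longrightarrow> partials is (\<lambda>x. c * f x) = (\<lambda>x. c * partials is f x)"
  by (induction "is") (simp_all add: partials_Cons elementary_partial_cmult elementary_partials)

lemma partials_zero: "partials is (\<lambda>x. 0) = (\<lambda>x. 0)"
  by (induction "is") (simp_all add: partials_Cons)

text \<open>Differentiating one of the k + 1 copies of x contracts one slot of c with the j-th unit
  vector; by symmetry all slots give the same term.\<close>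

lemma partial_tens:
  "perm_invariant c \<Longrightarrow> partial j (hom_poly (Suc k) c) = (\<lambda>x. real (Suc k) * hom_poly k (\<lambda>is. c (j # is)) x)"
proof (induction k arbitrary: c)
  case 0
  have "partial j (hom_poly (Suc 0) c) = (\<lambda>x. \<Sum>i\<in>UNIV. partial j (\<lambda>x. x $ i * c [i]) x)"
    by (simp add: elementary_partial_sum elementary_mult elementary_coord elementary_const)
  also have "\<dots> = (\<lambda>x. c [j])"
    by (simp add: elementary_partial_mult elementary_coord elementary_const partial_coord if_distrib[of "\<lambda>a. a * _"] cong: if_cong)
  finally show ?case by simp
next
  case (Suc k)
  have sc: "c (i # j # is) = c (j # i # is)" for i "is" using Suc.prems[unfolded perm_invariant_def, rule_format, of "i # j # is" "j # i # is"] by simp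
  have "partial j (hom_poly (Suc (Suc k)) c) = (\<lambda>x. \<Sum>i\<in>UNIV. partial j (\<lambda>x. x $ i * hom_poly (Suc k) (\<lambda>is. c (i # is)) x) x)"
    by (subst hom_poly.simps(2)) (rule elementary_partial_sum, auto intro: elementary_mult elementary_coord hom_poly_elem simp del: hom_poly.simps)
  also have "\<dots> = (\<lambda>x. \<Sum>i\<in>UNIV. (if i = j then 1 else 0) * hom_poly (Suc k) (\<lambda>is. c (i # is)) x
       + x $ i * (real (Suc k) * hom_poly k (\<lambda>is. c (i # j # is)) x))"
    by (simp only: elementary_partial_mult[OF elementary_coord hom_poly_elem] partial_coord Suc.IH[OF perm_invariant_Cons[OF Suc.prems]])
  also have "\<dots> = (\<lambda>x. hom_poly (Suc k) (\<lambda>is. c (j # is)) x + (\<Sum>i\<in>UNIV. x $ i * (real (Suc k) * hom_poly k (\<lambda>is. c (j # i # is)) x)))"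
    by (simp add: sum.distrib if_distrib[of "\<lambda>a. a * _"] sc del: hom_poly.simps cong: if_cong)
  also have "\<dots> = (\<lambda>x. real (Suc (Suc k)) * hom_poly (Suc k) (\<lambda>is. c (j # is)) x)"
  proof
    fix x
    have "(\<Sum>i\<in>UNIV. x $ i * (real (Suc k) * hom_poly k (\<lambda>is. c (j # i # is)) x)) = real (Suc k) * hom_poly (Suc k) (\<lambda>is. c (j # is)) x"
      unfolding hom_poly.simps sum_distrib_left by (rule sum.cong) (simp_all only: mult.left_commute)
    then show "hom_poly (Suc k) (\<lambda>is. c (j # is)) x + (\<Sum>i\<in>UNIV. x $ i * (real (Suc k) * hom_poly k (\<lambda>is. c (j # i # is)) x))
       = real (Suc (Suc k)) * hom_poly (Suc k) (\<lambda>is. c (j # is)) x"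
      by (simp add: algebra_simps del: hom_poly.simps)
  qed
  finally show ?case .
qed

lemma partials_tens_top:
  "perm_invariant c \<Longrightarrow> length js = k \<Longrightarrow> partials js (hom_poly k c) = (\<lambda>x. fact k * c js)"
proof (induction js arbitrary: k c rule: rev_induct)
  case Nil then show ?case by simp
next
  case (snoc j js)
  then obtain k' where k: "k = Suc k'" by (cases k) auto
  have p: "c (j # js) = c (js @ [j])" using snoc.prems(1)[unfolded perm_invariant_def, rule_format, of "j # js" "js @ [j]"] by simp
  show ?case unfolding k partials_snoc partial_tens[OF snoc.prems(1)] elementary_partials_cmult[OF hom_poly_elem]
    using snoc.IH[OF perm_invariant_Cons[OF snoc.prems(1)], of k' j] snoc.prems k p by (simp add: mult_ac)
qed

lemma partials_tens_zero:
  "perm_invariant c \<Longrightarrow> length js > k \<Longrightarrow> partials js (hom_poly k c) = (\<lambda>x. 0)"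
proof (induction js arbitrary: k c rule: rev_induct)
  case Nil then show ?case by simp
next
  case (snoc j js)
  show ?case
  proof (cases k)
    case 0 then show ?thesis by (simp add: partials_snoc partials_zero)
  next
    case (Suc k')
    show ?thesis unfolding Suc partials_snoc partial_tens[OF snoc.prems(1)] elementary_partials_cmult[OF hom_poly_elem]
      using snoc.IH[OF perm_invariant_Cons[OF snoc.prems(1)], of k' j] snoc.prems Suc by simp
  qed
qed

lemma finite_multi_indices: "finite {\<alpha> :: 'd::finite \<Rightarrow> nat. (\<Sum>i\<in>UNIV. \<alpha> i) < q}"
proof (rule finite_subset)
  show "{\<alpha> :: 'd \<Rightarrow> nat. (\<Sum>i\<in>UNIV. \<alpha> i) < q} \<subseteq> (\<Pi>\<^sub>E i\<in>UNIV. {..q})"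
  proof safe
    fix \<alpha> :: "'d \<Rightarrow> nat" and i assume "(\<Sum>i\<in>UNIV. \<alpha> i) < q"
    moreover have "\<alpha> i \<le> (\<Sum>i\<in>UNIV. \<alpha> i)" by (rule member_le_sum) auto
    ultimately show "\<alpha> i \<le> q" by simp
  qed auto
  show "finite (\<Pi>\<^sub>E i\<in>(UNIV :: 'd set). {..q})" by (intro finite_PiE) auto
qed

lemma polys_elem: "p \<in> polys_of_order q \<Longrightarrow> p \<in> elementary"
proof -
  have pw: "(\<lambda>x. x $ i ^ n) \<in> elementary" for i :: 'a and n :: nat
    by (induction n) (auto intro: elementary_const elementary_mult elementary_coord)
  show "p \<in> polys_of_order q \<Longrightarrow> p \<in> elementary"
    unfolding polys_of_order_def
    by (auto intro!: elementary_sum finite_multi_indices elementary_cmult elementary_prod pw)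
qed

lemma polys_add: 
  assumes "p \<in> polys_of_order q" "p' \<in> polys_of_order q" shows "(\<lambda>x. p x + p' x) \<in> polys_of_order q"
proof -
  obtain c c' where "p = (\<lambda>x. \<Sum>\<alpha> | (\<Sum>i\<in>UNIV. \<alpha> i) < q. c \<alpha> * (\<Prod>i\<in>UNIV. (x $ i) ^ \<alpha> i))"
    "p' = (\<lambda>x. \<Sum>\<alpha> | (\<Sum>i\<in>UNIV. \<alpha> i) < q. c' \<alpha> * (\<Prod>i\<in>UNIV. (x $ i) ^ \<alpha> i))"
    using assms unfolding polys_of_order_def by auto
  then show ?thesis unfolding polys_of_order_def
    by (intro CollectI exI[of _ "\<lambda>\<alpha>. c \<alpha> + c' \<alpha>"]) (simp add: sum.distrib distrib_right)
qed

lemma polys_0: "(\<lambda>x. 0) \<in> polys_of_order q"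
  unfolding polys_of_order_def by (intro CollectI exI[of _ "\<lambda>\<alpha>. 0"]) simp

lemma polys_sum: "finite A \<Longrightarrow> (\<And>a. a \<in> A \<Longrightarrow> f a \<in> polys_of_order q) \<Longrightarrow> (\<lambda>x. \<Sum>a\<in>A. f a x) \<in> polys_of_order q"
  by (induction A rule: finite_induct) (auto intro: polys_0 polys_add)

lemma polys_mono:
  assumes p: "p \<in> polys_of_order q" and q: "q \<le> q'" shows "p \<in> polys_of_order q'"
proof -
  obtain c where c: "p = (\<lambda>x. \<Sum>\<alpha> | (\<Sum>i\<in>UNIV. \<alpha> i) < q. c \<alpha> * (\<Prod>i\<in>UNIV. (x $ i) ^ \<alpha> i))"
    using p unfolding polys_of_order_def by auto
  have "p x = (\<Sum>\<alpha> | (\<Sum>i\<in>UNIV. \<alpha> i) < q'. (if (\<Sum>i\<in>UNIV. \<alpha> i) < q then c \<alpha> else 0) * (\<Prod>i\<in>UNIV. (x $ i) ^ \<alpha> i))" for x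
    unfolding c using q by (intro sum.mono_neutral_cong_left finite_multi_indices) auto
  then show ?thesis unfolding polys_of_order_def
    by (intro CollectI exI[of _ "\<lambda>\<alpha>. if (\<Sum>i\<in>UNIV. \<alpha> i) < q then c \<alpha> else 0"] ext)
qed

text \<open>Multiplication by the coordinate raises the j-th exponent by one; monomials free of that
  coordinate receive the coefficient 0.\<close>

lemma polys_coord_mult:
  fixes p :: "real ^ 'd::finite \<Rightarrow> real"
  assumes p: "p \<in> polys_of_order q" shows "(\<lambda>x. x $ j * p x) \<in> polys_of_order (Suc q)"
proof -
  obtain c where c: "p = (\<lambda>x. \<Sum>\<alpha> | (\<Sum>i\<in>UNIV. \<alpha> i) < q. c \<alpha> * (\<Prod>i\<in>UNIV. (x $ i) ^ \<alpha> i))"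
    using p unfolding polys_of_order_def by auto
  let ?u = "\<lambda>\<alpha> :: 'd \<Rightarrow> nat. \<alpha>(j := Suc (\<alpha> j))"
  let ?A = "{\<alpha> :: 'd \<Rightarrow> nat. (\<Sum>i\<in>UNIV. \<alpha> i) < q}" and ?A' = "{\<alpha> :: 'd \<Rightarrow> nat. (\<Sum>i\<in>UNIV. \<alpha> i) < Suc q}"
  have su: "(\<Sum>i\<in>UNIV. ?u \<alpha> i) = Suc (\<Sum>i\<in>UNIV. \<alpha> i)" for \<alpha>
    by (simp add: sum.remove[of UNIV j])
  have pu: "(\<Prod>i\<in>UNIV. (x $ i) ^ ?u \<alpha> i) = x $ j * (\<Prod>i\<in>UNIV. (x $ i) ^ \<alpha> i)" for \<alpha> and x :: "real ^ 'd"
    by (simp add: prod.remove[of UNIV j] mult.assoc)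
  have img: "?u ` ?A = {\<alpha> \<in> ?A'. \<alpha> j > 0}"
  proof safe
    fix \<alpha> :: "'d \<Rightarrow> nat" assume a: "(\<Sum>i\<in>UNIV. \<alpha> i) < Suc q" "0 < \<alpha> j"
    have "\<alpha> = ?u (\<alpha>(j := \<alpha> j - 1))" using a by auto
    moreover have "(\<Sum>i\<in>UNIV. (\<alpha>(j := \<alpha> j - 1)) i) < q"
      using su[of "\<alpha>(j := \<alpha> j - 1)"] a by simp
    ultimately show "\<alpha> \<in> ?u ` ?A" by blast
  qed (auto simp: su simp del: fun_upd_apply, simp)
  have inj: "inj_on ?u ?A"
  proof (rule inj_onI)
    fix \<alpha> \<beta> :: "'d \<Rightarrow> nat" assume e: "?u \<alpha> = ?u \<beta>"
    show "\<alpha> = \<beta>"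
    proof
      fix i show "\<alpha> i = \<beta> i" using fun_cong[OF e, of i] by (cases "i = j") auto
    qed
  qed
  have "x $ j * p x = (\<Sum>\<alpha>\<in>?A'. (if \<alpha> j > 0 then c (\<alpha>(j := \<alpha> j - 1)) else 0) * (\<Prod>i\<in>UNIV. (x $ i) ^ \<alpha> i))" for x
  proof -
    have "x $ j * p x = (\<Sum>\<alpha>\<in>?A. c \<alpha> * (\<Prod>i\<in>UNIV. (x $ i) ^ ?u \<alpha> i))"
      unfolding c pu sum_distrib_left by (simp add: mult_ac)
    also have "\<dots> = (\<Sum>\<alpha>\<in>?A. (\<lambda>\<alpha>. (if \<alpha> j > 0 then c (\<alpha>(j := \<alpha> j - 1)) else 0) * (\<Prod>i\<in>UNIV. (x $ i) ^ \<alpha> i)) (?u \<alpha>))"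
      by simp
    also have "\<dots> = (\<Sum>\<alpha>\<in>?u ` ?A. (if \<alpha> j > 0 then c (\<alpha>(j := \<alpha> j - 1)) else 0) * (\<Prod>i\<in>UNIV. (x $ i) ^ \<alpha> i))"
      by (subst sum.reindex[OF inj]) (simp add: o_def)
    also have "\<dots> = (\<Sum>\<alpha>\<in>?A'. (if \<alpha> j > 0 then c (\<alpha>(j := \<alpha> j - 1)) else 0) * (\<Prod>i\<in>UNIV. (x $ i) ^ \<alpha> i))"
      unfolding img by (intro sum.mono_neutral_left finite_multi_indices) auto
    finally show ?thesis .
  qed
  then show ?thesis unfolding polys_of_order_def
    by (intro CollectI exI[of _ "\<lambda>\<alpha>. if \<alpha> j > 0 then c (\<alpha>(j := \<alpha> j - 1)) else 0"]) (rule ext)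
qed

lemma hom_poly_polys: "hom_poly k c \<in> polys_of_order (Suc k)"
proof (induction k arbitrary: c)
  case 0
  have z: "{\<alpha> :: 'a \<Rightarrow> nat. (\<Sum>i\<in>UNIV. \<alpha> i) < Suc 0} = {\<lambda>i. 0}" by auto
  show ?case unfolding polys_of_order_def z by (intro CollectI exI[of _ "\<lambda>\<alpha>. c []"]) simp
next
  case (Suc k)
  then show ?case by (auto intro!: polys_sum polys_coord_mult simp del: hom_poly.simps(1))
qed

section \<open>Polynomials with prescribed means of derivatives\<close>

lemma mean_add:
  assumes "sq_int B f" "sq_int B g" "B \<in> sets borel" "bounded B"
  shows "mean B (\<lambda>x. f x + g x) = mean B f + mean B g"
proof -
  have i: "integrable lborel (\<lambda>x. indicator B x * f x)" "integrable lborel (\<lambda>x. indicator B x * g x)"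
    using assms by (auto intro: cut_integrable)
  show ?thesis unfolding mean_def distrib_left Bochner_Integration.integral_add[OF i] by (rule add_divide_distrib)
qed

lemma mean_diff:
  assumes "sq_int B f" "sq_int B g" "B \<in> sets borel" "bounded B"
  shows "mean B (\<lambda>x. f x - g x) = mean B f - mean B g"
proof -
  have i: "integrable lborel (\<lambda>x. indicator B x * f x)" "integrable lborel (\<lambda>x. indicator B x * g x)"
    using assms by (auto intro: cut_integrable)
  show ?thesis unfolding mean_def right_diff_distrib Bochner_Integration.integral_diff[OF i] by (rule diff_divide_distrib)
qed

lemma mean_const: "r > 0 \<Longrightarrow> mean (ball (c :: real ^ 'd) r) (\<lambda>x. k) = k"
  using measure_ball_pos[of r c] by (simp add: mean_def)

text \<open>The system is triangular. The homogeneous part of degree n with coefficients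
  \<open>a is / fact n\<close> has the constants \<open>a is\<close> as its derivatives of order n,
  and a polynomial of lower degree then corrects the means of lower order without disturbing the
  top.\<close>

lemma poly_with_means:
  fixes c :: "real ^ 'd"
  assumes R: "R > 0"
  shows "perm_invariant a \<Longrightarrow> \<exists>p\<in>polys_of_order n. (\<forall>is. length is < n \<longrightarrow> mean (ball c R) (partials is p) = a is) \<and>
    (\<forall>is. n \<le> length is \<longrightarrow> partials is p = (\<lambda>x. 0)) \<and> (\<forall>is. Suc (length is) = n \<longrightarrow> (\<exists>k. partials is p = (\<lambda>x. k)))"
proof (induction n arbitrary: a)
  case 0
  show ?case by (rule bexI[OF _ polys_0]) (simp add: partials_zero)
next
  case (Suc n)
  let ?B = "ball c R"
  define t where "t = hom_poly n (\<lambda>is. a is / fact n)"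
  have t: "t \<in> elementary" unfolding t_def by (rule hom_poly_elem)
  have st: "perm_invariant (\<lambda>is. a is / fact n)"
    unfolding perm_invariant_def by (intro allI impI arg_cong[where f = "\<lambda>v. v / fact n"]) (use Suc.prems in \<open>unfold perm_invariant_def, blast\<close>)
  \<comment> \<open>The means caused by t at lower orders are subtracted; they are symmetric because
    the derivatives of t commute.\<close>
  have sa: "perm_invariant (\<lambda>is. a is - mean ?B (partials is t))"
    unfolding perm_invariant_def
  proof (intro allI impI)
    fix "is" js :: "'d list" assume ms: "mset is = mset js"
    have "a is = a js" using Suc.prems ms unfolding perm_invariant_def by blast
    then show "a is - mean ?B (partials is t) = a js - mean ?B (partials js t)"
      using elementary_partials_perm[OF t ms] by simp
  qed
  obtain p where p: "p \<in> polys_of_order n" "\<And>is. length is < n \<Longrightarrow> mean ?B (partials is p) = a is - mean ?B (partials is t)"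
    "\<And>is. n \<le> length is \<Longrightarrow> partials is p = (\<lambda>x. 0)"
    using Suc.IH[OF sa] by blast
  have pe: "p \<in> elementary" by (rule polys_elem[OF p(1)])
  have add: "partials is (\<lambda>x. t x + p x) = (\<lambda>x. partials is t x + partials is p x)" for "is"
    by (rule elementary_partials_add[OF t pe])
  have ttop: "partials is t = (\<lambda>x. a is)" if "length is = n" for "is"
    using partials_tens_top[OF st that] by (simp add: t_def)
  show ?case
  proof (intro bexI[of _ "\<lambda>x. t x + p x"] conjI allI impI)
    fix "is" :: "'d list" assume l: "length is < Suc n"
    show "mean ?B (partials is (\<lambda>x. t x + p x)) = a is"
    proof (cases "length is = n")
      case True
      then show ?thesis unfolding add ttop[OF True] using p(3)[of "is"] mean_const[OF R] by simp
    next
      case False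
      then have "length is < n" using l by simp
      then show ?thesis unfolding add
        using p(2) by (subst mean_add) (auto intro!: elementary_sq elementary_partials t pe)
    qed
  next
    fix "is" :: "'d list" assume "Suc n \<le> length is"
    then show "partials is (\<lambda>x. t x + p x) = (\<lambda>x. 0)"
      unfolding add using partials_tens_zero[OF st, of n "is"] p(3)[of "is"] by (simp add: t_def)
  next
    fix "is" :: "'d list" assume "Suc (length is) = Suc n"
    then show "\<exists>k. partials is (\<lambda>x. t x + p x) = (\<lambda>x. k)"
      unfolding add using ttop[of "is"] p(3)[of "is"] by auto
  next
    have "t \<in> polys_of_order (Suc n)" unfolding t_def by (rule hom_poly_polys)
    then show "(\<lambda>x. t x + p x) \<in> polys_of_order (Suc n)"
      by (intro polys_add polys_mono[OF p(1)]) auto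
  qed
qed

text \<open>Derivatives belonging to permuted lists agree almost everywhere and hence have equal
  means, which is the solvability condition of \<open>poly_with_means\<close>.\<close>

lemma poly_matching_means:
  fixes c :: "real ^ 'd"
  assumes R: "R > 0" and V: "sobolev_family (ball c R) m N V" and n: "n \<le> Suc (nat \<lfloor>m\<rfloor>)"
  shows "\<exists>p\<in>polys_of_order n. (\<forall>is. length is < n \<longrightarrow> mean (ball c R) (\<lambda>x. V is x - partials is p x) = 0) \<and>
    (\<forall>is. n \<le> length is \<longrightarrow> partials is p = (\<lambda>x. 0)) \<and> (\<forall>is. Suc (length is) = n \<longrightarrow> (\<exists>k. partials is p = (\<lambda>x. k)))"
proof -
  let ?B = "ball c R"
  \<comment> \<open>The default 0 makes invariance hold for all lists, although the family is
    controlled only up to order \<open>\<lfloor>m\<rfloor>\<close>.\<close>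
  define a where "a is = (if length is < n then mean ?B (V is) else 0)" for "is"
  have "perm_invariant a"
    unfolding perm_invariant_def
  proof (intro allI impI)
    fix "is" js :: "'d list" assume ms: "mset is = mset js"
    then have ll: "length is = length js" by (metis size_mset)
    show "a is = a js"
    proof (cases "length is < n")
      case True
      then have l: "length is \<le> nat \<lfloor>m\<rfloor>" "length js \<le> nat \<lfloor>m\<rfloor>" using n ll by auto
      have "mean ?B (V is) = mean ?B (V js)"
        by (rule mean_cong_AE[OF sobolev_family_perm[OF V open_ball bounded_ball l(1) ms]]) (use l sobolev_family_measurable[OF V] in auto)
      then show ?thesis using ll by (simp add: a_def)
    qed (simp add: a_def ll)
  qed
  from poly_with_means[OF R this, of n c] obtain p where p: "p \<in> polys_of_order n"
    "\<And>is. length is < n \<Longrightarrow> mean ?B (partials is p) = a is" "\<forall>is. n \<le> length is \<longrightarrow> partials is p = (\<lambda>x. 0)"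
    "\<forall>is. Suc (length is) = n \<longrightarrow> (\<exists>k. partials is p = (\<lambda>x. k))" by blast
  have "mean ?B (\<lambda>x. V is x - partials is p x) = 0" if l: "length is < n" for "is"
  proof -
    have "mean ?B (\<lambda>x. V is x - partials is p x) = mean ?B (V is) - mean ?B (partials is p)"
      by (rule mean_diff) (use l n in \<open>auto intro!: sobolev_family_sq[OF V] elementary_sq elementary_partials polys_elem[OF p(1)]\<close>)
    then show ?thesis using p(2)[OF l] l by (simp add: a_def)
  qed
  then show ?thesis using p by blast
qed

section \<open>Sobolev families and Sobolev spaces\<close>

text \<open>Elements of the Sobolev space are Lebesgue measurable on \<Omega>; Borel representatives
  on the whole space make substitutions and Fubini under \<open>lborel\<close> available.\<close>

definition borel_rep :: "(real ^ 'd) set \<Rightarrow> (real ^ 'd \<Rightarrow> real) \<Rightarrow> (real ^ 'd \<Rightarrow> real) \<Rightarrow> bool" where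
  "borel_rep \<Omega> f g \<longleftrightarrow> g \<in> borel_measurable borel \<and> (AE x in lborel. x \<in> \<Omega> \<longrightarrow> f x = g x)"

lemma borel_rep_measurable: "borel_rep \<Omega> f g \<Longrightarrow> g \<in> borel_measurable borel"
  by (simp add: borel_rep_def)

lemma borel_rep_AE: "borel_rep \<Omega> f g \<Longrightarrow> AE x in lborel. x \<in> \<Omega> \<longrightarrow> f x = g x"
  by (simp add: borel_rep_def)

lemma borel_rep_refl: "g \<in> borel_measurable borel \<Longrightarrow> borel_rep \<Omega> g g"
  by (simp add: borel_rep_def)

lemma borel_rep_exists:
  assumes \<Omega>: "open \<Omega>" and f: "f \<in> borel_measurable (lebesgue_on \<Omega>)"
  shows "\<exists>g. borel_rep \<Omega> f g"
proof -
  have "(\<lambda>x. if x \<in> \<Omega> then f x else 0) \<in> borel_measurable lebesgue"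
    by (rule borel_measurable_if_I[OF f]) (use \<Omega> in auto)
  then obtain g where g: "g \<in> borel_measurable lborel" "AE x in lborel. (if x \<in> \<Omega> then f x else 0) = g x"
    using completion_ex_borel_measurable_real by blast
  have "AE x in lborel. x \<in> \<Omega> \<longrightarrow> f x = g x" using g(2) by eventually_elim auto
  then show ?thesis using g(1) by (auto simp: borel_rep_def)
qed

lemma borel_rep_imp_measurable:
  assumes \<Omega>: "open \<Omega>" and r: "borel_rep \<Omega> f g" shows "f \<in> borel_measurable (lebesgue_on \<Omega>)"
proof (rule borel_measurable_if_D)
  have [measurable]: "\<Omega> \<in> sets borel" "g \<in> borel_measurable borel" using \<Omega> r by (auto simp: borel_rep_def)
  have "(\<lambda>x. if x \<in> \<Omega> then g x else 0) \<in> borel_measurable lborel" by measurable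
  then have "(\<lambda>x. if x \<in> \<Omega> then g x else 0) \<in> borel_measurable lebesgue" by (rule measurable_completion)
  moreover have "AE x in lborel. (if x \<in> \<Omega> then g x else 0) = (if x \<in> \<Omega> then f x else 0)"
    using borel_rep_AE[OF r] by eventually_elim auto
  then have "AE x in lebesgue. (if x \<in> \<Omega> then g x else 0) = (if x \<in> \<Omega> then f x else 0)"
    by (rule AE_completion)
  ultimately show "(\<lambda>x. if x \<in> \<Omega> then f x else 0) \<in> borel_measurable lebesgue" by (rule borel_measurable_AE)
qed

lemma nn_integral_lebesgue_on:
  assumes "open \<Omega>" shows "(\<integral>\<^sup>+x. k x \<partial>lebesgue_on \<Omega>) = (\<integral>\<^sup>+x. k x * indicator \<Omega> x \<partial>lborel)"
  using assms by (subst nn_integral_restrict_space) (auto simp: nn_integral_completion)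

lemma integral_lebesgue_on_rep:
  assumes \<Omega>: "open \<Omega>" and r: "borel_rep \<Omega> f g"
  shows "(\<integral>x. f x \<partial>lebesgue_on \<Omega>) = (\<integral>x. indicator \<Omega> x * g x \<partial>lborel)"
proof -
  have [measurable]: "\<Omega> \<in> sets borel" "g \<in> borel_measurable borel" using \<Omega> r by (auto simp: borel_rep_def)
  have \<Omega>l: "\<Omega> \<in> sets lebesgue" using \<Omega> by auto
  have m: "(\<lambda>x. indicator \<Omega> x *\<^sub>R g x) \<in> borel_measurable lborel" by measurable
  have fm: "(\<lambda>x. indicator \<Omega> x *\<^sub>R f x) \<in> borel_measurable lebesgue"
    using borel_rep_imp_measurable[OF \<Omega> r] \<Omega>l by (subst (asm) borel_measurable_restrict_space_iff) auto
  have "(\<integral>x. f x \<partial>lebesgue_on \<Omega>) = (\<integral>x. indicator \<Omega> x *\<^sub>R f x \<partial>lebesgue)"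
    using \<Omega>l by (intro integral_restrict_space) auto
  also have "\<dots> = (\<integral>x. indicator \<Omega> x *\<^sub>R g x \<partial>lebesgue)"
  proof (rule integral_cong_AE[OF fm measurable_completion[OF m]])
    have "AE x in lborel. indicator \<Omega> x *\<^sub>R f x = indicator \<Omega> x *\<^sub>R g x"
      using borel_rep_AE[OF r] by eventually_elim (auto simp: indicator_def)
    then show "AE x in lebesgue. indicator \<Omega> x *\<^sub>R f x = indicator \<Omega> x *\<^sub>R g x" by (rule AE_completion)
  qed
  also have "\<dots> = (\<integral>x. indicator \<Omega> x *\<^sub>R g x \<partial>lborel)" by (rule integral_completion[OF m])
  finally show ?thesis by simp
qed

lemma borel_rep_mult:
  assumes "borel_rep \<Omega> f g" "\<phi> \<in> borel_measurable borel" shows "borel_rep \<Omega> (\<lambda>x. f x * \<phi> x) (\<lambda>x. g x * \<phi> x)"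
proof -
  have [measurable]: "g \<in> borel_measurable borel" "\<phi> \<in> borel_measurable borel" using assms by (auto simp: borel_rep_def)
  have "AE x in lborel. x \<in> \<Omega> \<longrightarrow> f x * \<phi> x = g x * \<phi> x" using borel_rep_AE[OF assms(1)] by eventually_elim auto
  then show ?thesis by (simp add: borel_rep_def)
qed

lemma nn_integral_square_rep:
  assumes \<Omega>: "open \<Omega>" and r: "borel_rep \<Omega> f g"
  shows "(\<integral>\<^sup>+x. ennreal ((f x)\<^sup>2) \<partial>lebesgue_on \<Omega>) = sq_norm \<Omega> g"
  unfolding nn_integral_lebesgue_on[OF \<Omega>] sq_norm_def
  by (rule nn_integral_cong_AE) (use borel_rep_AE[OF r] in \<open>auto elim!: eventually_mono simp: indicator_def\<close>)

lemma L2_rep: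
  assumes \<Omega>: "open \<Omega>" and r: "borel_rep \<Omega> f g" shows "L2 \<Omega> f \<longleftrightarrow> sq_norm \<Omega> g < \<infinity>"
proof -
  have [measurable]: "f \<in> borel_measurable (lebesgue_on \<Omega>)" by (rule borel_rep_imp_measurable[OF \<Omega> r])
  have "(\<lambda>x. (f x)\<^sup>2) \<in> borel_measurable (lebesgue_on \<Omega>)" by measurable
  then show ?thesis
    unfolding L2_def integrable_iff_bounded using nn_integral_square_rep[OF \<Omega> r] by simp
qed

lemma integral_square_rep:
  assumes \<Omega>: "open \<Omega>" and r: "borel_rep \<Omega> f g"
  shows "(\<integral>x. (f x)\<^sup>2 \<partial>lebesgue_on \<Omega>) = enn2real (sq_norm \<Omega> g)"
proof -
  have [measurable]: "f \<in> borel_measurable (lebesgue_on \<Omega>)" by (rule borel_rep_imp_measurable[OF \<Omega> r])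
  show ?thesis
    unfolding nn_integral_square_rep[OF \<Omega> r, symmetric] by (rule integral_eq_nn_integral) auto
qed

lemma slobodeckij_rep:
  assumes \<Omega>: "open \<Omega>" and r: "borel_rep \<Omega> f g"
  shows "slobodeckij \<Omega> \<sigma> f = Slob \<Omega> \<sigma> g"
proof -
  note ae = borel_rep_AE[OF r]
  have inner: "(\<integral>\<^sup>+y. ennreal ((f x - f y)\<^sup>2 / norm (x - y) powr a) * indicator \<Omega> y \<partial>lborel) =
     (\<integral>\<^sup>+y. indicator \<Omega> y * ennreal ((g x - g y)\<^sup>2 / norm (x - y) powr a) \<partial>lborel)" if "f x = g x" for x a
    by (rule nn_integral_cong_AE) (use ae that in \<open>auto elim!: eventually_mono simp: indicator_def\<close>)
  show ?thesis
    unfolding slobodeckij_def Slob_def nn_integral_lebesgue_on[OF \<Omega>]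
  proof (rule nn_integral_cong_AE)
    show "AE x in lborel. (\<integral>\<^sup>+y. ennreal ((f x - f y)\<^sup>2 / norm (x - y) powr (real CARD('a) + 2 * \<sigma>)) * indicator \<Omega> y \<partial>lborel) * indicator \<Omega> x =
       indicator \<Omega> x * (\<integral>\<^sup>+y. indicator \<Omega> y * ennreal ((g x - g y)\<^sup>2 / norm (x - y) powr (real CARD('a) + 2 * \<sigma>)) \<partial>lborel)"
      using ae
    proof eventually_elim
      case (elim x)
      show ?case
      proof (cases "x \<in> \<Omega>")
        case True
        show ?thesis unfolding inner[OF elim[rule_format, OF True]] by (rule mult.commute)
      qed simp
    qed
  qed
qed

lemma partials_test_function: "test_function U \<phi> \<Longrightarrow> test_function U (partials is \<phi>)"
  by (induction "is") (simp_all add: partials_Cons test_function_partial)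

lemma is_weak_deriv_rep:
  assumes \<Omega>: "open \<Omega>" and u: "borel_rep \<Omega> u U0" and v: "borel_rep \<Omega> v V0"
  shows "is_weak_deriv \<Omega> is u v \<longleftrightarrow> sq_norm \<Omega> V0 < \<infinity> \<and> (\<forall>\<phi>. test_function \<Omega> \<phi> \<longrightarrow>
     (\<integral>x. U0 x * partials is \<phi> x \<partial>lborel) = (- 1) ^ length is * (\<integral>x. V0 x * \<phi> x \<partial>lborel))"
proof -
  have I: "(\<integral>x. f x * \<phi> x \<partial>lebesgue_on \<Omega>) = (\<integral>x. g x * \<phi> x \<partial>lborel)" if r: "borel_rep \<Omega> f g" and \<phi>: "test_function \<Omega> \<phi>" for f g \<phi>
  proof -
    have "(\<integral>x. f x * \<phi> x \<partial>lebesgue_on \<Omega>) = (\<integral>x. indicator \<Omega> x * (g x * \<phi> x) \<partial>lborel)"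
      by (rule integral_lebesgue_on_rep[OF \<Omega> borel_rep_mult[OF r test_function_measurable[OF \<phi>]]])
    also have "\<dots> = (\<integral>x. g x * \<phi> x \<partial>lborel)"
      by (rule Bochner_Integration.integral_cong) (use test_function_zero[OF \<phi>] in \<open>auto simp: indicator_def\<close>)
    finally show ?thesis .
  qed
  show ?thesis unfolding is_weak_deriv_def L2_rep[OF \<Omega> v]
    using I[OF u partials_test_function] I[OF v] by auto
qed

text \<open>Makes the choice operator in \<open>weak_deriv\<close> harmless: any two admissible
  values agree almost everywhere in \<Omega>.\<close>

lemma weak_deriv_unique:
  fixes \<Omega> :: "(real ^ 'd) set"
  assumes \<Omega>: "open \<Omega>" "bounded \<Omega>" and sq_int: "sq_int \<Omega> f" "sq_int \<Omega> g"
    and eq: "\<And>\<phi>. test_function \<Omega> \<phi> \<Longrightarrow> (\<integral>x. f x * \<phi> x \<partial>lborel) = (\<integral>x. g x * \<phi> x \<partial>lborel)"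
  shows "AE x in lborel. x \<in> \<Omega> \<longrightarrow> f x = g x"
proof -
  have b: "\<Omega> \<in> sets borel" using \<Omega> by auto
  have "AE x in lborel. x \<in> \<Omega> \<longrightarrow> f x - g x = 0"
  proof (rule fundamental_lemma[OF \<Omega> sq_int_diff[OF sq_int b]])
    fix \<phi> :: "real ^ 'd \<Rightarrow> real" assume \<phi>: "test_function \<Omega> \<phi>"
    show "(\<integral>x. (f x - g x) * \<phi> x \<partial>lborel) = 0"
      unfolding left_diff_distrib using eq[OF \<phi>]
      by (subst Bochner_Integration.integral_diff) (use sq_int_test_integrable[OF _ b \<phi>] sq_int in auto)
  qed
  then show ?thesis by eventually_elim auto
qed

lemma finite_lists_length_eq: "finite {is :: 'd::finite list. length is = n}"
  by (rule finite_subset[OF _ finite_lists_length[of n]]) auto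

lemma sobolev_norm_square:
  "(sobolev_norm \<Omega> m u)\<^sup>2 =
     (\<Sum>is | length is \<le> nat \<lfloor>m\<rfloor>. \<integral>x. (weak_deriv \<Omega> is u x)\<^sup>2 \<partial>lebesgue_on \<Omega>) +
     (if m \<in> \<int> then 0
      else \<Sum>is | length is = nat \<lfloor>m\<rfloor>. enn2real (slobodeckij \<Omega> (frac m) (weak_deriv \<Omega> is u)))"
  unfolding sobolev_norm_def by (rule real_sqrt_pow2) (auto intro!: add_nonneg_nonneg sum_nonneg)

text \<open>Each component of the family is one nonnegative summand of the squared norm, so the
  squared norm itself can serve as N.\<close>

lemma sobolev_imp_fam:
  fixes \<Omega> :: "(real ^ 'd) set"
  assumes \<Omega>: "open \<Omega>" "bounded \<Omega>" and u: "u \<in> sobolev \<Omega> m"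
  shows "\<exists>V. sobolev_family \<Omega> m ((sobolev_norm \<Omega> m u)\<^sup>2) V \<and> borel_rep \<Omega> u (V [])"
proof -
  let ?n = "nat \<lfloor>m\<rfloor>" let ?N = "(sobolev_norm \<Omega> m u)\<^sup>2"
  let ?v = "\<lambda>is. weak_deriv \<Omega> is u"
  have wd: "is_weak_deriv \<Omega> is u (?v is)" if "length is \<le> ?n" for "is"
  proof -
    have "\<exists>v. is_weak_deriv \<Omega> is u v" using u that unfolding sobolev_def by blast
    then show ?thesis unfolding weak_deriv_def by (rule someI_ex)
  qed
  have "L2 \<Omega> u" using u by (simp add: sobolev_def)
  then have "u \<in> borel_measurable (lebesgue_on \<Omega>)" by (simp add: L2_def)
  then obtain U0 where U0: "borel_rep \<Omega> u U0" using borel_rep_exists[OF \<Omega>(1)] by blast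
  have sqU: "sq_int \<Omega> U0" using L2_rep[OF \<Omega>(1) U0] \<open>L2 \<Omega> u\<close> borel_rep_measurable[OF U0] by (simp add: sq_int_def)
  have "\<forall>is. \<exists>g. length is \<le> ?n \<longrightarrow> borel_rep \<Omega> (?v is) g"
    using wd borel_rep_exists[OF \<Omega>(1)] unfolding is_weak_deriv_def L2_def by blast
  then obtain V where V: "\<And>is. length is \<le> ?n \<Longrightarrow> borel_rep \<Omega> (?v is) (V is)" by metis
  have W: "sq_norm \<Omega> (V is) < \<infinity> \<and> (\<forall>\<phi>. test_function \<Omega> \<phi> \<longrightarrow>
     (\<integral>x. U0 x * partials is \<phi> x \<partial>lborel) = (- 1) ^ length is * (\<integral>x. V is x * \<phi> x \<partial>lborel))"
    if l: "length is \<le> ?n" for "is"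
    using wd[OF l] is_weak_deriv_rep[OF \<Omega>(1) U0 V[OF l]] by blast
  have sqV: "sq_int \<Omega> (V is)" if l: "length is \<le> ?n" for "is"
    using W[OF l] borel_rep_measurable[OF V[OF l]] by (simp add: sq_int_def)
  have sobolev_family: "sobolev_family \<Omega> m ?N V"
    unfolding sobolev_family_def
  proof (intro conjI allI impI)
    fix "is" :: "'d list" assume l: "length is \<le> ?n"
    show "V is \<in> borel_measurable borel" using sqV[OF l] by (simp add: sq_int_def)
    have "enn2real (sq_norm \<Omega> (V is)) = (\<integral>x. (?v is x)\<^sup>2 \<partial>lebesgue_on \<Omega>)"
      by (rule integral_square_rep[OF \<Omega>(1) V[OF l], symmetric])
    also have "\<dots> \<le> (\<Sum>is | length is \<le> ?n. \<integral>x. (?v is x)\<^sup>2 \<partial>lebesgue_on \<Omega>)"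
      by (rule member_le_sum) (auto simp: l finite_lists_length)
    also have "\<dots> \<le> ?N" unfolding sobolev_norm_square by (auto intro!: sum_nonneg)
    finally have "ennreal (enn2real (sq_norm \<Omega> (V is))) \<le> ennreal ?N" by (rule ennreal_leI)
    moreover have "ennreal (enn2real (sq_norm \<Omega> (V is))) = sq_norm \<Omega> (V is)" using W[OF l] by simp
    ultimately show "sq_norm \<Omega> (V is) \<le> ennreal ?N" by (simp only:)
  next
    fix "is" :: "'d list" and i assume l: "length is < ?n"
    show "weak_partial \<Omega> i (V is) (V (is @ [i]))"
      unfolding weak_partial_def
    proof (intro allI impI)
      fix \<phi> assume \<phi>: "test_function \<Omega> \<phi>"
      have l1: "length is \<le> ?n" and l2: "length (is @ [i]) \<le> ?n" using l by auto
      have "(\<integral>x. U0 x * partials is (partial i \<phi>) x \<partial>lborel) = (- 1) ^ length is * (\<integral>x. V is x * partial i \<phi> x \<partial>lborel)"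
        using W[OF l1] test_function_partial[OF \<phi>] by blast
      moreover have "(\<integral>x. U0 x * partials (is @ [i]) \<phi> x \<partial>lborel) = (- 1) ^ length (is @ [i]) * (\<integral>x. V (is @ [i]) x * \<phi> x \<partial>lborel)"
        using W[OF l2] \<phi> by blast
      ultimately have "(- 1) ^ length is * (\<integral>x. V is x * partial i \<phi> x \<partial>lborel) = (- 1) ^ length is * (- (\<integral>x. V (is @ [i]) x * \<phi> x \<partial>lborel))"
        by (simp add: partials_snoc)
      then show "(\<integral>x. V is x * partial i \<phi> x \<partial>lborel) = - (\<integral>x. V (is @ [i]) x * \<phi> x \<partial>lborel)"
        by (subst (asm) mult_left_cancel) auto
    qed
  next
    fix "is" :: "'d list" assume m: "m \<notin> \<int>" and l: "length is = ?n"
    have r: "borel_rep \<Omega> (?v is) (V is)" by (rule V) (simp add: l)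
    have s: "slobodeckij \<Omega> (frac m) (?v is) < \<infinity>" using u m l unfolding sobolev_def by blast
    have "enn2real (slobodeckij \<Omega> (frac m) (?v is)) \<le> (\<Sum>is | length is = ?n. enn2real (slobodeckij \<Omega> (frac m) (?v is)))"
      by (rule member_le_sum) (auto simp: l finite_lists_length_eq)
    also have "\<dots> \<le> ?N" unfolding sobolev_norm_square using m by (auto intro!: sum_nonneg)
    finally have "ennreal (enn2real (slobodeckij \<Omega> (frac m) (?v is))) \<le> ennreal ?N" by (rule ennreal_leI)
    moreover have "ennreal (enn2real (slobodeckij \<Omega> (frac m) (?v is))) = slobodeckij \<Omega> (frac m) (?v is)" using s by simp
    ultimately show "Slob \<Omega> (frac m) (V is) \<le> ennreal ?N" by (simp only: slobodeckij_rep[OF \<Omega>(1) r])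
  qed
  \<comment> \<open>The chosen derivative for the empty list need not be u itself; uniqueness shows
    that it equals u almost everywhere.\<close>
  have "AE x in lborel. x \<in> \<Omega> \<longrightarrow> U0 x = V [] x"
    by (rule weak_deriv_unique[OF \<Omega> sqU sqV]) (use W[of "[]"] in auto)
  then have "AE x in lborel. x \<in> \<Omega> \<longrightarrow> u x = V [] x" using borel_rep_AE[OF U0] by eventually_elim auto
  then have "borel_rep \<Omega> u (V [])" using sqV[of "[]"] by (simp add: borel_rep_def sq_int_def)
  then show ?thesis using sobolev_family by blast
qed

text \<open>By uniqueness, V represents the chosen weak derivatives. The factor 2 accounts for the
  L2 terms and the Slobodeckij terms, each at most as numerous as the lists.\<close>

lemma sobolev_family_imp_sobolev:
  fixes \<Omega> :: "(real ^ 'd) set"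
  assumes \<Omega>: "open \<Omega>" "bounded \<Omega>" and N: "0 \<le> N" and V: "sobolev_family \<Omega> m N V" and u: "borel_rep \<Omega> u (V [])"
  shows "u \<in> sobolev \<Omega> m"
    and "(sobolev_norm \<Omega> m u)\<^sup>2 \<le> 2 * real (card {is :: 'd list. length is \<le> nat \<lfloor>m\<rfloor>}) * N"
proof -
  let ?n = "nat \<lfloor>m\<rfloor>" let ?v = "\<lambda>is. weak_deriv \<Omega> is u"
  have wd: "is_weak_deriv \<Omega> is u (V is)" if l: "length is \<le> ?n" for "is"
    unfolding is_weak_deriv_rep[OF \<Omega>(1) u borel_rep_refl[OF sobolev_family_measurable[OF V l]]]
    using sobolev_family_sq[OF V l] sobolev_family_partials[OF V l] by (simp add: sq_int_def)
  have r: "borel_rep \<Omega> (?v is) (V is)" if l: "length is \<le> ?n" for "is"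
  proof -
    have w: "is_weak_deriv \<Omega> is u (?v is)"
      unfolding weak_deriv_def by (rule someI[of "is_weak_deriv \<Omega> is u", OF wd[OF l]])
    then have "?v is \<in> borel_measurable (lebesgue_on \<Omega>)" by (simp add: is_weak_deriv_def L2_def)
    then obtain W where W: "borel_rep \<Omega> (?v is) W" using borel_rep_exists[OF \<Omega>(1)] by blast
    have W2: "sq_norm \<Omega> W < \<infinity>" "\<And>\<phi>. test_function \<Omega> \<phi> \<Longrightarrow>
       (\<integral>x. V [] x * partials is \<phi> x \<partial>lborel) = (- 1) ^ length is * (\<integral>x. W x * \<phi> x \<partial>lborel)"
      using w is_weak_deriv_rep[OF \<Omega>(1) u W] by blast+
    have "AE x in lborel. x \<in> \<Omega> \<longrightarrow> W x = V is x"
    proof (rule weak_deriv_unique[OF \<Omega> _ sobolev_family_sq[OF V l]])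
      show "sq_int \<Omega> W" using W2(1) borel_rep_measurable[OF W] by (simp add: sq_int_def)
      fix \<phi> :: "real ^ 'd \<Rightarrow> real" assume \<phi>: "test_function \<Omega> \<phi>"
      have "(- 1) ^ length is * (\<integral>x. W x * \<phi> x \<partial>lborel) = (- 1) ^ length is * (\<integral>x. V is x * \<phi> x \<partial>lborel)"
        using W2(2)[OF \<phi>] sobolev_family_partials[OF V l \<phi>] by simp
      then show "(\<integral>x. W x * \<phi> x \<partial>lborel) = (\<integral>x. V is x * \<phi> x \<partial>lborel)" by simp
    qed
    then have "AE x in lborel. x \<in> \<Omega> \<longrightarrow> ?v is x = V is x" using borel_rep_AE[OF W] by eventually_elim auto
    then show ?thesis using sobolev_family_measurable[OF V l] by (simp add: borel_rep_def)
  qed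
  have sl: "slobodeckij \<Omega> (frac m) (?v is) \<le> ennreal N" if "m \<notin> \<int>" "length is = ?n" for "is"
    using slobodeckij_rep[OF \<Omega>(1) r, of "is" "frac m"] sobolev_family_Slob[OF V that] that by simp
  have "L2 \<Omega> u" using L2_rep[OF \<Omega>(1) u] sobolev_family_sq[OF V, of "[]"] by (simp add: sq_int_def)
  moreover have "slobodeckij \<Omega> (frac m) (?v is) < \<infinity>" if "m \<notin> \<int>" "length is = ?n" for "is"
    using sl[OF that] by (auto intro: le_less_trans[OF _ ennreal_less_top])
  ultimately show "u \<in> sobolev \<Omega> m" unfolding sobolev_def using wd by blast
  let ?c = "real (card {is :: 'd list. length is \<le> ?n})"
  have 1: "(\<Sum>is | length is \<le> ?n. \<integral>x. (?v is x)\<^sup>2 \<partial>lebesgue_on \<Omega>) \<le> ?c * N"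
  proof (rule sum_bounded_above[of "{is :: 'd list. length is \<le> ?n}", simplified])
    fix "is" :: "'d list" assume l: "length is \<le> ?n"
    have "(\<integral>x. (?v is x)\<^sup>2 \<partial>lebesgue_on \<Omega>) = enn2real (sq_norm \<Omega> (V is))"
      by (rule integral_square_rep[OF \<Omega>(1) r[OF l]])
    also have "\<dots> \<le> N" using sobolev_family_E2[OF V l] N by (simp add: enn2real_leI)
    finally show "(\<integral>x. (?v is x)\<^sup>2 \<partial>lebesgue_on \<Omega>) \<le> N" .
  qed
  have 2: "(if m \<in> \<int> then 0 else \<Sum>is | length is = ?n. enn2real (slobodeckij \<Omega> (frac m) (?v is))) \<le> ?c * N"
  proof (cases "m \<in> \<int>")
    case False
    have "(\<Sum>is | length is = ?n. enn2real (slobodeckij \<Omega> (frac m) (?v is))) \<le> real (card {is :: 'd list. length is = ?n}) * N"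
      by (rule sum_bounded_above) (use sl[OF False] N in \<open>auto intro: enn2real_leI\<close>)
    also have "\<dots> \<le> ?c * N"
      using N by (intro mult_right_mono of_nat_mono card_mono finite_lists_length) auto
    finally show ?thesis using False by simp
  qed (use N in simp)
  show "(sobolev_norm \<Omega> m u)\<^sup>2 \<le> 2 * ?c * N"
    unfolding sobolev_norm_square by (rule order_trans[OF add_mono[OF 1 2]]) (simp add: mult.assoc)
qed

section \<open>Dilations\<close>

lemma partial_scale:
  fixes f :: "real ^ 'd \<Rightarrow> real"
  assumes "f differentiable (at (c *\<^sub>R x))"
  shows "partial i (\<lambda>y. k * f (c *\<^sub>R y)) x = k * c * partial i f (c *\<^sub>R x)"
proof -
  have 1: "((\<lambda>y. c *\<^sub>R y) has_derivative (\<lambda>v. c *\<^sub>R v)) (at x)" by (auto intro!: derivative_eq_intros)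
  obtain D where D: "(f has_derivative D) (at (c *\<^sub>R x))" using assms by (auto simp: differentiable_def)
  have "((\<lambda>y. k * f (c *\<^sub>R y)) has_derivative (\<lambda>v. k * D (c *\<^sub>R v))) (at x)"
    by (rule has_derivative_mult_right) (rule has_derivative_compose[OF 1 D])
  from partial_eqI[OF this] show ?thesis
    using linear_cmul[OF has_derivative_linear[OF D]] by (simp add: partial_eqI[OF D])
qed

lemma smooth_scale:
  fixes \<phi> :: "real ^ 'd \<Rightarrow> real"
  assumes "smooth \<phi>" shows "partials is (\<lambda>y. \<phi> (c *\<^sub>R y)) = (\<lambda>y. c ^ length is * partials is \<phi> (c *\<^sub>R y))"
proof (induction "is")
  case (Cons i "is")
  have "partial i (\<lambda>y. c ^ length is * partials is \<phi> (c *\<^sub>R y)) x = c ^ length is * c * partial i (partials is \<phi>) (c *\<^sub>R x)" for x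
    by (rule partial_scale) (use assms in \<open>auto simp: smooth_def\<close>)
  then show ?case by (simp add: partials_Cons Cons mult.commute fun_eq_iff)
qed simp

lemma test_function_scale:
  fixes \<phi> :: "real ^ 'd \<Rightarrow> real"
  assumes \<phi>: "test_function U' \<phi>" and h: "h > 0" and U: "(\<lambda>x. h *\<^sub>R x) ` U' \<subseteq> U"
  shows "test_function U (\<lambda>y. \<phi> ((1 / h) *\<^sub>R y))"
proof -
  have sm: "smooth \<phi>" using \<phi> by (simp add: test_function_def)
  have "smooth (\<lambda>y. \<phi> ((1 / h) *\<^sub>R y))"
    unfolding smooth_def smooth_scale[OF sm]
  proof (intro allI)
    fix "is" and x :: "real ^ 'd"
    have "(\<lambda>y. partials is \<phi> ((1 / h) *\<^sub>R y)) differentiable at x"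
      using differentiable_chain_at[of "\<lambda>y. (1 / h) *\<^sub>R y" x "partials is \<phi>"] sm by (simp add: smooth_def o_def)
    then show "(\<lambda>y. (1 / h) ^ length is * partials is \<phi> ((1 / h) *\<^sub>R y)) differentiable at x"
      by (intro differentiable_mult) auto
  qed
  moreover have supp: "closure {y. \<phi> ((1 / h) *\<^sub>R y) \<noteq> 0} = (\<lambda>x. h *\<^sub>R x) ` closure {x. \<phi> x \<noteq> 0}"
  proof -
    have "{y. \<phi> ((1 / h) *\<^sub>R y) \<noteq> 0} = (\<lambda>x. h *\<^sub>R x) ` {x. \<phi> x \<noteq> 0}"
    proof safe
      fix y assume "\<phi> ((1 / h) *\<^sub>R y) \<noteq> 0"
      moreover have "y = h *\<^sub>R ((1 / h) *\<^sub>R y)" using h by simp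
      ultimately show "y \<in> (\<lambda>x. h *\<^sub>R x) ` {x. \<phi> x \<noteq> 0}" by blast
    qed (use h in simp)
    then show ?thesis by (simp add: closure_scaleR)
  qed
  moreover have "compact ((\<lambda>x. h *\<^sub>R x) ` closure {x. \<phi> x \<noteq> 0})"
    using \<phi> by (intro compact_continuous_image continuous_intros) (simp add: test_function_def)
  moreover have "(\<lambda>x. h *\<^sub>R x) ` closure {x. \<phi> x \<noteq> 0} \<subseteq> U"
    using \<phi> U unfolding test_function_def by blast
  ultimately show ?thesis unfolding test_function_def by simp
qed

text \<open>The factor h comes from the chain rule for the dilated test function, while the
  Jacobians on both sides cancel; k carries the factors collected at lower orders.\<close>

lemma weak_partial_scale:
  fixes f :: "real ^ 'd \<Rightarrow> real"
  assumes w: "weak_partial U i f g" and h: "h > 0" and U: "(\<lambda>x. h *\<^sub>R x) ` U' \<subseteq> U"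
    and fm: "f \<in> borel_measurable borel" "g \<in> borel_measurable borel"
  shows "weak_partial U' i (\<lambda>x. k * f (h *\<^sub>R x)) (\<lambda>x. (k * h) * g (h *\<^sub>R x))"
  unfolding weak_partial_def
proof (intro allI impI)
  fix \<phi> assume \<phi>: "test_function U' \<phi>"
  note [measurable] = fm test_function_measurable[OF \<phi>] test_function_measurable[OF test_function_partial[OF \<phi>, of i]]
  let ?\<psi> = "\<lambda>y. \<phi> ((1 / h) *\<^sub>R y)"
  have \<psi>: "test_function U ?\<psi>" by (rule test_function_scale[OF \<phi> h U])
  have p: "partial i ?\<psi> y = (1 / h) * partial i \<phi> ((1 / h) *\<^sub>R y)" for y
    using partial_scale[of \<phi> "1 / h" y i 1] test_function_differentiable[OF \<phi>] by simp
  have hd: "\<bar>h\<bar> ^ DIM(real ^ 'd) \<noteq> 0" using h by simp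
  have "(\<integral>y. f y * partial i ?\<psi> y \<partial>lborel) = - (\<integral>y. g y * ?\<psi> y \<partial>lborel)"
    using w \<psi> unfolding weak_partial_def by blast
  moreover have "(\<integral>y. f y * partial i ?\<psi> y \<partial>lborel) = \<bar>h\<bar> ^ DIM(real ^ 'd) * (\<integral>x. f (h *\<^sub>R x) * ((1 / h) * partial i \<phi> x) \<partial>lborel)"
    unfolding p using integral_lborel_affine[of "\<lambda>y. f y * ((1 / h) * partial i \<phi> ((1 / h) *\<^sub>R y))" h 0] h by simp
  moreover have "(\<integral>y. g y * ?\<psi> y \<partial>lborel) = \<bar>h\<bar> ^ DIM(real ^ 'd) * (\<integral>x. g (h *\<^sub>R x) * \<phi> x \<partial>lborel)"
    using integral_lborel_affine[of "\<lambda>y. g y * ?\<psi> y" h 0] h by simp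
  ultimately have "\<bar>h\<bar> ^ DIM(real ^ 'd) * (\<integral>x. f (h *\<^sub>R x) * ((1 / h) * partial i \<phi> x) \<partial>lborel) = \<bar>h\<bar> ^ DIM(real ^ 'd) * (- (\<integral>x. g (h *\<^sub>R x) * \<phi> x \<partial>lborel))"
    by simp
  then have e: "(\<integral>x. f (h *\<^sub>R x) * ((1 / h) * partial i \<phi> x) \<partial>lborel) = - (\<integral>x. g (h *\<^sub>R x) * \<phi> x \<partial>lborel)"
    by (rule mult_left_cancel[OF hd, THEN iffD1])
  have "(\<integral>x. k * f (h *\<^sub>R x) * partial i \<phi> x \<partial>lborel) = (\<integral>x. (k * h) * (f (h *\<^sub>R x) * ((1 / h) * partial i \<phi> x)) \<partial>lborel)"
    using h by (intro Bochner_Integration.integral_cong) auto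
  also have "\<dots> = (k * h) * (- (\<integral>x. g (h *\<^sub>R x) * \<phi> x \<partial>lborel))"
    by (simp only: integral_mult_right_zero e)
  also have "\<dots> = - (\<integral>x. (k * h) * (g (h *\<^sub>R x) * \<phi> x) \<partial>lborel)"
    by (simp only: integral_mult_right_zero)
  finally show "(\<integral>x. k * f (h *\<^sub>R x) * partial i \<phi> x \<partial>lborel) = - (\<integral>x. k * h * g (h *\<^sub>R x) * \<phi> x \<partial>lborel)"
    by (simp only: mult.assoc)
qed

lemma sq_norm_scale:
  fixes f :: "real ^ 'd \<Rightarrow> real"
  assumes [measurable]: "f \<in> borel_measurable borel" "U \<in> sets borel" and h: "h > 0" and U: "(\<lambda>x. h *\<^sub>R x) ` U' \<subseteq> U"
  shows "sq_norm U' (\<lambda>x. k * f (h *\<^sub>R x)) \<le> ennreal (k\<^sup>2 / h ^ CARD('d)) * sq_norm U f"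
proof -
  have "sq_norm U' (\<lambda>x. k * f (h *\<^sub>R x)) \<le> (\<integral>\<^sup>+x. ennreal (k\<^sup>2) * (indicator U (0 + h *\<^sub>R x) * ennreal ((f (0 + h *\<^sub>R x))\<^sup>2)) \<partial>lborel)"
    unfolding sq_norm_def using U
    by (intro nn_integral_mono) (auto simp: indicator_def power_mult_distrib ennreal_mult)
  also have "\<dots> = ennreal (k\<^sup>2) * (\<integral>\<^sup>+x. indicator U (0 + h *\<^sub>R x) * ennreal ((f (0 + h *\<^sub>R x))\<^sup>2) \<partial>lborel)"
    by (rule nn_integral_cmult) measurable
  also have "(\<integral>\<^sup>+x. indicator U (0 + h *\<^sub>R x) * ennreal ((f (0 + h *\<^sub>R x))\<^sup>2) \<partial>lborel) = ennreal (1 / h ^ CARD('d)) * sq_norm U f"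
  proof -
    have "sq_norm U f = ennreal (\<bar>h\<bar> ^ DIM(real ^ 'd)) * (\<integral>\<^sup>+x. indicator U (0 + h *\<^sub>R x) * ennreal ((f (0 + h *\<^sub>R x))\<^sup>2) \<partial>lborel)"
      unfolding sq_norm_def by (rule nn_integral_lborel_affine) (use h in auto)
    then have "ennreal (1 / h ^ CARD('d)) * sq_norm U f = ennreal (1 / h ^ CARD('d) * \<bar>h\<bar> ^ DIM(real ^ 'd)) * (\<integral>\<^sup>+x. indicator U (0 + h *\<^sub>R x) * ennreal ((f (0 + h *\<^sub>R x))\<^sup>2) \<partial>lborel)"
      using h by (subst ennreal_mult) (auto simp: mult.assoc)
    then show ?thesis using h by simp
  qed
  also have "ennreal (k\<^sup>2) * (ennreal (1 / h ^ CARD('d)) * sq_norm U f) = ennreal (k\<^sup>2 * (1 / h ^ CARD('d))) * sq_norm U f"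
    using h by (subst ennreal_mult) (auto simp: mult.assoc)
  finally show ?thesis by simp
qed

text \<open>The two integrations contribute \<open>h powr (- 2 * d)\<close> and the kernel
  \<open>h powr (d + 2 * \<sigma>)\<close>.\<close>

lemma Slob_scale:
  fixes f :: "real ^ 'd \<Rightarrow> real"
  assumes [measurable]: "f \<in> borel_measurable borel" "U \<in> sets borel" and h: "h > 0" and U: "(\<lambda>x. h *\<^sub>R x) ` U' \<subseteq> U"
  shows "Slob U' \<sigma> (\<lambda>x. k * f (h *\<^sub>R x)) \<le> ennreal (k\<^sup>2 * h powr (2 * \<sigma> - real CARD('d))) * Slob U \<sigma> f"
proof -
  let ?a = "real CARD('d) + 2 * \<sigma>" let ?d = "ennreal (h ^ CARD('d))"
  define H where "H x y = indicator U x * (indicator U y * ennreal ((f x - f y)\<^sup>2 / norm (x - y) powr ?a))" for x y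
  have [measurable]: "(\<lambda>(x, y). H x y) \<in> borel_measurable (borel \<Otimes>\<^sub>M borel)" unfolding H_def by measurable
  have S: "Slob U \<sigma> f = (\<integral>\<^sup>+x. \<integral>\<^sup>+y. H x y \<partial>lborel \<partial>lborel)"
    unfolding Slob_def H_def by (simp add: nn_integral_cmult)
  also have "\<dots> = ?d * (\<integral>\<^sup>+x. \<integral>\<^sup>+y. H (h *\<^sub>R x) y \<partial>lborel \<partial>lborel)"
    using nn_integral_lborel_affine[of "\<lambda>x. \<integral>\<^sup>+y. H x y \<partial>lborel" h 0] h by simp
  also have "(\<integral>\<^sup>+x. \<integral>\<^sup>+y. H (h *\<^sub>R x) y \<partial>lborel \<partial>lborel) = (\<integral>\<^sup>+x. ?d * (\<integral>\<^sup>+y. H (h *\<^sub>R x) (h *\<^sub>R y) \<partial>lborel) \<partial>lborel)"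
    using nn_integral_lborel_affine[of "\<lambda>y. H (h *\<^sub>R _) y" h 0] h by (intro nn_integral_cong) simp
  also have "\<dots> = ?d * (\<integral>\<^sup>+x. \<integral>\<^sup>+y. H (h *\<^sub>R x) (h *\<^sub>R y) \<partial>lborel \<partial>lborel)"
    by (rule nn_integral_cmult) measurable
  finally have SH: "Slob U \<sigma> f = ?d * (?d * (\<integral>\<^sup>+x. \<integral>\<^sup>+y. H (h *\<^sub>R x) (h *\<^sub>R y) \<partial>lborel \<partial>lborel))" .
  let ?J = "\<integral>\<^sup>+x. \<integral>\<^sup>+y. H (h *\<^sub>R x) (h *\<^sub>R y) \<partial>lborel \<partial>lborel"
  let ?c = "k\<^sup>2 * h powr ?a"
  have pt: "indicator U' x * (indicator U' y * ennreal ((k * f (h *\<^sub>R x) - k * f (h *\<^sub>R y))\<^sup>2 / norm (x - y) powr ?a)) \<le> ennreal ?c * H (h *\<^sub>R x) (h *\<^sub>R y)" for x y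
  proof (cases "x \<in> U' \<and> y \<in> U'")
    case True
    then have hU: "h *\<^sub>R x \<in> U" "h *\<^sub>R y \<in> U" using U by auto
    have "norm (h *\<^sub>R x - h *\<^sub>R y) = h * norm (x - y)" using h by (simp flip: scaleR_diff_right)
    then have "norm (h *\<^sub>R x - h *\<^sub>R y) powr ?a = h powr ?a * norm (x - y) powr ?a" by (simp add: powr_mult)
    moreover have "(k * f (h *\<^sub>R x) - k * f (h *\<^sub>R y))\<^sup>2 = k\<^sup>2 * (f (h *\<^sub>R x) - f (h *\<^sub>R y))\<^sup>2"
      by (simp add: power_mult_distrib flip: right_diff_distrib)
    ultimately have "(k * f (h *\<^sub>R x) - k * f (h *\<^sub>R y))\<^sup>2 / norm (x - y) powr ?a = ?c * ((f (h *\<^sub>R x) - f (h *\<^sub>R y))\<^sup>2 / norm (h *\<^sub>R x - h *\<^sub>R y) powr ?a)"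
      using h by simp
    then show ?thesis using True hU by (simp only: H_def indicator_simps mult_1_left) (simp add: ennreal_mult[symmetric])
  qed (auto simp: indicator_def)
  have "Slob U' \<sigma> (\<lambda>x. k * f (h *\<^sub>R x)) \<le> (\<integral>\<^sup>+x. \<integral>\<^sup>+y. ennreal ?c * H (h *\<^sub>R x) (h *\<^sub>R y) \<partial>lborel \<partial>lborel)"
    unfolding Slob_def
  proof (rule nn_integral_mono)
    fix x
    have "indicator U' x * (\<integral>\<^sup>+y. indicator U' y * ennreal ((k * f (h *\<^sub>R x) - k * f (h *\<^sub>R y))\<^sup>2 / norm (x - y) powr ?a) \<partial>lborel) =
      (if x \<in> U' then (\<integral>\<^sup>+y. indicator U' x * (indicator U' y * ennreal ((k * f (h *\<^sub>R x) - k * f (h *\<^sub>R y))\<^sup>2 / norm (x - y) powr ?a)) \<partial>lborel) else 0)"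
      by simp
    also have "\<dots> \<le> (\<integral>\<^sup>+y. ennreal ?c * H (h *\<^sub>R x) (h *\<^sub>R y) \<partial>lborel)"
    proof (cases "x \<in> U'")
      case True then show ?thesis by (simp only: if_True) (rule nn_integral_mono, rule pt)
    qed simp
    finally show "indicator U' x * (\<integral>\<^sup>+y. indicator U' y * ennreal ((k * f (h *\<^sub>R x) - k * f (h *\<^sub>R y))\<^sup>2 / norm (x - y) powr ?a) \<partial>lborel) \<le> (\<integral>\<^sup>+y. ennreal ?c * H (h *\<^sub>R x) (h *\<^sub>R y) \<partial>lborel)" .
  qed
  also have "\<dots> = ennreal ?c * ?J" by (simp add: nn_integral_cmult)
  also have "\<dots> = ennreal (k\<^sup>2 * h powr (2 * \<sigma> - real CARD('d))) * Slob U \<sigma> f"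
  proof -
    have "h powr (2 * \<sigma> - real CARD('d)) * (h ^ CARD('d) * h ^ CARD('d)) = h powr (2 * \<sigma> - real CARD('d)) * (h powr real CARD('d) * h powr real CARD('d))"
      using h by (simp add: powr_realpow)
    also have "\<dots> = h powr ?a" by (simp flip: powr_add)
    finally have e: "?c = k\<^sup>2 * h powr (2 * \<sigma> - real CARD('d)) * (h ^ CARD('d) * h ^ CARD('d))" by simp
    show ?thesis unfolding e SH using h by (simp add: ennreal_mult mult.assoc)
  qed
  finally show ?thesis .
qed

lemma sobolev_family_weaken: "sobolev_family U m N V \<Longrightarrow> N \<le> N' \<Longrightarrow> sobolev_family U m N' V"
  unfolding sobolev_family_def by (meson ennreal_leI order_trans)

lemma frac_floor_nat: "0 \<le> m \<Longrightarrow> real (nat \<lfloor>m\<rfloor>) + frac m = m"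
  by (simp add: frac_def)

text \<open>Purely qualitative, as N' depends on h. The sharp power of h is determined later and at
  the top order alone.\<close>

lemma sobolev_family_scale:
  fixes V :: "'d::finite list \<Rightarrow> real ^ 'd \<Rightarrow> real"
  assumes V: "sobolev_family U m N V" and N: "0 \<le> N" and h: "0 < h" and U: "U \<in> sets borel" "(\<lambda>x. h *\<^sub>R x) ` U' \<subseteq> U"
  shows "\<exists>N'\<ge>0. sobolev_family U' m N' (\<lambda>is x. h ^ length is * V is (h *\<^sub>R x))"
proof -
  let ?n = "nat \<lfloor>m\<rfloor>"
  define A where "A = (\<Sum>l\<le>?n. (h ^ l)\<^sup>2 / h ^ CARD('d)) + (h ^ ?n)\<^sup>2 * h powr (2 * frac m - real CARD('d))"
  have A0: "(\<Sum>l\<le>?n. (h ^ l)\<^sup>2 / h ^ CARD('d)) \<ge> 0" using h by (intro sum_nonneg) auto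
  have A: "A \<ge> 0" using A0 by (simp add: A_def)
  show ?thesis
  proof (intro exI[of _ "A * N"] conjI)
    show "0 \<le> A * N" using A N by simp
    show "sobolev_family U' m (A * N) (\<lambda>is x. h ^ length is * V is (h *\<^sub>R x))"
      unfolding sobolev_family_def
    proof (intro conjI allI impI)
      fix "is" :: "'d list" assume l: "length is \<le> ?n"
      have m[measurable]: "V is \<in> borel_measurable borel" by (rule sobolev_family_measurable[OF V l])
      show "(\<lambda>x. h ^ length is * V is (h *\<^sub>R x)) \<in> borel_measurable borel" by measurable
      have "sq_norm U' (\<lambda>x. h ^ length is * V is (h *\<^sub>R x)) \<le> ennreal ((h ^ length is)\<^sup>2 / h ^ CARD('d)) * sq_norm U (V is)"
        by (rule sq_norm_scale[OF m U(1) h U(2)])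
      also have "\<dots> \<le> ennreal A * ennreal N"
      proof (intro mult_mono sobolev_family_E2[OF V l] ennreal_leI)
        have "(h ^ length is)\<^sup>2 / h ^ CARD('d) \<le> (\<Sum>l\<le>?n. (h ^ l)\<^sup>2 / h ^ CARD('d))"
          using h l by (intro member_le_sum[of "length is" "{..?n}" "\<lambda>l. (h ^ l)\<^sup>2 / h ^ CARD('d)"]) auto
        also have "\<dots> \<le> A" by (simp add: A_def)
        finally show "(h ^ length is)\<^sup>2 / h ^ CARD('d) \<le> A" .
      qed auto
      finally show "sq_norm U' (\<lambda>x. h ^ length is * V is (h *\<^sub>R x)) \<le> ennreal (A * N)" using A N by (simp add: ennreal_mult)
    next
      fix "is" :: "'d list" and i assume l: "length is < ?n"
      have "weak_partial U' i (\<lambda>x. h ^ length is * V is (h *\<^sub>R x)) (\<lambda>x. (h ^ length is * h) * V (is @ [i]) (h *\<^sub>R x))"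
        by (rule weak_partial_scale[OF sobolev_family_wder[OF V l] h U(2)]) (use l in \<open>auto intro!: sobolev_family_measurable[OF V]\<close>)
      then show "weak_partial U' i (\<lambda>x. h ^ length is * V is (h *\<^sub>R x)) (\<lambda>x. h ^ length (is @ [i]) * V (is @ [i]) (h *\<^sub>R x))"
        by (simp add: mult.commute)
    next
      fix "is" :: "'d list" assume nz: "m \<notin> \<int>" and l: "length is = ?n"
      have m[measurable]: "V is \<in> borel_measurable borel" by (rule sobolev_family_measurable[OF V]) (simp add: l)
      have "Slob U' (frac m) (\<lambda>x. h ^ length is * V is (h *\<^sub>R x)) \<le> ennreal ((h ^ length is)\<^sup>2 * h powr (2 * frac m - real CARD('d))) * Slob U (frac m) (V is)"
        by (rule Slob_scale[OF m U(1) h U(2)])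
      also have "\<dots> \<le> ennreal A * ennreal N"
        by (intro mult_mono sobolev_family_Slob[OF V nz l] ennreal_leI) (use A0 in \<open>auto simp: A_def l\<close>)
      finally show "Slob U' (frac m) (\<lambda>x. h ^ length is * V is (h *\<^sub>R x)) \<le> ennreal (A * N)" using A N by (simp add: ennreal_mult)
    qed
  qed
qed

lemma borel_rep_scale:
  assumes r: "borel_rep U f g" and h: "0 < h" and U: "(\<lambda>x. h *\<^sub>R x) ` U' \<subseteq> U"
  shows "borel_rep U' (\<lambda>x. f (h *\<^sub>R x)) (\<lambda>x. g (h *\<^sub>R x))"
proof -
  have [measurable]: "g \<in> borel_measurable borel" by (rule borel_rep_measurable[OF r])
  have "AE x in lborel. (0 + h *\<^sub>R x \<in> U \<longrightarrow> f (0 + h *\<^sub>R x) = g (0 + h *\<^sub>R x))"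
    by (rule AE_lborel_affine[OF borel_rep_AE[OF r]]) (use h in simp)
  then have "AE x in lborel. x \<in> U' \<longrightarrow> f (h *\<^sub>R x) = g (h *\<^sub>R x)"
    by eventually_elim (use U in auto)
  then show ?thesis by (simp add: borel_rep_def)
qed

section \<open>Continuous representatives\<close>

lemma cont_rep_properties:
  fixes \<Omega> :: "(real ^ 'd) set"
  assumes \<Omega>: "open \<Omega>" and ex: "\<exists>v. continuous_on \<Omega> v \<and> (AE x in lborel. x \<in> \<Omega> \<longrightarrow> v x = u x)"
  shows "continuous_on \<Omega> (cont_rep \<Omega> u)" "AE x in lborel. x \<in> \<Omega> \<longrightarrow> cont_rep \<Omega> u x = u x"
proof -
  have iff: "(AE x in lebesgue_on \<Omega>. v x = u x) \<longleftrightarrow> (AE x in lborel. x \<in> \<Omega> \<longrightarrow> v x = u x)" for v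
    using \<Omega> by (subst AE_restrict_space_iff) (auto simp: AE_completion_iff)
  have "continuous_on \<Omega> (cont_rep \<Omega> u) \<and> (AE x in lebesgue_on \<Omega>. cont_rep \<Omega> u x = u x)"
    using someI_ex[of "\<lambda>v. continuous_on \<Omega> v \<and> (AE x in lebesgue_on \<Omega>. v x = u x)"] ex iff
    unfolding cont_rep_def by blast
  then show "continuous_on \<Omega> (cont_rep \<Omega> u)" "AE x in lborel. x \<in> \<Omega> \<longrightarrow> cont_rep \<Omega> u x = u x"
    unfolding iff by auto
qed

lemma cont_rep_continuous:
  assumes \<Omega>: "open \<Omega>" and p: "continuous_on \<Omega> p" and y: "y \<in> \<Omega>"
  shows "cont_rep \<Omega> p y = p y"
proof -
  have ex: "\<exists>v. continuous_on \<Omega> v \<and> (AE x in lborel. x \<in> \<Omega> \<longrightarrow> v x = p x)" using p by (intro exI[of _ p]) auto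
  show ?thesis by (rule continuous_AE_eq[OF \<Omega> cont_rep_properties(1)[OF \<Omega> ex] p cont_rep_properties(2)[OF \<Omega> ex] y])
qed

section \<open>Convergence rates\<close>

text \<open>Membership at the integer order \<open>\<lceil>\<mu>\<rceil>\<close> is immediate, and
  the embedding lowers the order. In particular F can be applied to polynomials.\<close>

lemma elementary_in_sobolev:
  fixes \<Omega> :: "(real ^ 'd) set"
  assumes \<Omega>: "open \<Omega>" "bounded \<Omega>" "chain_domain \<Omega>" and m: "0 \<le> \<mu>" and p: "p \<in> elementary"
  shows "p \<in> sobolev \<Omega> \<mu>"
proof -
  have b: "\<Omega> \<in> sets borel" using \<Omega> by auto
  obtain N where N: "N \<ge> 0" "sobolev_family \<Omega> (real (nat \<lceil>\<mu>\<rceil>)) N (\<lambda>is. partials is p)"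
    using elementary_fam[OF p b \<Omega>(2)] by blast
  have "\<mu> \<le> real (nat \<lceil>\<mu>\<rceil>)" by linarith
  then obtain C where "C \<ge> 0" "\<forall>V N. 0 \<le> N \<longrightarrow> sobolev_family \<Omega> (real (nat \<lceil>\<mu>\<rceil>)) N V \<longrightarrow> sobolev_family \<Omega> \<mu> (C * N) V"
    using sobolev_order_embedding[OF \<Omega> m] by blast
  then have "sobolev_family \<Omega> \<mu> (C * N) (\<lambda>is. partials is p)" "0 \<le> C * N" using N by auto
  then show ?thesis
    by (intro sobolev_family_imp_sobolev(1)[OF \<Omega>(1,2), where V = "\<lambda>is. partials is p"]) (auto intro: borel_rep_refl elementary_measurable p)
qed

text \<open>After subtraction of p, only derivatives of order M matter. For integer M they
  contribute 2 M - d by scaling and 2 \<tau> by decay on the ball of radius h R. A non-integer M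
  must equal m, and then the Slobodeckij seminorm scales directly.\<close>

lemma scaled_polynomial_approximation:
  fixes \<Omega> :: "(real ^ 'd) set"
  assumes R: "R > 0" and r0: "r0 > 0" and m: "0 \<le> m" and q: "0 < q"
    and M: "M = min m (real q)" and t: "\<tau> \<le> m - M" "2 * \<tau> < real CARD('d)"
  shows "\<exists>C\<ge>0. \<forall>V h. 0 < h \<longrightarrow> h \<le> 1 \<longrightarrow> h * R \<le> r0 \<longrightarrow> sobolev_family (ball (0 :: real ^ 'd) r0) m 1 V \<longrightarrow>
    (\<exists>p\<in>polys_of_order q. sobolev_family (ball 0 R) M (C * h powr (2 * (M + \<tau>) - real CARD('d)))
       (\<lambda>is x. h ^ length is * V is (h *\<^sub>R x) - partials is p x))"
proof -
  let ?B = "ball (0 :: real ^ 'd) R" and ?Br = "ball (0 :: real ^ 'd) r0"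
  let ?D = "real CARD('d)" and ?n = "nat \<lfloor>M\<rfloor>" and ?k = "nat \<lceil>M\<rceil>"
  have M0: "0 \<le> M" and Mm: "M \<le> m" and Mq: "M \<le> real q" using m M by auto
  have nm: "?n \<le> nat \<lfloor>m\<rfloor>" using Mm by (intro nat_mono floor_mono)
  have kq: "?k \<le> q" using Mq by (simp add: ceiling_le_iff nat_le_iff)
  have kn: "?k \<le> Suc ?n" using M0 by linarith
  have "\<tau> \<le> m - real ?n" using t(1) M0 of_nat_floor[OF M0] by linarith
  from family_decays[OF m r0 nm this t(2)] obtain C1 where C1: "C1 \<ge> 0"
    "\<And>(c :: real ^ 'd) V N is r. 0 \<le> N \<Longrightarrow> sobolev_family (ball c r0) m N V \<Longrightarrow> length is = ?n \<Longrightarrow> 0 < r \<and> r \<le> r0 \<Longrightarrow>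
       sq_norm (ball c r) (V is) \<le> ennreal (C1 * N * r powr (2 * \<tau>))"
    unfolding decays_def by meson
  from bramble_hilbert[OF M0 R, where 'd = 'd] obtain C2 where C20: "C2 \<ge> 0"
    and bh: "\<forall>(c :: real ^ 'd) W N0 N. 0 \<le> N \<longrightarrow> sobolev_family (ball c R) M N0 W \<longrightarrow>
     (\<forall>is. length is < ?k \<longrightarrow> mean (ball c R) (W is) = 0) \<longrightarrow>
     (M \<in> \<int> \<longrightarrow> (\<forall>is. length is = ?n \<longrightarrow> sq_norm (ball c R) (W is) \<le> ennreal N)) \<longrightarrow>
     (M \<notin> \<int> \<longrightarrow> (\<forall>is. length is = ?n \<longrightarrow> Slob (ball c R) (frac M) (W is) \<le> ennreal N)) \<longrightarrow>
     sobolev_family (ball c R) M (C2 * N) W"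
    by (elim exE conjE)
  note C2 = C20 bh[THEN spec, THEN spec, THEN spec, THEN spec, THEN mp, THEN mp, THEN mp, THEN mp, THEN mp]
  obtain C3 where C3: "\<And>V N. 0 \<le> N \<Longrightarrow> sobolev_family ?B m N V \<Longrightarrow> sobolev_family ?B M (C3 * N) V" "C3 \<ge> 0"
    using sobolev_order_embedding[OF open_ball bounded_ball convex_chain_domain[OF convex_ball] M0 Mm] by meson
  \<comment> \<open>The summand 1 serves the non-integer case, where the decay constant does not
    occur.\<close>
  define K where "K = C1 * R powr (2 * \<tau>) + 1"
  have K: "K \<ge> 1" using C1 by (simp add: K_def)
  show ?thesis
  proof (intro exI[of _ "C2 * K"] conjI allI impI)
    show "0 \<le> C2 * K" using C2 K by simp
    fix V and h :: real
    assume h: "0 < h" "h \<le> 1" "h * R \<le> r0" and V: "sobolev_family ?Br m 1 V"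
    let ?Vh = "\<lambda>is x. h ^ length is * V is (h *\<^sub>R x)"
    let ?N = "K * h powr (2 * (M + \<tau>) - ?D)"
    have N: "?N \<ge> 0" using K by simp
    have sub: "(\<lambda>x. h *\<^sub>R x) ` ?B \<subseteq> ball 0 (h * R)"
    proof
      fix z assume "z \<in> (\<lambda>x. h *\<^sub>R x) ` ?B"
      then obtain x where x: "z = h *\<^sub>R x" "x \<in> ?B" by blast
      have "norm z = h * norm x" using h(1) x by simp
      also have "\<dots> < h * R" using h(1) x by simp
      finally show "z \<in> ball 0 (h * R)" by simp
    qed
    have sub0: "ball (0 :: real ^ 'd) (h * R) \<subseteq> ?Br" using h by (intro subset_ball)
    obtain N1 where N1: "N1 \<ge> 0" "sobolev_family ?B m N1 ?Vh"
      using sobolev_family_scale[OF V zero_le_one h(1) ball_sets_borel order_trans[OF sub sub0]] by blast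
    have "?k \<le> Suc (nat \<lfloor>m\<rfloor>)" using kn nm by simp
    from poly_matching_means[OF R N1(2) this] obtain p where p: "p \<in> polys_of_order ?k"
      "\<forall>is. length is < ?k \<longrightarrow> mean ?B (\<lambda>x. ?Vh is x - partials is p x) = 0"
      "\<And>is. ?k \<le> length is \<Longrightarrow> partials is p = (\<lambda>x. 0)"
      "\<And>is. Suc (length is) = ?k \<Longrightarrow> \<exists>k. partials is p = (\<lambda>x. k)" by blast
    have top: "Suc ?n = ?k" if "M \<notin> \<int>"
    proof -
      have "\<lceil>M\<rceil> = \<lfloor>M\<rfloor> + 1" using that by (simp add: ceiling_altdef) (metis Ints_of_int)
      then show ?thesis using M0 by (simp add: nat_add_distrib)
    qed
    have NM: "0 \<le> C3 * N1" using C3 N1 by simp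
    have VM: "sobolev_family ?B M (C3 * N1) ?Vh" by (rule C3(1)[OF N1])
    have pe: "p \<in> elementary" by (rule polys_elem[OF p(1)])
    obtain N2 where N2: "sobolev_family ?B M N2 (\<lambda>is x. ?Vh is x - partials is p x)"
      using sobolev_family_minus_elem[OF VM pe _ bounded_ball NM] p(4) top by auto
    have powh: "(h ^ ?n)\<^sup>2 = h powr (2 * real ?n)"
      using h by (simp add: powr_realpow[symmetric] power2_eq_square flip: powr_add)
    have "sobolev_family ?B M (C2 * ?N) (\<lambda>is x. ?Vh is x - partials is p x)"
    proof (rule C2(2)[OF N N2 p(2)]; intro impI allI)
      fix "is" :: "'d list" assume Mi: "M \<in> \<int>" and l: "length is = ?n"
      have Mn: "real ?n = M" using Mi M0 by (auto elim!: Ints_cases)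
      \<comment> \<open>For integer M the order of p is M, so its derivatives of order M
        vanish.\<close>
      have "?k \<le> length is" using Mi M0 l by (auto elim!: Ints_cases)
      then have "sq_norm ?B (\<lambda>x. ?Vh is x - partials is p x) = sq_norm ?B (?Vh is)" using p(3) by simp
      also have "\<dots> \<le> ennreal ((h ^ ?n)\<^sup>2 / h ^ CARD('d)) * sq_norm (ball 0 (h * R)) (V is)"
        unfolding l by (rule sq_norm_scale[OF _ _ h(1) sub]) (use l nm in \<open>auto intro!: sobolev_family_measurable[OF V]\<close>)
      also have "\<dots> \<le> ennreal ((h ^ ?n)\<^sup>2 / h ^ CARD('d)) * ennreal (C1 * 1 * (h * R) powr (2 * \<tau>))"
        by (intro mult_left_mono C1(2)[OF _ V l]) (use h R in auto)
      also have "\<dots> = ennreal ((h ^ ?n)\<^sup>2 / h ^ CARD('d) * (C1 * 1 * (h * R) powr (2 * \<tau>)))"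
        using h C1 by (intro ennreal_mult[symmetric]) auto
      also have "\<dots> \<le> ennreal ?N"
      proof (rule ennreal_leI)
        have "(h ^ ?n)\<^sup>2 / h ^ CARD('d) = h powr (2 * M - ?D)"
          unfolding powh Mn powr_diff using h by (simp add: powr_realpow)
        then have "(h ^ ?n)\<^sup>2 / h ^ CARD('d) * (C1 * 1 * (h * R) powr (2 * \<tau>)) = C1 * R powr (2 * \<tau>) * (h powr (2 * M - ?D) * h powr (2 * \<tau>))"
          by (simp add: powr_mult)
        also have "h powr (2 * M - ?D) * h powr (2 * \<tau>) = h powr (2 * (M + \<tau>) - ?D)"
          unfolding powr_add[symmetric] by (simp add: algebra_simps)
        also have "C1 * R powr (2 * \<tau>) * h powr (2 * (M + \<tau>) - ?D) \<le> ?N"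
          by (intro mult_right_mono) (auto simp: K_def)
        finally show "(h ^ ?n)\<^sup>2 / h ^ CARD('d) * (C1 * 1 * (h * R) powr (2 * \<tau>)) \<le> ?N" .
      qed
      finally show "sq_norm ?B (\<lambda>x. ?Vh is x - partials is p x) \<le> ennreal ?N" .
    next
      fix "is" :: "'d list" assume Mi: "M \<notin> \<int>" and l: "length is = ?n"
      \<comment> \<open>As q is an integer, a non-integer minimum of m and q must be m.\<close>
      have Mm': "M = m" using Mi M by (auto simp: min_def split: if_splits)
      have nn: "nat \<lfloor>m\<rfloor> = ?n" using Mm' by simp
      obtain k where k: "partials is p = (\<lambda>x. k)" using p(4)[of "is"] top[OF Mi] l by auto
      have "Slob ?B (frac M) (\<lambda>x. ?Vh is x - partials is p x) = Slob ?B (frac M) (?Vh is)" by (simp add: Slob_def k)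
      also have "\<dots> \<le> ennreal ((h ^ ?n)\<^sup>2 * h powr (2 * frac M - ?D)) * Slob ?Br (frac M) (V is)"
        unfolding l by (rule Slob_scale[OF _ _ h(1) order_trans[OF sub sub0]]) (use l nm in \<open>auto intro!: sobolev_family_measurable[OF V]\<close>)
      also have "\<dots> \<le> ennreal ((h ^ ?n)\<^sup>2 * h powr (2 * frac M - ?D)) * ennreal 1"
        by (intro mult_left_mono sobolev_family_Slob[OF V, folded Mm']) (use Mi l in auto)
      also have "\<dots> = ennreal ((h ^ ?n)\<^sup>2 * h powr (2 * frac M - ?D))" by simp
      also have "\<dots> \<le> ennreal ?N"
      proof (rule ennreal_leI)
        have "(h ^ ?n)\<^sup>2 * h powr (2 * frac M - ?D) = h powr (2 * (real ?n + frac M) - ?D)"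
          unfolding powh powr_add[symmetric] by (simp add: algebra_simps)
        also have "real ?n + frac M = M" by (rule frac_floor_nat[OF M0])
        \<comment> \<open>Since M = m forces \<tau> \<le> 0, and h \<le> 1, only a weaker power is
          claimed than scaling provides.\<close>
        also have "h powr (2 * M - ?D) \<le> h powr (2 * (M + \<tau>) - ?D)"
          using t(1) Mm' h by (intro powr_mono') auto
        also have "\<dots> \<le> ?N"
          using mult_right_mono[OF K, of "h powr (2 * (M + \<tau>) - ?D)"] by simp
        finally show "(h ^ ?n)\<^sup>2 * h powr (2 * frac M - ?D) \<le> ?N" .
      qed
      finally show "Slob ?B (frac M) (\<lambda>x. ?Vh is x - partials is p x) \<le> ennreal ?N" .
    qed
    then have "sobolev_family ?B M (C2 * K * h powr (2 * (M + \<tau>) - ?D)) (\<lambda>is x. ?Vh is x - partials is p x)" by (simp add: mult.assoc)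
    then show "\<exists>p\<in>polys_of_order q. sobolev_family ?B M (C2 * K * h powr (2 * (M + \<tau>) - ?D)) (\<lambda>is x. ?Vh is x - partials is p x)"
      using polys_mono[OF p(1) kq] by blast
  qed
qed

text \<open>The order \<open>M\<close> is as much smoothness as polynomials of order \<open>q\<close> can exploit; the remaining smoothness
  \<open>m - M\<close> enters through the decay, with exponent \<open>\<tau>\<close>, of the \<open>L\<^sub>2\<close> norms of the derivatives of order \<open>M\<close> on
  small balls around the origin.\<close>

lemma stencil_rate:
  fixes \<Omega> X :: "(real ^ 'd) set"
  assumes bd: "bounded \<Omega>" and lip: "lipschitz_domain \<Omega>" and sc: "scalable \<Omega>"
    and X: "finite X" "X \<subseteq> \<Omega>"
    and mu: "\<mu> > real CARD('d) / 2"
    and F: "continuous_functional \<Omega> \<mu> F" and Fs: "has_scaling_order \<Omega> \<mu> F s"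
    and q: "real q \<ge> \<mu>" and pe: "poly_exact \<Omega> X a F q"
    and m: "\<mu> \<le> m" and M: "M = min m (real q)" and t: "\<tau> \<le> m - M" "2 * \<tau> < real CARD('d)"
  shows "stencil_has_rate \<Omega> X a F s m (M + \<tau> - s - real CARD('d) / 2)"
proof -
  let ?D = "real CARD('d)"
  have op: "open \<Omega>" using lip by (simp add: lipschitz_domain_def)
  have ob: "\<Omega> \<in> sets borel" using op by auto
  have ch: "chain_domain \<Omega>" by (rule lipschitz_chain_domain[OF bd lip])
  have mu0: "\<mu> > 0" using mu by (meson divide_nonneg_nonneg of_nat_0_le_iff order.strict_trans1 zero_le_numeral)
  have m0: "0 \<le> m" and mu00: "0 \<le> \<mu>" using m mu0 by auto
  have q0: "0 < q" using q mu0 by (cases q) auto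
  have muM: "\<mu> \<le> M" using m q M by simp
  obtain R0 where R0: "R0 > 0" "\<And>x. x \<in> \<Omega> \<Longrightarrow> norm x \<le> R0" using bd by (auto simp: bounded_pos)
  \<comment> \<open>The margin ensures that the unit ball around each node lies in the large ball,
    as needed for the pointwise estimate.\<close>
  define R where "R = R0 + 2"
  have R: "R > 0" using R0 by (simp add: R_def)
  have \<Omega>R: "\<Omega> \<subseteq> ball 0 R" using R0 by (force simp: R_def)
  have yR: "ball y 1 \<subseteq> ball 0 R" if "y \<in> \<Omega>" for y
  proof
    fix x assume "x \<in> ball y 1"
    then have "norm (x - y) < 1" by (simp add: dist_norm norm_minus_commute)
    then have "norm x < R" using R0(2)[OF that] norm_triangle_ineq[of "x - y" y] by (simp add: R_def)
    then show "x \<in> ball 0 R" by simp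
  qed
  have "0 \<in> \<Omega>" using sc interior_subset by (auto simp: scalable_def)
  then obtain r0 where r0: "r0 > 0" "ball 0 r0 \<subseteq> \<Omega>" using op openE by blast
  have hO: "(\<lambda>x. h *\<^sub>R x) ` \<Omega> \<subseteq> \<Omega>" if "0 < h" "h \<le> 1" for h
    using sc that by (auto simp: scalable_def)
  obtain C1 where C1: "C1 \<ge> 0" "\<And>V h. 0 < h \<Longrightarrow> h \<le> 1 \<Longrightarrow> h * R \<le> r0 \<Longrightarrow> sobolev_family (ball (0 :: real ^ 'd) r0) m 1 V \<Longrightarrow>
    (\<exists>p\<in>polys_of_order q. sobolev_family (ball 0 R) M (C1 * h powr (2 * (M + \<tau>) - ?D))
       (\<lambda>is x. h ^ length is * V is (h *\<^sub>R x) - partials is p x))"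
    using scaled_polynomial_approximation[OF R r0(1) m0 q0 M t] by meson
  obtain C2 where C2: "C2 \<ge> 0" "\<And>V N. 0 \<le> N \<Longrightarrow> sobolev_family (ball (0 :: real ^ 'd) R) M N V \<Longrightarrow> sobolev_family (ball 0 R) \<mu> (C2 * N) V"
    using sobolev_order_embedding[OF open_ball bounded_ball convex_chain_domain[OF convex_ball] mu00 muM] by meson
  obtain C3 where C3: "C3 \<ge> 0" "\<And>V N. 0 \<le> N \<Longrightarrow> sobolev_family \<Omega> m N V \<Longrightarrow> sobolev_family \<Omega> \<mu> (C3 * N) V"
    using sobolev_order_embedding[OF op bd ch mu00 m] by meson
  obtain C4 where C4: "C4 \<ge> 0" "\<And>(c :: real ^ 'd) V N w. 0 \<le> N \<Longrightarrow> sobolev_family (ball c 1) \<mu> N V \<Longrightarrow> continuous_on (ball c 1) w \<Longrightarrow>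
    (AE x in lborel. x \<in> ball c 1 \<longrightarrow> w x = V [] x) \<Longrightarrow> \<bar>w c\<bar> \<le> C4 * sqrt N"
    using sobolev_pointwise[OF mu] by meson
  obtain CF where CF: "\<And>u. u \<in> sobolev \<Omega> \<mu> \<Longrightarrow> \<bar>F u\<bar> \<le> CF * sobolev_norm \<Omega> \<mu> u"
    using F unfolding continuous_functional_def by blast
  have Fadd: "F (\<lambda>x. u x + v x) = F u + F v" if "u \<in> sobolev \<Omega> \<mu>" "v \<in> sobolev \<Omega> \<mu>" for u v
    using F that unfolding continuous_functional_def by blast
  define c where "c = 2 * real (card {is :: 'd list. length is \<le> nat \<lfloor>\<mu>\<rfloor>})"
  define C where "C = (\<bar>CF\<bar> * sqrt c + (\<Sum>y\<in>X. \<bar>a y\<bar> * C4)) * sqrt (C2 * C1)"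
  \<comment> \<open>Below h0 the dilation maps the large ball into the small one inside
    \<Omega>.\<close>
  define h0 where "h0 = min 1 (r0 / R)"
  have h0: "h0 > 0" using r0 R by (simp add: h0_def)
  have main: "\<bar>stencil_error \<Omega> X a F s h u\<bar> \<le> C * h powr (M + \<tau> - s - ?D / 2)"
    if h: "0 < h" "h < h0" and u: "u \<in> sobolev \<Omega> m" "sobolev_norm \<Omega> m u \<le> 1" for h u
  proof -
    have h1: "h \<le> 1" "h * R \<le> r0" using h R by (auto simp: h0_def field_simps)
    obtain V0 where V0: "sobolev_family \<Omega> m ((sobolev_norm \<Omega> m u)\<^sup>2) V0" "borel_rep \<Omega> u (V0 [])"
      using sobolev_imp_fam[OF op bd u(1)] by blast
    have sn0: "sobolev_norm \<Omega> m u \<ge> 0" unfolding sobolev_norm_def by (intro real_sqrt_ge_zero add_nonneg_nonneg sum_nonneg) (auto intro: sum_nonneg)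
    have V: "sobolev_family \<Omega> m 1 V0" by (rule sobolev_family_weaken[OF V0(1)]) (use u(2) sn0 in \<open>simp add: power_le_one\<close>)
    have Vmu: "sobolev_family \<Omega> \<mu> (C3 * 1) V0" by (rule C3(2)[OF zero_le_one V])
    let ?u = "cont_rep \<Omega> u"
    have mD: "m > ?D / 2" using mu m by simp
    have uex: "\<exists>v. continuous_on \<Omega> v \<and> (AE x in lborel. x \<in> \<Omega> \<longrightarrow> v x = u x)"
    proof -
      obtain w where w: "continuous_on \<Omega> w" "AE x in lborel. x \<in> \<Omega> \<longrightarrow> w x = V0 [] x"
        using continuous_representative[OF mD op bd zero_le_one V] by blast
      have "AE x in lborel. x \<in> \<Omega> \<longrightarrow> w x = u x" using w(2) borel_rep_AE[OF V0(2)] by eventually_elim auto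
      then show ?thesis using w(1) by blast
    qed
    note urep = cont_rep_properties[OF op uex]
    \<comment> \<open>Needed in order to apply the scaling order to u; the embedding constant C3
      does not enter C.\<close>
    have usob: "u \<in> sobolev \<Omega> \<mu>" by (rule sobolev_family_imp_sobolev(1)[OF op bd _ Vmu V0(2)]) (use C3 in simp)
    define v where "v = (\<lambda>x. u (h *\<^sub>R x))"
    let ?Vh = "\<lambda>is x. h ^ length is * V0 is (h *\<^sub>R x)"
    have vrep: "borel_rep \<Omega> v (?Vh [])" unfolding v_def using borel_rep_scale[OF V0(2) h(1) hO[OF h(1) h1(1)]] by simp
    define Nh where "Nh = C2 * (C1 * h powr (2 * (M + \<tau>) - ?D))"
    have Nh: "Nh \<ge> 0" using C1 C2 by (simp add: Nh_def)
    obtain p where p: "p \<in> polys_of_order q" "sobolev_family (ball 0 R) M (C1 * h powr (2 * (M + \<tau>) - ?D)) (\<lambda>is x. ?Vh is x - partials is p x)"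
      using C1(2)[OF h(1) h1 sobolev_family_mono[OF V r0(2)]] by blast
    let ?W = "\<lambda>is x. ?Vh is x - partials is p x"
    have WB: "sobolev_family (ball 0 R) \<mu> Nh ?W" unfolding Nh_def by (rule C2(2)[OF _ p(2)]) (use C1 in simp)
    have W\<Omega>: "sobolev_family \<Omega> \<mu> Nh ?W" by (rule sobolev_family_mono[OF WB \<Omega>R])
    have pelem: "p \<in> elementary" by (rule polys_elem[OF p(1)])
    have psob: "p \<in> sobolev \<Omega> \<mu>" by (rule elementary_in_sobolev[OF op bd ch mu00 pelem])
    have wrep: "borel_rep \<Omega> (\<lambda>x. v x - p x) (?W [])"
    proof -
      have "AE x in lborel. x \<in> \<Omega> \<longrightarrow> v x - p x = ?W [] x" using borel_rep_AE[OF vrep] by eventually_elim auto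
      moreover have "?W [] \<in> borel_measurable borel" by (rule sobolev_family_measurable[OF W\<Omega>]) simp
      ultimately show ?thesis by (simp add: borel_rep_def)
    qed
    have wsob: "(\<lambda>x. v x - p x) \<in> sobolev \<Omega> \<mu>" by (rule sobolev_family_imp_sobolev(1)[OF op bd Nh W\<Omega> wrep])
    have wnorm: "sobolev_norm \<Omega> \<mu> (\<lambda>x. v x - p x) \<le> sqrt (c * Nh)"
      using sobolev_family_imp_sobolev(2)[OF op bd Nh W\<Omega> wrep] by (intro real_le_rsqrt) (simp add: c_def)
    have Fv: "F v = F (\<lambda>x. v x - p x) + F p" using Fadd[OF wsob psob] by simp
    have Fu: "F u = h powr (- s) * F v"
    proof -
      have "F v = h powr s * F u" using Fs usob h(1) h1(1) unfolding has_scaling_order_def v_def by blast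
      then have "h powr (- s) * F v = (h powr (- s) * h powr s) * F u" by simp
      also have "h powr (- s) * h powr s = 1" using h by (simp flip: powr_add)
      finally show ?thesis by simp
    qed
    have Fp: "F p = (\<Sum>y\<in>X. a y * p y)"
    proof -
      have "F p = nodal \<Omega> X a 1 p" using pe p(1) unfolding poly_exact_def by force
      also have "\<dots> = (\<Sum>y\<in>X. a y * p y)"
        unfolding nodal_def using X(2) cont_rep_continuous[OF op elementary_continuous[OF pelem]]
        by (intro sum.cong) auto
      finally show ?thesis .
    qed
    \<comment> \<open>The point estimate is applied on the unit ball around the unscaled node y.
      That ball may leave \<Omega>, but its image under the dilation does not.\<close>
    have pt: "\<bar>?u (h *\<^sub>R y) - p y\<bar> \<le> C4 * sqrt Nh" if y: "y \<in> X" for y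
    proof (rule C4(2)[of Nh y ?W "\<lambda>x. ?u (h *\<^sub>R x) - p x"])
      have y\<Omega>: "y \<in> \<Omega>" using X(2) y by blast
      have hB: "(\<lambda>x. h *\<^sub>R x) ` ball y 1 \<subseteq> \<Omega>"
      proof
        fix z assume "z \<in> (\<lambda>x. h *\<^sub>R x) ` ball y 1"
        then obtain x where x: "x \<in> ball y 1" "z = h *\<^sub>R x" by blast
        have "norm x < R" using yR[OF y\<Omega>] x by auto
        then have "h * norm x < h * R" using h by simp
        moreover have "norm z = h * norm x" using h x by simp
        ultimately have "norm z < r0" using h1(2) by linarith
        then show "z \<in> \<Omega>" using r0(2) by auto
      qed
      show "sobolev_family (ball y 1) \<mu> Nh ?W" by (rule sobolev_family_mono[OF WB yR[OF y\<Omega>]])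
      show "continuous_on (ball y 1) (\<lambda>x. ?u (h *\<^sub>R x) - p x)"
        by (intro continuous_on_diff elementary_continuous pelem continuous_on_compose2[OF urep(1)] continuous_intros hB)
      have "AE x in lborel. x \<in> \<Omega> \<longrightarrow> ?u x = V0 [] x" using urep(2) borel_rep_AE[OF V0(2)] by eventually_elim auto
      then have "borel_rep \<Omega> ?u (V0 [])" using borel_rep_measurable[OF V0(2)] by (simp add: borel_rep_def)
      from borel_rep_AE[OF borel_rep_scale[OF this h(1) hB]]
      show "AE x in lborel. x \<in> ball y 1 \<longrightarrow> ?u (h *\<^sub>R x) - p x = ?W [] x" by eventually_elim auto
    qed (rule Nh)
    \<comment> \<open>Exactness removes p: its value under F equals the nodal sum, so both parts of
      the error see only v - p.\<close>
    have "stencil_error \<Omega> X a F s h u = h powr (- s) * (F (\<lambda>x. v x - p x) - (\<Sum>y\<in>X. a y * (?u (h *\<^sub>R y) - p y)))"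
      unfolding stencil_error_def nodal_def Fu Fv Fp by (simp add: algebra_simps sum_subtractf)
    then have "\<bar>stencil_error \<Omega> X a F s h u\<bar> = h powr (- s) * \<bar>F (\<lambda>x. v x - p x) - (\<Sum>y\<in>X. a y * (?u (h *\<^sub>R y) - p y))\<bar>"
      by (simp add: abs_mult)
    also have "\<dots> \<le> h powr (- s) * (\<bar>CF\<bar> * sqrt (c * Nh) + (\<Sum>y\<in>X. \<bar>a y\<bar> * (C4 * sqrt Nh)))"
    proof (intro mult_left_mono)
      have 1: "\<bar>F (\<lambda>x. v x - p x)\<bar> \<le> \<bar>CF\<bar> * sqrt (c * Nh)"
      proof -
        have "\<bar>F (\<lambda>x. v x - p x)\<bar> \<le> CF * sobolev_norm \<Omega> \<mu> (\<lambda>x. v x - p x)" by (rule CF[OF wsob])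
        also have "\<dots> \<le> \<bar>CF\<bar> * sobolev_norm \<Omega> \<mu> (\<lambda>x. v x - p x)"
          by (intro mult_right_mono) (auto simp: sobolev_norm_def intro!: real_sqrt_ge_zero add_nonneg_nonneg sum_nonneg)
        also have "\<dots> \<le> \<bar>CF\<bar> * sqrt (c * Nh)" by (intro mult_left_mono wnorm) auto
        finally show ?thesis .
      qed
      have "\<bar>\<Sum>y\<in>X. a y * (?u (h *\<^sub>R y) - p y)\<bar> \<le> (\<Sum>y\<in>X. \<bar>a y * (?u (h *\<^sub>R y) - p y)\<bar>)" by (rule sum_abs)
      also have "\<dots> \<le> (\<Sum>y\<in>X. \<bar>a y\<bar> * (C4 * sqrt Nh))"
        unfolding abs_mult by (intro sum_mono mult_left_mono pt) auto
      finally show "\<bar>F (\<lambda>x. v x - p x) - (\<Sum>y\<in>X. a y * (?u (h *\<^sub>R y) - p y))\<bar> \<le> \<bar>CF\<bar> * sqrt (c * Nh) + (\<Sum>y\<in>X. \<bar>a y\<bar> * (C4 * sqrt Nh))"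
        using 1 by linarith
    qed simp
    also have "\<dots> = h powr (- s) * ((\<bar>CF\<bar> * sqrt c + (\<Sum>y\<in>X. \<bar>a y\<bar> * C4)) * sqrt Nh)"
      by (simp add: real_sqrt_mult sum_distrib_right sum_distrib_left distrib_left distrib_right mult_ac)
    also have "sqrt Nh = sqrt (C2 * C1) * h powr (M + \<tau> - ?D / 2)"
    proof -
      have "2 * (M + \<tau>) - ?D = (M + \<tau> - ?D / 2) + (M + \<tau> - ?D / 2)" by simp
      then have "h powr (2 * (M + \<tau>) - ?D) = (h powr (M + \<tau> - ?D / 2))\<^sup>2"
        by (simp only: powr_add power2_eq_square)
      then have "Nh = (C2 * C1) * (h powr (M + \<tau> - ?D / 2))\<^sup>2" by (simp only: Nh_def mult.assoc)
      then show ?thesis by (simp only: real_sqrt_mult real_sqrt_abs) simp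
    qed
    also have "h powr (- s) * ((\<bar>CF\<bar> * sqrt c + (\<Sum>y\<in>X. \<bar>a y\<bar> * C4)) * (sqrt (C2 * C1) * h powr (M + \<tau> - ?D / 2))) =
       C * (h powr (- s) * h powr (M + \<tau> - ?D / 2))"
      by (simp only: C_def mult_ac)
    also have "h powr (- s) * h powr (M + \<tau> - ?D / 2) = h powr (M + \<tau> - s - ?D / 2)"
      unfolding powr_add[symmetric] by (simp add: algebra_simps)
    finally show ?thesis .
  qed
  show ?thesis
    unfolding stencil_has_rate_def
  proof (intro exI[of _ C])
    have "eventually (\<lambda>h. 0 < h \<and> h < h0) (at_right 0)"
      using h0 by (auto simp: eventually_at_right_field)
    then show "\<forall>\<^sub>F h in at_right 0. dual_norm \<Omega> m (stencil_error \<Omega> X a F s h) \<le> ereal (C * h powr (M + \<tau> - s - ?D / 2))"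
    proof eventually_elim
      case (elim h)
      show ?case unfolding dual_norm_def
        by (rule SUP_least) (use main elim in auto)
    qed
  qed
qed

theorem theorem6:
  fixes \<Omega> X :: "(real ^ 'd::finite) set"
    and F :: "(real ^ 'd \<Rightarrow> real) \<Rightarrow> real"
    and s \<mu> :: real and q :: nat
  assumes "bounded \<Omega>" and "lipschitz_domain \<Omega>" and "scalable \<Omega>"
    and "finite X" and "X \<subseteq> \<Omega>"
    and "\<mu> > real CARD('d) / 2"
    and "continuous_functional \<Omega> \<mu> F" and "has_scaling_order \<Omega> \<mu> F s"
    and "real q \<ge> \<mu>"
    and "\<exists>a. poly_exact \<Omega> X a F q"
  shows "\<forall>a. poly_exact \<Omega> X a F q \<longrightarrow>
    (\<forall>m. \<mu> \<le> m \<and> m < real q + real CARD('d) / 2 \<longrightarrow>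
       stencil_has_rate \<Omega> X a F s m (m - s - real CARD('d) / 2)) \<and>
    (\<forall>m. m = real q + real CARD('d) / 2 \<longrightarrow>
       (\<forall>\<epsilon>>0. stencil_has_rate \<Omega> X a F s m (m - s - real CARD('d) / 2 - \<epsilon>)))"
proof (intro allI impI conjI)
  note rate = stencil_rate[OF assms(1-9)]
  fix a assume a: "poly_exact \<Omega> X a F q"
  {
    fix m assume m: "\<mu> \<le> m \<and> m < real q + real CARD('d) / 2"
    \<comment> \<open>Here \<tau> = m - min m q, which is 0 for m \<le> q and m - q < d / 2
      otherwise.\<close>
    have "stencil_has_rate \<Omega> X a F s m (min m (real q) + (m - min m (real q)) - s - real CARD('d) / 2)"
      by (rule rate[OF a _ refl]) (use m in \<open>auto simp: min_def\<close>)
    then show "stencil_has_rate \<Omega> X a F s m (m - s - real CARD('d) / 2)" by simp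
  next
    fix m \<epsilon> :: real assume m: "m = real q + real CARD('d) / 2" and e: "\<epsilon> > 0"
    have mq: "min m (real q) = real q" using m by simp
    \<comment> \<open>Now m - q equals the excluded value d / 2, and \<tau> = d / 2 - \<epsilon>
      takes its place.\<close>
    have "stencil_has_rate \<Omega> X a F s m (real q + (real CARD('d) / 2 - \<epsilon>) - s - real CARD('d) / 2)"
      by (rule rate[OF a _ mq[symmetric]]) (use m e assms(9) in auto)
    moreover have "real q + (real CARD('d) / 2 - \<epsilon>) - s - real CARD('d) / 2 = m - s - real CARD('d) / 2 - \<epsilon>"
      by (simp add: m)
    ultimately show "stencil_has_rate \<Omega> X a F s m (m - s - real CARD('d) / 2 - \<epsilon>)" by simp
  }
qed

end
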